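(* Let $L$ be the Lie algebra of a split simple algebraic group over a field $\mathbb{F}$ of characteristic $p$ with (irreducible) root datum $R=(X,\Phi,Y,\Phi^\vee)$, and let $\overline{\Phi}=\Phi(L,H)$ be the set of roots on $L$ of a split Cartan subalgebra $H$ of $L$. Then the multiplicities of the roots in $\overline{\Phi}$ are either all $1$ or as indicated in the following list. In the list, $R(p)$ denotes the type and isogeny type of $R$ together with the characteristic $p$; $m^k$ means that there are $k$ elements of $\overline{\Phi}$ of multiplicity $m$ (and $m$ alone means $m^1$); bold entries correspond to the root $0$. Characteristic 3: - $\mathrm{A}_2^{\mathrm{sc}}(3)$: $3^2$; - $\mathrm{G}_2(3)$: $1^6, 3^2$. Characteristic 2: - $\mathrm{A}_3^{\mathrm{sc}}(2)$ and $\mathrm{A}_3^{(2)}(2)$: $4^3$; - $\mathrm{B}_2^{\mathrm{ad}}(2)$: $2^2, 4$; - $\mathrm{B}_n^{\mathrm{ad}}(2)$, $n\ge 3$: $2^n, 4^{\binom n2}$; - $\mathrm{B}_2^{\mathrm{sc}}(2)$: $\mathbf{4}, 4$; - $\mathrm{B}_3^{\mathrm{sc}}(2)$: $6^3$; - $\mathrm{B}_4^{\mathrm{sc}}(2)$: $2^4, 8^3$; - $\mathrm{B}_n^{\mathrm{sc}}(2)$, $n\ge5$: $2^n, 4^{\binom n2}$; - $\mathrm{C}_n^{\mathrm{ad}}(2)$, $n\ge3$: $2n, 2^{n(n-1)}$ (one root of multiplicity $2n$ and $n(n-1)$ roots of multiplicity $2$); - $\mathrm{C}_n^{\mathrm{sc}}(2)$,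 $n\ge3$: $\mathbf{2n}, 4^{\binom n2}$; - $\mathrm{D}_4^{(1)}(2)$, $\mathrm{D}_4^{(3)}(2)$ and $\mathrm{D}_4^{(4)}(2)$: $4^6$; - $\mathrm{D}_4^{\mathrm{sc}}(2)$: $8^3$; - $\mathrm{D}_n^{(1)}(2)$, $n\ge5$: $4^{\binom n2}$; - $\mathrm{D}_n^{\mathrm{sc}}(2)$, $n\ge5$: $4^{\binom n2}$; - $\mathrm{F}_4(2)$: $2^{12}, 8^3$; - $\mathrm{G}_2(2)$: $4^3$; - all remaining irreducible root data in characteristic $2$: $2^{|\Phi^+|}$.
   Context: A root datum of rank $n$ is $R=(X,\Phi,Y,\Phi^\vee)$ with $X,Y$ free $\mathbb{Z}$-modules of rank $n$ in duality via $\langle\cdot,\cdot\rangle$, with roots $\Phi\subset X$, coroots $\Phi^\vee\subset Y$ (reduced root datum in the usual sense). $\Phi^+$ denotes the positive roots with respect to a choice of simple roots. $R$ is irreducible if its Coxeter diagram is connected; since the group is simple, the number of simple roots equals $n$. Irreducible types are $\mathrm{A}_n$ ($n\ge1$), $\mathrm{B}_n$ ($n\ge2$), $\mathrm{C}_n$ ($n\ge3$), $\mathrm{D}_n$ ($n\ge4$), $\mathrm{E}_n$ ($n=6,7,8$), $\mathrm{F}_4$, $\mathrm{G}_2$, with nodes labelled as in Bourbaki. Roots and multiplicities. We have $L\cong L_{\mathbb{F}}(R)=L_{\mathbb{Z}}(R)\otimes\mathbb{F}$, where $L_{\mathbb{Z}}(R)=Y\oplus\bigoplus_{\alpha\in\Phi}\mathbb{Z}X_\alpha$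 is the Chevalley Lie ring of $R$ (so $[X_\alpha,y]=\langle\alpha,y\rangle X_\alpha$ for $y\in Y$, together with the usual Chevalley relations among the $X_\alpha$), and all split Cartan subalgebras of $L$ are conjugate under the group, so $H$ may be identified with $Y\otimes\mathbb{F}$. For $\alpha\in\Phi$ the root $\overline{\alpha}$ of $H$ on $L$ is the linear function $\overline{\alpha}:H\to\mathbb{F}$, $\sum_i y_i\otimes t_i\mapsto\sum_i\langle\alpha,y_i\rangle t_i$, with $\langle\alpha,y_i\rangle$ interpreted in $\mathbb{Z}/p\mathbb{Z}$ (in $\mathbb{Z}$ if $p=0$); it can be the zero function. $\Phi(L,H)=\{\overline{\alpha}\mid\alpha\in\Phi\}$. The multiplicity of $\overline{\alpha}$ is the number of $\beta\in\Phi$ with $\overline{\beta}=\overline{\alpha}$. Isogeny types. The superscript $\mathrm{ad}$ denotes the adjoint type ($X=\mathbb{Z}\Phi$) and $\mathrm{sc}$ the simply connected type ($Y=\mathbb{Z}\Phi^\vee$). $\mathrm{A}_3^{(2)}$ is the intermediate type of $\mathrm{A}_3$, corresponding to the subgroup of order $2$ of the fundamental group $\mathbb{Z}/4\mathbb{Z}$. For $\mathrm{D}_n$ with $n$ odd, $\mathrm{D}_n^{(1)}$ is the unique intermediate type; for $n$ even the three intermediate types are $\mathrm{D}_n^{(1)},\mathrm{D}_n^{(n-1)},\mathrm{D}_n^{(n)}$, where $\mathrm{D}_n^{(i)}$ is the type in which $X$ is generated by $\mathbb{Z}\Phi$ and the $i$-th fundamental weight. A type listed without superscript has a single isogeny type.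 *)

theory Defs
  imports
    "HOL-Library.Multiset"
    "HOL-Library.FuncSet"
    "HOL-Computational_Algebra.Computational_Algebra"
begin

section \<open>Abelian groups as \<open>\<int>\<close>-modules\<close>

definition zmult :: "int \<Rightarrow> 'a::ab_group_add \<Rightarrow> 'a"
  where "zmult k x = (if 0 \<le> k then ((+) x ^^ nat k) 0 else - (((+) x ^^ nat (- k)) 0))"

lemma zmult_of_nat: "zmult (int n) x = ((+) x ^^ n) 0"
  by (simp add: zmult_def)

lemma zmult_minus: "zmult (- k) x = - zmult k x"
  by (auto simp: zmult_def)

lemma zmult_succ: "zmult (k + 1) x = x + zmult k x"
proof (cases "0 \<le> k")
  case True
  then obtain n where n: "k = int n" by (metis nonneg_int_cases)
  then have "k + 1 = int (Suc n)" by simp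
  then show ?thesis by (simp only: n zmult_of_nat) simp
next
  case False
  define n where "n = nat (- k - 1)"
  have k: "k = - int (Suc n)" "k + 1 = - int n" using False by (auto simp: n_def)
  show ?thesis unfolding k(2) unfolding k(1) zmult_minus zmult_of_nat by (simp add: algebra_simps)
qed

lemma zmult_pred: "zmult (k - 1) x = zmult k x - x"
  using zmult_succ[of "k - 1" x] by (simp add: algebra_simps)

interpretation zmod: module zmult
proof
  fix a b :: int and x y :: 'a
  show add: "zmult (a + b) x = zmult a x + zmult b x" for a b x
  proof (induction a rule: int_induct[where k = 0])
    case base
    show ?case by (simp add: zmult_def)
  next
    case (step1 i)
    have "zmult (i + 1 + b) x = zmult ((i + b) + 1) x" by (simp add: algebra_simps)
    then show ?case by (simp only: zmult_succ step1.IH) (simp only: ac_simps)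
  next
    case (step2 i)
    have "zmult (i - 1 + b) x = zmult ((i + b) - 1) x" by (simp add: algebra_simps)
    then show ?case by (simp only: zmult_pred step2.IH) (simp add: algebra_simps)
  qed
  show "zmult a (x + y) = zmult a x + zmult a y"
  proof (induction a rule: int_induct[where k = 0])
    case base
    show ?case by (simp add: zmult_def)
  next
    case (step1 i)
    show ?case by (simp only: zmult_succ step1.IH) (simp only: ac_simps)
  next
    case (step2 i)
    show ?case by (simp only: zmult_pred step2.IH) (simp add: algebra_simps)
  qed
  show "zmult a (zmult b x) = zmult (a * b) x"
  proof (induction a rule: int_induct[where k = 0])
    case base
    show ?case by (simp add: zmult_def)
  next
    case (step1 i)
    have "zmult (i + 1) (zmult b x) = zmult b x + zmult (i * b) x"
      by (simp only: zmult_succ step1.IH)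
    also have "\<dots> = zmult (b + i * b) x" by (rule add[symmetric])
    also have "b + i * b = (i + 1) * b" by (simp add: algebra_simps)
    finally show ?case .
  next
    case (step2 i)
    have "zmult (i - 1) (zmult b x) = zmult (i * b) x - zmult b x"
      by (simp only: zmult_pred step2.IH)
    also have "\<dots> = zmult (i * b + - b) x" by (simp only: add zmult_minus) simp
    also have "i * b + - b = (i - 1) * b" by (simp add: algebra_simps)
    finally show ?case .
  qed
  show "zmult 1 x = x" by (simp add: zmult_def)
qed

definition zbasis :: "'a::ab_group_add set \<Rightarrow> bool"
  where "zbasis B \<longleftrightarrow> zmod.independent B \<and> zmod.span B = UNIV"


section \<open>Root data\<close>

text \<open>The lattices \<open>X\<close> and \<open>Y\<close> are the types \<^typ>\<open>'x\<close> and \<^typ>\<open>'y\<close>;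
  \<open>coroot R\<close> is the bijection \<open>\<alpha> \<mapsto> \<alpha>\<^sup>\<vee>\<close>, relevant only on \<open>roots R\<close>.\<close>

record ('x, 'y) root_data =
  pair :: "'x \<Rightarrow> 'y \<Rightarrow> int"
  roots :: "'x set"
  coroot :: "'x \<Rightarrow> 'y"

definition perfect_pairing :: "('x::ab_group_add \<Rightarrow> 'y::ab_group_add \<Rightarrow> int) \<Rightarrow> bool"
  where "perfect_pairing b \<longleftrightarrow>
    (\<forall>x. additive (b x)) \<and> (\<forall>y. additive (\<lambda>x. b x y)) \<and>
    (\<forall>f. additive f \<longrightarrow> (\<exists>!x. f = b x)) \<and> (\<forall>f. additive f \<longrightarrow> (\<exists>!y. f = (\<lambda>x. b x y)))"

definition root_datum :: "nat \<Rightarrow> ('x::ab_group_add, 'y::ab_group_add) root_data \<Rightarrow> bool"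
  where "root_datum n R \<longleftrightarrow>
    (\<exists>B :: 'x set. finite B \<and> card B = n \<and> zbasis B) \<and>
    (\<exists>B :: 'y set. finite B \<and> card B = n \<and> zbasis B) \<and>
    perfect_pairing (pair R) \<and>
    finite (roots R) \<and> inj_on (coroot R) (roots R) \<and>
    (\<forall>\<alpha>\<in>roots R. pair R \<alpha> (coroot R \<alpha>) = 2) \<and>
    (\<forall>\<alpha>\<in>roots R. (\<lambda>x. x - zmult (pair R x (coroot R \<alpha>)) \<alpha>) ` roots R = roots R) \<and>
    (\<forall>\<alpha>\<in>roots R. (\<lambda>y. y - zmult (pair R \<alpha> y) (coroot R \<alpha>)) ` coroot R ` roots R
                  = coroot R ` roots R)"

text \<open>\<open>\<Phi> \<inter> \<rat>\<alpha> = {\<alpha>, -\<alpha>}\<close>, with denominators cleared.\<close>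

definition reduced :: "('x::ab_group_add, 'y) root_data \<Rightarrow> bool"
  where "reduced R \<longleftrightarrow> (\<forall>\<alpha>\<in>roots R. \<forall>\<beta>\<in>roots R. \<forall>a b.
    a \<noteq> 0 \<and> zmult a \<alpha> = zmult b \<beta> \<longrightarrow> \<beta> = \<alpha> \<or> \<beta> = - \<alpha>)"

definition simple_roots :: "('x::ab_group_add, 'y) root_data \<Rightarrow> 'x set \<Rightarrow> bool"
  where "simple_roots R \<Delta> \<longleftrightarrow> \<Delta> \<subseteq> roots R \<and> zmod.independent \<Delta> \<and>
    (\<forall>\<beta>\<in>roots R. \<exists>c. \<beta> = (\<Sum>\<alpha>\<in>\<Delta>. zmult (c \<alpha>) \<alpha>) \<and>
       ((\<forall>\<alpha>\<in>\<Delta>. 0 \<le> c \<alpha>) \<or> (\<forall>\<alpha>\<in>\<Delta>. c \<alpha> \<le> 0)))"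

definition positive_roots :: "('x::ab_group_add, 'y) root_data \<Rightarrow> 'x set \<Rightarrow> 'x set"
  where "positive_roots R \<Delta> =
    {\<beta> \<in> roots R. \<exists>c. \<beta> = (\<Sum>\<alpha>\<in>\<Delta>. zmult (c \<alpha>) \<alpha>) \<and> (\<forall>\<alpha>\<in>\<Delta>. 0 \<le> c \<alpha>)}"

definition coxeter_edges :: "('x, 'y) root_data \<Rightarrow> 'x set \<Rightarrow> ('x \<times> 'x) set"
  where "coxeter_edges R \<Delta> =
    {(\<alpha>, \<beta>). \<alpha> \<in> \<Delta> \<and> \<beta> \<in> \<Delta> \<and> \<alpha> \<noteq> \<beta> \<and> pair R \<alpha> (coroot R \<beta>) \<noteq> 0}"

text \<open>As \<open>R\<close> is the datum of a simple group, \<open>X\<close> is required to have rank \<open>card \<Delta>\<close>.\<close>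

definition irreducible_root_datum ::
    "nat \<Rightarrow> ('x::ab_group_add, 'y::ab_group_add) root_data \<Rightarrow> 'x set \<Rightarrow> bool"
  where "irreducible_root_datum n R \<Delta> \<longleftrightarrow>
    root_datum n R \<and> reduced R \<and> simple_roots R \<Delta> \<and> card \<Delta> = n \<and>
    \<Delta> \<noteq> {} \<and> (\<forall>\<alpha>\<in>\<Delta>. \<forall>\<beta>\<in>\<Delta>. (\<alpha>, \<beta>) \<in> (coxeter_edges R \<Delta>)\<^sup>*)"


section \<open>Types and isogeny types\<close>

text \<open>The types \<open>E\<^sub>6\<close>, \<open>E\<^sub>7\<close>, \<open>E\<^sub>8\<close> do not occur by name in the list of multiplicities
  and are therefore not given a name here.\<close>

datatype dynkin = DynA nat | DynB nat | DynC nat | DynD nat | DynF4 | DynG2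

fun dynkin_rank :: "dynkin \<Rightarrow> nat"
  where
    "dynkin_rank (DynA n) = n"
  | "dynkin_rank (DynB n) = n"
  | "dynkin_rank (DynC n) = n"
  | "dynkin_rank (DynD n) = n"
  | "dynkin_rank DynF4 = 4"
  | "dynkin_rank DynG2 = 2"

text \<open>Off-diagonal entries \<open>\<langle>\<alpha>\<^sub>i, \<alpha>\<^sub>j\<^sup>\<vee>\<rangle>\<close> of the Cartan matrices in Bourbaki's labelling, which
  starts at 1. In type \<open>B\<^sub>n\<close> the root \<open>\<alpha>\<^sub>n\<close> is short, in type \<open>C\<^sub>n\<close> it is long; in type
  \<open>F\<^sub>4\<close> the roots \<open>\<alpha>\<^sub>3\<close>, \<open>\<alpha>\<^sub>4\<close> are short, and in type \<open>G\<^sub>2\<close> the root \<open>\<alpha>\<^sub>1\<close> is short.\<close>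

definition chain :: "nat \<Rightarrow> nat \<Rightarrow> bool"
  where "chain i j \<longleftrightarrow> j = i + 1 \<or> i = j + 1"

fun cartan_off :: "dynkin \<Rightarrow> nat \<Rightarrow> nat \<Rightarrow> int"
  where
    "cartan_off (DynA n) i j = (if chain i j then -1 else 0)"
  | "cartan_off (DynB n) i j =
      (if i + 1 = n \<and> j = n then -2 else if chain i j then -1 else 0)"
  | "cartan_off (DynC n) i j =
      (if i = n \<and> j + 1 = n then -2 else if chain i j then -1 else 0)"
  | "cartan_off (DynD n) i j =
      (if chain i j \<and> i < n \<and> j < n \<or> i + 2 = n \<and> j = n \<or> i = n \<and> j + 2 = n then -1 else 0)"
  | "cartan_off DynF4 i j = (if i = 2 \<and> j = 3 then -2 else if chain i j then -1 else 0)"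
  | "cartan_off DynG2 i j = (if i = 2 \<and> j = 1 then -3 else if chain i j then -1 else 0)"

definition bourbaki_labelling ::
    "('x, 'y) root_data \<Rightarrow> 'x set \<Rightarrow> dynkin \<Rightarrow> (nat \<Rightarrow> 'x) \<Rightarrow> bool"
  where "bourbaki_labelling R \<Delta> T l \<longleftrightarrow>
    bij_betw l {1..dynkin_rank T} \<Delta> \<and>
    (\<forall>i\<in>{1..dynkin_rank T}. \<forall>j\<in>{1..dynkin_rank T}.
       pair R (l i) (coroot R (l j)) = (if i = j then 2 else cartan_off T i j))"

definition has_type :: "('x, 'y) root_data \<Rightarrow> 'x set \<Rightarrow> dynkin \<Rightarrow> bool"
  where "has_type R \<Delta> T \<longleftrightarrow> (\<exists>l. bourbaki_labelling R \<Delta> T l)"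

definition adjoint_type :: "('x::ab_group_add, 'y) root_data \<Rightarrow> bool"
  where "adjoint_type R \<longleftrightarrow> zmod.span (roots R) = UNIV"

definition simply_connected_type :: "('x, 'y::ab_group_add) root_data \<Rightarrow> bool"
  where "simply_connected_type R \<longleftrightarrow> zmod.span (coroot R ` roots R) = UNIV"

text \<open>The order of \<open>X/\<int>\<Phi>\<close>, a subgroup of the fundamental group.\<close>

definition root_index :: "('x::ab_group_add, 'y) root_data \<Rightarrow> nat"
  where "root_index R = card (UNIV // {(x, y). x - y \<in> zmod.span (roots R)})"

text \<open>Type \<open>D\<^sub>n\<^sup>(\<^sup>i\<^sup>)\<close>: the lattice \<open>X\<close> is generated by \<open>\<int>\<Phi>\<close> and the fundamental weight
  \<open>\<omega>\<^sub>i\<close>.\<close>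

definition D_isogeny :: "('x::ab_group_add, 'y) root_data \<Rightarrow> 'x set \<Rightarrow> nat \<Rightarrow> nat \<Rightarrow> bool"
  where "D_isogeny R \<Delta> n i \<longleftrightarrow> (\<exists>l \<omega>. bourbaki_labelling R \<Delta> (DynD n) l \<and>
    (\<forall>j\<in>{1..n}. pair R \<omega> (coroot R (l j)) = (if j = i then 1 else 0)) \<and>
    zmod.span (insert \<omega> (roots R)) = UNIV)"


section \<open>Chevalley Lie rings and algebras\<close>

definition lie_ring :: "('l::ab_group_add \<Rightarrow> 'l \<Rightarrow> 'l) \<Rightarrow> bool"
  where "lie_ring br \<longleftrightarrow>
    (\<forall>x. additive (br x)) \<and> (\<forall>y. additive (\<lambda>x. br x y)) \<and> (\<forall>x. br x x = 0) \<and>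
    (\<forall>x y z. br x (br y z) + br y (br z x) + br z (br x y) = 0)"

definition lie_algebra ::
    "('f::field \<Rightarrow> 'l::ab_group_add \<Rightarrow> 'l) \<Rightarrow> ('l \<Rightarrow> 'l \<Rightarrow> 'l) \<Rightarrow> bool"
  where "lie_algebra scale br \<longleftrightarrow> vector_space scale \<and> lie_ring br \<and>
    (\<forall>c x y. br (scale c x) y = scale c (br x y))"

text \<open>\<open>chevalley_lie_ring R br h e\<close>: the type \<^typ>\<open>'z\<close> with bracket \<open>br\<close> is the Lie ring
  \<open>L\<^sub>\<int>(R) = Y \<oplus> \<Oplus>\<^bsub>\<alpha>\<in>\<Phi>\<^esub> \<int> X\<^sub>\<alpha>\<close>, where \<open>h\<close> is the inclusion of \<open>Y\<close> and \<open>e \<alpha> = X\<^sub>\<alpha>\<close>. The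
  sign in \<open>[X\<^sub>-\<^sub>\<alpha>, X\<^sub>\<alpha>] = \<alpha>\<^sup>\<vee>\<close> is the one compatible with \<open>[X\<^sub>\<alpha>, y] = \<langle>\<alpha>, y\<rangle> X\<^sub>\<alpha>\<close>. The
  structure constants are \<open>\<plusminus>(q + 1)\<close> with \<open>q\<close> maximal such that \<open>\<beta> - q\<alpha>\<close> is a root.\<close>

definition chevalley_lie_ring ::
    "('x::ab_group_add, 'y::ab_group_add) root_data \<Rightarrow> ('z::ab_group_add \<Rightarrow> 'z \<Rightarrow> 'z) \<Rightarrow>
     ('y \<Rightarrow> 'z) \<Rightarrow> ('x \<Rightarrow> 'z) \<Rightarrow> bool"
  where "chevalley_lie_ring R br h e \<longleftrightarrow>
    lie_ring br \<and> additive h \<and>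
    (\<forall>z. \<exists>!(y, c). (\<forall>\<alpha>. \<alpha> \<notin> roots R \<longrightarrow> c \<alpha> = 0) \<and>
       z = h y + (\<Sum>\<alpha>\<in>roots R. zmult (c \<alpha>) (e \<alpha>))) \<and>
    (\<forall>y y'. br (h y) (h y') = 0) \<and>
    (\<forall>\<alpha>\<in>roots R. \<forall>y. br (e \<alpha>) (h y) = zmult (pair R \<alpha> y) (e \<alpha>)) \<and>
    (\<forall>\<alpha>\<in>roots R. br (e (- \<alpha>)) (e \<alpha>) = h (coroot R \<alpha>)) \<and>
    (\<forall>\<alpha>\<in>roots R. \<forall>\<beta>\<in>roots R. \<alpha> + \<beta> \<noteq> 0 \<and> \<alpha> + \<beta> \<notin> roots R \<longrightarrow> br (e \<alpha>) (e \<beta>) = 0) \<and>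
    (\<forall>\<alpha>\<in>roots R. \<forall>\<beta>\<in>roots R. \<alpha> + \<beta> \<in> roots R \<longrightarrow>
       (\<exists>N. \<bar>N\<bar> = int (GREATEST q. \<beta> - zmult (int q) \<alpha> \<in> roots R) + 1 \<and>
            br (e \<alpha>) (e \<beta>) = zmult N (e (\<alpha> + \<beta>))))"

text \<open>\<open>\<iota>\<close> is the map \<open>z \<mapsto> z \<otimes> 1\<close> from a free Lie ring to a Lie algebra \<open>L\<close> identified by it
  with the tensor product of the Lie ring with the field.\<close>

definition scalar_extension ::
    "('z::ab_group_add \<Rightarrow> 'z \<Rightarrow> 'z) \<Rightarrow> ('f::field \<Rightarrow> 'l::ab_group_add \<Rightarrow> 'l) \<Rightarrow>
     ('l \<Rightarrow> 'l \<Rightarrow> 'l) \<Rightarrow> ('z \<Rightarrow> 'l) \<Rightarrow> bool"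
  where "scalar_extension brZ scale br \<iota> \<longleftrightarrow>
    additive \<iota> \<and> (\<forall>a b. \<iota> (brZ a b) = br (\<iota> a) (\<iota> b)) \<and>
    (\<exists>B. zbasis B \<and> inj_on \<iota> B \<and>
       \<not> module.dependent scale (\<iota> ` B) \<and> module.span scale (\<iota> ` B) = UNIV)"


section \<open>Roots of the Cartan subalgebra\<close>

text \<open>In this section \<open>\<eta>\<close> is the map \<open>y \<mapsto> y \<otimes> 1\<close> from \<open>Y\<close> to \<open>L\<close>, so that the Cartan
  subalgebra \<open>H = Y \<otimes> \<bbbF>\<close> is the span of its range.\<close>

definition cartan_subalgebra :: "('f::field \<Rightarrow> 'l::ab_group_add \<Rightarrow> 'l) \<Rightarrow> ('y \<Rightarrow> 'l) \<Rightarrow> 'l set"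
  where "cartan_subalgebra scale \<eta> = module.span scale (range \<eta>)"

text \<open>The function \<open>\<Sum>\<^sub>i y\<^sub>i \<otimes> t\<^sub>i \<mapsto> \<Sum>\<^sub>i \<langle>\<alpha>, y\<^sub>i\<rangle> t\<^sub>i\<close> on \<open>H\<close>. It is made \<^const>\<open>undefined\<close> outside
  \<open>H\<close>, so that equality of two such functions means equality on \<open>H\<close>.\<close>

definition root_on ::
    "('x, 'y) root_data \<Rightarrow> ('f::field \<Rightarrow> 'l::ab_group_add \<Rightarrow> 'l) \<Rightarrow> ('y \<Rightarrow> 'l) \<Rightarrow> 'x \<Rightarrow> 'l \<Rightarrow> 'f"
  where "root_on R scale \<eta> \<alpha> = (THE f. f \<in> extensional (cartan_subalgebra scale \<eta>) \<and>
    (\<forall>S t. finite S \<longrightarrow>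
       f (\<Sum>y\<in>S. scale (t y) (\<eta> y)) = (\<Sum>y\<in>S. of_int (pair R \<alpha> y) * t y)))"

definition roots_on ::
    "('x, 'y) root_data \<Rightarrow> ('f::field \<Rightarrow> 'l::ab_group_add \<Rightarrow> 'l) \<Rightarrow> ('y \<Rightarrow> 'l) \<Rightarrow> ('l \<Rightarrow> 'f) set"
  where "roots_on R scale \<eta> = root_on R scale \<eta> ` roots R"

definition zero_on :: "('f::field \<Rightarrow> 'l::ab_group_add \<Rightarrow> 'l) \<Rightarrow> ('y \<Rightarrow> 'l) \<Rightarrow> 'l \<Rightarrow> 'f"
  where "zero_on scale \<eta> = (\<lambda>v\<in>cartan_subalgebra scale \<eta>. 0)"

definition root_mult ::
    "('x, 'y) root_data \<Rightarrow> ('f::field \<Rightarrow> 'l::ab_group_add \<Rightarrow> 'l) \<Rightarrow> ('y \<Rightarrow> 'l) \<Rightarrow> ('l \<Rightarrow> 'f) \<Rightarrow> nat"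
  where "root_mult R scale \<eta> \<phi> = card {\<beta> \<in> roots R. root_on R scale \<eta> \<beta> = \<phi>}"

definition mults ::
    "('x, 'y) root_data \<Rightarrow> ('f::field \<Rightarrow> 'l::ab_group_add \<Rightarrow> 'l) \<Rightarrow> ('y \<Rightarrow> 'l) \<Rightarrow>
     ('l \<Rightarrow> 'f) set \<Rightarrow> nat multiset"
  where "mults R scale \<eta> S = image_mset (root_mult R scale \<eta>) (mset_set S)"


section \<open>The list of multiplicities\<close>

text \<open>\<open>listed R \<Delta> p Z M\<close>: the datum \<open>R\<close> in characteristic \<open>p\<close> is one of those named in the list,
  the bold multiplicities (those of the root 0) being \<open>Z\<close> and the others \<open>M\<close>. The final item
  of the list, for the remaining data in characteristic 2, is not included; among these, the
  root 0 occurs only for the simply connected type \<open>A\<^sub>1\<close>.\<close>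

inductive listed ::
    "('x::ab_group_add, 'y::ab_group_add) root_data \<Rightarrow> 'x set \<Rightarrow> nat \<Rightarrow>
     nat multiset \<Rightarrow> nat multiset \<Rightarrow> bool"
  for R \<Delta>
  where
    A2_sc_3: "has_type R \<Delta> (DynA 2) \<Longrightarrow> simply_connected_type R \<Longrightarrow>
      listed R \<Delta> 3 {#} (replicate_mset 2 3)"
  | G2_3: "has_type R \<Delta> DynG2 \<Longrightarrow>
      listed R \<Delta> 3 {#} (replicate_mset 6 1 + replicate_mset 2 3)"
  | A3_sc: "has_type R \<Delta> (DynA 3) \<Longrightarrow> simply_connected_type R \<Longrightarrow>
      listed R \<Delta> 2 {#} (replicate_mset 3 4)"
  | A3_2: "has_type R \<Delta> (DynA 3) \<Longrightarrow> root_index R = 2 \<Longrightarrow>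
      listed R \<Delta> 2 {#} (replicate_mset 3 4)"
  | B2_ad: "has_type R \<Delta> (DynB 2) \<Longrightarrow> adjoint_type R \<Longrightarrow>
      listed R \<Delta> 2 {#} (replicate_mset 2 2 + {#4#})"
  | Bn_ad: "n \<ge> 3 \<Longrightarrow> has_type R \<Delta> (DynB n) \<Longrightarrow> adjoint_type R \<Longrightarrow>
      listed R \<Delta> 2 {#} (replicate_mset n 2 + replicate_mset (n choose 2) 4)"
  | B2_sc: "has_type R \<Delta> (DynB 2) \<Longrightarrow> simply_connected_type R \<Longrightarrow>
      listed R \<Delta> 2 {#4#} {#4#}"
  | B3_sc: "has_type R \<Delta> (DynB 3) \<Longrightarrow> simply_connected_type R \<Longrightarrow>
      listed R \<Delta> 2 {#} (replicate_mset 3 6)"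
  | B4_sc: "has_type R \<Delta> (DynB 4) \<Longrightarrow> simply_connected_type R \<Longrightarrow>
      listed R \<Delta> 2 {#} (replicate_mset 4 2 + replicate_mset 3 8)"
  | Bn_sc: "n \<ge> 5 \<Longrightarrow> has_type R \<Delta> (DynB n) \<Longrightarrow> simply_connected_type R \<Longrightarrow>
      listed R \<Delta> 2 {#} (replicate_mset n 2 + replicate_mset (n choose 2) 4)"
  | Cn_ad: "n \<ge> 3 \<Longrightarrow> has_type R \<Delta> (DynC n) \<Longrightarrow> adjoint_type R \<Longrightarrow>
      listed R \<Delta> 2 {#} ({#2 * n#} + replicate_mset (n * (n - 1)) 2)"
  | Cn_sc: "n \<ge> 3 \<Longrightarrow> has_type R \<Delta> (DynC n) \<Longrightarrow> simply_connected_type R \<Longrightarrow>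
      listed R \<Delta> 2 {#2 * n#} (replicate_mset (n choose 2) 4)"
  | D4_intermediate: "i \<in> {1, 3, 4} \<Longrightarrow> D_isogeny R \<Delta> 4 i \<Longrightarrow>
      listed R \<Delta> 2 {#} (replicate_mset 6 4)"
  | D4_sc: "has_type R \<Delta> (DynD 4) \<Longrightarrow> simply_connected_type R \<Longrightarrow>
      listed R \<Delta> 2 {#} (replicate_mset 3 8)"
  | Dn_1: "n \<ge> 5 \<Longrightarrow> D_isogeny R \<Delta> n 1 \<Longrightarrow>
      listed R \<Delta> 2 {#} (replicate_mset (n choose 2) 4)"
  | Dn_sc: "n \<ge> 5 \<Longrightarrow> has_type R \<Delta> (DynD n) \<Longrightarrow> simply_connected_type R \<Longrightarrow>
      listed R \<Delta> 2 {#} (replicate_mset (n choose 2) 4)"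
  | F4: "has_type R \<Delta> DynF4 \<Longrightarrow>
      listed R \<Delta> 2 {#} (replicate_mset 12 2 + replicate_mset 3 8)"
  | G2_2: "has_type R \<Delta> DynG2 \<Longrightarrow>
      listed R \<Delta> 2 {#} (replicate_mset 3 4)"

end

theory Submission
  imports Defs "HOL-Library.Function_Algebras"
begin

text \<open>Because the pairing is perfect, two roots induce the same function on \<open>H\<close> exactly if their
  difference lies in \<open>pX\<close> (\<open>root_on_eq_iff\<close>). The multiplicities are therefore the sizes of the
  classes of \<open>\<Phi>\<close> modulo \<open>pX\<close>, and only the lattice \<open>X\<close> with its roots and coroots matters.

  Suppose that distinct roots \<open>\<alpha>\<close>, \<open>\<beta>\<close> are congruent modulo \<open>pX\<close>. Pairing the difference with the two
  coroots restricts the Cartan integers, whose product is at most 3 by the Cauchy-Schwarz inequality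
  for the invariant form. If \<open>p\<close> is odd, this leaves \<open>p = 3\<close> and an angle of 120 degrees
  (\<open>congr_odd\<close>). Unless there is a triple bond, all other roots are then orthogonal to \<open>\<alpha>\<close> and \<open>\<beta>\<close>, and
  the datum is the simply connected one of type \<open>A\<^sub>2\<close> (\<open>congr_three_types\<close>).

  If \<open>p = 2\<close>, then \<open>\<alpha>\<close> and \<open>- \<alpha>\<close> are always congruent, and a further coincidence can only occur between
  orthogonal roots. In a simply laced datum take a coincidence for which the half sum \<open>x\<close> of the two
  roots is as high as possible. Then \<open>x\<close> is dominant, its length is known, and this makes the
  coefficients of \<open>2x\<close> a labelling of the diagram by \<open>2, \<dots>, 2\<close> along a path that ends in a fork
  labelled by \<open>1, 1\<close>. So the type is \<open>D\<^sub>n\<close>, where \<open>D\<^sub>3 = A\<^sub>3\<close>, and \<open>X\<close> contains the first fundamental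
  weight \<open>x\<close> (\<open>coincidence_D\<close>); the lattices with this property are those in the list. A datum that
  is not simply laced is of type \<open>B\<close>, \<open>C\<close>, \<open>F\<^sub>4\<close> or \<open>G\<^sub>2\<close>, because every other diagram with a multiple
  bond would carry a nonzero vector of nonpositive length (\<open>multiply_laced_types\<close>), and all of these data are in the list.

  It remains to compute the classes for the data in the list. Types \<open>B\<close>, \<open>C\<close> and \<open>D\<close> have coordinates
  in which every root has one or two nonzero entries. Congruence modulo \<open>2X\<close> is then a matter of
  supports, with exceptions only if \<open>X\<close> contains half-integral vectors and the rank is at most 4
  (\<open>supp_if_congr\<close>, \<open>congr_if_supp\<close>); type \<open>C\<close> is governed by the parity of the
  entries and of their sum. The exceptions and the types \<open>A\<^sub>2\<close>, \<open>F\<^sub>4\<close>, \<open>G\<^sub>2\<close> are finite computations with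
  explicit lists of roots (\<open>roots_eq\<close>).\<close>

section \<open>Integral functionals\<close>

lemma zmult_int [simp]: "zmult k (m::int) = k * m"
proof (induction k rule: int_induct[where k = 0])
  case (step1 i) then show ?case by (simp only: zmult_succ) (simp add: algebra_simps)
next
  case (step2 i) then show ?case by (simp only: zmult_pred) (simp add: algebra_simps)
qed simp

lemma additive_zmult: "additive f \<Longrightarrow> f (zmult k x) = zmult k (f x)"
proof (induction k rule: int_induct[where k = 0])
  case base then show ?case by (simp add: additive.zero)
next
  case (step1 i) then show ?case by (simp only: zmult_succ additive.add)
next
  case (step2 i) then show ?case by (simp only: zmult_pred additive.diff)
qed

lemma additive_int_zmult: "additive (f :: _ \<Rightarrow> int) \<Longrightarrow> f (zmult k x) = k * f x"
  by (simp add: additive_zmult)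

lemma zmult_neg_one [simp]: "zmult (-1) x = - x"
  using zmult_minus[of 1 x] by simp

lemma zmult_two: "zmult 2 x = x + x"
  using zmod.scale_left_distrib[of 1 1 x] by simp

section \<open>Irreducible root data\<close>

locale irreducible_datum =
  fixes R :: "('x::ab_group_add, 'y::ab_group_add) root_data" and \<Delta> :: "'x set" and n :: nat
  assumes irreducible: "irreducible_root_datum n R \<Delta>"
begin

abbreviation Phi ("\<Phi>") where "\<Phi> \<equiv> roots R"
abbreviation cp where "cp x \<gamma> \<equiv> pair R x (coroot R \<gamma>)"
definition refl where "refl \<gamma> x = x - zmult (cp x \<gamma>) \<gamma>"
definition corefl where "corefl \<gamma> y = y - zmult (pair R \<gamma> y) (coroot R \<gamma>)"

lemma datum: "root_datum n R" and reduced: "reduced R" and simple: "simple_roots R \<Delta>"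
  and card_simple: "card \<Delta> = n" and simple_ne: "\<Delta> \<noteq> {}"
  and connected: "\<alpha> \<in> \<Delta> \<Longrightarrow> \<beta> \<in> \<Delta> \<Longrightarrow> (\<alpha>, \<beta>) \<in> (coxeter_edges R \<Delta>)\<^sup>*"
  using irreducible by (auto simp: irreducible_root_datum_def)

lemma perfect: "perfect_pairing (pair R)" and finite_roots [simp]: "finite \<Phi>"
  and inj_coroot: "inj_on (coroot R) \<Phi>"
  and cp_self [simp]: "\<alpha> \<in> \<Phi> \<Longrightarrow> cp \<alpha> \<alpha> = 2"
  and refl_image: "\<alpha> \<in> \<Phi> \<Longrightarrow> refl \<alpha> ` \<Phi> = \<Phi>"
  and corefl_image: "\<alpha> \<in> \<Phi> \<Longrightarrow> corefl \<alpha> ` coroot R ` \<Phi> = coroot R ` \<Phi>"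
  using datum unfolding root_datum_def refl_def[abs_def] corefl_def[abs_def] by blast+

lemma additive_left: "additive (\<lambda>x. pair R x y)" and additive_right: "additive (pair R x)"
  using perfect by (auto simp: perfect_pairing_def)

lemma pair_simps [simp]:
  "pair R (a + b) y = pair R a y + pair R b y" "pair R x (c + d) = pair R x c + pair R x d"
  "pair R (a - b) y = pair R a y - pair R b y" "pair R x (c - d) = pair R x c - pair R x d"
  "pair R (- a) y = - pair R a y" "pair R x (- c) = - pair R x c"
  "pair R 0 y = 0" "pair R x 0 = 0"
  "pair R (zmult k a) y = k * pair R a y" "pair R x (zmult k c) = k * pair R x c"
  "pair R (sum f A) y = (\<Sum>i\<in>A. pair R (f i) y)" "pair R x (sum g A) = (\<Sum>i\<in>A. pair R x (g i))"
  by (simp_all only: additive.add[OF additive_left] additive.add[OF additive_right]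
    additive.diff[OF additive_left] additive.diff[OF additive_right]
    additive.minus[OF additive_left] additive.minus[OF additive_right]
    additive.zero[OF additive_left] additive.zero[OF additive_right]
    additive_int_zmult[OF additive_left] additive_int_zmult[OF additive_right]
    additive.sum[OF additive_left] additive.sum[OF additive_right])

lemma ex1_left: "additive f \<Longrightarrow> \<exists>!x. f = pair R x"
  and ex1_right: "additive g \<Longrightarrow> \<exists>!y. g = (\<lambda>x. pair R x y)"
  using perfect unfolding perfect_pairing_def by blast+

lemma eq_by_left: assumes "\<And>y. pair R x y = pair R x' y" shows "x = x'"
proof -
  have "pair R x = pair R x'" using assms by (rule ext)
  then show ?thesis using ex1E[OF ex1_left[OF additive_right[of x]]] by metis
qed

lemma represent_left: assumes "additive f" shows "\<exists>x. \<forall>y. f y = pair R x y"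
proof -
  obtain x where "f = pair R x" using ex1_left[OF assms] by (rule ex1E)
  then have "\<forall>y. f y = pair R x y" by simp
  then show ?thesis ..
qed

lemma zmult_cancel: "k \<noteq> 0 \<Longrightarrow> zmult k x = zmult k (x'::'x) \<Longrightarrow> x = x'"
proof (rule eq_by_left)
  fix y assume "k \<noteq> 0" "zmult k x = zmult k x'"
  then have "pair R (zmult k x) y = pair R (zmult k x') y" by (simp only:)
  then have "k * pair R x y = k * pair R x' y" unfolding pair_simps .
  then show "pair R x y = pair R x' y" using \<open>k \<noteq> 0\<close> by (simp only: mult_cancel_left) simp
qed

text \<open>If all values of \<open>v\<close> are divisible by \<open>k\<close>, the quotients form an additive function on \<open>Y\<close>, which
  is represented by an element of \<open>X\<close> because the pairing is perfect.\<close>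

lemma divisible_iff: "(\<exists>x. v = zmult k x) \<longleftrightarrow> (\<forall>y. k dvd pair R v y)"
proof (cases "k = 0")
  case True then show ?thesis 
    using eq_by_left[of v 0] by (metis dvd_0_left_iff dvd_refl pair_simps(7) zmod.scale_zero_left)
next
  case False
  show ?thesis
  proof
    assume d: "\<forall>y. k dvd pair R v y"
    have "additive (\<lambda>y. pair R v y div k)" by standard (simp add: d div_plus_div_distrib_dvd_left)
    then obtain x where x: "\<And>y. pair R v y div k = pair R x y" using represent_left by blast
    have "v = zmult k x"
    proof (rule eq_by_left)
      fix y show "pair R v y = pair R (zmult k x) y"
        unfolding pair_simps x[symmetric] using d by simp
    qed
    then show "\<exists>x. v = zmult k x" ..
  qed auto
qed

lemma simple_sub: "\<Delta> \<subseteq> \<Phi>" and indep: "zmod.independent \<Delta>" and finite_simple [simp]: "finite \<Delta>"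
  using simple finite_subset[of \<Delta> \<Phi>] by (auto simp: simple_roots_def)

lemma simple_root [simp]: "\<delta> \<in> \<Delta> \<Longrightarrow> \<delta> \<in> \<Phi>" using simple_sub by auto

lemma refl_root: "\<alpha> \<in> \<Phi> \<Longrightarrow> \<beta> \<in> \<Phi> \<Longrightarrow> refl \<alpha> \<beta> \<in> \<Phi>" using refl_image by blast

lemma refl_self: "\<alpha> \<in> \<Phi> \<Longrightarrow> refl \<alpha> \<alpha> = - \<alpha>" by (simp add: refl_def zmult_two)

lemma neg_root: "\<alpha> \<in> \<Phi> \<Longrightarrow> - \<alpha> \<in> \<Phi>" using refl_root[of \<alpha> \<alpha>] refl_self by simp

lemma refl_refl: assumes "\<alpha> \<in> \<Phi>" shows "refl \<alpha> (refl \<alpha> x) = x"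
proof -
  have "cp (refl \<alpha> x) \<alpha> = - cp x \<alpha>" using assms by (simp add: refl_def)
  then have "refl \<alpha> (refl \<alpha> x) = refl \<alpha> x - zmult (- cp x \<alpha>) \<alpha>" by (simp only: refl_def)
  then show ?thesis by (simp add: zmult_minus refl_def)
qed

lemma root_ne_0: "\<alpha> \<in> \<Phi> \<Longrightarrow> \<alpha> \<noteq> 0" using cp_self by fastforce

lemma root_ne_neg: "\<alpha> \<in> \<Phi> \<Longrightarrow> - \<alpha> \<noteq> \<alpha>"
proof
  assume a: "\<alpha> \<in> \<Phi>" "- \<alpha> = \<alpha>"
  have "cp (-\<alpha>) \<alpha> = cp \<alpha> \<alpha>" unfolding a(2) ..
  then show False using a(1) by simp
qed

subsection \<open>Coordinates with respect to the simple roots\<close>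

definition coef where "coef = zmod.representation \<Delta>"
abbreviation QL where "QL \<equiv> zmod.span \<Delta>"

lemma coef_sum: "v \<in> QL \<Longrightarrow> (\<Sum>\<delta>\<in>\<Delta>. zmult (coef v \<delta>) \<delta>) = v"
  unfolding coef_def by (rule zmod.sum_representation_eq) (use indep in auto)

lemma comb_in [simp]: "(\<Sum>\<delta>\<in>\<Delta>. zmult (c \<delta>) \<delta>) \<in> QL"
  by (intro zmod.span_sum zmod.span_scale zmod.span_base)

lemma coef_comb: assumes "\<delta> \<in> \<Delta>" shows "coef (\<Sum>\<delta>\<in>\<Delta>. zmult (c \<delta>) \<delta>) \<delta> = c \<delta>"
proof -
  let ?v = "\<Sum>\<delta>\<in>\<Delta>. zmult (c \<delta>) \<delta>"
  have "(\<Sum>\<delta>\<in>\<Delta>. zmult (coef ?v \<delta> - c \<delta>) \<delta>) = 0"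
    using coef_sum[of ?v] by (simp add: zmod.scale_left_diff_distrib sum_subtractf)
  from zmod.independentD[OF indep finite_simple _ this assms] show ?thesis by simp
qed

lemma coef_out [simp]: "\<delta> \<notin> \<Delta> \<Longrightarrow> coef v \<delta> = 0"
  unfolding coef_def using zmod.representation_ne_zero by metis

lemma coef_simps:
  "u \<in> QL \<Longrightarrow> v \<in> QL \<Longrightarrow> coef (u + v) \<delta> = coef u \<delta> + coef v \<delta>"
  "u \<in> QL \<Longrightarrow> v \<in> QL \<Longrightarrow> coef (u - v) \<delta> = coef u \<delta> - coef v \<delta>"
  "u \<in> QL \<Longrightarrow> coef (- u) \<delta> = - coef u \<delta>"
  "u \<in> QL \<Longrightarrow> coef (zmult k u) \<delta> = k * coef u \<delta>"
  "coef 0 \<delta> = 0"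
  "\<gamma> \<in> \<Delta> \<Longrightarrow> coef \<gamma> \<delta> = (if \<delta> = \<gamma> then 1 else 0)"
  unfolding coef_def by (simp_all add: zmod.representation_add[OF indep] zmod.representation_diff[OF indep]
    zmod.representation_neg[OF indep] zmod.representation_scale[OF indep]
    zmod.representation_zero zmod.representation_basis[OF indep])

lemma coef_eqI:
  assumes "u \<in> QL" "v \<in> QL" "\<And>\<delta>. \<delta> \<in> \<Delta> \<Longrightarrow> coef u \<delta> = coef v \<delta>"
  shows "u = v"
proof -
  have "(\<Sum>\<delta>\<in>\<Delta>. zmult (coef u \<delta>) \<delta>) = (\<Sum>\<delta>\<in>\<Delta>. zmult (coef v \<delta>) \<delta>)"
    by (rule sum.cong) (simp_all add: assms(3))
  then show ?thesis unfolding coef_sum[OF assms(1)] coef_sum[OF assms(2)] .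
qed

lemma root_in_QL: "\<alpha> \<in> \<Phi> \<Longrightarrow> \<alpha> \<in> QL"
  using simple unfolding simple_roots_def by (metis comb_in)

lemma span_roots: "zmod.span \<Phi> = QL"
proof
  show "zmod.span \<Phi> \<subseteq> QL" by (rule zmod.span_minimal) (auto intro: root_in_QL)
  show "QL \<subseteq> zmod.span \<Phi>" by (rule zmod.span_mono[OF simple_sub])
qed

lemma coef_comb_all: "coef (\<Sum>\<delta>\<in>\<Delta>. zmult (c \<delta>) \<delta>) \<delta> = (if \<delta> \<in> \<Delta> then c \<delta> else 0)"
  using coef_comb[of \<delta> c] by simp

lemma root_sign: assumes "\<alpha> \<in> \<Phi>" shows "(\<forall>\<delta>. 0 \<le> coef \<alpha> \<delta>) \<or> (\<forall>\<delta>. coef \<alpha> \<delta> \<le> 0)"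
proof -
  obtain c where c: "\<alpha> = (\<Sum>\<alpha>\<in>\<Delta>. zmult (c \<alpha>) \<alpha>)" and s: "(\<forall>\<alpha>\<in>\<Delta>. 0 \<le> c \<alpha>) \<or> (\<forall>\<alpha>\<in>\<Delta>. c \<alpha> \<le> 0)"
    using simple assms unfolding simple_roots_def by meson
  show ?thesis unfolding c coef_comb_all using s by auto
qed

definition pos where "pos = {\<alpha> \<in> \<Phi>. \<forall>\<delta>. 0 \<le> coef \<alpha> \<delta>}"

lemma positive_roots_eq: "positive_roots R \<Delta> = pos"
proof -
  have "(\<exists>c. \<beta> = (\<Sum>\<alpha>\<in>\<Delta>. zmult (c \<alpha>) \<alpha>) \<and> (\<forall>\<alpha>\<in>\<Delta>. 0 \<le> c \<alpha>)) \<longleftrightarrow> (\<forall>\<delta>. 0 \<le> coef \<beta> \<delta>)"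
    if "\<beta> \<in> \<Phi>" for \<beta>
  proof
    assume "\<exists>c. \<beta> = (\<Sum>\<alpha>\<in>\<Delta>. zmult (c \<alpha>) \<alpha>) \<and> (\<forall>\<alpha>\<in>\<Delta>. 0 \<le> c \<alpha>)"
    then obtain c where c: "\<beta> = (\<Sum>\<alpha>\<in>\<Delta>. zmult (c \<alpha>) \<alpha>)" and s: "\<forall>\<alpha>\<in>\<Delta>. 0 \<le> c \<alpha>" by blast
    show "\<forall>\<delta>. 0 \<le> coef \<beta> \<delta>" unfolding c coef_comb_all using s by auto
  next
    assume "\<forall>\<delta>. 0 \<le> coef \<beta> \<delta>"
    then show "\<exists>c. \<beta> = (\<Sum>\<alpha>\<in>\<Delta>. zmult (c \<alpha>) \<alpha>) \<and> (\<forall>\<alpha>\<in>\<Delta>. 0 \<le> c \<alpha>)"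
      using coef_sum[OF root_in_QL[OF that], symmetric] by (intro exI[of _ "coef \<beta>"]) blast
  qed
  then show ?thesis unfolding positive_roots_def pos_def by blast
qed

lemma coef_nonzero: assumes "\<alpha> \<in> \<Phi>" obtains \<delta> where "\<delta> \<in> \<Delta>" "coef \<alpha> \<delta> \<noteq> 0"
proof -
  have "\<exists>\<delta>\<in>\<Delta>. coef \<alpha> \<delta> \<noteq> 0"
  proof (rule ccontr)
    assume "\<not> ?thesis"
    then have "\<alpha> = 0" by (intro coef_eqI[OF root_in_QL[OF assms] zmod.span_zero]) (simp add: coef_simps(5))
    then show False using root_ne_0[OF assms] by simp
  qed
  then show thesis using that by blast
qed

lemma coef_neg: "\<alpha> \<in> \<Phi> \<Longrightarrow> coef (- \<alpha>) \<delta> = - coef \<alpha> \<delta>"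
  by (rule coef_simps(3)[OF root_in_QL])

lemma pos_or_neg: assumes a: "\<alpha> \<in> \<Phi>" shows "(\<alpha> \<in> pos) \<noteq> (- \<alpha> \<in> pos)"
proof -
  obtain \<delta> where d: "coef \<alpha> \<delta> \<noteq> 0" using coef_nonzero[OF a] by blast
  have "\<alpha> \<in> pos \<longleftrightarrow> (\<forall>\<delta>. 0 \<le> coef \<alpha> \<delta>)" "- \<alpha> \<in> pos \<longleftrightarrow> (\<forall>\<delta>. coef \<alpha> \<delta> \<le> 0)"
    using a neg_root[OF a] by (simp_all add: pos_def coef_neg)
  then show ?thesis using root_sign[OF a] d by (metis order_antisym)
qed

subsection \<open>The invariant form\<close>

definition frm where "frm x x' = (\<Sum>\<gamma>\<in>\<Phi>. cp x \<gamma> * cp x' \<gamma>)"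
definition cofrm where "cofrm y y' = (\<Sum>\<gamma>\<in>\<Phi>. pair R \<gamma> y * pair R \<gamma> y')"

lemma frm_simps [simp]:
  "frm (a + b) c = frm a c + frm b c" "frm c (a + b) = frm c a + frm c b"
  "frm (a - b) c = frm a c - frm b c" "frm c (a - b) = frm c a - frm c b"
  "frm (- a) c = - frm a c" "frm c (- a) = - frm c a"
  "frm (zmult k a) c = k * frm a c" "frm c (zmult k a) = k * frm c a"
  by (simp_all add: frm_def algebra_simps sum.distrib sum_subtractf sum_negf sum_distrib_left)

lemma frm_sum: "frm (sum f A) c = (\<Sum>i\<in>A. frm (f i) c)" "frm c (sum f A) = (\<Sum>i\<in>A. frm c (f i))"
  by (induction A rule: infinite_finite_induct) (simp_all, simp_all add: frm_def)

lemma frm_commute: "frm a b = frm b a" by (simp add: frm_def mult.commute)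

text \<open>The coreflection permutes the coroots, hence the summands of the form.\<close>

lemma frm_refl: assumes "\<delta> \<in> \<Phi>" shows "frm (refl \<delta> x) (refl \<delta> x') = frm x x'"
proof -
  let ?Y = "coroot R ` \<Phi>"
  have *: "frm u v = (\<Sum>y\<in>?Y. pair R u y * pair R v y)" for u v
    by (simp add: frm_def sum.reindex[OF inj_coroot])
  have inj: "inj_on (corefl \<delta>) ?Y"
    using corefl_image[OF assms] by (metis finite_imageI finite_roots eq_card_imp_inj_on)
  have "frm x x' = (\<Sum>y\<in>corefl \<delta> ` ?Y. pair R x y * pair R x' y)"
    unfolding corefl_image[OF assms] * ..
  also have "\<dots> = (\<Sum>y\<in>?Y. pair R x (corefl \<delta> y) * pair R x' (corefl \<delta> y))"
    by (simp add: sum.reindex[OF inj])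
  also have "\<dots> = (\<Sum>y\<in>?Y. pair R (refl \<delta> x) y * pair R (refl \<delta> x') y)"
    by (simp add: corefl_def refl_def mult.commute)
  finally show ?thesis unfolding * ..
qed

lemma cofrm_corefl: assumes "\<delta> \<in> \<Phi>" shows "cofrm (corefl \<delta> x) (corefl \<delta> x') = cofrm x x'"
proof -
  have inj: "inj_on (refl \<delta>) \<Phi>"
    using refl_image[OF assms] by (metis finite_roots eq_card_imp_inj_on)
  have "cofrm x x' = (\<Sum>y\<in>refl \<delta> ` \<Phi>. pair R y x * pair R y x')"
    unfolding refl_image[OF assms] cofrm_def ..
  also have "\<dots> = (\<Sum>y\<in>\<Phi>. pair R (refl \<delta> y) x * pair R (refl \<delta> y) x')"
    by (simp add: sum.reindex[OF inj])
  also have "\<dots> = cofrm (corefl \<delta> x) (corefl \<delta> x')"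
    by (simp add: corefl_def refl_def cofrm_def mult.commute)
  finally show ?thesis ..
qed

text \<open>Invariance under the reflection in \<open>\<delta>\<close>, which negates \<open>\<delta>\<close>, gives the usual formula
  \<open>\<langle>x, \<delta>\<^sup>\<vee>\<rangle> = 2 (x, \<delta>) / (\<delta>, \<delta>)\<close>, here with the denominator cleared.\<close>

lemma frm_root: assumes "\<delta> \<in> \<Phi>" shows "2 * frm x \<delta> = cp x \<delta> * frm \<delta> \<delta>"
  using frm_refl[OF assms, of x \<delta>] unfolding refl_self[OF assms] by (simp add: refl_def)

lemma cofrm_root: assumes "\<delta> \<in> \<Phi>"
  shows "2 * cofrm y (coroot R \<delta>) = pair R \<delta> y * cofrm (coroot R \<delta>) (coroot R \<delta>)"
proof -
  have s: "corefl \<delta> (coroot R \<delta>) = - coroot R \<delta>" using assms by (simp add: corefl_def zmult_two)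
  have "cofrm (corefl \<delta> y) (- coroot R \<delta>) = cofrm y (coroot R \<delta>)"
    using cofrm_corefl[OF assms, of y "coroot R \<delta>"] unfolding s .
  moreover have "cofrm (corefl \<delta> y) (- coroot R \<delta>)
      = - cofrm y (coroot R \<delta>) + pair R \<delta> y * cofrm (coroot R \<delta>) (coroot R \<delta>)"
    by (simp add: cofrm_def corefl_def algebra_simps sum_negf sum_subtractf sum_distrib_left)
  ultimately show ?thesis by linarith
qed

lemma frm_pos: assumes "\<delta> \<in> \<Phi>" shows "frm \<delta> \<delta> > 0"
proof -
  have "cp \<delta> \<delta> * cp \<delta> \<delta> \<le> frm \<delta> \<delta>" unfolding frm_def
    by (rule member_le_sum) (use assms in auto)
  then show ?thesis using assms by simp
qed

lemma cofrm_pos: assumes "\<delta> \<in> \<Phi>" shows "cofrm (coroot R \<delta>) (coroot R \<delta>) > 0"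
proof -
  have "cp \<delta> \<delta> * cp \<delta> \<delta> \<le> cofrm (coroot R \<delta>) (coroot R \<delta>)" unfolding cofrm_def
    by (rule member_le_sum[where f="\<lambda>x. pair R x (coroot R \<delta>) * pair R x (coroot R \<delta>)"]) (use assms in auto)
  then show ?thesis using assms by simp
qed

text \<open>The dual form identifies each simple root, as a functional on \<open>Y\<close>, with a multiple of its coroot, and
  so \<open>v\<close> with a rational combination \<open>u\<close> of the simple coroots. The numbers \<open>G \<gamma>\<close> are the values of the
  roots at \<open>u\<close>. As \<open>v\<close> vanishes on the simple coroots, the sum of their squares is 0; hence they all
  vanish, and \<open>v\<close> with them.\<close>

lemma nondegenerate_QL:
  assumes v: "v \<in> QL" and 0: "\<And>\<delta>. \<delta> \<in> \<Delta> \<Longrightarrow> cp v \<delta> = 0"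
  shows "v = 0"
proof -
  define r :: "'x \<Rightarrow> rat" where "r \<delta> = 2 * of_int (coef v \<delta>) / of_int (cofrm (coroot R \<delta>) (coroot R \<delta>))" for \<delta>
  define G :: "'x \<Rightarrow> rat" where "G \<gamma> = (\<Sum>\<delta>\<in>\<Delta>. r \<delta> * of_int (cp \<gamma> \<delta>))" for \<gamma>
  have e: "of_int (pair R v y) = (\<Sum>\<gamma>\<in>\<Phi>. of_int (pair R \<gamma> y) * G \<gamma>)" for y
  proof -
    have t: "rat_of_int (coef v \<delta> * pair R \<delta> y) = r \<delta> * of_int (cofrm y (coroot R \<delta>))" if "\<delta> \<in> \<Delta>" for \<delta>
    proof -
      let ?N = "cofrm (coroot R \<delta>) (coroot R \<delta>)"
      have N: "?N > 0" using cofrm_pos that by simp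
      have "2 * rat_of_int (cofrm y (coroot R \<delta>)) = of_int (pair R \<delta> y) * of_int ?N"
        using cofrm_root[of \<delta> y] that by (metis of_int_mult of_int_numeral simple_root)
      then show ?thesis using N by (simp add: r_def field_simps)
    qed
    have "pair R v y = (\<Sum>\<delta>\<in>\<Delta>. coef v \<delta> * pair R \<delta> y)"
      by (subst coef_sum[OF v, symmetric]) simp
    then have "rat_of_int (pair R v y) = (\<Sum>\<delta>\<in>\<Delta>. rat_of_int (coef v \<delta> * pair R \<delta> y))" by simp
    also have "\<dots> = (\<Sum>\<delta>\<in>\<Delta>. r \<delta> * of_int (cofrm y (coroot R \<delta>)))" using t by (intro sum.cong) auto
    also have "\<dots> = (\<Sum>\<gamma>\<in>\<Phi>. of_int (pair R \<gamma> y) * G \<gamma>)"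
      unfolding cofrm_def G_def of_int_sum sum_distrib_left
      by (subst sum.swap) (simp add: algebra_simps)
    finally show ?thesis .
  qed
  have "(\<Sum>\<gamma>\<in>\<Phi>. G \<gamma> * G \<gamma>) = (\<Sum>\<gamma>\<in>\<Phi>. \<Sum>\<delta>\<in>\<Delta>. r \<delta> * of_int (cp \<gamma> \<delta>) * G \<gamma>)"
    by (subst (1) G_def) (simp add: sum_distrib_right)
  also have "\<dots> = (\<Sum>\<delta>\<in>\<Delta>. r \<delta> * (\<Sum>\<gamma>\<in>\<Phi>. of_int (cp \<gamma> \<delta>) * G \<gamma>))"
    by (subst sum.swap) (simp add: sum_distrib_left algebra_simps)
  also have "\<dots> = 0" using e 0 by (auto simp flip: e intro: sum.neutral)
  finally have "(\<Sum>\<gamma>\<in>\<Phi>. G \<gamma> * G \<gamma>) = 0" .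
  then have "\<forall>\<gamma>\<in>\<Phi>. G \<gamma> = 0" by (subst (asm) sum_nonneg_eq_0_iff) auto
  then have "pair R v y = 0" for y using e[of y] by simp
  then show ?thesis using eq_by_left[of v 0] by simp
qed

lemma frm_definite: assumes "v \<in> QL" "frm v v = 0" shows "v = 0"
proof (rule nondegenerate_QL[OF assms(1)])
  have "\<forall>\<gamma>\<in>\<Phi>. cp v \<gamma> * cp v \<gamma> = 0"
    using assms(2) unfolding frm_def by (subst (asm) sum_nonneg_eq_0_iff) auto
  then show "cp v \<delta> = 0" if "\<delta> \<in> \<Delta>" for \<delta> using that by simp
qed

lemma frm_nonneg: "frm v v \<ge> 0" unfolding frm_def by (rule sum_nonneg) simp

end

subsection \<open>Rank\<close>

text \<open>Rationally, an independent set with as many elements as a basis spans everything: together with \<open>x\<close>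
  it has too many elements to be independent in the rational vector space of coordinate functions
  with respect to \<open>B\<close>. Clearing denominators in a linear relation gives the claim.\<close>

lemma zrank_dependent:
  fixes B D :: "'a::ab_group_add set"
  assumes B: "finite B" "zbasis B" and D: "finite D" "zmod.independent D" "card B = card D"
  shows "\<exists>k. k \<noteq> 0 \<and> zmult k x \<in> zmod.span D"
proof (cases "x \<in> zmod.span D")
  case True then show ?thesis by (intro exI[of _ 1]) simp
next
  case False
  define sc :: "rat \<Rightarrow> ('a \<Rightarrow> rat) \<Rightarrow> ('a \<Rightarrow> rat)" where "sc c f = (\<lambda>b. c * f b)" for c f
  interpret V: vector_space sc
    by standard (auto simp: sc_def algebra_simps fun_eq_iff)
  define rp where "rp v b = rat_of_int (zmod.representation B v b)" for v b
  have Bs: "v \<in> zmod.span B" and Bi: "zmod.independent B" for v using B(2) by (auto simp: zbasis_def)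
  have rp_add: "rp (u + v) = rp u + rp v" for u v
    unfolding rp_def zmod.representation_add[OF Bi Bs Bs] plus_fun_def of_int_add ..
  have rp_sc: "rp (zmult k u) = sc (of_int k) (rp u)" for u k
    unfolding rp_def sc_def zmod.representation_scale[OF Bi Bs] of_int_mult ..
  have rp_0: "rp 0 = 0"
    unfolding rp_def zmod.representation_zero zero_fun_def of_int_0 ..
  have rp_comb: "rp (\<Sum>v\<in>S. zmult (u v) (f v)) = (\<Sum>v\<in>S. sc (of_int (u v)) (rp (f v)))" for S u f
    by (induction S rule: infinite_finite_induct) (simp_all only: sum.infinite sum.empty sum.insert rp_0 rp_add rp_sc
      simp_thms)
  have rp_inj: "rp u = rp v \<Longrightarrow> u = v" for u v
  proof -
    assume "rp u = rp v"
    then have "zmod.representation B u = zmod.representation B v" by (auto simp: rp_def fun_eq_iff)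
    then have "(\<Sum>b\<in>B. zmult (zmod.representation B u b) b) = (\<Sum>b\<in>B. zmult (zmod.representation B v b) b)"
      by (rule arg_cong)
    then show "u = v" unfolding zmod.sum_representation_eq[OF Bi Bs B(1) order_refl] .
  qed
  let ?S = "rp ` insert x D"
  have fin: "finite (insert x D)" using D by simp
  have "rp v \<in> V.span (rp ` B)" for v
  proof -
    have "v = (\<Sum>b\<in>B. zmult (zmod.representation B v b) b)"
      by (rule zmod.sum_representation_eq[OF Bi Bs B(1) order_refl, symmetric])
    then have "rp v = (\<Sum>b\<in>B. sc (of_int (zmod.representation B v b)) (rp b))"
      using rp_comb[of "zmod.representation B v" "\<lambda>b. b" B] by (simp only:)
    also have "\<dots> \<in> V.span (rp ` B)" by (intro V.span_sum V.span_scale V.span_base) auto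
    finally show ?thesis .
  qed
  then have sub: "?S \<subseteq> V.span (rp ` B)" by auto
  have xD: "x \<notin> D" using False zmod.span_base by blast
  have card: "card ?S = Suc (card B)"
    using D xD rp_inj by (subst card_image) (auto simp: inj_on_def)
  have "\<not> V.independent ?S"
    using V.independent_span_bound[OF _ _ sub] B card card_image_le[OF B(1), of rp] by fastforce
  then obtain w where w: "(\<Sum>v\<in>?S. sc (w v) v) = 0" "\<exists>v\<in>?S. w v \<noteq> 0"
    using V.dependent_finite[of ?S] fin by auto
  define w' where "w' v = w (rp v)" for v
  have inj: "inj_on rp (insert x D)" using rp_inj by (auto simp: inj_on_def)
  have w'0: "(\<Sum>v\<in>insert x D. sc (w' v) (rp v)) = 0"
    using w(1) unfolding sum.reindex[OF inj] by (simp add: w'_def)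
  have w'1: "\<exists>v\<in>insert x D. w' v \<noteq> 0" using w(2) by (auto simp: w'_def)
  define K where "K = (\<Prod>v\<in>insert x D. snd (quotient_of (w' v)))"
  have Kpos: "K > 0" unfolding K_def by (intro prod_pos) (auto intro: quotient_of_denom_pos')
  have "\<exists>m. of_int K * w' v = of_int m" if "v \<in> insert x D" for v
  proof -
    obtain a b where ab: "quotient_of (w' v) = (a, b)" by fastforce
    have "b dvd K" unfolding K_def using that fin ab
      by (metis dvd_prodI snd_conv)
    then obtain c where c: "K = b * c" by blast
    have "b > 0" using ab quotient_of_denom_pos by blast
    then have "of_int K * w' v = of_int (c * a)" using quotient_of_div[OF ab] c by simp
    then show ?thesis ..
  qed
  then obtain m where m: "\<And>v. v \<in> insert x D \<Longrightarrow> of_int K * w' v = of_int (m v)" by metis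
  have "rp (\<Sum>v\<in>insert x D. zmult (m v) v) = (\<Sum>v\<in>insert x D. sc (of_int (m v)) (rp v))"
    by (rule rp_comb[of _ "\<lambda>v. v"])
  also have "\<dots> = (\<Sum>v\<in>insert x D. sc (of_int K) (sc (w' v) (rp v)))"
    by (intro sum.cong refl) (simp add: m[symmetric])
  also have "\<dots> = sc (of_int K) 0" unfolding w'0[symmetric] by (simp add: V.scale_sum_right)
  also have "\<dots> = rp 0" by (simp add: rp_def sc_def zmod.representation_zero fun_eq_iff)
  finally have "(\<Sum>v\<in>insert x D. zmult (m v) v) = 0" by (rule rp_inj)
  then have z: "zmult (m x) x + (\<Sum>v\<in>D. zmult (m v) v) = 0" using D xD by simp
  have "m x \<noteq> 0"
  proof
    assume mx: "m x = 0"
    then have "\<forall>v\<in>D. m v = 0" using z zmod.independentD[OF D(2) D(1), of m] by auto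
    with mx have "\<forall>v\<in>insert x D. m v = 0" by auto
    then show False using w'1 m Kpos by fastforce
  qed
  moreover have "zmult (m x) x = - (\<Sum>v\<in>D. zmult (m v) v)" using z by (simp add: eq_neg_iff_add_eq_0)
  then have "zmult (m x) x \<in> zmod.span D"
    by (simp only:) (intro zmod.span_neg zmod.span_sum zmod.span_scale zmod.span_base)
  ultimately show ?thesis by blast
qed

context irreducible_datum begin

lemma nondegenerate: assumes "\<And>\<delta>. \<delta> \<in> \<Delta> \<Longrightarrow> cp x \<delta> = 0" shows "x = 0"
proof -
  obtain B where B: "finite B" "card B = n" "zbasis (B::'x set)" using datum by (auto simp: root_datum_def)
  obtain k where k: "k \<noteq> 0" "zmult k x \<in> QL"
    using zrank_dependent[OF B(1,3) finite_simple indep] B(2) card_simple by auto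
  have "zmult k x = 0" by (rule nondegenerate_QL[OF k(2)]) (simp add: assms)
  then show ?thesis using zmult_cancel[OF k(1), of x 0] by simp
qed

lemma eq_by_simple: "(\<And>\<delta>. \<delta> \<in> \<Delta> \<Longrightarrow> cp x \<delta> = cp x' \<delta>) \<Longrightarrow> x = x'"
  using nondegenerate[of "x - x'"] by simp

end

section \<open>Multisets of fibre sizes\<close>

definition fibres :: "('a \<Rightarrow> 'k) \<Rightarrow> 'a set \<Rightarrow> nat multiset"
  where "fibres f A = image_mset (\<lambda>k. card {a \<in> A. f a = k}) (mset_set (f ` A))"

lemma fibres_cong:
  assumes A: "finite A" and fg: "\<And>a b. a \<in> A \<Longrightarrow> b \<in> A \<Longrightarrow> f a = f b \<longleftrightarrow> g a = g b"
  shows "fibres f A = fibres g A"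
proof -
  define h where "h k = g (SOME a. a \<in> A \<and> f a = k)" for k
  have h: "h (f a) = g a" if "a \<in> A" for a
  proof -
    have "\<exists>b. b \<in> A \<and> f b = f a" using that by blast
    then have "(SOME b. b \<in> A \<and> f b = f a) \<in> A \<and> f (SOME b. b \<in> A \<and> f b = f a) = f a" by (rule someI_ex)
    then show ?thesis using fg[OF _ that] unfolding h_def by blast
  qed
  have img: "g ` A = h ` f ` A" using h by (force simp: image_image)
  have inj: "inj_on h (f ` A)" using h fg by (auto simp: inj_on_def)
  have "fibres g A = image_mset (\<lambda>k. card {a \<in> A. g a = h k}) (mset_set (f ` A))"
    unfolding fibres_def img image_mset_mset_set[OF inj, symmetric]
    by (simp add: multiset.map_comp comp_def)
  also have "\<dots> = fibres f A" unfolding fibres_def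
  proof (rule image_mset_cong)
    fix k assume "k \<in># mset_set (f ` A)"
    then obtain b where b: "b \<in> A" "k = f b" using A by auto
    have "{a \<in> A. g a = h k} = {a \<in> A. f a = k}" unfolding b(2) h[OF b(1)] using fg b(1) by blast
    then show "card {a \<in> A. g a = h k} = card {a \<in> A. f a = k}" by simp
  qed
  finally show ?thesis by simp
qed

lemma fibres_const:
  assumes "finite A" "\<And>k. k \<in> f ` A \<Longrightarrow> card {a \<in> A. f a = k} = m"
  shows "fibres f A = replicate_mset (card (f ` A)) m"
proof -
  have "fibres f A = image_mset (\<lambda>k. m) (mset_set (f ` A))"
    unfolding fibres_def by (rule image_mset_cong) (use assms in auto)
  then show ?thesis by (simp add: image_mset_const_eq)
qed

lemma fibres_union:
  assumes "finite A" "finite B" "f ` A \<inter> f ` B = {}"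
  shows "fibres f (A \<union> B) = fibres f A + fibres f B"
proof -
  have "mset_set (f ` (A \<union> B)) = mset_set (f ` A) + mset_set (f ` B)"
    unfolding image_Un using assms by (intro mset_set_Union) auto
  moreover have "image_mset (\<lambda>k. card {a \<in> A \<union> B. f a = k}) (mset_set (f ` A)) = fibres f A"
    unfolding fibres_def by (rule image_mset_cong, rule arg_cong[of _ _ card]) (use assms in auto)
  moreover have "image_mset (\<lambda>k. card {a \<in> A \<union> B. f a = k}) (mset_set (f ` B)) = fibres f B"
    unfolding fibres_def by (rule image_mset_cong, rule arg_cong[of _ _ card]) (use assms in auto)
  ultimately show ?thesis unfolding fibres_def[of f "A \<union> B"] by simp
qed

lemma fibres_empty [simp]: "fibres f {} = {#}" by (simp add: fibres_def)

section \<open>The roots as functions on the Cartan subalgebra\<close>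

definition congr :: "int \<Rightarrow> 'a::ab_group_add \<Rightarrow> 'a \<Rightarrow> bool"
  where "congr k x x' \<longleftrightarrow> (\<exists>v. x - x' = zmult k v)"

definition residue :: "int \<Rightarrow> 'a::ab_group_add \<Rightarrow> 'a set"
  where "residue k x = {x'. congr k x x'}"

context irreducible_datum begin

lemma congr_iff: "congr k (x::'x) x' \<longleftrightarrow> (\<forall>y. k dvd pair R x y - pair R x' y)"
  unfolding congr_def divisible_iff by simp

lemma congr_refl [simp]: "congr k (x::'x) x" unfolding congr_iff by simp

lemma congr_sym: "congr k (x::'x) x' \<Longrightarrow> congr k x' x"
  unfolding congr_iff by (metis dvd_minus_iff minus_diff_eq)

lemma congr_trans: "congr k (a::'x) b \<Longrightarrow> congr k b c \<Longrightarrow> congr k a c"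
  unfolding congr_iff by (metis diff_add_cancel add_diff_eq dvd_add)

lemma residue_eq: "residue k (x::'x) = residue k x' \<longleftrightarrow> congr k x x'"
proof
  assume "residue k x = residue k x'"
  moreover have "x' \<in> residue k x'" by (simp add: residue_def)
  ultimately have "x' \<in> residue k x" by simp
  then show "congr k x x'" by (simp add: residue_def)
next
  assume "congr k x x'"
  then show "residue k x = residue k x'"
    unfolding residue_def using congr_sym congr_trans by blast
qed

definition null_roots where "null_roots k = {\<alpha> \<in> \<Phi>. congr k \<alpha> 0}"

end

text \<open>The decomposition of an element of the Lie ring is unique, so its component in \<open>Y\<close> depends additively on
  the element.\<close>

lemma exists_coordinate:
  assumes LZ: "chevalley_lie_ring R brZ h e"
  obtains c where "additive c" "\<And>y. c (h y) = y"
proof -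
  define P where "P z w \<longleftrightarrow> (\<forall>\<alpha>. \<alpha> \<notin> roots R \<longrightarrow> snd w \<alpha> = 0) \<and>
       z = h (fst w) + (\<Sum>\<alpha>\<in>roots R. zmult (snd w \<alpha>) (e \<alpha>))" for z w
  have "\<forall>z. \<exists>!(y, c). (\<forall>\<alpha>. \<alpha> \<notin> roots R \<longrightarrow> c \<alpha> = 0) \<and> z = h y + (\<Sum>\<alpha>\<in>roots R. zmult (c \<alpha>) (e \<alpha>))"
    and h: "additive h" using LZ unfolding chevalley_lie_ring_def by blast+
  moreover have "P z = (\<lambda>(y, c). (\<forall>\<alpha>. \<alpha> \<notin> roots R \<longrightarrow> c \<alpha> = 0) \<and>
      z = h y + (\<Sum>\<alpha>\<in>roots R. zmult (c \<alpha>) (e \<alpha>)))" for z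
    by (auto simp: P_def fun_eq_iff)
  ultimately have ex1: "\<exists>!w. P z w" for z by simp
  define w where "w z = (THE w. P z w)" for z
  have Pw: "P z (w z)" for z unfolding w_def using ex1 by (rule theI')
  have uniq: "P z v \<Longrightarrow> w z = v" for z v using ex1[of z] Pw[of z] by blast
  have Padd: "P (a + b) (fst (w a) + fst (w b), \<lambda>\<alpha>. snd (w a) \<alpha> + snd (w b) \<alpha>)" for a b
  proof -
    have "a + b = h (fst (w a)) + (\<Sum>\<alpha>\<in>roots R. zmult (snd (w a) \<alpha>) (e \<alpha>))
       + (h (fst (w b)) + (\<Sum>\<alpha>\<in>roots R. zmult (snd (w b) \<alpha>) (e \<alpha>)))"
      using Pw[of a] Pw[of b] unfolding P_def by simp
    also have "\<dots> = h (fst (w a) + fst (w b)) + (\<Sum>\<alpha>\<in>roots R. zmult (snd (w a) \<alpha> + snd (w b) \<alpha>) (e \<alpha>))"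
      by (simp add: zmod.scale_left_distrib sum.distrib additive.add[OF h])
    finally show ?thesis using Pw[of a] Pw[of b] unfolding P_def by simp
  qed
  have 1: "additive (\<lambda>z. fst (w z))" by unfold_locales (simp add: uniq[OF Padd])
  have "P (h y) (y, \<lambda>_. 0)" for y by (simp add: P_def)
  then have 2: "fst (w (h y)) = y" for y using uniq[of "h y" "(y, \<lambda>_. 0)"] by simp
  show thesis by (rule that[OF 1 2])
qed

text \<open>A \<open>\<int>\<close>-basis of the Lie ring is mapped to a basis of the Lie algebra, on which the values of a linear
  functional can be prescribed.\<close>

lemma exists_linear_extension:
  fixes scale :: "'f::field \<Rightarrow> 'l::ab_group_add \<Rightarrow> 'l" and g :: "'z::ab_group_add \<Rightarrow> int"
  assumes vs: "vector_space scale" and S: "scalar_extension brZ scale br \<iota>" and g: "additive g"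
  obtains f where "Vector_Spaces.linear scale (*) f" "\<And>z. f (\<iota> z) = of_int (g z)"
proof -
  interpret V: vector_space scale by (rule vs)
  interpret F: vector_space "(*) :: 'f \<Rightarrow> 'f \<Rightarrow> 'f" by standard (simp_all add: algebra_simps)
  interpret P: vector_space_pair scale "(*) :: 'f \<Rightarrow> 'f \<Rightarrow> 'f" ..
  obtain B where B: "zbasis B" "inj_on \<iota> B" "\<not> V.dependent (\<iota> ` B)" and i: "additive \<iota>"
    using S unfolding scalar_extension_def by blast
  obtain f where f: "Vector_Spaces.linear scale (*) f" and fB: "\<forall>v\<in>\<iota> ` B. f v = of_int (g (inv_into B \<iota> v))"
    using P.linear_independent_extend[OF B(3), of "\<lambda>v. of_int (g (inv_into B \<iota> v))"] by blast
  interpret f: Vector_Spaces.linear scale "(*)" f by (rule f)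
  have span: "zmod.span B = UNIV" using B(1) by (simp add: zbasis_def)
  have i_zmult: "\<iota> (zmult k z) = scale (of_int k) (\<iota> z)" for k z
  proof (induction k rule: int_induct[where k = 0])
    case base then show ?case by (simp add: additive.zero[OF i])
  next
    case (step1 k) then show ?case unfolding zmult_succ additive.add[OF i] by (simp add: V.scale_left_distrib)
  next
    case (step2 k) then show ?case unfolding zmult_pred additive.diff[OF i] by (simp add: V.scale_left_diff_distrib)
  qed
  have "f (\<iota> z) = of_int (g z)" for z
  proof -
    have "z \<in> zmod.span B" using span by simp
    then show ?thesis
    proof (induction rule: zmod.span_induct_alt)
      case base then show ?case by (simp add: additive.zero[OF i] additive.zero[OF g] f.zero)
    next
      case (step c x y)
      have "f (\<iota> x) = of_int (g x)" using fB step B(2) by simp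
      then show ?case
        using step by (simp add: additive.add[OF i] additive.add[OF g] f.add i_zmult f.scale additive_int_zmult[OF g])
    qed
  qed
  then show thesis by (rule that[OF f])
qed

locale root_functions = irreducible_datum R \<Delta> n
  for R :: "('x::ab_group_add, 'y::ab_group_add) root_data" and \<Delta> n +
  fixes brZ :: "'z::ab_group_add \<Rightarrow> 'z \<Rightarrow> 'z" and h :: "'y \<Rightarrow> 'z" and e :: "'x \<Rightarrow> 'z"
    and scale :: "'f::field \<Rightarrow> 'l::ab_group_add \<Rightarrow> 'l" and br :: "'l \<Rightarrow> 'l \<Rightarrow> 'l"
    and \<iota> :: "'z \<Rightarrow> 'l" and \<eta> :: "'y \<Rightarrow> 'l"
  assumes LZ: "chevalley_lie_ring R brZ h e"
    and L: "lie_algebra scale br" "scalar_extension brZ scale br \<iota>"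
    and \<eta>: "\<eta> = \<iota> \<circ> h"
begin

abbreviation "H \<equiv> cartan_subalgebra scale \<eta>"

lemma vs: "vector_space scale" using L(1) by (simp add: lie_algebra_def)

text \<open>The definite description in \<open>root_on\<close> denotes something: the functional \<open>\<langle>\<alpha>, \<sqdot>\<rangle>\<close> on \<open>Y\<close> extends to
  the Lie ring by means of the coordinate in \<open>Y\<close>, and then to the Lie algebra. Uniqueness holds because
  \<open>H\<close> is spanned by the range of \<open>\<eta>\<close>.\<close>

lemma root_on_props:
  "root_on R scale \<eta> \<alpha> \<in> extensional H"
  "finite S \<Longrightarrow> root_on R scale \<eta> \<alpha> (\<Sum>y\<in>S. scale (t y) (\<eta> y)) = (\<Sum>y\<in>S. of_int (pair R \<alpha> y) * t y)"
proof -
  interpret V: vector_space scale by (rule vs)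
  define Q where "Q f \<longleftrightarrow> f \<in> extensional H \<and>
    (\<forall>S t. finite S \<longrightarrow> f (\<Sum>y\<in>S. scale (t y) (\<eta> y)) = (\<Sum>y\<in>S. of_int (pair R \<alpha> y) * t y))" for f
  obtain c where c: "additive c" "\<And>y. c (h y) = y" using exists_coordinate[OF LZ] by blast
  have "additive (\<lambda>z. pair R \<alpha> (c z))" by unfold_locales (simp add: additive.add[OF c(1)])
  then obtain f where f: "Vector_Spaces.linear scale (*) f" "\<And>z. f (\<iota> z) = of_int (pair R \<alpha> (c z))"
    using exists_linear_extension[OF vs L(2)] by blast
  interpret f: Vector_Spaces.linear scale "(*)" f by (rule f)
  have f_eta: "f (\<eta> y) = of_int (pair R \<alpha> y)" for y by (simp add: \<eta> f(2) c(2))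
  have fS: "f (\<Sum>y\<in>S. scale (t y) (\<eta> y)) = (\<Sum>y\<in>S. of_int (pair R \<alpha> y) * t y)" for S t
    unfolding f.sum f.scale f_eta by (simp add: mult.commute)
  have HS: "(\<Sum>y\<in>S. scale (t y) (\<eta> y)) \<in> H" for S t unfolding cartan_subalgebra_def
    by (intro V.span_sum V.span_scale V.span_base) auto
  have ex: "Q (restrict f H)" unfolding Q_def using HS fS by simp
  have H_ex: "\<exists>S t. finite S \<and> v = (\<Sum>y\<in>S. scale (t y) (\<eta> y))" if v: "v \<in> H" for v
  proof -
    obtain T r where T: "finite T" "T \<subseteq> range \<eta>" "v = (\<Sum>a\<in>T. scale (r a) a)"
      using v unfolding cartan_subalgebra_def V.span_explicit by blast
    obtain S where S: "finite S" "inj_on \<eta> S" "T = \<eta> ` S" using T(1,2)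
      by (metis subset_image_inj finite_image_iff)
    have "v = (\<Sum>y\<in>S. scale (r (\<eta> y)) (\<eta> y))" unfolding T(3) S(3) by (simp add: sum.reindex[OF S(2)])
    then show ?thesis using S(1) by (intro exI[of _ S] exI[of _ "\<lambda>y. r (\<eta> y)"]) simp
  qed
  have uq: "g = restrict f H" if "Q g" for g
  proof (rule extensionalityI[of _ H])
    show "g \<in> extensional H" "restrict f H \<in> extensional H" using that ex by (auto simp: Q_def)
    fix v assume "v \<in> H"
    then obtain S t where "finite S" "v = (\<Sum>y\<in>S. scale (t y) (\<eta> y))" using H_ex by blast
    then show "g v = restrict f H v" using that ex unfolding Q_def by metis
  qed
  have "Q (THE f. Q f)" by (rule theI[of Q, OF ex uq])
  then show "root_on R scale \<eta> \<alpha> \<in> extensional H"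
    "finite S \<Longrightarrow> root_on R scale \<eta> \<alpha> (\<Sum>y\<in>S. scale (t y) (\<eta> y)) = (\<Sum>y\<in>S. of_int (pair R \<alpha> y) * t y)"
    unfolding Q_def root_on_def by blast+
qed

lemma root_on_eta: "root_on R scale \<eta> \<alpha> (\<eta> y) = of_int (pair R \<alpha> y)"
proof -
  interpret V: vector_space scale by (rule vs)
  show ?thesis using root_on_props(2)[of "{y}" \<alpha> "\<lambda>_. 1"] by simp
qed

lemma root_on_eqI:
  assumes g: "g \<in> extensional H"
    and gS: "\<And>S t. finite S \<Longrightarrow> g (\<Sum>y\<in>S. scale (t y) (\<eta> y)) = (\<Sum>y\<in>S. of_int (pair R \<alpha> y) * t y)"
  shows "root_on R scale \<eta> \<alpha> = g"
proof (rule extensionalityI[OF root_on_props(1) g])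
  interpret V: vector_space scale by (rule vs)
  fix v assume v: "v \<in> H"
  obtain T r where T: "finite T" "T \<subseteq> range \<eta>" "v = (\<Sum>a\<in>T. scale (r a) a)"
    using v unfolding cartan_subalgebra_def V.span_explicit by blast
  obtain S where S: "finite S" "inj_on \<eta> S" "T = \<eta> ` S" using T(1,2)
    by (metis subset_image_inj finite_image_iff)
  have "v = (\<Sum>y\<in>S. scale (r (\<eta> y)) (\<eta> y))" unfolding T(3) S(3) by (simp add: sum.reindex[OF S(2)])
  then show "root_on R scale \<eta> \<alpha> v = g v" using root_on_props(2)[OF S(1)] gS[OF S(1)] by simp
qed

text \<open>Both functions are determined by their values at the elements \<open>\<eta> y\<close>, which are the images in the field
  of the integers \<open>\<langle>\<alpha>, y\<rangle>\<close> and \<open>\<langle>\<beta>, y\<rangle>\<close>; and congruence in \<open>X\<close> can be tested on \<open>Y\<close>.\<close>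

lemma root_on_eq_iff:
  "root_on R scale \<eta> \<alpha> = root_on R scale \<eta> \<beta> \<longleftrightarrow> congr (int CHAR('f)) \<alpha> \<beta>"
proof -
  have c: "int CHAR('f) dvd pair R \<alpha> y - pair R \<beta> y \<longleftrightarrow> (of_int (pair R \<alpha> y) :: 'f) = of_int (pair R \<beta> y)" for y
    unfolding of_int_eq_0_iff_char_dvd[symmetric, where 'a='f] by simp
  have "root_on R scale \<eta> \<alpha> = root_on R scale \<eta> \<beta> \<longleftrightarrow> (\<forall>y. (of_int (pair R \<alpha> y) :: 'f) = of_int (pair R \<beta> y))"
  proof
    assume "root_on R scale \<eta> \<alpha> = root_on R scale \<eta> \<beta>"
    then show "\<forall>y. (of_int (pair R \<alpha> y) :: 'f) = of_int (pair R \<beta> y)"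
      by (simp flip: root_on_eta)
  next
    assume "\<forall>y. (of_int (pair R \<alpha> y) :: 'f) = of_int (pair R \<beta> y)"
    then show "root_on R scale \<eta> \<alpha> = root_on R scale \<eta> \<beta>"
      by (intro root_on_eqI root_on_props(1)) (simp add: root_on_props(2))
  qed
  then show ?thesis unfolding congr_iff c .
qed

lemma zero_on_eq: "zero_on scale \<eta> = root_on R scale \<eta> 0"
proof (rule root_on_eqI[symmetric])
  show "zero_on scale \<eta> \<in> extensional H" by (simp add: zero_on_def)
  interpret V: vector_space scale by (rule vs)
  fix S and t :: "_ \<Rightarrow> 'f"
  have "(\<Sum>y\<in>S. scale (t y) (\<eta> y)) \<in> H" unfolding cartan_subalgebra_def
    by (intro V.span_sum V.span_scale V.span_base) auto
  then show "zero_on scale \<eta> (\<Sum>y\<in>S. scale (t y) (\<eta> y)) = (\<Sum>y\<in>S. of_int (pair R 0 y) * t y)"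
    by (simp add: zero_on_def)
qed

text \<open>A multiplicity counts all roots with the given restriction to \<open>H\<close>, while \<open>fibres\<close> only sees \<open>A\<close>;
  therefore \<open>A\<close> has to be a union of congruence classes.\<close>

lemma mults_eq_fibres:
  assumes A: "A \<subseteq> \<Phi>" and sat: "\<And>\<alpha> \<beta>. \<alpha> \<in> A \<Longrightarrow> \<beta> \<in> \<Phi> \<Longrightarrow> congr (int CHAR('f)) \<alpha> \<beta> \<Longrightarrow> \<beta> \<in> A"
  shows "mults R scale \<eta> (root_on R scale \<eta> ` A) = fibres (residue (int CHAR('f))) A"
proof -
  have fin: "finite A" using A finite_subset finite_roots by blast
  have "mults R scale \<eta> (root_on R scale \<eta> ` A) = fibres (root_on R scale \<eta>) A"
    unfolding mults_def fibres_def
  proof (rule image_mset_cong)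
    fix \<phi> assume "\<phi> \<in># mset_set (root_on R scale \<eta> ` A)"
    then obtain \<alpha> where "\<alpha> \<in> A" "\<phi> = root_on R scale \<eta> \<alpha>" using fin by auto
    then have "{\<beta> \<in> \<Phi>. root_on R scale \<eta> \<beta> = \<phi>} = {\<beta> \<in> A. root_on R scale \<eta> \<beta> = \<phi>}"
      using A sat by (auto simp: root_on_eq_iff congr_sym)
    then show "root_mult R scale \<eta> \<phi> = card {\<beta> \<in> A. root_on R scale \<eta> \<beta> = \<phi>}" unfolding root_mult_def by simp
  qed
  also have "\<dots> = fibres (residue (int CHAR('f))) A"
    by (rule fibres_cong[OF fin]) (simp add: root_on_eq_iff residue_eq)
  finally show ?thesis .
qed

lemma zero_part_eq:
  "roots_on R scale \<eta> \<inter> {zero_on scale \<eta>} = root_on R scale \<eta> ` null_roots (int CHAR('f))"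
  "roots_on R scale \<eta> - (roots_on R scale \<eta> \<inter> {zero_on scale \<eta>}) = root_on R scale \<eta> ` (\<Phi> - null_roots (int CHAR('f)))"
  unfolding roots_on_def zero_on_eq null_roots_def by (auto simp: root_on_eq_iff)

lemma mults_parts:
  "mults R scale \<eta> (roots_on R scale \<eta> \<inter> {zero_on scale \<eta>})
     = fibres (residue (int CHAR('f))) (null_roots (int CHAR('f)))"
  "mults R scale \<eta> (roots_on R scale \<eta> - (roots_on R scale \<eta> \<inter> {zero_on scale \<eta>}))
     = fibres (residue (int CHAR('f))) (\<Phi> - null_roots (int CHAR('f)))"
  "mults R scale \<eta> (roots_on R scale \<eta>) = fibres (residue (int CHAR('f))) \<Phi>"
proof -
  show "mults R scale \<eta> (roots_on R scale \<eta> \<inter> {zero_on scale \<eta>})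
     = fibres (residue (int CHAR('f))) (null_roots (int CHAR('f)))"
    unfolding zero_part_eq(1)
    by (rule mults_eq_fibres; unfold null_roots_def; blast intro: congr_sym congr_trans)
  show "mults R scale \<eta> (roots_on R scale \<eta> - (roots_on R scale \<eta> \<inter> {zero_on scale \<eta>}))
     = fibres (residue (int CHAR('f))) (\<Phi> - null_roots (int CHAR('f)))"
    unfolding zero_part_eq(2)
    by (rule mults_eq_fibres; unfold null_roots_def; blast intro: congr_sym congr_trans)
  show "mults R scale \<eta> (roots_on R scale \<eta>) = fibres (residue (int CHAR('f))) \<Phi>"
    unfolding roots_on_def by (rule mults_eq_fibres) auto
qed

lemma root_mult_one:
  assumes "\<And>\<alpha> \<beta>. \<alpha> \<in> \<Phi> \<Longrightarrow> \<beta> \<in> \<Phi> \<Longrightarrow> congr (int CHAR('f)) \<alpha> \<beta> \<Longrightarrow> \<alpha> = \<beta>" "\<phi> \<in> roots_on R scale \<eta>"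
  shows "root_mult R scale \<eta> \<phi> = 1"
proof -
  obtain \<alpha> where "\<alpha> \<in> \<Phi>" "\<phi> = root_on R scale \<eta> \<alpha>" using assms(2) by (auto simp: roots_on_def)
  then have "{\<beta> \<in> \<Phi>. root_on R scale \<eta> \<beta> = \<phi>} = {\<alpha>}" using assms(1) by (auto simp: root_on_eq_iff)
  then show ?thesis by (simp add: root_mult_def)
qed

end

context irreducible_datum begin

section \<open>Roots in terms of simple roots\<close>

lemma eq_by_right: assumes "\<And>x. pair R x y = pair R x y'" shows "y = y'"
proof -
  have "(\<lambda>x. pair R x y) = (\<lambda>x. pair R x y')" using assms by (rule ext)
  then show ?thesis using ex1E[OF ex1_right[OF additive_left[of y]]] by metis
qed

lemma cp_length: "\<alpha> \<in> \<Phi> \<Longrightarrow> \<beta> \<in> \<Phi> \<Longrightarrow> cp \<alpha> \<beta> * frm \<beta> \<beta> = cp \<beta> \<alpha> * frm \<alpha> \<alpha>"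
  using frm_root[of \<beta> \<alpha>] frm_root[of \<alpha> \<beta>] frm_commute[of \<alpha> \<beta>] by simp

text \<open>The Cauchy-Schwarz inequality, in the form that \<open>M \<alpha> - t \<beta>\<close> has positive length. This vector is not 0
  because the datum is reduced.\<close>

lemma cp_product:
  assumes a: "\<alpha> \<in> \<Phi>" and b: "\<beta> \<in> \<Phi>" and ne: "\<beta> \<noteq> \<alpha>" "\<beta> \<noteq> - \<alpha>"
  shows "0 \<le> cp \<alpha> \<beta> * cp \<beta> \<alpha>" "cp \<alpha> \<beta> * cp \<beta> \<alpha> < 4"
proof -
  define N M t where "N = frm \<alpha> \<alpha>" and "M = frm \<beta> \<beta>" and "t = frm \<alpha> \<beta>"
  have N: "N > 0" and M: "M > 0" using frm_pos a b by (auto simp: N_def M_def)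
  have t1: "2 * t = cp \<alpha> \<beta> * M" using frm_root[OF b] by (simp add: t_def M_def)
  have t2: "2 * t = cp \<beta> \<alpha> * N" using frm_root[OF a] frm_commute[of \<alpha> \<beta>] by (simp add: t_def N_def)
  have prod: "(cp \<alpha> \<beta> * cp \<beta> \<alpha>) * (M * N) = 4 * (t * t)"
  proof -
    have "(cp \<alpha> \<beta> * cp \<beta> \<alpha>) * (M * N) = (cp \<alpha> \<beta> * M) * (cp \<beta> \<alpha> * N)" by (simp only: ac_simps)
    also have "\<dots> = 4 * (t * t)" unfolding t1[symmetric] t2[symmetric] by simp
    finally show ?thesis .
  qed
  define v where "v = zmult M \<alpha> - zmult t \<beta>"
  have vQ: "v \<in> QL" unfolding v_def using root_in_QL[OF a] root_in_QL[OF b]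
    by (intro zmod.span_diff zmod.span_scale)
  have "frm v v = M * (M * frm \<alpha> \<alpha> - t * frm \<beta> \<alpha>) - t * (M * frm \<alpha> \<beta> - t * frm \<beta> \<beta>)"
    unfolding v_def frm_simps ..
  also have "\<dots> = M * (M * N - t * t)"
    unfolding frm_commute[of \<beta> \<alpha>] N_def[symmetric] M_def[symmetric] t_def[symmetric] by (simp add: algebra_simps)
  finally have fv: "frm v v = M * (M * N - t * t)" .
  have "v \<noteq> 0"
  proof
    assume "v = 0"
    then have "M \<noteq> 0 \<and> zmult M \<alpha> = zmult t \<beta>" using M by (simp add: v_def)
    then have "\<beta> = \<alpha> \<or> \<beta> = - \<alpha>" using reduced a b unfolding reduced_def by blast
    then show False using ne by blast
  qed
  then have "frm v v \<noteq> 0" using frm_definite[OF vQ] by blast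
  then have "frm v v > 0" using frm_nonneg[of v] by linarith
  then have lt: "t * t < M * N" using M by (simp add: fv zero_less_mult_iff)
  have MN: "M * N > 0" using M N by simp
  have "(cp \<alpha> \<beta> * cp \<beta> \<alpha>) * (M * N) < 4 * (M * N)" unfolding prod using lt by simp
  then show "cp \<alpha> \<beta> * cp \<beta> \<alpha> < 4" by (rule mult_right_less_imp_less) (use MN in simp)
  have "0 \<le> (cp \<alpha> \<beta> * cp \<beta> \<alpha>) * (M * N)" unfolding prod by simp
  then show "0 \<le> cp \<alpha> \<beta> * cp \<beta> \<alpha>" using MN by (simp add: zero_le_mult_iff)
qed

lemma cp_zero_iff: assumes a: "\<alpha> \<in> \<Phi>" and b: "\<beta> \<in> \<Phi>" shows "cp \<alpha> \<beta> = 0 \<longleftrightarrow> cp \<beta> \<alpha> = 0"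
  using cp_length[OF a b] frm_pos[OF a] frm_pos[OF b] by auto

lemma small_int_pairs:
  fixes a b :: int
  assumes "0 \<le> a * b" "a * b < 4" "a = 0 \<longleftrightarrow> b = 0"
  shows "(a, b) \<in> {(0,0),(1,1),(1,2),(2,1),(1,3),(3,1),(-1,-1),(-1,-2),(-2,-1),(-1,-3),(-3,-1)}"
proof -
  have *: "\<lbrakk>x > 0; y > 0; x * y < 4\<rbrakk> \<Longrightarrow> (x, y) \<in> {(1,1),(1,2),(2,1),(1,3),(3,1)}" for x y :: int
  proof -
    assume xy: "x > 0" "y > 0" "x * y < 4"
    have "x * 1 \<le> x * y" "1 * y \<le> x * y" using xy by (intro mult_left_mono mult_right_mono; simp)+
    then have "x \<le> 3" "y \<le> 3" using xy(3) by linarith+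
    then have "x = 1 \<or> x = 2 \<or> x = 3" "y = 1 \<or> y = 2 \<or> y = 3" using xy by presburger+
    then show ?thesis using xy by auto
  qed
  show ?thesis
  proof (cases "a = 0")
    case False
    then consider "a > 0" "b > 0" | "a < 0" "b < 0" using assms by (auto simp: zero_le_mult_iff)
    then show ?thesis using *[of a b] *[of "- a" "- b"] assms by cases auto
  qed (use assms in auto)
qed

lemma cp_cases:
  assumes "\<alpha> \<in> \<Phi>" "\<beta> \<in> \<Phi>" "\<beta> \<noteq> \<alpha>" "\<beta> \<noteq> - \<alpha>"
  shows "(cp \<alpha> \<beta>, cp \<beta> \<alpha>) \<in> {(0,0),(1,1),(1,2),(2,1),(1,3),(3,1),(-1,-1),(-1,-2),(-2,-1),(-1,-3),(-3,-1)}"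
  by (rule small_int_pairs[OF cp_product[OF assms] cp_zero_iff[OF assms(1,2)]])

lemma coef_refl: "x \<in> QL \<Longrightarrow> \<delta> \<in> \<Delta> \<Longrightarrow> coef (refl \<delta> x) \<epsilon> = coef x \<epsilon> - (if \<epsilon> = \<delta> then cp x \<delta> else 0)"
  unfolding refl_def by (simp add: coef_simps(2,4,6) zmod.span_scale zmod.span_base)

lemma simple_cp_nonpos: assumes d: "\<delta> \<in> \<Delta>" and e: "\<epsilon> \<in> \<Delta>" and ne: "\<delta> \<noteq> \<epsilon>" shows "cp \<delta> \<epsilon> \<le> 0"
proof -
  have r: "refl \<epsilon> \<delta> \<in> \<Phi>" using d e refl_root by simp
  have "coef (refl \<epsilon> \<delta>) \<delta> = 1" "coef (refl \<epsilon> \<delta>) \<epsilon> = - cp \<delta> \<epsilon>"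
    using d e ne by (simp_all add: coef_refl zmod.span_base coef_simps(6))
  then show ?thesis using root_sign[OF r] by (metis neg_0_le_iff_le not_one_le_zero)
qed

lemma simple_ne_neg: assumes d: "\<delta> \<in> \<Delta>" and e: "\<epsilon> \<in> \<Delta>" shows "\<epsilon> \<noteq> - \<delta>"
proof
  assume "\<epsilon> = - \<delta>"
  then have "coef \<epsilon> \<epsilon> = - coef \<delta> \<epsilon>" using coef_neg[of \<delta> \<epsilon>] d by simp
  then show False using d e by (simp add: coef_simps(6) split: if_splits)
qed

lemma simple_cp_cases:
  assumes "\<delta> \<in> \<Delta>" "\<epsilon> \<in> \<Delta>" "\<delta> \<noteq> \<epsilon>"
  shows "(cp \<delta> \<epsilon>, cp \<epsilon> \<delta>) \<in> {(0,0),(-1,-1),(-1,-2),(-2,-1),(-1,-3),(-3,-1)}"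
  using cp_cases[of \<delta> \<epsilon>] simple_cp_nonpos[OF assms] simple_ne_neg[OF assms(1,2)] assms by auto

definition height where "height x = (\<Sum>\<delta>\<in>\<Delta>. coef x \<delta>)"

lemma height_refl: "x \<in> QL \<Longrightarrow> \<delta> \<in> \<Delta> \<Longrightarrow> height (refl \<delta> x) = height x - cp x \<delta>"
  unfolding height_def by (simp add: coef_refl sum_subtractf)

lemma pair_coef: "x \<in> QL \<Longrightarrow> pair R x y = (\<Sum>\<delta>\<in>\<Delta>. coef x \<delta> * pair R \<delta> y)"
  using arg_cong[OF coef_sum, of x "\<lambda>v. pair R v y"] by simp

lemma frm_coef: "x \<in> QL \<Longrightarrow> frm z x = (\<Sum>\<delta>\<in>\<Delta>. coef x \<delta> * frm z \<delta>)"
  using arg_cong[OF coef_sum, of x "frm z"] by (simp add: frm_sum)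

text \<open>Some simple root pairs positively with \<open>\<alpha>\<close>, because \<open>(\<alpha>, \<alpha>)\<close> is positive and a nonnegative
  combination of the numbers \<open>(\<alpha>, \<delta>)\<close>. The reflection changes only one coefficient, and as \<open>\<alpha>\<close> is
  not simple another positive coefficient keeps the reflected root positive.\<close>

lemma exists_descent:
  assumes a: "\<alpha> \<in> pos" and ns: "\<alpha> \<notin> \<Delta>"
  obtains \<delta> where "\<delta> \<in> \<Delta>" "cp \<alpha> \<delta> > 0" "refl \<delta> \<alpha> \<in> pos"
proof -
  have r: "\<alpha> \<in> \<Phi>" and c: "\<And>\<delta>. 0 \<le> coef \<alpha> \<delta>" using a by (auto simp: pos_def)
  have Q: "\<alpha> \<in> QL" using root_in_QL[OF r] .
  have "\<exists>\<delta>\<in>\<Delta>. cp \<alpha> \<delta> > 0"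
  proof (rule ccontr)
    assume *: "\<not> ?thesis"
    have "frm \<alpha> \<delta> \<le> 0" if d: "\<delta> \<in> \<Delta>" for \<delta>
    proof -
      have "cp \<alpha> \<delta> \<le> 0" "frm \<delta> \<delta> \<ge> 0" using * d frm_nonneg by auto
      then have "cp \<alpha> \<delta> * frm \<delta> \<delta> \<le> 0" by (rule mult_nonpos_nonneg)
      then show ?thesis using frm_root[of \<delta> \<alpha>] d by simp
    qed
    then have "frm \<alpha> \<alpha> \<le> 0" unfolding frm_coef[OF Q, of \<alpha>]
      using c by (intro sum_nonpos) (simp add: mult_nonneg_nonpos)
    then show False using frm_pos[OF r] by simp
  qed
  then obtain \<delta> where d: "\<delta> \<in> \<Delta>" "cp \<alpha> \<delta> > 0" by blast
  have "\<exists>\<epsilon>\<in>\<Delta>. \<epsilon> \<noteq> \<delta> \<and> coef \<alpha> \<epsilon> \<noteq> 0"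
  proof (rule ccontr)
    assume *: "\<not> ?thesis"
    have dQ: "\<delta> \<in> QL" using d by (simp add: zmod.span_base)
    have "\<alpha> = zmult (coef \<alpha> \<delta>) \<delta>"
      by (rule coef_eqI[OF Q zmod.span_scale[OF dQ]]) (use * d in \<open>auto simp: coef_simps(4)[OF dQ] coef_simps(6)\<close>)
    then have "zmult 1 \<alpha> = zmult (coef \<alpha> \<delta>) \<delta>" by simp
    then have "\<delta> = \<alpha> \<or> \<delta> = - \<alpha>" using reduced r d unfolding reduced_def
      by (metis simple_root zero_neq_one)
    then have "\<delta> = - \<alpha>" using ns d by auto
    then have "coef \<delta> \<delta> = - coef \<alpha> \<delta>" using coef_neg[OF r] by simp
    then show False using c[of \<delta>] d by (simp add: coef_simps(6))
  qed
  then obtain \<epsilon> where e: "\<epsilon> \<in> \<Delta>" "\<epsilon> \<noteq> \<delta>" "coef \<alpha> \<epsilon> \<noteq> 0" by blast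
  have "coef (refl \<delta> \<alpha>) \<epsilon> > 0" using coef_refl[OF Q d(1), of \<epsilon>] e c[of \<epsilon>] by simp
  moreover have rr: "refl \<delta> \<alpha> \<in> \<Phi>" using r d refl_root by simp
  ultimately have "refl \<delta> \<alpha> \<in> pos" using root_sign[OF rr] unfolding pos_def by (auto simp: not_le[symmetric])
  then show thesis using that d by blast
qed

text \<open>By descent of the height all roots are obtained from the simple ones by simple reflections. The
  positive roots \<open>\<alpha>\<close> are treated together with \<open>- \<alpha>\<close>; a negative simple root is the reflection of the
  simple root in itself.\<close>

lemma root_induct [consumes 1, case_names simple refl]:
  assumes a: "\<alpha> \<in> \<Phi>" and s: "\<And>\<delta>. \<delta> \<in> \<Delta> \<Longrightarrow> P \<delta>"
    and r: "\<And>\<alpha> \<delta>. \<alpha> \<in> \<Phi> \<Longrightarrow> \<delta> \<in> \<Delta> \<Longrightarrow> P \<alpha> \<Longrightarrow> P (refl \<delta> \<alpha>)"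
  shows "P \<alpha>"
proof -
  have *: "P \<alpha> \<and> P (- \<alpha>)" if "\<alpha> \<in> pos" for \<alpha>
    using that
  proof (induction "nat (height \<alpha>)" arbitrary: \<alpha> rule: less_induct)
    case less
    then have ar: "\<alpha> \<in> \<Phi>" and c: "\<And>\<delta>. 0 \<le> coef \<alpha> \<delta>" by (auto simp: pos_def)
    show ?case
    proof (cases "\<alpha> \<in> \<Delta>")
      case True
      then have "P (refl \<alpha> \<alpha>)" using s r ar by blast
      then show ?thesis using True s refl_self[OF ar] by simp
    next
      case False
      obtain \<delta> where d: "\<delta> \<in> \<Delta>" "cp \<alpha> \<delta> > 0" "refl \<delta> \<alpha> \<in> pos" using exists_descent[OF less.prems False] .
      have h: "height (refl \<delta> \<alpha>) = height \<alpha> - cp \<alpha> \<delta>" by (rule height_refl[OF root_in_QL[OF ar] d(1)])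
      have "0 \<le> height (refl \<delta> \<alpha>)" using d(3) unfolding height_def pos_def by (auto intro: sum_nonneg)
      then have "P (refl \<delta> \<alpha>) \<and> P (- refl \<delta> \<alpha>)" using less.hyps[OF _ d(3)] h d(2) by simp
      moreover have "refl \<delta> \<alpha> \<in> \<Phi>" using ar d refl_root by simp
      ultimately have "P (refl \<delta> (refl \<delta> \<alpha>))" "P (refl \<delta> (- refl \<delta> \<alpha>))" using r d(1) neg_root by blast+
      moreover have "refl \<delta> (- x) = - refl \<delta> x" for x by (simp add: refl_def zmult_minus)
      ultimately show ?thesis using refl_refl d(1) by simp
    qed
  qed
  show ?thesis
  proof (cases "\<alpha> \<in> pos")
    case False
    then have "P (- (- \<alpha>))" using * pos_or_neg[OF a] by blast
    then show ?thesis by simp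
  qed (use * in blast)
qed

lemma exists_simple_length: "\<alpha> \<in> \<Phi> \<Longrightarrow> \<exists>\<delta>\<in>\<Delta>. frm \<alpha> \<alpha> = frm \<delta> \<delta>"
  by (induction rule: root_induct) (auto simp: frm_refl)

lemma cp_refl: assumes d: "\<delta> \<in> \<Phi>" and a: "\<alpha> \<in> \<Phi>" shows "cp x (refl \<delta> \<alpha>) = cp (refl \<delta> x) \<alpha>"
proof -
  have r: "refl \<delta> \<alpha> \<in> \<Phi>" using refl_root[OF d a] .
  have "cp x (refl \<delta> \<alpha>) * frm \<alpha> \<alpha> = 2 * frm x (refl \<delta> \<alpha>)"
    using frm_root[OF r, of x] frm_refl[OF d, of \<alpha> \<alpha>] by simp
  also have "\<dots> = 2 * frm (refl \<delta> x) \<alpha>"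
    using frm_refl[OF d, of x "refl \<delta> \<alpha>"] refl_refl[OF d, of \<alpha>] by simp
  also have "\<dots> = cp (refl \<delta> x) \<alpha> * frm \<alpha> \<alpha>" by (rule frm_root[OF a])
  finally show ?thesis using frm_pos[OF a] by simp
qed

text \<open>By the invariant form a coroot, as a functional on \<open>X\<close>, is determined by its root; so the bijection
  between roots and coroots commutes with reflections.\<close>

lemma coroot_refl: assumes d: "\<delta> \<in> \<Phi>" and a: "\<alpha> \<in> \<Phi>"
  shows "coroot R (refl \<delta> \<alpha>) = corefl \<delta> (coroot R \<alpha>)"
proof (rule eq_by_right)
  fix x show "cp x (refl \<delta> \<alpha>) = pair R x (corefl \<delta> (coroot R \<alpha>))"
    unfolding cp_refl[OF d a] by (simp add: refl_def corefl_def)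
qed

lemma cp_neg [simp]: "\<alpha> \<in> \<Phi> \<Longrightarrow> cp x (- \<alpha>) = - cp x \<alpha>"
  using cp_refl[of \<alpha> \<alpha> x] by (simp add: refl_self) (simp add: refl_def)

lemma coroot_span: "\<alpha> \<in> \<Phi> \<Longrightarrow> coroot R \<alpha> \<in> zmod.span (coroot R ` \<Delta>)"
proof (induction rule: root_induct)
  case (simple \<delta>) then show ?case by (intro zmod.span_base) simp
next
  case (refl \<alpha> \<delta>)
  then show ?case using coroot_refl[of \<delta> \<alpha>]
    by (simp add: corefl_def zmod.span_base zmod.span_diff zmod.span_scale)
qed

section \<open>Adjoint and simply connected data\<close>

lemma simply_connected_iff: "simply_connected_type R \<longleftrightarrow> zmod.span (coroot R ` \<Delta>) = UNIV"
proof -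
  have "zmod.span (coroot R ` \<Phi>) = zmod.span (coroot R ` \<Delta>)"
  proof
    show "zmod.span (coroot R ` \<Phi>) \<subseteq> zmod.span (coroot R ` \<Delta>)"
      by (rule zmod.span_minimal) (auto intro: coroot_span)
    show "zmod.span (coroot R ` \<Delta>) \<subseteq> zmod.span (coroot R ` \<Phi>)"
      by (intro zmod.span_mono image_mono simple_sub)
  qed
  then show ?thesis by (simp add: simply_connected_type_def)
qed

lemma adjoint_iff: "adjoint_type R \<longleftrightarrow> QL = UNIV"
  by (simp add: adjoint_type_def span_roots)

lemma congr_cp: "congr k (x::'x) x' \<Longrightarrow> k dvd cp x \<delta> - cp x' \<delta>"
  unfolding congr_iff by blast

text \<open>When the simple coroots generate \<open>Y\<close>, divisibility only has to be tested on them.\<close>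

lemma simply_connected_congr:
  assumes sc: "simply_connected_type R" and d: "\<And>\<delta>. \<delta> \<in> \<Delta> \<Longrightarrow> k dvd cp x \<delta> - cp x' \<delta>"
  shows "congr k x x'"
proof -
  have "k dvd pair R x y - pair R x' y" for y
  proof -
    have "y \<in> zmod.span (coroot R ` \<Delta>)" using sc simply_connected_iff by simp
    then show ?thesis
    proof (induction rule: zmod.span_induct_alt)
      case (step c a b)
      have "k dvd c * (pair R x a - pair R x' a) + (pair R x b - pair R x' b)"
        using step d by auto
      then show ?case by (simp add: algebra_simps)
    qed simp
  qed
  then show ?thesis unfolding congr_iff by blast
qed

lemma congr_of_coef:
  assumes x: "x \<in> QL" "x' \<in> QL" and d: "\<And>\<delta>. \<delta> \<in> \<Delta> \<Longrightarrow> k dvd coef x \<delta> - coef x' \<delta>"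
  shows "congr k x x'"
proof -
  define v where "v = (\<Sum>\<delta>\<in>\<Delta>. zmult ((coef x \<delta> - coef x' \<delta>) div k) \<delta>)"
  have vQ: "v \<in> QL" unfolding v_def by simp
  have "x - x' = zmult k v"
  proof (rule coef_eqI[OF zmod.span_diff[OF x] zmod.span_scale[OF vQ]])
    fix \<delta> assume "\<delta> \<in> \<Delta>"
    then show "coef (x - x') \<delta> = coef (zmult k v) \<delta>"
      unfolding coef_simps(2)[OF x] coef_simps(4)[OF vQ] unfolding v_def coef_comb_all using d by simp
  qed
  then show ?thesis unfolding congr_def by blast
qed

lemma adjoint_congr:
  assumes "adjoint_type R" "congr k x x'"
  shows "k dvd coef x \<delta> - coef x' \<delta>"
proof -
  have Q: "u \<in> QL" for u using assms(1) adjoint_iff by simp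
  obtain v where "x - x' = zmult k v" using assms(2) unfolding congr_def by blast
  then have "coef x \<delta> - coef x' \<delta> = k * coef v \<delta>"
    using coef_simps(2)[OF Q Q, of x x'] coef_simps(4)[OF Q, of k v] by simp
  then show ?thesis by simp
qed

text \<open>The fundamental weights, once they lie in \<open>X\<close>, expand every \<open>x\<close> with the coefficients
  \<open>\<langle>x, \<epsilon>\<^sup>\<vee>\<rangle>\<close>. By perfectness every \<open>y\<close> is dually a combination of the simple coroots.\<close>

lemma weights_simply_connected:
  assumes "\<And>\<delta>. \<delta> \<in> \<Delta> \<Longrightarrow> \<exists>\<omega>. \<forall>\<epsilon>\<in>\<Delta>. cp \<omega> \<epsilon> = (if \<epsilon> = \<delta> then 1 else 0)"
  shows "simply_connected_type R"
proof -
  obtain w where w: "\<And>\<delta> \<epsilon>. \<delta> \<in> \<Delta> \<Longrightarrow> \<epsilon> \<in> \<Delta> \<Longrightarrow> cp (w \<delta>) \<epsilon> = (if \<epsilon> = \<delta> then 1 else 0)"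
    using assms by metis
  have "y \<in> zmod.span (coroot R ` \<Delta>)" for y
  proof -
    define y' where "y' = (\<Sum>\<delta>\<in>\<Delta>. zmult (pair R (w \<delta>) y) (coroot R \<delta>))"
    have "y = y'"
    proof (rule eq_by_right)
      fix x
      have "x = (\<Sum>\<delta>\<in>\<Delta>. zmult (cp x \<delta>) (w \<delta>))"
      proof (rule eq_by_simple)
        fix \<epsilon> assume e: "\<epsilon> \<in> \<Delta>"
        have "cp (\<Sum>\<delta>\<in>\<Delta>. zmult (cp x \<delta>) (w \<delta>)) \<epsilon> = (\<Sum>\<delta>\<in>\<Delta>. cp x \<delta> * cp (w \<delta>) \<epsilon>)"
          by (simp only: pair_simps)
        also have "\<dots> = (\<Sum>\<delta>\<in>\<Delta>. if \<delta> = \<epsilon> then cp x \<delta> else 0)"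
          by (rule sum.cong) (simp_all add: w e)
        finally have "cp (\<Sum>\<delta>\<in>\<Delta>. zmult (cp x \<delta>) (w \<delta>)) \<epsilon> = (\<Sum>\<delta>\<in>\<Delta>. if \<delta> = \<epsilon> then cp x \<delta> else 0)" .
        then show "cp x \<epsilon> = cp (\<Sum>\<delta>\<in>\<Delta>. zmult (cp x \<delta>) (w \<delta>)) \<epsilon>" using e by simp
      qed
      then have "pair R x y = pair R (\<Sum>\<delta>\<in>\<Delta>. zmult (cp x \<delta>) (w \<delta>)) y" by (rule arg_cong)
      then show "pair R x y = pair R x y'" unfolding y'_def by (simp add: mult.commute)
    qed
    also have "y' \<in> zmod.span (coroot R ` \<Delta>)" unfolding y'_def
      by (intro zmod.span_sum zmod.span_scale zmod.span_base) auto
    finally show ?thesis .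
  qed
  then show ?thesis using simply_connected_iff by blast
qed

section \<open>Coincidences of roots\<close>

text \<open>Pairing the difference with the two coroots shows that both Cartan integers are even, while one of them is
  \<open>\<plusminus>1\<close> unless they vanish.\<close>

lemma congr_two_orthogonal:
  assumes a: "\<alpha> \<in> \<Phi>" and b: "\<beta> \<in> \<Phi>" and c: "congr 2 \<alpha> \<beta>" and ne: "\<beta> \<noteq> \<alpha>" "\<beta> \<noteq> - \<alpha>"
  shows "cp \<alpha> \<beta> = 0" "cp \<beta> \<alpha> = 0"
proof -
  have "even (cp \<alpha> \<beta>)" "even (cp \<beta> \<alpha>)" using congr_cp[OF c, of \<alpha>] congr_cp[OF c, of \<beta>] a b by auto
  then show "cp \<alpha> \<beta> = 0" "cp \<beta> \<alpha> = 0" using cp_cases[OF a b ne] by auto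
qed

lemma congr_neg_two: "congr 2 \<alpha> (- \<alpha>)" for \<alpha> :: 'x
  unfolding congr_def by (rule exI[of _ \<alpha>]) (simp add: zmult_two)

lemma congr_zero: assumes "congr 0 (x::'x) x'" shows "x = x'"
proof (rule eq_by_left)
  fix y show "pair R x y = pair R x' y" using assms unfolding congr_iff by simp
qed

text \<open>Both Cartan integers are congruent to 2 modulo \<open>p\<close>. Comparison with the possible pairs of Cartan integers
  leaves only \<open>-1, -1\<close>, and then \<open>p\<close> divides 3.\<close>

lemma congr_odd:
  fixes p :: nat
  assumes p: "prime p" "p \<noteq> 2" and a: "\<alpha> \<in> \<Phi>" and b: "\<beta> \<in> \<Phi>" and c: "congr (int p) \<alpha> \<beta>" and ne: "\<alpha> \<noteq> \<beta>"
  shows "p = 3" "cp \<alpha> \<beta> = -1" "cp \<beta> \<alpha> = -1"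
proof -
  have p3: "p \<ge> 3" using p prime_ge_2_nat[of p] by linarith
  have d1: "int p dvd cp \<alpha> \<beta> - 2" using congr_cp[OF c, of \<beta>] b by simp
  have d2: "int p dvd 2 - cp \<beta> \<alpha>" using congr_cp[OF c, of \<alpha>] a by simp
  have small: "int p dvd k \<Longrightarrow> k > 0 \<Longrightarrow> int p \<le> k" for k using zdvd_imp_le by blast
  have n4: "\<not> int p dvd 4"
  proof
    assume "int p dvd 4"
    then have "p dvd 2 * 2" by (metis int_dvd_int_iff mult_2 numeral_Bit0 of_nat_numeral)
    then have "p dvd 2" using p(1) prime_dvd_mult_iff by blast
    then show False using p3 by (auto dest: dvd_imp_le)
  qed
  have "\<beta> \<noteq> - \<alpha>" using n4 d2 a by auto
  note cases = cp_cases[OF a b ne[symmetric] this]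
  have n2: "\<not> int p dvd 2" and n1: "\<not> int p dvd 1" using small[of 2] small[of 1] p3 by auto
  have m: "\<not> int p dvd - 1" "\<not> int p dvd - 2" "\<not> int p dvd - 4" using n1 n2 n4 by (simp_all only: dvd_minus_iff not_False_eq_True)
  have ex: "k \<noteq> 0 \<and> k \<noteq> 1 \<and> k \<noteq> 3 \<and> k \<noteq> -2" if "int p dvd k - 2" for k
    using that m n1 by auto
  have d3: "int p dvd cp \<beta> \<alpha> - 2" using d2 by (simp add: dvd_diff_commute)
  have "\<not> (int p dvd - 5 \<and> int p dvd - 3)" using n2 dvd_diff[of "int p" "-3" "-5"] by auto
  then have t: "cp \<alpha> \<beta> = -1 \<and> cp \<beta> \<alpha> = -1"
    using cases ex[OF d1] ex[OF d3] d1 d3 by auto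
  then show "cp \<alpha> \<beta> = -1" "cp \<beta> \<alpha> = -1" by auto
  then have "int p dvd 3" using d2 by simp
  then show "p = 3" using small[of 3] p3 by auto
qed

text \<open>Here the classes are the pairs \<open>{\<alpha>, - \<alpha>}\<close>, each of which contains exactly one positive root.\<close>

lemma fibres_plus_minus:
  assumes "\<And>\<alpha> \<beta>. \<alpha> \<in> \<Phi> \<Longrightarrow> \<beta> \<in> \<Phi> \<Longrightarrow> congr 2 \<alpha> \<beta> \<Longrightarrow> \<beta> = \<alpha> \<or> \<beta> = - \<alpha>"
  shows "fibres (residue 2) \<Phi> = replicate_mset (card pos) 2"
proof -
  define key where "key \<alpha> = (if \<alpha> \<in> pos then \<alpha> else - \<alpha>)" for \<alpha>
  have pos_sub: "pos \<subseteq> \<Phi>" by (auto simp: pos_def)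
  have kk: "key \<alpha> = key \<beta> \<longleftrightarrow> \<beta> = \<alpha> \<or> \<beta> = - \<alpha>" if "\<alpha> \<in> \<Phi>" "\<beta> \<in> \<Phi>" for \<alpha> \<beta>
    using pos_or_neg[OF that(1)] pos_or_neg[OF that(2)] unfolding key_def by auto
  have "fibres (residue 2) \<Phi> = fibres key \<Phi>"
    by (rule fibres_cong) (auto simp: residue_eq kk congr_neg_two dest: assms)
  also have "\<dots> = replicate_mset (card (key ` \<Phi>)) 2"
  proof (rule fibres_const)
    fix k assume "k \<in> key ` \<Phi>"
    then obtain \<alpha> where a: "\<alpha> \<in> \<Phi>" "k = key \<alpha>" by blast
    then have "{\<beta> \<in> \<Phi>. key \<beta> = k} = {\<alpha>, - \<alpha>}" using kk neg_root by auto
    then show "card {\<beta> \<in> \<Phi>. key \<beta> = k} = 2" using root_ne_neg[OF a(1)] by (simp add: card_insert_if)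
  qed simp
  also have "key ` \<Phi> = pos"
  proof
    show "key ` \<Phi> \<subseteq> pos" using pos_or_neg unfolding key_def by auto
    show "pos \<subseteq> key ` \<Phi>" using pos_sub unfolding key_def by (auto intro!: rev_image_eqI)
  qed
  finally show ?thesis .
qed

section \<open>Subdiagrams of affine type\<close>

lemma connected_closed:
  assumes S: "S \<subseteq> \<Delta>" "S \<noteq> {}" and cl: "\<And>\<alpha> \<beta>. \<alpha> \<in> S \<Longrightarrow> \<beta> \<in> \<Delta> \<Longrightarrow> cp \<alpha> \<beta> \<noteq> 0 \<Longrightarrow> \<beta> \<in> S"
  shows "S = \<Delta>"
proof -
  obtain \<alpha> where a: "\<alpha> \<in> S" using S by blast
  have "\<beta> \<in> S" if "\<beta> \<in> \<Delta>" for \<beta>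
  proof -
    have "(\<alpha>, \<beta>) \<in> (coxeter_edges R \<Delta>)\<^sup>*" using connected a S that by blast
    then show ?thesis by (induction rule: rtrancl_induct) (use a cl in \<open>auto simp: coxeter_edges_def\<close>)
  qed
  then show ?thesis using S by blast
qed

text \<open>A vector with positive coefficients on a set of nodes that pairs nonpositively with each of these nodes
  would have nonpositive length. It is enough to know the neighbours in \<open>T\<close>, since all others can only
  lower the pairing.\<close>

lemma no_affine_subdiagram:
  assumes S: "S \<subseteq> \<Delta>" "S \<noteq> {}" and c: "\<And>\<delta>. \<delta> \<in> S \<Longrightarrow> c \<delta> > 0"
    and T: "\<And>\<delta>. \<delta> \<in> S \<Longrightarrow> \<exists>T \<subseteq> S - {\<delta>}. 2 * c \<delta> + (\<Sum>\<epsilon>\<in>T. c \<epsilon> * cp \<epsilon> \<delta>) \<le> 0"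
  shows False
proof -
  have fS: "finite S" using S finite_subset finite_simple by blast
  define v where "v = (\<Sum>\<delta>\<in>S. zmult (c \<delta>) \<delta>)"
  have vQ: "v \<in> QL" unfolding v_def using S
    by (intro zmod.span_sum zmod.span_scale zmod.span_base) auto
  have cpv: "cp v \<delta> \<le> 0" if d: "\<delta> \<in> S" for \<delta>
  proof -
    obtain T where T: "T \<subseteq> S - {\<delta>}" "2 * c \<delta> + (\<Sum>\<epsilon>\<in>T. c \<epsilon> * cp \<epsilon> \<delta>) \<le> 0" using T d by blast
    have "cp v \<delta> = (\<Sum>\<epsilon>\<in>S. c \<epsilon> * cp \<epsilon> \<delta>)" unfolding v_def pair_simps ..
    also have "\<dots> = 2 * c \<delta> + (\<Sum>\<epsilon>\<in>S - {\<delta>}. c \<epsilon> * cp \<epsilon> \<delta>)"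
      unfolding sum.remove[OF fS d] using subsetD[OF S(1) d] by simp
    also have "(\<Sum>\<epsilon>\<in>S - {\<delta>}. c \<epsilon> * cp \<epsilon> \<delta>) = (\<Sum>\<epsilon>\<in>S - {\<delta>} - T. c \<epsilon> * cp \<epsilon> \<delta>) + (\<Sum>\<epsilon>\<in>T. c \<epsilon> * cp \<epsilon> \<delta>)"
      by (rule sum.subset_diff[OF T(1)]) (use fS in simp)
    also have "(\<Sum>\<epsilon>\<in>S - {\<delta>} - T. c \<epsilon> * cp \<epsilon> \<delta>) \<le> 0"
    proof (rule sum_nonpos)
      fix \<epsilon> assume "\<epsilon> \<in> S - {\<delta>} - T"
      then have e: "\<epsilon> \<in> S" "\<epsilon> \<noteq> \<delta>" by auto
      have "c \<epsilon> \<ge> 0" using c[OF e(1)] by simp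
      moreover have "cp \<epsilon> \<delta> \<le> 0" using e S(1) d by (intro simple_cp_nonpos) auto
      ultimately show "c \<epsilon> * cp \<epsilon> \<delta> \<le> 0" by (rule mult_nonneg_nonpos)
    qed
    finally show ?thesis using T(2) by simp
  qed
  have "frm v v = (\<Sum>\<delta>\<in>S. frm v (zmult (c \<delta>) \<delta>))"
    using frm_sum(2)[of v "\<lambda>\<delta>. zmult (c \<delta>) \<delta>" S] unfolding v_def[symmetric] .
  then have "2 * frm v v = (\<Sum>\<delta>\<in>S. c \<delta> * (2 * frm v \<delta>))"
    by (simp add: sum_distrib_left mult.left_commute)
  also have "\<dots> = (\<Sum>\<delta>\<in>S. c \<delta> * (cp v \<delta> * frm \<delta> \<delta>))"
  proof (rule sum.cong)
    fix \<delta> assume "\<delta> \<in> S"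
    then have "\<delta> \<in> \<Phi>" using S(1) by auto
    then show "c \<delta> * (2 * frm v \<delta>) = c \<delta> * (cp v \<delta> * frm \<delta> \<delta>)" by (simp only: frm_root)
  qed simp
  also have "\<dots> \<le> 0"
  proof (rule sum_nonpos)
    fix \<delta> assume d: "\<delta> \<in> S"
    then have "frm \<delta> \<delta> > 0" using frm_pos S by auto
    then have "cp v \<delta> * frm \<delta> \<delta> \<le> 0" using cpv[OF d] by (simp add: mult_nonpos_nonneg)
    then show "c \<delta> * (cp v \<delta> * frm \<delta> \<delta>) \<le> 0" using c[OF d] by (simp add: mult_nonneg_nonpos)
  qed
  finally have "frm v v = 0" using frm_nonneg[of v] by simp
  then have v0: "v = 0" using frm_definite vQ by blast
  obtain \<delta> where d: "\<delta> \<in> S" using S by blast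
  have "(\<Sum>\<delta>\<in>S. zmult (c \<delta>) \<delta>) = 0" using v0 unfolding v_def .
  then have "c \<delta> = 0" using zmod.independentD[OF indep fS S(1), of c] d by blast
  then show False using c[OF d] by simp
qed

section \<open>Paths in the diagram\<close>

text \<open>All neighbours of the nodes before the last lie on the path, so that the rest of the diagram is attached
  to the last node only. It is attached there by the nodes in \<open>exits\<close>.\<close>

definition linear_path where
  "linear_path q t \<longleftrightarrow> 1 \<le> t \<and> inj_on q {1..t} \<and> q ` {1..t} \<subseteq> \<Delta> \<and>
    (\<forall>s. 1 \<le> s \<and> s < t \<longrightarrow> cp (q s) (q (Suc s)) \<noteq> 0) \<and>
    (\<forall>s \<beta>. 1 \<le> s \<and> s < t \<and> \<beta> \<in> \<Delta> \<and> cp (q s) \<beta> \<noteq> 0 \<longrightarrow>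
       \<beta> = q s \<or> \<beta> = q (Suc s) \<or> 1 < s \<and> \<beta> = q (s - 1))"

definition exits where
  "exits q t = {u \<in> \<Delta>. cp (q t) u \<noteq> 0 \<and> u \<noteq> q t \<and> \<not> (1 < t \<and> u = q (t - 1))}"

lemma simple_cp_zero_iff: "\<alpha> \<in> \<Delta> \<Longrightarrow> \<beta> \<in> \<Delta> \<Longrightarrow> cp \<alpha> \<beta> = 0 \<longleftrightarrow> cp \<beta> \<alpha> = 0"
  using cp_zero_iff simple_root by blast

context
  fixes q t assumes path: "linear_path q t"
begin

lemma path_pos: "1 \<le> t" and path_inj_on: "inj_on q {1..t}" and path_sub: "q ` {1..t} \<subseteq> \<Delta>"
  using path unfolding linear_path_def by blast+

lemma path_simple [simp]: "1 \<le> s \<Longrightarrow> s \<le> t \<Longrightarrow> q s \<in> \<Delta>"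
  by (rule subsetD[OF path_sub]) simp

lemma path_inj: "1 \<le> s \<Longrightarrow> s \<le> t \<Longrightarrow> 1 \<le> r \<Longrightarrow> r \<le> t \<Longrightarrow> q s = q r \<longleftrightarrow> s = r"
  by (rule inj_on_eq_iff[OF path_inj_on]) simp_all

lemma path_edge: "1 \<le> s \<Longrightarrow> s < t \<Longrightarrow> cp (q s) (q (Suc s)) \<noteq> 0"
  and path_closed: "1 \<le> s \<Longrightarrow> s < t \<Longrightarrow> \<beta> \<in> \<Delta> \<Longrightarrow> cp (q s) \<beta> \<noteq> 0 \<Longrightarrow>
       \<beta> = q s \<or> \<beta> = q (Suc s) \<or> 1 < s \<and> \<beta> = q (s - 1)"
  using path unfolding linear_path_def by blast+

lemma path_length: "t \<le> n"
proof -
  have "card (q ` {1..t}) \<le> card \<Delta>" using path unfolding linear_path_def by (intro card_mono) auto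
  then show ?thesis using path unfolding linear_path_def by (simp add: card_image card_simple)
qed

lemma path_zero: assumes "1 \<le> s" "s < r" "r \<le> t" "Suc s \<noteq> r" shows "cp (q s) (q r) = 0" "cp (q r) (q s) = 0"
proof -
  show 1: "cp (q s) (q r) = 0"
  proof (rule ccontr)
    assume "cp (q s) (q r) \<noteq> 0"
    then have "q r = q s \<or> q r = q (Suc s) \<or> 1 < s \<and> q r = q (s - 1)" using assms by (intro path_closed) auto
    then show False using assms by (auto simp: path_inj)
  qed
  then show "cp (q r) (q s) = 0" using assms by (subst simple_cp_zero_iff) auto
qed

lemma exits_simple: "u \<in> exits q t \<Longrightarrow> u \<in> \<Delta>" by (simp add: exits_def)

lemma finite_exits: "finite (exits q t)" using finite_simple by (simp add: exits_def)

lemma exits_new: assumes u: "u \<in> exits q t" "1 \<le> s" "s \<le> t" shows "u \<noteq> q s"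
proof
  assume us: "u = q s"
  have st: "s \<noteq> t" using u us by (auto simp: exits_def)
  have "cp (q s) (q t) \<noteq> 0" using u us path_pos by (subst simple_cp_zero_iff) (auto simp: exits_def)
  then have "Suc s = t" using path_zero(1)[of s t] u st by linarith
  then show False using u us by (auto simp: exits_def)
qed

lemma exits_cp: assumes "u \<in> exits q t" shows "cp (q t) u \<le> - 1" "cp u (q t) \<le> - 1"
proof -
  have u: "u \<in> \<Delta>" "cp (q t) u \<noteq> 0" "u \<noteq> q t" using assms by (auto simp: exits_def)
  have "q t \<in> \<Delta>" using path_pos by simp
  then have "cp (q t) u \<le> 0" "cp u (q t) \<le> 0" "cp u (q t) \<noteq> 0"
    using u simple_cp_nonpos[of "q t" u] simple_cp_nonpos[of u "q t"] simple_cp_zero_iff[of "q t" u] by auto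
  then show "cp (q t) u \<le> - 1" "cp u (q t) \<le> - 1" using u by auto
qed

lemma path_all: assumes "exits q t = {}" shows "q ` {1..t} = \<Delta>"
proof (rule connected_closed)
  show "q ` {1..t} \<subseteq> \<Delta>" by auto
  show "q ` {1..t} \<noteq> {}" using path_pos by auto
  fix \<alpha> \<beta> assume "\<alpha> \<in> q ` {1..t}" "\<beta> \<in> \<Delta>" "cp \<alpha> \<beta> \<noteq> 0"
  then obtain s where s: "1 \<le> s" "s \<le> t" "cp (q s) \<beta> \<noteq> 0" by auto
  have "\<exists>r\<in>{1..t}. \<beta> = q r"
  proof (cases "s < t")
    case True
    then have "\<beta> = q s \<or> \<beta> = q (Suc s) \<or> 1 < s \<and> \<beta> = q (s - 1)" using s \<open>\<beta> \<in> \<Delta>\<close> by (intro path_closed) auto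
    moreover have "s \<in> {1..t}" "Suc s \<in> {1..t}" "1 < s \<longrightarrow> s - 1 \<in> {1..t}" using s True by auto
    ultimately show ?thesis by blast
  next
    case False
    then have "s = t" using s by simp
    then have "\<beta> = q t \<or> 1 < t \<and> \<beta> = q (t - 1)" using assms s \<open>\<beta> \<in> \<Delta>\<close> unfolding exits_def by blast
    moreover have "t \<in> {1..t}" "1 < t \<longrightarrow> t - 1 \<in> {1..t}" using path_pos by auto
    ultimately show ?thesis by blast
  qed
  then show "\<beta> \<in> q ` {1..t}" by blast
qed

lemma path_extend: assumes u: "exits q t = {u}" shows "linear_path (q(Suc t := u)) (Suc t)"
proof -
  let ?q = "q(Suc t := u)"
  have eq: "?q s = q s" if "s \<le> t" for s using that by simp
  have ue: "u \<in> exits q t" using u by simp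
  have "inj_on ?q {1..Suc t}"
  proof (rule inj_onI)
    fix a b assume ab: "a \<in> {1..Suc t}" "b \<in> {1..Suc t}" "?q a = ?q b"
    show "a = b"
    proof (cases "a = Suc t"; cases "b = Suc t")
      assume "a \<noteq> Suc t" "b \<noteq> Suc t" then show ?thesis using ab path_inj[of a b] by auto
    next
      assume "a = Suc t" "b \<noteq> Suc t" then show ?thesis using ab exits_new[OF ue, of b] by auto
    next
      assume "a \<noteq> Suc t" "b = Suc t" then show ?thesis using ab exits_new[OF ue, of a] by auto
    qed simp
  qed
  moreover have "?q ` {1..Suc t} \<subseteq> \<Delta>" using exits_simple[OF ue] by auto
  moreover have "cp (?q s) (?q (Suc s)) \<noteq> 0" if "1 \<le> s" "s < Suc t" for s
    using path_edge[of s] that exits_cp[OF ue] by (cases "s = t") auto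
  moreover have "\<beta> = ?q s \<or> \<beta> = ?q (Suc s) \<or> 1 < s \<and> \<beta> = ?q (s - 1)"
    if "1 \<le> s" "s < Suc t" "\<beta> \<in> \<Delta>" "cp (?q s) \<beta> \<noteq> 0" for s \<beta>
  proof (cases "s = t")
    case True
    show ?thesis
    proof (cases "\<beta> = q t \<or> 1 < t \<and> \<beta> = q (t - 1)")
      case False
      then have "\<beta> \<in> exits q t" using that True unfolding exits_def by (auto simp del: One_nat_def)
      then have "\<beta> = u" using u by simp
      then show ?thesis using True by simp
    qed (use True in auto)
  next
    case False then show ?thesis using path_closed[of s \<beta>] that by auto
  qed
  ultimately show ?thesis unfolding linear_path_def by (intro conjI allI impI) (simp, blast+)
qed

text \<open>A path that starts with a double bond is given the marks \<open>c\<^sub>1, 2, \<dots>, 2\<close> of an affine diagram, and the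
  exits in \<open>U\<close> the marks \<open>w\<close>. The assumptions on \<open>w\<close> say that the pairings with the end of the path and
  with the exits are nonpositive.\<close>

lemma double_bond_path:
  assumes t2: "2 \<le> t" and b1: "cp (q 1) (q 2) * cp (q 2) (q 1) = 2"
    and U: "U \<subseteq> exits q t" "\<And>u. u \<in> U \<Longrightarrow> w u > 0"
    and s: "(\<Sum>u\<in>U. w u * cp u (q t)) \<le> - 2"
    and wu: "\<And>u. u \<in> U \<Longrightarrow> w u + cp (q t) u \<le> 0"
  shows False
proof -
  \<comment> \<open>The mark \<open>c\<^sub>1\<close>, which is 1 or 2 according to the direction of the bond, makes the pairing with \<open>q 1\<close>
    vanish; since the product of the two Cartan integers is 2, \<open>q 1\<close> contributes \<open>-2\<close> to the pairing with \<open>q 2\<close>.\<close>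
  define c1 where "c1 = - cp (q 2) (q 1)"
  define c where "c x = (if x \<in> U then w x else if x = q 1 then c1 else 2)" for x
  have c_path: "c (q s) = (if s = 1 then c1 else 2)" if "1 \<le> s" "s \<le> t" for s
  proof -
    have "q s \<notin> U" using U(1) exits_new that by blast
    then show ?thesis using that path_inj[of s 1] by (auto simp: c_def)
  qed
  have q12: "cp (q 1) (q 2) \<le> 0" "cp (q 2) (q 1) \<le> 0" using t2 by (intro simple_cp_nonpos; simp add: path_inj)+
  then have c1: "c1 > 0" "c1 * cp (q 1) (q 2) = - 2" using b1 unfolding c1_def
    by (auto simp: order.strict_iff_order mult.commute)
  have edge: "cp (q s) (q (Suc s)) \<le> - 1" "cp (q (Suc s)) (q s) \<le> - 1" if "1 \<le> s" "s < t" for s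
  proof -
    have "q s \<in> \<Delta>" "q (Suc s) \<in> \<Delta>" "q s \<noteq> q (Suc s)" using that by (auto simp: path_inj)
    then show "cp (q s) (q (Suc s)) \<le> - 1" "cp (q (Suc s)) (q s) \<le> - 1"
      using path_edge[OF that] simple_cp_nonpos[of "q s" "q (Suc s)"] simple_cp_nonpos[of "q (Suc s)" "q s"]
        simple_cp_zero_iff[of "q s" "q (Suc s)"] by auto
  qed
  have before: "c (q (s - 1)) * cp (q (s - 1)) (q s) \<le> - 2" if "2 \<le> s" "s \<le> t" for s
  proof (cases "s = 2")
    case True then show ?thesis using c_path[of 1] c1 t2 by simp
  next
    case False
    then have "c (q (s - 1)) = 2" using c_path[of "s - 1"] that by auto
    then show ?thesis using edge(1)[of "s - 1"] that by simp
  qed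
  show False
  proof (rule no_affine_subdiagram[where S = "q ` {1..t} \<union> U" and c = c])
    show "q ` {1..t} \<union> U \<subseteq> \<Delta>" using U exits_simple by auto
    show "q ` {1..t} \<union> U \<noteq> {}" using t2 by auto
    show "c \<delta> > 0" if "\<delta> \<in> q ` {1..t} \<union> U" for \<delta> using that U(2) c1 by (auto simp: c_def)
    fix \<delta> assume "\<delta> \<in> q ` {1..t} \<union> U"
    then consider (u) "\<delta> \<in> U" | (q) s where "1 \<le> s" "s \<le> t" "\<delta> = q s" by auto
    then show "\<exists>T\<subseteq>q ` {1..t} \<union> U - {\<delta>}. 2 * c \<delta> + (\<Sum>\<epsilon>\<in>T. c \<epsilon> * cp \<epsilon> \<delta>) \<le> 0"
    proof cases
      case u
      have "c \<delta> = w \<delta>" "c (q t) = 2" using u c_path[of t] t2 by (auto simp: c_def)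
      moreover have "q t \<noteq> \<delta>" using exits_new[of \<delta> t] u U t2 by auto
      ultimately show ?thesis using wu[OF u] t2 by (intro exI[of _ "{q t}"]) auto
    next
      case q
      consider "s = 1" | "2 \<le> s" "s < t" | "s = t" "2 \<le> s" using q t2 by linarith
      then show ?thesis
      proof cases
        case 1
        have "c (q 2) = 2" "c (q 1) = c1" using c_path[of 2] c_path[of 1] t2 by auto
        then show ?thesis using q 1 t2 path_inj[of 2 1] by (intro exI[of _ "{q 2}"]) (auto simp: c1_def)
      next
        case 2
        have "c (q s) = 2" "c (q (Suc s)) = 2" using c_path[of s] c_path[of "Suc s"] 2 by auto
        moreover have "q (s - 1) \<noteq> q (Suc s)" "q (s - 1) \<noteq> q s" "q (Suc s) \<noteq> q s"
          using path_inj[of "s - 1" "Suc s"] path_inj[of "s - 1" s] path_inj[of "Suc s" s] 2 by auto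
        moreover have "s - 1 \<in> {1..t}" "Suc s \<in> {1..t}" using 2 by auto
        ultimately show ?thesis using q before[of s] edge(2)[of s] 2
          by (intro exI[of _ "{q (s - 1), q (Suc s)}"]) auto
      next
        case 3
        have fU: "finite U" using U finite_exits finite_subset by blast
        have "c (q t) = 2" using c_path[of t] t2 by auto
        moreover have nU: "q (t - 1) \<notin> U" "q t \<notin> U" using U exits_new[of _ "t - 1"] exits_new[of _ t] t2 by force+
        moreover have "q (t - 1) \<noteq> q t" using path_inj[of "t - 1" t] t2 by auto
        moreover have "t - 1 \<in> {1..t}" using t2 by auto
        moreover have "(\<Sum>\<epsilon>\<in>U. c \<epsilon> * cp \<epsilon> (q t)) = (\<Sum>u\<in>U. w u * cp u (q t))"
          by (rule sum.cong) (auto simp: c_def)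
        ultimately show ?thesis using q 3 before[of t] s fU
          by (intro exI[of _ "insert (q (t - 1)) U"]) auto
      qed
    qed
  qed
qed

end

lemma maximal_path:
  assumes base: "P q\<^sub>0 t\<^sub>0" and lp: "\<And>q t. P q t \<Longrightarrow> linear_path q t"
  obtains q t where "P q t" "\<And>q'. \<not> P q' (Suc t)"
proof -
  let ?t = "GREATEST t. \<exists>q. P q t"
  have b: "\<forall>t. (\<exists>q. P q t) \<longrightarrow> t \<le> n" using lp path_length by blast
  have "\<exists>q. P q ?t" by (rule GreatestI_nat[where P="\<lambda>t. \<exists>q. P q t"]) (use base b in auto)
  moreover have "\<not> P q' (Suc ?t)" for q'
    using Greatest_le_nat[of "\<lambda>t. \<exists>q. P q t" "Suc ?t" n] b by (metis Suc_n_not_le_n)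
  ultimately show thesis using that by blast
qed

text \<open>A longest path that begins with the terminal node and the double bond has no exits: two exits, or one
  exit behind another multiple bond, would complete an affine diagram. So it exhausts the connected
  diagram.\<close>

lemma double_bond_chain:
  assumes ab: "a \<in> \<Delta>" "b \<in> \<Delta>" "a \<noteq> b" and bond: "cp a b * cp b a = 2"
    and terminal: "\<And>\<beta>. \<beta> \<in> \<Delta> \<Longrightarrow> cp a \<beta> \<noteq> 0 \<Longrightarrow> \<beta> = a \<or> \<beta> = b"
  obtains q where "bij_betw q {1..n} \<Delta>" "2 \<le> n" "q 1 = a" "q 2 = b"
    "\<And>s. 2 \<le> s \<Longrightarrow> s < n \<Longrightarrow> cp (q s) (q (Suc s)) = - 1 \<and> cp (q (Suc s)) (q s) = - 1"
    "\<And>s r. 1 \<le> s \<Longrightarrow> s < r \<Longrightarrow> r \<le> n \<Longrightarrow> Suc s \<noteq> r \<Longrightarrow> cp (q s) (q r) = 0 \<and> cp (q r) (q s) = 0"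
proof -
  define P where "P q t \<longleftrightarrow> linear_path q t \<and> 2 \<le> t \<and> q 1 = a \<and> q 2 = b \<and>
    (\<forall>s. 2 \<le> s \<and> s < t \<longrightarrow> cp (q s) (q (Suc s)) = - 1 \<and> cp (q (Suc s)) (q s) = - 1)" for q t
  define q0 where "q0 s = (if s = (1::nat) then a else b)" for s
  have i12: "{1..2::nat} = {1, 2}" by auto
  have "cp a b \<noteq> 0" using bond by auto
  then have "linear_path q0 2"
    unfolding linear_path_def i12 using ab terminal by (auto simp: q0_def inj_on_def Suc_le_eq less_Suc_eq numeral_2_eq_2)
  then have "P q0 2" by (auto simp: P_def q0_def)
  then obtain q t where P: "P q t" and mx: "\<And>q'. \<not> P q' (Suc t)"
    using maximal_path[of P q0 2] unfolding P_def by blast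
  have lp: "linear_path q t" and t2: "2 \<le> t" and q12: "q 1 = a" "q 2 = b"
    and simple: "\<And>s. 2 \<le> s \<Longrightarrow> s < t \<Longrightarrow> cp (q s) (q (Suc s)) = - 1 \<and> cp (q (Suc s)) (q s) = - 1"
    using P by (auto simp: P_def)
  have bond': "cp (q 1) (q 2) * cp (q 2) (q 1) = 2" using bond q12 by simp
  note dbp = double_bond_path[OF lp t2 bond']
  have "exits q t = {}"
  proof (rule ccontr)
    assume "exits q t \<noteq> {}"
    then obtain u where u: "u \<in> exits q t" by blast
    have "exits q t = {u}"
    proof (rule ccontr)
      assume "exits q t \<noteq> {u}"
      then obtain v where v: "v \<in> exits q t" "v \<noteq> u" using u by blast
      have "(\<Sum>u\<in>{u, v}. 1 * cp u (q t)) \<le> - 2"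
        using exits_cp(2)[OF lp u] exits_cp(2)[OF lp v(1)] v(2) by simp
      moreover have "1 + cp (q t) z \<le> 0" if "z \<in> {u, v}" for z
        using exits_cp(1)[OF lp, of z] u v(1) that by auto
      ultimately show False using u v(1) by (intro dbp[of "{u, v}" "\<lambda>_. 1"]) auto
    qed
    then have ext: "linear_path (q(Suc t := u)) (Suc t)" by (rule path_extend[OF lp])
    have ud: "u \<in> \<Delta>" "q t \<in> \<Delta>" "u \<noteq> q t" using u lp t2 path_simple[OF lp, of t] by (auto simp: exits_def)
    have "cp (q t) u = - 1"
    proof (rule ccontr)
      assume "cp (q t) u \<noteq> - 1"
      then have "cp (q t) u \<le> - 2" using exits_cp(1)[OF lp u] by linarith
      then show False by (intro dbp[of "{u}" "\<lambda>_. 2"]) (use u exits_cp[OF lp u] in auto)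
    qed
    moreover have "cp u (q t) = - 1"
    proof (rule ccontr)
      assume "cp u (q t) \<noteq> - 1"
      then have "cp u (q t) \<le> - 2" using exits_cp(2)[OF lp u] by linarith
      then show False by (intro dbp[of "{u}" "\<lambda>_. 1"]) (use u exits_cp[OF lp u] in auto)
    qed
    ultimately have "P (q(Suc t := u)) (Suc t)"
      using ext t2 q12 simple unfolding P_def by (auto simp: less_Suc_eq)
    then show False using mx by blast
  qed
  then have all: "q ` {1..t} = \<Delta>" by (rule path_all[OF lp])
  have inj: "inj_on q {1..t}" using lp unfolding linear_path_def by blast
  have tn: "t = n" using card_image[OF inj] all card_simple by simp
  show thesis
  proof (rule that)
    show "bij_betw q {1..n} \<Delta>" using inj all tn by (auto simp: bij_betw_def)
    show "2 \<le> n" "q 1 = a" "q 2 = b" using t2 tn q12 by auto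
    show "cp (q s) (q (Suc s)) = - 1 \<and> cp (q (Suc s)) (q s) = - 1" if "2 \<le> s" "s < n" for s
      using simple that tn by blast
    show "cp (q s) (q r) = 0 \<and> cp (q r) (q s) = 0" if "1 \<le> s" "s < r" "r \<le> n" "Suc s \<noteq> r" for s r
      using path_zero[OF lp, of s r] that tn by blast
  qed
qed

text \<open>The paths constructed here begin at the double bond, with which Bourbaki's labellings of types \<open>B\<close> and
  \<open>C\<close> end.\<close>

lemma reversed_labelling:
  assumes q: "bij_betw q {1..n} \<Delta>" and rk: "dynkin_rank T = n"
    and C: "\<And>i j. 1 \<le> i \<Longrightarrow> i \<le> n \<Longrightarrow> 1 \<le> j \<Longrightarrow> j \<le> n \<Longrightarrow> i \<noteq> j \<Longrightarrow>
      cp (q (n + 1 - i)) (q (n + 1 - j)) = cartan_off T i j"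
  shows "has_type R \<Delta> T"
proof -
  have rev: "bij_betw (\<lambda>i. n + 1 - i) {1..n} {1..n}"
    by (rule bij_betwI[of _ _ _ "\<lambda>i. n + 1 - i"]) auto
  have bij: "bij_betw (\<lambda>i. q (n + 1 - i)) {1..n} \<Delta>"
    using bij_betw_trans[OF rev q] by (simp add: comp_def)
  have "\<forall>i\<in>{1..n}. \<forall>j\<in>{1..n}. cp (q (n + 1 - i)) (q (n + 1 - j)) = (if i = j then 2 else cartan_off T i j)"
  proof (intro ballI)
    fix i j assume ij: "i \<in> {1..n}" "j \<in> {1..n}"
    have "q (n + 1 - i) \<in> \<Delta>" using bij ij(1) by (rule bij_betwE[rule_format])
    then show "cp (q (n + 1 - i)) (q (n + 1 - j)) = (if i = j then 2 else cartan_off T i j)"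
      using C[of i j] ij by auto
  qed
  then have "bourbaki_labelling R \<Delta> T (\<lambda>i. q (n + 1 - i))"
    unfolding bourbaki_labelling_def rk using bij by blast
  then show ?thesis unfolding has_type_def by blast
qed

lemma double_bond_B_or_C:
  assumes ab: "a \<in> \<Delta>" "b \<in> \<Delta>" "a \<noteq> b"
    and terminal: "\<And>\<beta>. \<beta> \<in> \<Delta> \<Longrightarrow> cp a \<beta> \<noteq> 0 \<Longrightarrow> \<beta> = a \<or> \<beta> = b"
    and bond: "cp a b = x" "cp b a = y" "x * y = 2"
  shows "2 \<le> n" "(x, y) = (-1, -2) \<Longrightarrow> has_type R \<Delta> (DynB n)" "(x, y) = (-2, -1) \<Longrightarrow> has_type R \<Delta> (DynC n)"
proof -
  have bd: "cp a b * cp b a = 2" using bond by simp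
  obtain q where q: "bij_betw q {1..n} \<Delta>" "2 \<le> n" "q 1 = a" "q 2 = b"
    and s: "\<And>s. 2 \<le> s \<Longrightarrow> s < n \<Longrightarrow> cp (q s) (q (Suc s)) = - 1 \<and> cp (q (Suc s)) (q s) = - 1"
    and z: "\<And>s r. 1 \<le> s \<Longrightarrow> s < r \<Longrightarrow> r \<le> n \<Longrightarrow> Suc s \<noteq> r \<Longrightarrow> cp (q s) (q r) = 0 \<and> cp (q r) (q s) = 0"
    using double_bond_chain[OF ab bd terminal] by blast
  show "2 \<le> n" by (rule q(2))
  have val: "cp (q (n + 1 - i)) (q (n + 1 - j)) =
      (if i = n \<and> j + 1 = n then x else if i + 1 = n \<and> j = n then y else if chain i j then - 1 else 0)"
    if "1 \<le> i" "i \<le> n" "1 \<le> j" "j \<le> n" "i \<noteq> j" for i j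
  proof -
    have "(i = n \<and> j + 1 = n) \<or> (i + 1 = n \<and> j = n) \<or> (i = j + 1 \<and> i < n) \<or> (j = i + 1 \<and> j < n)
        \<or> i + 1 < j \<or> j + 1 < i" using that by arith
    then consider "i = n" "j + 1 = n" | "i + 1 = n" "j = n"
      | "i = j + 1" "i < n" | "j = i + 1" "j < n" | "i + 1 < j" | "j + 1 < i" by blast
    then show ?thesis
    proof cases
      case 1
      then have "n + 1 - i = 1" "n + 1 - j = 2" by auto
      then show ?thesis using 1 q bond by (simp only:) simp
    next
      case 2
      then have "n + 1 - i = 2" "n + 1 - j = 1" by auto
      then show ?thesis using 2 q bond by (simp only:) simp
    next
      case 3
      then have "n + 1 - j = Suc (n + 1 - i)" by auto
      then show ?thesis using 3 s[of "n + 1 - i"] that by (simp only:) (auto simp: chain_def)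
    next
      case 4
      then have "n + 1 - i = Suc (n + 1 - j)" by auto
      then show ?thesis using 4 s[of "n + 1 - j"] that by (simp only:) (auto simp: chain_def)
    next
      case 5
      then show ?thesis using z[of "n + 1 - j" "n + 1 - i"] that by (auto simp: chain_def)
    next
      case 6
      then show ?thesis using z[of "n + 1 - i" "n + 1 - j"] that by (auto simp: chain_def)
    qed
  qed
  show "has_type R \<Delta> (DynB n)" if xy: "(x, y) = (-1, -2)"
  proof (rule reversed_labelling[OF q(1)])
    fix i j assume ij: "1 \<le> i" "i \<le> n" "1 \<le> j" "j \<le> n" "i \<noteq> j"
    show "cp (q (n + 1 - i)) (q (n + 1 - j)) = cartan_off (DynB n) i j"
      unfolding val[OF ij] using xy by (auto simp: chain_def)
  qed simp
  show "has_type R \<Delta> (DynC n)" if xy: "(x, y) = (-2, -1)"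
  proof (rule reversed_labelling[OF q(1)])
    fix i j assume ij: "1 \<le> i" "i \<le> n" "1 \<le> j" "j \<le> n" "i \<noteq> j"
    show "cp (q (n + 1 - i)) (q (n + 1 - j)) = cartan_off (DynC n) i j"
      unfolding val[OF ij] using xy by (auto simp: chain_def)
  qed simp
qed

section \<open>Multiply laced diagrams\<close>

text \<open>The exclusion principle for explicitly listed nodes and marks.\<close>

lemma no_affine_list:
  assumes d: "distinct (map fst xs)" and s: "fst ` set xs \<subseteq> \<Delta>" and ne: "xs \<noteq> []"
    and la: "list_all (\<lambda>p. snd p > 0 \<and> sum_list (map (\<lambda>q. snd q * cp (fst q) (fst p)) xs) \<le> 0) xs"
  shows False
proof -
  have c: "k > 0 \<and> (\<Sum>p\<leftarrow>xs. snd p * cp (fst p) \<delta>) \<le> 0" if "(\<delta>, k) \<in> set xs" for \<delta> k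
    using la that by (auto simp: list_all_iff)
  define c where "c \<delta> = the (map_of xs \<delta>)" for \<delta>
  let ?S = "fst ` set xs"
  have cx: "c \<delta> = k" if "(\<delta>, k) \<in> set xs" for \<delta> k
    using that d by (simp add: c_def)
  have sm: "(\<Sum>p\<leftarrow>xs. snd p * cp (fst p) \<delta>) = (\<Sum>\<epsilon>\<in>?S. c \<epsilon> * cp \<epsilon> \<delta>)" for \<delta>
  proof -
    have dx: "distinct xs" using d by (simp add: distinct_map)
    have inj: "inj_on fst (set xs)" using d by (simp add: distinct_map)
    have "(\<Sum>p\<leftarrow>xs. snd p * cp (fst p) \<delta>) = (\<Sum>p\<in>set xs. snd p * cp (fst p) \<delta>)"
      using dx by (rule sum_list_distinct_conv_sum_set)
    also have "\<dots> = (\<Sum>p\<in>set xs. c (fst p) * cp (fst p) \<delta>)"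
      by (rule sum.cong) (auto simp: cx)
    finally show ?thesis by (simp add: sum.reindex[OF inj])
  qed
  show False
  proof (rule no_affine_subdiagram[where S = ?S and c = c])
    show "?S \<noteq> {}" using ne by simp
    show "c \<delta> > 0" if "\<delta> \<in> ?S" for \<delta> using that c cx by fastforce
    fix \<delta> assume dS: "\<delta> \<in> ?S"
    then obtain k where k: "(\<delta>, k) \<in> set xs" by auto
    have dD: "\<delta> \<in> \<Phi>" using dS s by auto
    have "2 * c \<delta> + (\<Sum>\<epsilon>\<in>?S - {\<delta>}. c \<epsilon> * cp \<epsilon> \<delta>) = (\<Sum>\<epsilon>\<in>?S. c \<epsilon> * cp \<epsilon> \<delta>)"
      using dD by (subst sum.remove[OF _ dS]) simp_all
    also have "\<dots> \<le> 0" using c[OF k] sm by simp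
    finally show "\<exists>T\<subseteq>?S - {\<delta>}. 2 * c \<delta> + (\<Sum>\<epsilon>\<in>T. c \<epsilon> * cp \<epsilon> \<delta>) \<le> 0" by blast
  qed (rule s)
qed

lemmas affine_simps = list.pred_inject simp_thms list.map sum_list.Cons sum_list.Nil fst_conv snd_conv

lemma neighbour_cp: assumes "u \<in> \<Delta>" "v \<in> \<Delta>" "u \<noteq> v" "cp u v \<noteq> 0" shows "cp u v \<le> - 1" "cp v u \<le> - 1"
  using simple_cp_cases[OF assms(1-3)] assms(4) by auto

text \<open>A third node at either end of a triple bond would give an affine diagram. The marks are \<open>1, 2, 3\<close> for
  a node at the long root (the extended diagram of \<open>G\<^sub>2\<close>) and \<open>1, 2, 1\<close> for a node at the short root (its dual).\<close>

lemma triple_bond: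
  assumes i: "i \<in> \<Delta>" and j: "j \<in> \<Delta>" and ij: "i \<noteq> j" and b: "cp i j = - 3"
  shows "has_type R \<Delta> DynG2"
proof -
  have b': "cp j i = - 1" using simple_cp_cases[OF i j ij] b by auto
  have no: False if u: "u \<in> \<Delta>" "u \<noteq> i" "u \<noteq> j" "cp i u \<noteq> 0 \<or> cp j u \<noteq> 0" for u
  proof -
    have n: "cp i u \<le> 0" "cp u i \<le> 0" "cp j u \<le> 0" "cp u j \<le> 0"
      using simple_cp_nonpos i j u by auto
    show False
    proof (cases "cp i u = 0")
      case False
      have f: "cp i u \<le> - 1" "cp u i \<le> - 1" using neighbour_cp[OF i u(1)] u False by auto
      show False by (rule no_affine_list[of "[(u,1),(i,2),(j,3)]"]) (use i j ij u b b' n f in auto)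
    next
      case True
      then have f: "cp j u \<le> - 1" "cp u j \<le> - 1" using neighbour_cp[OF j u(1)] u by auto
      show False by (rule no_affine_list[of "[(u,1),(i,1),(j,2)]"]) (use i j ij u b b' n f in auto)
    qed
  qed
  have D: "{i, j} = \<Delta>"
    by (rule connected_closed) (use i j no in auto)
  have I: "{1..2::nat} = {1, 2}" by auto
  have "bourbaki_labelling R \<Delta> DynG2 (\<lambda>k. if k = 1 then j else i)"
    unfolding bourbaki_labelling_def D[symmetric] dynkin_rank.simps I
    using i j ij b b' by (auto simp: bij_betw_def chain_def)
  then show ?thesis unfolding has_type_def by blast
qed

text \<open>Both nodes of the double bond have another neighbour, \<open>l\<close> and \<open>s\<close>. A further bond, a multiple bond
  to \<open>l\<close> or \<open>s\<close>, or a fifth node would complete a diagram of affine or indefinite type. The listed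
  marks witness this; for a fifth node at an end of the chain they are those of the extended diagram of
  \<open>F\<^sub>4\<close> and of its dual.\<close>

lemma double_bond_F4:
  assumes i: "i \<in> \<Delta>" and j: "j \<in> \<Delta>" and ij: "i \<noteq> j" and b: "cp i j = - 2"
    and l: "l \<in> \<Delta>" "l \<noteq> i" "l \<noteq> j" "cp i l \<noteq> 0"
    and s: "s \<in> \<Delta>" "s \<noteq> i" "s \<noteq> j" "cp j s \<noteq> 0"
  shows "has_type R \<Delta> DynF4"
proof -
  have b': "cp j i = - 1" using simple_cp_cases[OF i j ij] b by auto
  have N: "cp x y \<le> 0" if "x \<in> \<Delta>" "y \<in> \<Delta>" "x \<noteq> y" for x y using simple_cp_nonpos that by auto
  have sym: "cp x y = 0 \<longleftrightarrow> cp y x = 0" if "x \<in> \<Delta>" "y \<in> \<Delta>" for x y using simple_cp_zero_iff that by auto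
  have fl: "cp i l \<le> - 1" "cp l i \<le> - 1" using neighbour_cp[OF i l(1)] l by auto
  have fs: "cp j s \<le> - 1" "cp s j \<le> - 1" using neighbour_cp[OF j s(1)] s by auto
  have mem: "i \<in> \<Delta>" "j \<in> \<Delta>" "l \<in> \<Delta>" "s \<in> \<Delta>" and two: "cp i i = 2" "cp j j = 2" "cp l l = 2" "cp s s = 2"
    using i j l s by auto
  note neq = ij ij[symmetric] l(2,3) l(2,3)[symmetric] s(2,3) s(2,3)[symmetric]
  have lj: "cp l j = 0"
  proof (rule ccontr)
    assume "cp l j \<noteq> 0"
    then have f: "cp l j \<le> - 1" "cp j l \<le> - 1" using neighbour_cp[OF l(1) j] l by auto
    show False by (rule no_affine_list[of "[(i,1),(j,1),(l,1)]"], (use neq in simp), (use mem in simp), simp,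
        (simp only: affine_simps, intro conjI; (use two b b' fl f in linarith)))
  qed
  have si: "cp s i = 0"
  proof (rule ccontr)
    assume "cp s i \<noteq> 0"
    then have f: "cp s i \<le> - 1" "cp i s \<le> - 1" using neighbour_cp[OF s(1) i] s by auto
    show False by (rule no_affine_list[of "[(i,1),(j,1),(s,1)]"], (use neq in simp), (use mem in simp), simp,
        (simp only: affine_simps, intro conjI; (use two b b' fs f in linarith)))
  qed
  have jl: "cp j l = 0" and i_s: "cp i s = 0" using lj si sym[of l j] sym[of s i] i j l(1) s(1) by blast+
  have ls: "l \<noteq> s" using l i_s by auto
  have cls: "cp l s = 0"
  proof (rule ccontr)
    assume "cp l s \<noteq> 0"
    then have f: "cp l s \<le> - 1" "cp s l \<le> - 1" using neighbour_cp[OF l(1) s(1)] ls by auto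
    show False by (rule no_affine_list[of "[(i,1),(j,1),(l,1),(s,1)]"], (use neq ls ls[symmetric] in simp), (use mem in simp), simp,
        (simp only: affine_simps, intro conjI; (use two b b' fl fs f lj jl si i_s in linarith)))
  qed
  have csl: "cp s l = 0" using cls sym[of l s] l(1) s(1) by blast
  have l1: "cp l i = - 1"
  proof (rule ccontr)
    assume "cp l i \<noteq> - 1"
    then have f: "cp l i \<le> - 2" using fl by linarith
    show False by (rule no_affine_list[of "[(l,1),(i,2),(j,2)]"], (use neq in simp), (use mem in simp), simp,
        (simp only: affine_simps, intro conjI; (use two b b' fl lj jl f in linarith)))
  qed
  have l2: "cp i l = - 1"
  proof (rule ccontr)
    assume "cp i l \<noteq> - 1"
    then have f: "cp i l \<le> - 2" using fl by linarith
    show False by (rule no_affine_list[of "[(l,1),(i,1),(j,1)]"], (use neq in simp), (use mem in simp), simp,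
        (simp only: affine_simps, intro conjI; (use two b b' fl lj jl f in linarith)))
  qed
  have s1: "cp s j = - 1"
  proof (rule ccontr)
    assume "cp s j \<noteq> - 1"
    then have f: "cp s j \<le> - 2" using fs by linarith
    show False by (rule no_affine_list[of "[(i,1),(j,2),(s,1)]"], (use neq in simp), (use mem in simp), simp,
        (simp only: affine_simps, intro conjI; (use two b b' fs si i_s f in linarith)))
  qed
  have s2: "cp j s = - 1"
  proof (rule ccontr)
    assume "cp j s \<noteq> - 1"
    then have f: "cp j s \<le> - 2" using fs by linarith
    show False by (rule no_affine_list[of "[(i,1),(j,2),(s,2)]"], (use neq in simp), (use mem in simp), simp,
        (simp only: affine_simps, intro conjI; (use two b b' fs si i_s f in linarith)))
  qed
  have no: False if u: "u \<in> \<Delta>" "u \<noteq> i" "u \<noteq> j" "u \<noteq> l" "u \<noteq> s" "cp x u \<noteq> 0" "x \<in> {i, j, l, s}" for u x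
  proof -
    have n: "cp i u \<le> 0" "cp u i \<le> 0" "cp j u \<le> 0" "cp u j \<le> 0" "cp l u \<le> 0" "cp u l \<le> 0" "cp s u \<le> 0" "cp u s \<le> 0"
      using N i j l s u by auto
    have "x \<in> \<Delta>" "x \<noteq> u" using u i j l s by auto
    then have f: "cp x u \<le> - 1" "cp u x \<le> - 1" using neighbour_cp[of x u] u by auto
    have u2: "cp u u = 2" using u(1) by simp
    consider "x = i" | "x = j" | "x = l" | "x = s" using u by auto
    then show False
    proof cases
      case 1
      note f = f[unfolded 1]
      show False by (rule no_affine_list[of "[(l,1),(u,1),(i,2),(j,2)]"], (use neq u(2-5) u(2-5)[symmetric] in simp), (use mem u(1) in simp), simp,
        (simp only: affine_simps, intro conjI; (use two u2 b b' n f l1 l2 lj jl in linarith)))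
    next
      case 2
      note f = f[unfolded 2]
      show False by (rule no_affine_list[of "[(s,1),(u,1),(j,2),(i,1)]"], (use neq u(2-5) u(2-5)[symmetric] in simp), (use mem u(1) in simp), simp,
        (simp only: affine_simps, intro conjI; (use two u2 b b' n f s1 s2 si i_s in linarith)))
    next
      case 3
      note f = f[unfolded 3]
      show False by (rule no_affine_list[of "[(u,1),(l,2),(i,3),(j,4),(s,2)]"], (use neq ls ls[symmetric] u(2-5) u(2-5)[symmetric] in simp), (use mem u(1) in simp), simp,
        (simp only: affine_simps, intro conjI; (use two u2 b b' n f l1 l2 s1 s2 lj jl si i_s cls csl in linarith)))
    next
      case 4
      note f = f[unfolded 4]
      show False by (rule no_affine_list[of "[(l,1),(i,2),(j,3),(s,2),(u,1)]"], (use neq ls ls[symmetric] u(2-5) u(2-5)[symmetric] in simp), (use mem u(1) in simp), simp,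
        (simp only: affine_simps, intro conjI; (use two u2 b b' n f l1 l2 s1 s2 lj jl si i_s cls csl in linarith)))
    qed
  qed
  have D: "{i, j, l, s} = \<Delta>"
  proof (rule connected_closed)
    show "{i, j, l, s} \<subseteq> \<Delta>" using i j l s by auto
    fix \<alpha> \<beta> assume "\<alpha> \<in> {i, j, l, s}" "\<beta> \<in> \<Delta>" "cp \<alpha> \<beta> \<noteq> 0"
    then show "\<beta> \<in> {i, j, l, s}" using no[of \<beta> \<alpha>] by blast
  qed simp
  have I: "{1..4::nat} = {1, 2, 3, 4}" by auto
  define f where "f k = (if k = 1 then l else if k = 2 then i else if k = 3 then j else s)" for k :: nat
  have f: "f 1 = l" "f 2 = i" "f 3 = j" "f 4 = s" by (auto simp: f_def)
  have "bij_betw f {1..4} \<Delta>" unfolding I D[symmetric] bij_betw_def using neq ls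
    by (simp add: f insert_commute del: One_nat_def)
  moreover have "cp (f x) (f y) = (if x = y then 2 else cartan_off DynF4 x y)" if "x \<in> {1,2,3,4}" "y \<in> {1,2,3,4}" for x y
    using that by (elim insertE emptyE; hypsubst)
      (simp_all add: f two b b' l1 l2 s1 s2 lj jl si i_s cls csl chain_def del: One_nat_def)
  ultimately have "bourbaki_labelling R \<Delta> DynF4 f"
    unfolding bourbaki_labelling_def dynkin_rank.simps I by blast
  then show ?thesis unfolding has_type_def by blast
qed

definition simply_laced where
  "simply_laced \<longleftrightarrow> (\<forall>\<delta>\<in>\<Delta>. \<forall>\<epsilon>\<in>\<Delta>. \<delta> \<noteq> \<epsilon> \<longrightarrow> cp \<delta> \<epsilon> \<in> {0, - 1})"

text \<open>Apart from \<open>G\<^sub>2\<close>, the type is decided by the nodes of a double bond that have another neighbour: if both do, it is \<open>F\<^sub>4\<close>,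
  and otherwise one node is terminal and the diagram is a chain that starts there. The terminal node
  is the short one in type \<open>B\<close> and the long one in type \<open>C\<close>.\<close>

lemma multiply_laced_types:
  assumes "\<not> simply_laced"
  shows "has_type R \<Delta> DynG2 \<or> has_type R \<Delta> DynF4 \<or> 2 \<le> n \<and> has_type R \<Delta> (DynB n) \<or> 3 \<le> n \<and> has_type R \<Delta> (DynC n)"
proof -
  obtain i j where ij: "i \<in> \<Delta>" "j \<in> \<Delta>" "i \<noteq> j" "cp i j \<notin> {0, -1}" using assms unfolding simply_laced_def by blast
  then have c: "cp i j = -3 \<or> cp i j = -2 \<and> cp j i = -1" using simple_cp_cases[OF ij(1-3)] by auto
  show ?thesis
  proof (cases "cp i j = - 3")
    case True then show ?thesis using triple_bond ij by blast
  next
    case False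
    with c have b: "cp i j = - 2" "cp j i = - 1" by auto
    show ?thesis
    proof (cases "\<exists>s\<in>\<Delta>. s \<noteq> i \<and> s \<noteq> j \<and> cp j s \<noteq> 0")
      case False
      then have "2 \<le> n" "has_type R \<Delta> (DynB n)"
        using double_bond_B_or_C[of j i "-1" "-2"] ij b by auto
      then show ?thesis by blast
    next
      case True
      then obtain s where s: "s \<in> \<Delta>" "s \<noteq> i" "s \<noteq> j" "cp j s \<noteq> 0" by blast
      show ?thesis
      proof (cases "\<exists>l\<in>\<Delta>. l \<noteq> i \<and> l \<noteq> j \<and> cp i l \<noteq> 0")
        case True
        then show ?thesis using double_bond_F4[OF ij(1-3) b(1)] s by blast
      next
        case False
        then have "has_type R \<Delta> (DynC n)"
          using double_bond_B_or_C(3)[of i j "-2" "-1"] ij b by auto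
        moreover have "card {i, j, s} \<le> card \<Delta>" using ij s by (intro card_mono) auto
        then have "3 \<le> n" using ij s card_simple by auto
        ultimately show ?thesis by blast
      qed
    qed
  qed
qed

section \<open>Root lengths\<close>

text \<open>Neighbouring simple roots have the same length, the diagram is connected, and every root has the length of
  some simple root.\<close>

lemma simply_laced_length:
  assumes sl: simply_laced and "\<alpha> \<in> \<Phi>" "\<beta> \<in> \<Phi>"
  shows "frm \<alpha> \<alpha> = frm \<beta> \<beta>"
proof -
  have s: "frm \<delta> \<delta> = frm \<epsilon> \<epsilon>" if de: "\<delta> \<in> \<Delta>" "\<epsilon> \<in> \<Delta>" for \<delta> \<epsilon>
  proof -
    have "{\<gamma>\<in>\<Delta>. frm \<gamma> \<gamma> = frm \<delta> \<delta>} = \<Delta>"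
    proof (rule connected_closed)
      show "{\<gamma>\<in>\<Delta>. frm \<gamma> \<gamma> = frm \<delta> \<delta>} \<noteq> {}" using de by auto
      fix x y assume x: "x \<in> {\<gamma>\<in>\<Delta>. frm \<gamma> \<gamma> = frm \<delta> \<delta>}" and y: "y \<in> \<Delta>" "cp x y \<noteq> 0"
      show "y \<in> {\<gamma>\<in>\<Delta>. frm \<gamma> \<gamma> = frm \<delta> \<delta>}"
      proof (cases "x = y")
        case False
        then have "cp x y = - 1" "cp y x = - 1"
          using sl x y simple_cp_zero_iff[of x y] unfolding simply_laced_def by auto
        then show ?thesis using cp_length[of x y] x y by auto
      qed (use x in simp)
    qed auto
    then have "\<epsilon> \<in> {\<gamma>\<in>\<Delta>. frm \<gamma> \<gamma> = frm \<delta> \<delta>}" using de by simp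
    then show ?thesis by simp
  qed
  obtain \<delta> \<epsilon> where "\<delta> \<in> \<Delta>" "\<epsilon> \<in> \<Delta>" "frm \<alpha> \<alpha> = frm \<delta> \<delta>" "frm \<beta> \<beta> = frm \<epsilon> \<epsilon>"
    using exists_simple_length assms by metis
  then show ?thesis using s[of \<delta> \<epsilon>] by simp
qed

lemma simply_laced_cp:
  assumes sl: simply_laced and a: "\<alpha> \<in> \<Phi>" and b: "\<beta> \<in> \<Phi>"
  shows "cp \<alpha> \<beta> = cp \<beta> \<alpha>" "\<beta> \<noteq> \<alpha> \<Longrightarrow> \<beta> \<noteq> - \<alpha> \<Longrightarrow> cp \<alpha> \<beta> \<in> {-1, 0, 1}"
proof -
  show s: "cp \<alpha> \<beta> = cp \<beta> \<alpha>"
    using cp_length[OF a b] simply_laced_length[OF sl a b] frm_pos[OF b] by simp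
  show "cp \<alpha> \<beta> \<in> {-1, 0, 1}" if "\<beta> \<noteq> \<alpha>" "\<beta> \<noteq> - \<alpha>"
    using cp_cases[OF a b that] s by auto
qed

text \<open>Without a triple bond all ratios of squared lengths are powers of 2, so no two roots have ratio 3.\<close>

lemma no_triple_cp:
  assumes nt: "\<And>i j. i \<in> \<Delta> \<Longrightarrow> j \<in> \<Delta> \<Longrightarrow> i \<noteq> j \<Longrightarrow> cp i j \<noteq> - 3" and a: "\<alpha> \<in> \<Phi>" and b: "\<beta> \<in> \<Phi>"
  shows "\<bar>cp \<alpha> \<beta>\<bar> \<noteq> 3"
proof
  assume c3: "\<bar>cp \<alpha> \<beta>\<bar> = 3"
  have s: "\<exists>k m :: nat. 2 ^ k * frm \<epsilon> \<epsilon> = 2 ^ m * frm \<delta> \<delta>" if de: "\<delta> \<in> \<Delta>" "\<epsilon> \<in> \<Delta>" for \<delta> \<epsilon>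
  proof -
    let ?S = "{\<gamma>\<in>\<Delta>. \<exists>k m :: nat. 2 ^ k * frm \<gamma> \<gamma> = 2 ^ m * frm \<delta> \<delta>}"
    have "?S = \<Delta>"
    proof (rule connected_closed)
      show "?S \<noteq> {}" using de by auto
      fix x y assume x: "x \<in> ?S" and y: "y \<in> \<Delta>" "cp x y \<noteq> 0"
      obtain k m :: nat where km: "2 ^ k * frm x x = 2 ^ m * frm \<delta> \<delta>" using x by blast
      show "y \<in> ?S"
      proof (cases "x = y")
        case False
        then have "(cp x y, cp y x) \<in> {(-1,-1), (-1,-2), (-2,-1)}"
          using simple_cp_cases[of x y] nt[of x y] nt[of y x] x y by auto
        then consider "frm y y = frm x x" | "frm y y = 2 * frm x x" | "2 * frm y y = frm x x"
          using cp_length[of x y] x y by auto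
        then show ?thesis
        proof cases
          case 1 then show ?thesis using km y by auto
        next
          case 2
          then have "2 ^ k * frm y y = 2 ^ Suc m * frm \<delta> \<delta>" using km by simp
          then show ?thesis using y by blast
        next
          case 3
          have "2 ^ Suc k * frm y y = 2 ^ k * (2 * frm y y)" by simp
          then have "2 ^ Suc k * frm y y = 2 ^ m * frm \<delta> \<delta>" using km 3 by simp
          then show ?thesis using y by blast
        qed
      qed (use x in simp)
    qed auto
    then show ?thesis using de by blast
  qed
  have "\<beta> \<noteq> \<alpha>" "\<beta> \<noteq> - \<alpha>" using c3 a by auto
  from cp_cases[OF a b this] c3 have "cp \<alpha> \<beta> = 3 \<and> cp \<beta> \<alpha> = 1 \<or> cp \<alpha> \<beta> = - 3 \<and> cp \<beta> \<alpha> = - 1" by auto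
  then have len: "3 * frm \<beta> \<beta> = frm \<alpha> \<alpha>" using cp_length[OF a b] by auto
  obtain \<delta> \<epsilon> where de: "\<delta> \<in> \<Delta>" "\<epsilon> \<in> \<Delta>" "frm \<alpha> \<alpha> = frm \<delta> \<delta>" "frm \<beta> \<beta> = frm \<epsilon> \<epsilon>"
    using exists_simple_length a b by metis
  obtain k m :: nat where km: "2 ^ k * frm \<epsilon> \<epsilon> = 2 ^ m * frm \<delta> \<delta>" using s de by blast
  have "2 ^ k * frm \<epsilon> \<epsilon> = (2 ^ m * 3) * frm \<epsilon> \<epsilon>" using km len de by simp
  moreover have "frm \<epsilon> \<epsilon> > 0" using frm_pos de by simp
  ultimately have "(2::int) ^ k = 2 ^ m * 3" by simp
  then have "(3::int) dvd 2 ^ k" by simp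
  then have "(3::int) dvd 2" by (rule prime_dvd_power[rotated]) simp
  then show False by simp
qed

section \<open>A root in \<open>2X\<close>\<close>

text \<open>A root in \<open>2X\<close> has even Cartan integers, so it is orthogonal to all roots except \<open>\<plusminus>\<alpha>\<close>, and by
  connectedness the rank is 1. Half of it is, up to sign, the fundamental weight.\<close>

lemma simply_laced_null:
  assumes sl: simply_laced and a: "\<alpha> \<in> \<Phi>" and c: "congr 2 \<alpha> 0"
  shows "has_type R \<Delta> (DynA 1)" "simply_connected_type R"
proof -
  obtain x where x: "\<alpha> = zmult 2 x" using c unfolding congr_def by auto
  have orth: "cp \<alpha> \<gamma> = 0" if "\<gamma> \<in> \<Phi>" "\<gamma> \<noteq> \<alpha>" "\<gamma> \<noteq> - \<alpha>" for \<gamma>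
    using simply_laced_cp(2)[OF sl a that] congr_cp[OF c, of \<gamma>] by auto
  have "\<exists>\<delta>\<in>\<Delta>. cp \<alpha> \<delta> \<noteq> 0" using nondegenerate[of \<alpha>] root_ne_0[OF a] by blast
  then obtain \<delta> where d: "\<delta> \<in> \<Delta>" "cp \<alpha> \<delta> \<noteq> 0" by blast
  then have da: "\<delta> = \<alpha> \<or> \<delta> = - \<alpha>" using orth[of \<delta>] by auto
  have D: "{\<delta>} = \<Delta>"
  proof (rule connected_closed)
    fix x y assume xy: "x \<in> {\<delta>}" "y \<in> \<Delta>" "cp x y \<noteq> 0"
    then have "cp \<alpha> y \<noteq> 0" using da by auto
    then have "y = \<alpha> \<or> y = - \<alpha>" using orth[of y] xy by auto
    then show "y \<in> {\<delta>}" using da simple_ne_neg[OF d(1) xy(2)] by auto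
  qed (use d in auto)
  have "bourbaki_labelling R \<Delta> (DynA 1) (\<lambda>_. \<delta>)"
    unfolding bourbaki_labelling_def D[symmetric] using d by (auto simp: bij_betw_def)
  then show "has_type R \<Delta> (DynA 1)" unfolding has_type_def by blast
  have "2 * cp x \<alpha> = cp \<alpha> \<alpha>" using arg_cong[OF x, of "\<lambda>z. cp z \<alpha>"] by simp
  then have "cp x \<alpha> = 1" using a by simp
  then have "cp x \<delta> = 1 \<or> cp (- x) \<delta> = 1" using da a by auto
  then have "\<exists>\<omega>. cp \<omega> \<delta> = 1" by blast
  then show "simply_connected_type R"
    by (intro weights_simply_connected) (simp add: D[symmetric])
qed

section \<open>Coincidences in characteristic 3\<close>

text \<open>The roots \<open>\<alpha>\<close> and \<open>\<beta>\<close> span a subsystem \<open>A\<close> of type \<open>A\<^sub>2\<close>. For a root \<open>\<gamma>\<close> outside \<open>A\<close> the Cartan integers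
  \<open>\<langle>\<alpha>, \<gamma>\<^sup>\<vee>\<rangle>\<close> and \<open>\<langle>\<beta>, \<gamma>\<^sup>\<vee>\<rangle>\<close> agree modulo 3, and the possible values and lengths force both to
  vanish. So the connected diagram lies in \<open>A\<close>. Any two roots of \<open>A\<close> at an angle of 120 degrees are
  congruent modulo \<open>3X\<close>; a third of the difference of the two simple roots therefore lies in \<open>X\<close>, and
  together with the simple roots it generates the fundamental weights.\<close>

lemma congr_three_types:
  assumes nt: "\<And>i j. i \<in> \<Delta> \<Longrightarrow> j \<in> \<Delta> \<Longrightarrow> i \<noteq> j \<Longrightarrow> cp i j \<noteq> - 3"
    and a: "\<alpha> \<in> \<Phi>" and b: "\<beta> \<in> \<Phi>" and ne: "\<alpha> \<noteq> \<beta>" and c: "congr 3 \<alpha> \<beta>"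
  shows "has_type R \<Delta> (DynA 2)" "simply_connected_type R"
proof -
  have ab: "cp \<alpha> \<beta> = -1" "cp \<beta> \<alpha> = -1" using congr_odd[of 3 \<alpha> \<beta>] a b ne c by auto
  have r: "\<alpha> + \<beta> \<in> \<Phi>" using refl_root[OF b a] ab by (simp add: refl_def)
  have ca: "coroot R (\<alpha> + \<beta>) = coroot R \<alpha> + coroot R \<beta>"
    using coroot_refl[OF b a] ab by (simp add: refl_def corefl_def)
  define s where "s = \<alpha> + \<beta>"
  have sr: "s \<in> \<Phi>" using r by (simp add: s_def)
  have cs: "cp s \<alpha> = 1" "cp s \<beta> = 1" "cp \<alpha> s = 1" "cp \<beta> s = 1"
    unfolding s_def using ca ab a b by simp_all
  define A where "A = {\<alpha>, \<beta>, - s, - \<alpha>, - \<beta>, s}"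
  have len: "frm \<alpha> \<alpha> = frm \<beta> \<beta>" "frm (\<alpha> + \<beta>) (\<alpha> + \<beta>) = frm \<alpha> \<alpha>"
    using cp_length[OF a b] ab frm_refl[OF b, of \<alpha> \<alpha>] by (simp_all add: refl_def)
  have orth: "cp \<alpha> \<gamma> = 0 \<and> cp \<beta> \<gamma> = 0" if g: "\<gamma> \<in> \<Phi>" "\<gamma> \<notin> A" for \<gamma>
  proof -
    define u v where "u = cp \<alpha> \<gamma>" and "v = cp \<beta> \<gamma>"
    have three: "3 dvd u - v" using congr_cp[OF c, of \<gamma>] by (simp add: u_def v_def)
    have val: "cp x \<gamma> \<in> {-2,-1,0,1,2} \<and> (\<bar>cp x \<gamma>\<bar> = 2 \<longrightarrow> 2 * frm \<gamma> \<gamma> = frm x x)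
         \<and> (\<bar>cp x \<gamma>\<bar> = 1 \<longrightarrow> (\<exists>m. frm \<gamma> \<gamma> = m * frm x x))"
      if x: "x \<in> {\<alpha>, \<beta>, \<alpha> + \<beta>}" for x
    proof -
      have xr: "x \<in> \<Phi>" "\<gamma> \<noteq> x" "\<gamma> \<noteq> - x" using x a b r g by (auto simp: A_def s_def)
      show ?thesis using cp_cases[OF xr(1) g(1) xr(2,3)] no_triple_cp[OF nt xr(1) g(1)] cp_length[OF xr(1) g(1)]
        by (auto intro: exI[of _ 1] exI[of _ 2] exI[of _ 3])
    qed
    have v1: "u \<in> {-2,-1,0,1,2}" "v \<in> {-2,-1,0,1,2}" "u + v \<in> {-2,-1,0,1,2}"
      using val[of \<alpha>] val[of \<beta>] val[of "\<alpha> + \<beta>"] by (auto simp: u_def v_def)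
    \<comment> \<open>The equally long roots \<open>x\<close> and \<open>y\<close> would have a squared length that is twice that of \<open>\<gamma>\<close> and at most that
      of \<open>\<gamma>\<close>.\<close>
    have no: False if xy: "x \<in> {\<alpha>, \<beta>, \<alpha> + \<beta>}" "y \<in> {\<alpha>, \<beta>, \<alpha> + \<beta>}" "\<bar>cp x \<gamma>\<bar> = 2" "\<bar>cp y \<gamma>\<bar> = 1" for x y
    proof -
      have l: "frm x x = frm y y" using that len by auto
      obtain m where m: "frm \<gamma> \<gamma> = m * frm y y" using val[OF xy(2)] xy(4) by blast
      have "2 * frm \<gamma> \<gamma> = frm y y" using val[OF that(1)] that(3) l by simp
      then have "(2 * m) * frm y y = 1 * frm y y" using m by simp
      moreover have "frm y y \<noteq> 0" using frm_pos[of y] that a b r by auto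
      ultimately have "2 * m = 1" by (simp only: mult_cancel_right simp_thms)
      then show False by presburger
    qed
    have "u = 0 \<and> v = 0"
      using v1 three no[of \<alpha> \<beta>] no[of \<beta> \<alpha>] no[of "\<alpha> + \<beta>" \<alpha>] by (auto simp flip: u_def v_def)
    then show ?thesis by (simp add: u_def v_def)
  qed
  have A_pair: "cp x y \<in> {-1, 1} \<and> cp y x = cp x y" if xy: "x \<in> A" "y \<in> A" "x \<noteq> y" "y \<noteq> - x" for x y
    using xy unfolding A_def by (elim insertE emptyE; hypsubst) (simp_all add: ab a b sr cs)
  have AD: "\<Delta> \<inter> A = \<Delta>"
  proof (rule connected_closed)
    have "\<exists>\<delta>\<in>\<Delta>. cp \<alpha> \<delta> \<noteq> 0" using nondegenerate[of \<alpha>] root_ne_0[OF a] by blast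
    then obtain \<delta> where "\<delta> \<in> \<Delta>" "cp \<alpha> \<delta> \<noteq> 0" by blast
    then have "\<delta> \<in> \<Delta> \<inter> A" using orth[of \<delta>] by auto
    then show "\<Delta> \<inter> A \<noteq> {}" by blast
    fix x y assume xy: "x \<in> \<Delta> \<inter> A" "y \<in> \<Delta>" "cp x y \<noteq> 0"
    show "y \<in> \<Delta> \<inter> A"
    proof (rule ccontr)
      assume "y \<notin> \<Delta> \<inter> A"
      then have "cp \<alpha> y = 0" "cp \<beta> y = 0" using orth[of y] xy by auto
      moreover have "cp s y = cp \<alpha> y + cp \<beta> y" by (simp add: s_def)
      ultimately show False using xy by (auto simp: A_def)
    qed
  qed auto
  obtain \<delta> where d: "\<delta> \<in> \<Delta>" using simple_ne by blast
  have "\<exists>\<epsilon>\<in>\<Delta>. \<epsilon> \<noteq> \<delta>"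
  proof (rule ccontr)
    assume "\<not> ?thesis"
    then have D: "\<Delta> = {\<delta>}" using d by blast
    have "\<gamma> = \<delta> \<or> \<gamma> = - \<delta>" if "\<gamma> \<in> \<Phi>" for \<gamma>
    proof -
      have "zmult 1 \<gamma> = zmult (coef \<gamma> \<delta>) \<delta>" using coef_sum[OF root_in_QL[OF that]] D by simp
      then have "\<delta> = \<gamma> \<or> \<delta> = - \<gamma>" using reduced that d unfolding reduced_def
        by (metis simple_root zero_neq_one)
      then show ?thesis by auto
    qed
    from this[OF a] this[OF b] have "\<beta> = \<alpha> \<or> \<beta> = - \<alpha>" by auto
    then show False using ab a ne by auto
  qed
  then obtain \<epsilon> where e: "\<epsilon> \<in> \<Delta>" "\<epsilon> \<noteq> \<delta>" by blast
  have pair: "cp x y = - 1" if "x \<in> \<Delta>" "y \<in> \<Delta>" "x \<noteq> y" for x y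
    using A_pair[of x y] that AD simple_ne_neg[OF that(1,2)] simple_cp_nonpos[OF that] by auto
  have D: "\<Delta> = {\<delta>, \<epsilon>}"
  proof (rule ccontr)
    assume "\<Delta> \<noteq> {\<delta>, \<epsilon>}"
    then obtain \<zeta> where z: "\<zeta> \<in> \<Delta>" "\<zeta> \<noteq> \<delta>" "\<zeta> \<noteq> \<epsilon>" using d e by blast
    show False by (rule no_affine_list[of "[(\<delta>,1),(\<epsilon>,1),(\<zeta>,1)]"]) (use d e z pair in auto)
  qed
  have I: "{1..2::nat} = {1, 2}" by auto
  have "bourbaki_labelling R \<Delta> (DynA 2) (\<lambda>k. if k = 1 then \<delta> else \<epsilon>)"
    unfolding bourbaki_labelling_def dynkin_rank.simps I
    using d e pair[of \<delta> \<epsilon>] pair[of \<epsilon> \<delta>] by (auto simp: bij_betw_def chain_def D)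
  then show "has_type R \<Delta> (DynA 2)" unfolding has_type_def by blast
  obtain w where w: "\<alpha> - \<beta> = zmult 3 w" using c unfolding congr_def by blast
  have A3: "congr 3 x y" if xy: "x \<in> A" "y \<in> A" "x \<noteq> y" "cp x y = - 1" for x y
  proof -
    have ex: "congr 3 x y" if "3 dvd i" "x - y = zmult i \<alpha> + zmult j (\<alpha> - \<beta>)" for i j
    proof -
      have "x - y = zmult 3 (zmult (i div 3) \<alpha> + zmult j w)"
        unfolding that(2) w using that(1) by (simp add: zmod.scale_right_distrib mult.commute)
      then show ?thesis unfolding congr_def by blast
    qed
    have m: "zmult 3 \<alpha> = \<alpha> + \<alpha> + \<alpha>" "zmult (- 3) \<alpha> = - (\<alpha> + \<alpha> + \<alpha>)"
      "zmult 2 (\<alpha> - \<beta>) = (\<alpha> - \<beta>) + (\<alpha> - \<beta>)" "zmult (- 2) (\<alpha> - \<beta>) = - ((\<alpha> - \<beta>) + (\<alpha> - \<beta>))"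
      "zmult 1 (\<alpha> - \<beta>) = \<alpha> - \<beta>" "zmult (- 1) (\<alpha> - \<beta>) = - (\<alpha> - \<beta>)" "zmult 0 \<alpha> = 0"
      using zmod.scale_left_distrib[of 2 1 \<alpha>] zmult_minus[of 3 \<alpha>] zmult_minus[of 2 "\<alpha> - \<beta>"]
      by (simp_all add: zmult_two)
    have "\<exists>i j. (3::int) dvd i \<and> x - y = zmult i \<alpha> + zmult j (\<alpha> - \<beta>)"
    proof -
      have "(x, y) \<in> {(\<alpha>, \<beta>), (- \<beta>, - \<alpha>)} \<or> (x, y) \<in> {(\<beta>, \<alpha>), (- \<alpha>, - \<beta>)} \<or>
        (x, y) \<in> {(\<alpha>, - s), (s, - \<alpha>)} \<or> (x, y) \<in> {(- s, \<alpha>), (- \<alpha>, s)} \<or>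
        (x, y) \<in> {(\<beta>, - s), (s, - \<beta>)} \<or> (x, y) \<in> {(- s, \<beta>), (- \<beta>, s)}"
        using xy unfolding A_def by (elim insertE emptyE; hypsubst) (simp_all add: ab a b sr cs)
      then consider "x - y = \<alpha> - \<beta>" | "x - y = - (\<alpha> - \<beta>)"
        | "x - y = (\<alpha> + \<alpha> + \<alpha>) - (\<alpha> - \<beta>)" | "x - y = - (\<alpha> + \<alpha> + \<alpha>) + (\<alpha> - \<beta>)"
        | "x - y = (\<alpha> + \<alpha> + \<alpha>) - ((\<alpha> - \<beta>) + (\<alpha> - \<beta>))" | "x - y = - (\<alpha> + \<alpha> + \<alpha>) + ((\<alpha> - \<beta>) + (\<alpha> - \<beta>))"
        by (elim disjE insertE emptyE; simp add: s_def)
      then show ?thesis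
      proof cases
        case 1 then show ?thesis by (intro exI[of _ 0] exI[of _ 1]) (simp only: m, simp)
      next
        case 2 then show ?thesis by (intro exI[of _ 0] exI[of _ "- 1"]) (simp only: m, simp)
      next
        case 3 then show ?thesis by (intro exI[of _ 3] exI[of _ "- 1"]) (simp only: m, simp)
      next
        case 4 then show ?thesis by (intro exI[of _ "- 3"] exI[of _ 1]) (simp only: m, simp)
      next
        case 5 then show ?thesis by (intro exI[of _ 3] exI[of _ "- 2"]) (simp only: m, simp)
      next
        case 6 then show ?thesis by (intro exI[of _ "- 3"] exI[of _ 2]) (simp only: m, simp)
      qed
    qed
    then show ?thesis using ex by blast
  qed
  obtain x where x: "\<delta> - \<epsilon> = zmult 3 x" using A3[of \<delta> \<epsilon>] pair[of \<delta> \<epsilon>] d e AD unfolding congr_def by blast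
  have "3 * cp x \<delta> = cp (\<delta> - \<epsilon>) \<delta>" "3 * cp x \<epsilon> = cp (\<delta> - \<epsilon>) \<epsilon>" unfolding x by simp_all
  then have cx: "cp x \<delta> = 1" "cp x \<epsilon> = - 1" using d e pair[of \<delta> \<epsilon>] pair[of \<epsilon> \<delta>] by auto
  show "simply_connected_type R"
  proof (rule weights_simply_connected)
    fix \<gamma> assume "\<gamma> \<in> \<Delta>"
    then consider "\<gamma> = \<delta>" | "\<gamma> = \<epsilon>" using D by blast
    then show "\<exists>\<omega>. \<forall>\<zeta>\<in>\<Delta>. cp \<omega> \<zeta> = (if \<zeta> = \<gamma> then 1 else 0)"
    proof cases
      case 1
      then show ?thesis using d e pair[of \<delta> \<epsilon>] pair[of \<epsilon> \<delta>] cx by (intro exI[of _ "\<delta> - x"]) (auto simp: D)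
    next
      case 2
      then show ?thesis using d e pair[of \<delta> \<epsilon>] pair[of \<epsilon> \<delta>] cx by (intro exI[of _ "x + \<epsilon>"]) (auto simp: D)
    qed
  qed
qed

section \<open>Coincidences in a simply laced datum\<close>

lemma refl_simps: "refl \<delta> (x + y) = refl \<delta> x + refl \<delta> y" "refl \<delta> (x - y) = refl \<delta> x - refl \<delta> y"
    "refl \<delta> (- x) = - refl \<delta> x" "refl \<delta> (zmult k x) = zmult k (refl \<delta> x)"
  unfolding refl_def
  by (simp_all add: zmod.scale_left_distrib zmod.scale_left_diff_distrib zmult_minus zmod.scale_right_diff_distrib)

lemma congr_reflect: "congr k x y \<Longrightarrow> congr k (refl \<delta> x) (refl \<delta> y)"
  unfolding congr_def by (metis refl_simps(2,4))

text \<open>The nodes with negative coefficients would form a set as in \<open>no_affine_subdiagram\<close>. Once all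
  coefficients are nonnegative, dominance makes them vanish at the neighbours of a node where they
  vanish, hence everywhere by connectedness.\<close>

lemma dominant_coef_pos:
  assumes v: "v \<in> QL" "v \<noteq> 0" and dom: "\<And>\<delta>. \<delta> \<in> \<Delta> \<Longrightarrow> cp v \<delta> \<ge> 0" and d: "\<delta> \<in> \<Delta>"
  shows "coef v \<delta> > 0"
proof -
  have split: "cp v \<delta> = (\<Sum>\<epsilon>\<in>S. coef v \<epsilon> * cp \<epsilon> \<delta>) + (\<Sum>\<epsilon>\<in>\<Delta> - S. coef v \<epsilon> * cp \<epsilon> \<delta>)" if "S \<subseteq> \<Delta>" for S \<delta>
    unfolding pair_coef[OF v(1)] using sum.subset_diff[OF that finite_simple] by (simp add: add.commute)
  let ?N = "{\<delta>\<in>\<Delta>. coef v \<delta> < 0}"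
  have nonneg: "?N = {}"
  proof (rule ccontr)
    assume ne: "?N \<noteq> {}"
    show False
    proof (rule no_affine_subdiagram[where S = ?N and c = "\<lambda>\<delta>. - coef v \<delta>"])
      fix \<delta> assume dN: "\<delta> \<in> ?N"
      have fN: "finite ?N" by simp
      have "(\<Sum>\<epsilon>\<in>\<Delta> - ?N. coef v \<epsilon> * cp \<epsilon> \<delta>) \<le> 0"
      proof (rule sum_nonpos)
        fix \<epsilon> assume "\<epsilon> \<in> \<Delta> - ?N"
        then have "coef v \<epsilon> \<ge> 0" "cp \<epsilon> \<delta> \<le> 0" using dN by (auto intro!: simple_cp_nonpos)
        then show "coef v \<epsilon> * cp \<epsilon> \<delta> \<le> 0" by (rule mult_nonneg_nonpos)
      qed
      then have "(\<Sum>\<epsilon>\<in>?N. coef v \<epsilon> * cp \<epsilon> \<delta>) \<ge> 0" using split[of ?N \<delta>] dom[of \<delta>] dN by auto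
      moreover have "(\<Sum>\<epsilon>\<in>?N. coef v \<epsilon> * cp \<epsilon> \<delta>) = 2 * coef v \<delta> + (\<Sum>\<epsilon>\<in>?N - {\<delta>}. coef v \<epsilon> * cp \<epsilon> \<delta>)"
        unfolding sum.remove[OF fN dN] using dN by simp
      ultimately have "2 * (- coef v \<delta>) + (\<Sum>\<epsilon>\<in>?N - {\<delta>}. - coef v \<epsilon> * cp \<epsilon> \<delta>) \<le> 0"
        by (simp add: sum_negf)
      then show "\<exists>T\<subseteq>?N - {\<delta>}. 2 * (- coef v \<delta>) + (\<Sum>\<epsilon>\<in>T. - coef v \<epsilon> * cp \<epsilon> \<delta>) \<le> 0" by blast
    qed (use ne in auto)
  qed
  then have c0: "coef v \<epsilon> \<ge> 0" if "\<epsilon> \<in> \<Delta>" for \<epsilon> using that by force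
  show ?thesis
  proof (rule ccontr)
    assume "\<not> coef v \<delta> > 0"
    then have "coef v \<delta> = 0" using c0[OF d] by simp
    let ?Z = "{\<epsilon>\<in>\<Delta>. coef v \<epsilon> = 0}"
    have "?Z = \<Delta>"
    proof (rule connected_closed)
      show "?Z \<noteq> {}" using d \<open>coef v \<delta> = 0\<close> by auto
      fix x y assume x: "x \<in> ?Z" and y: "y \<in> \<Delta>" "cp x y \<noteq> 0"
      have np: "coef v \<epsilon> * cp \<epsilon> x \<le> 0" if "\<epsilon> \<in> \<Delta>" for \<epsilon>
      proof (cases "\<epsilon> = x")
        case False
        then have "cp \<epsilon> x \<le> 0" using that x by (intro simple_cp_nonpos) auto
        then show ?thesis using c0[OF that] by (simp add: mult_nonneg_nonpos)
      qed (use x in simp)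
      have "(\<Sum>\<epsilon>\<in>\<Delta>. coef v \<epsilon> * cp \<epsilon> x) \<le> 0" by (rule sum_nonpos) (rule np)
      then have "(\<Sum>\<epsilon>\<in>\<Delta>. - (coef v \<epsilon> * cp \<epsilon> x)) = 0" using dom[of x] x pair_coef[OF v(1)] by (simp add: sum_negf)
      then have "\<forall>\<epsilon>\<in>\<Delta>. - (coef v \<epsilon> * cp \<epsilon> x) = 0"
        by (subst (asm) sum_nonneg_eq_0_iff) (use np in auto)
      then have "coef v y * cp y x = 0" using y(1) by simp
      then show "y \<in> ?Z" using y x simple_cp_zero_iff[of x y] by auto
    qed auto
    then have "v = 0" using coef_eqI[OF v(1) zmod.span_zero] by (auto simp: coef_simps(5))
    then show False using v(2) by blast
  qed
qed

lemma sum_two_cases: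
  fixes d :: "'a \<Rightarrow> int"
  assumes E: "finite E" "\<And>u. u \<in> E \<Longrightarrow> d u \<ge> 1" "(\<Sum>u\<in>E. d u) = 2"
  shows "(\<exists>u. E = {u} \<and> d u = 2) \<or> (\<exists>u w. u \<noteq> w \<and> E = {u, w} \<and> d u = 1 \<and> d w = 1)"
proof -
  have "int (card E) = (\<Sum>u\<in>E. 1)" by simp
  also have "\<dots> \<le> (\<Sum>u\<in>E. d u)" by (rule sum_mono) (rule E(2))
  finally have "card E \<le> 2" using E(3) by simp
  moreover have "E \<noteq> {}" using E(3) by auto
  ultimately have "card E = 1 \<or> card E = 2" using E(1) by (metis One_nat_def card_gt_0_iff le_Suc_eq le_zero_eq numeral_2_eq_2 not_less_zero)
  then show ?thesis
  proof
    assume "card E = 1"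
    then obtain u where "E = {u}" by (auto simp: card_1_singleton_iff)
    then show ?thesis using E(3) by auto
  next
    assume "card E = 2"
    then obtain u w where uw: "E = {u, w}" "u \<noteq> w" by (auto simp: card_2_iff)
    then have "d u + d w = 2" "d u \<ge> 1" "d w \<ge> 1" using E by auto
    then have "d u = 1" "d w = 1" by linarith+
    then show ?thesis using uw by blast
  qed
qed

text \<open>The path followed by its two exits is Bourbaki's labelling of \<open>D\<^sub>n\<close>. By the assumptions on \<open>u\<close> and \<open>w\<close>
  the exits are terminal nodes, so that nothing else belongs to the connected diagram.\<close>

lemma fork_labelling:
  assumes sl: simply_laced and path: "linear_path q t" and ex: "exits q t = {u, w}" "u \<noteq> w"
    and tu: "\<And>\<beta>. \<beta> \<in> \<Delta> \<Longrightarrow> cp u \<beta> \<noteq> 0 \<Longrightarrow> \<beta> = u \<or> \<beta> = q t"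
    and tw: "\<And>\<beta>. \<beta> \<in> \<Delta> \<Longrightarrow> cp w \<beta> \<noteq> 0 \<Longrightarrow> \<beta> = w \<or> \<beta> = q t"
  shows "n = t + 2" "bourbaki_labelling R \<Delta> (DynD n) (\<lambda>s. if s \<le> t then q s else if s = t + 1 then u else w)"
proof -
  let ?l = "\<lambda>s. if s \<le> t then q s else if s = t + 1 then u else w"
  have ue: "u \<in> exits q t" "w \<in> exits q t" using ex by auto
  have uD: "u \<in> \<Delta>" "w \<in> \<Delta>" using exits_simple[OF path] ue by blast+
  have t1: "1 \<le> t" using path_pos[OF path] .
  note new = exits_new[OF path ue(1)] exits_new[OF path ue(2)]
  have "q ` {1..t} \<union> {u, w} = \<Delta>"
  proof (rule connected_closed)
    show "q ` {1..t} \<union> {u, w} \<subseteq> \<Delta>" using path_sub[OF path] uD by auto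
    fix \<alpha> \<beta> assume ab: "\<alpha> \<in> q ` {1..t} \<union> {u, w}" "\<beta> \<in> \<Delta>" "cp \<alpha> \<beta> \<noteq> 0"
    have qt: "q t \<in> q ` {1..t}" using t1 by auto
    consider "\<alpha> = u" | "\<alpha> = w" | s where "1 \<le> s" "s \<le> t" "\<alpha> = q s" using ab(1) by auto
    then show "\<beta> \<in> q ` {1..t} \<union> {u, w}"
    proof cases
      case 1 then show ?thesis using tu[OF ab(2)] ab(3) qt by blast
    next
      case 2 then show ?thesis using tw[OF ab(2)] ab(3) qt by blast
    next
      case 3
      show ?thesis
      proof (cases "s = t")
        case True
        have "cp (q t) \<beta> \<noteq> 0" using ab(3) 3 True by simp
        then have "\<beta> \<in> exits q t \<or> \<beta> = q t \<or> 1 < t \<and> \<beta> = q (t - 1)"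
          using ab(2) unfolding exits_def by blast
        then have "\<beta> \<in> {u, w} \<or> \<beta> = q t \<or> 1 < t \<and> \<beta> = q (t - 1)" unfolding ex(1) .
        moreover have "1 < t \<Longrightarrow> q (t - 1) \<in> q ` {1..t}" by auto
        ultimately show ?thesis using qt by blast
      next
        case False
        then have st: "s < t" using 3 by simp
        have "s \<in> {1..t}" "Suc s \<in> {1..t}" "1 < s \<Longrightarrow> s - 1 \<in> {1..t}" using 3 st by auto
        then have m: "q s \<in> q ` {1..t}" "q (Suc s) \<in> q ` {1..t}" "1 < s \<Longrightarrow> q (s - 1) \<in> q ` {1..t}"
          by (blast intro: imageI)+
        have "cp (q s) \<beta> \<noteq> 0" using ab(3) 3(3) by simp
        from path_closed[OF path 3(1) st ab(2) this] have "\<beta> \<in> q ` {1..t}"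
        proof (elim disjE conjE)
          assume "\<beta> = q s" then show ?thesis using m(1) by (simp only:)
        next
          assume "\<beta> = q (Suc s)" then show ?thesis using m(2) by (simp only:)
        next
          assume "1 < s" "\<beta> = q (s - 1)" then show ?thesis using m(3) by (simp only:)
        qed
        then show ?thesis by (rule UnI1)
      qed
    qed
  qed auto
  note D = this
  have disj: "q ` {1..t} \<inter> {u, w} = {}"
  proof -
    have "u \<noteq> q s" "w \<noteq> q s" if "s \<in> {1..t}" for s using new(1)[of s] new(2)[of s] that by simp_all
    then show ?thesis by blast
  qed
  have "card (q ` {1..t} \<union> {u, w}) = t + 2"
    using disj ex(2) card_image[OF path_inj_on[OF path]] by (subst card_Un_disjoint) auto
  then show nt: "n = t + 2" using D card_simple by simp
  have interval: "{1..t + 2} = {1..t} \<union> {t + 1, t + 2}" by auto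
  have im1: "?l ` {1..t} = q ` {1..t}" by auto
  have im2: "?l ` {t + 1, t + 2} = {u, w}" by auto
  have im: "?l ` {1..t + 2} = \<Delta>" unfolding interval image_Un im1 im2 by (rule D)
  have bij: "bij_betw ?l {1..n} \<Delta>"
    unfolding nt bij_betw_def using im card_simple nt by (intro conjI eq_card_imp_inj_on) simp_all
  have sym: "cp x y = cp y x" if "x \<in> \<Delta>" "y \<in> \<Delta>" for x y using simply_laced_cp(1)[OF sl] that by simp
  have m1: "cp x y = - 1" if "x \<in> \<Delta>" "y \<in> \<Delta>" "x \<noteq> y" "cp x y \<noteq> 0" for x y
    using sl that unfolding simply_laced_def by blast
  have lD: "?l i \<in> \<Delta>" if "i \<in> {1..n}" for i
    using bij_betwE[OF bij] that by (rule bspec)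
  have off: "cp (?l i) (?l j) = cartan_off (DynD n) i j" if ij: "1 \<le> i" "i < j" "j \<le> n" for i j
  proof -
    have "j \<le> t \<and> j = i + 1 \<or> j \<le> t \<and> i + 1 < j \<or> j = t + 1 \<and> i < t \<or> j = t + 1 \<and> i = t
      \<or> j = t + 2 \<and> i < t \<or> j = t + 2 \<and> i = t \<or> j = t + 2 \<and> i = t + 1"
    proof -
      consider "j \<le> t" | "j = t + 1" | "j = t + 2" using ij nt by linarith
      then show ?thesis
      proof cases
        case 1
        have "j = i + 1 \<or> i + 1 < j" using ij by linarith
        then show ?thesis using 1 by blast
      next
        case 2
        have "i < t \<or> i = t" using ij 2 by linarith
        then show ?thesis using 2 by blast
      next
        case 3
        have "i < t \<or> i = t \<or> i = t + 1" using ij 3 by linarith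
        then show ?thesis using 3 by blast
      qed
    qed
    then consider "j \<le> t" "j = i + 1" | "j \<le> t" "i + 1 < j" | "j = t + 1" "i < t" | "j = t + 1" "i = t"
      | "j = t + 2" "i < t" | "j = t + 2" "i = t" | "j = t + 2" "i = t + 1" by blast
    then show ?thesis
    proof cases
      case 1
      have e: "cp (q i) (q (Suc i)) \<noteq> 0" using ij 1 by (intro path_edge[OF path]) auto
      have "q i \<in> \<Delta>" "q (Suc i) \<in> \<Delta>" using ij 1 by (intro path_simple[OF path]; simp)+
      moreover have "q i \<noteq> q (Suc i)" using path_inj[OF path, of i "Suc i"] ij 1 by simp
      ultimately have "cp (q i) (q (Suc i)) = - 1" using e by (rule m1)
      then show ?thesis using 1 nt by (simp add: chain_def)
    next
      case 2
      then have "cp (q i) (q j) = 0" using ij by (intro path_zero[OF path]) auto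
      then show ?thesis using 2 nt by (simp add: chain_def)
    next
      case 3
      have "cp (q i) u = 0"
      proof (rule ccontr)
        assume "cp (q i) u \<noteq> 0"
        then have "u = q i \<or> u = q (Suc i) \<or> 1 < i \<and> u = q (i - 1)"
          using path_closed[OF path ij(1) 3(2) uD(1)] by blast
        moreover have "u \<noteq> q i" "u \<noteq> q (Suc i)" "1 < i \<Longrightarrow> u \<noteq> q (i - 1)" using ij 3 by (intro new(1); simp)+
        ultimately show False by blast
      qed
      then show ?thesis using 3 nt by (simp add: chain_def)
    next
      case 4
      have "q t \<in> \<Delta>" using t1 by (intro path_simple[OF path]) simp_all
      moreover have "q t \<noteq> u" using new(1)[of t] t1 by auto
      moreover have "cp (q t) u \<noteq> 0" using exits_cp(1)[OF path ue(1)] by simp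
      ultimately have "cp (q t) u = - 1" using uD by (intro m1) simp_all
      then show ?thesis using 4 nt by (simp add: chain_def)
    next
      case 5
      have "cp (q i) w = 0"
      proof (rule ccontr)
        assume "cp (q i) w \<noteq> 0"
        then have "w = q i \<or> w = q (Suc i) \<or> 1 < i \<and> w = q (i - 1)"
          using path_closed[OF path ij(1) 5(2) uD(2)] by blast
        moreover have "w \<noteq> q i" "w \<noteq> q (Suc i)" "1 < i \<Longrightarrow> w \<noteq> q (i - 1)" using ij 5 by (intro new(2); simp)+
        ultimately show False by blast
      qed
      then show ?thesis using 5 nt by (simp add: chain_def)
    next
      case 6
      have "q t \<in> \<Delta>" using t1 by (intro path_simple[OF path]) simp_all
      moreover have "q t \<noteq> w" using new(2)[of t] t1 by auto
      moreover have "cp (q t) w \<noteq> 0" using exits_cp(1)[OF path ue(2)] by simp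
      ultimately have "cp (q t) w = - 1" using uD by (intro m1) simp_all
      then show ?thesis using 6 nt by (simp add: chain_def)
    next
      case 7
      have "cp u w = 0" using tu[OF uD(2)] ex(2) new(2)[of t] t1 by auto
      then show ?thesis using 7 nt by (simp add: chain_def)
    qed
  qed
  have csym: "cartan_off (DynD n) i j = cartan_off (DynD n) j i" for i j by (auto simp: chain_def)
  have "cp (?l i) (?l j) = (if i = j then 2 else cartan_off (DynD n) i j)" if ij: "i \<in> {1..n}" "j \<in> {1..n}" for i j
  proof -
    consider "i = j" | "i < j" | "j < i" by linarith
    then show ?thesis
    proof cases
      case 1
      have "cp (?l i) (?l i) = 2" using lD[OF ij(1)] by (intro cp_self simple_root)
      then show ?thesis using 1 by (simp only: simp_thms if_True)
    next
      case 2 then show ?thesis using off[of i j] ij by simp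
    next
      case 3
      then have "cp (?l j) (?l i) = cartan_off (DynD n) j i" using off[of j i] ij by simp
      then show ?thesis using 3 sym[OF lD[OF ij(1)] lD[OF ij(2)]] csym[of i j] by simp
    qed
  qed
  then show "bourbaki_labelling R \<Delta> (DynD n) ?l"
    unfolding bourbaki_labelling_def dynkin_rank.simps using bij by blast
qed

text \<open>Among all coincidences take one for which the height of \<open>v = \<alpha> + \<beta> = 2x\<close> is maximal. Simple reflections
  lead to other coincidences and do not increase the height, so \<open>x\<close> is dominant. Let \<open>d\<close> be
  the coefficients of \<open>v\<close>, which are positive, and \<open>m\<close> the pairings of \<open>x\<close> with the simple coroots.
  In a simply laced datum \<open>2 d = 2 m + \<Sum> d\<close> at each node, where the sum is over its neighbours
  (\<open>harm\<close>). As \<open>\<alpha>\<close> and \<open>\<beta>\<close> are orthogonal, the length of \<open>v\<close> yields \<open>\<Sum> d m = 2\<close> (\<open>dm\<close>). It follows that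
  \<open>m\<close> is 1 at a single node \<open>k\<close>, where \<open>d\<close> is 2, and 0 elsewhere. Starting from \<open>k\<close>, the equation lets
  \<open>d\<close> stay equal to 2 along a path without branches until it splits into \<open>1 + 1\<close>, and nodes with \<open>d = 1\<close>
  are terminal. This is the diagram \<open>D\<^sub>n\<close>, with \<open>D\<^sub>3 = A\<^sub>3\<close>, and \<open>x\<close> is its first fundamental weight.\<close>

lemma coincidence_D:
  assumes sl: simply_laced and ab0: "\<alpha>\<^sub>0 \<in> \<Phi>" "\<beta>\<^sub>0 \<in> \<Phi>" "congr 2 \<alpha>\<^sub>0 \<beta>\<^sub>0" "\<beta>\<^sub>0 \<noteq> \<alpha>\<^sub>0" "\<beta>\<^sub>0 \<noteq> - \<alpha>\<^sub>0"
  obtains l \<omega> where "3 \<le> n" "bourbaki_labelling R \<Delta> (DynD n) l"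
    "\<And>j. j \<in> {1..n} \<Longrightarrow> cp \<omega> (l j) = (if j = 1 then 1 else 0)"
proof -
  define C where "C = {(\<alpha>, \<beta>) \<in> \<Phi> \<times> \<Phi>. congr 2 \<alpha> \<beta> \<and> \<beta> \<noteq> \<alpha> \<and> \<beta> \<noteq> - \<alpha>}"
  have "C \<subseteq> \<Phi> \<times> \<Phi>" by (auto simp: C_def)
  then have fC: "finite C" by (rule finite_subset) simp
  have neC: "C \<noteq> {}" using ab0 by (auto simp: C_def)
  let ?h = "\<lambda>p. height (fst p) + height (snd p)"
  have "Max (?h ` C) \<in> ?h ` C" using fC neC by (intro Max_in) auto
  then obtain p where p: "p \<in> C" "?h p = Max (?h ` C)" by auto
  obtain \<alpha> \<beta> where pab: "p = (\<alpha>, \<beta>)" by fastforce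
  have a: "\<alpha> \<in> \<Phi>" and b: "\<beta> \<in> \<Phi>" and c: "congr 2 \<alpha> \<beta>" and ne: "\<beta> \<noteq> \<alpha>" "\<beta> \<noteq> - \<alpha>"
    using p pab by (auto simp: C_def)
  have mx: "height \<alpha>' + height \<beta>' \<le> height \<alpha> + height \<beta>" if "(\<alpha>', \<beta>') \<in> C" for \<alpha>' \<beta>'
  proof -
    have "?h (\<alpha>', \<beta>') \<le> Max (?h ` C)" using imageI[OF that, of ?h] fC by (intro Max_ge) simp_all
    then show ?thesis using p(2) pab by simp
  qed
  define v where "v = \<alpha> + \<beta>"
  define d where "d = coef v"
  have Q: "\<alpha> \<in> QL" "\<beta> \<in> QL" "v \<in> QL" unfolding v_def
    by (rule root_in_QL[OF a] root_in_QL[OF b] zmod.span_add[OF root_in_QL[OF a] root_in_QL[OF b]])+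
  have dom: "cp v \<delta> \<ge> 0" if "\<delta> \<in> \<Delta>" for \<delta>
  proof -
    have r: "\<delta> \<in> \<Phi>" using that by simp
    have "(refl \<delta> \<alpha>, refl \<delta> \<beta>) \<in> C"
      unfolding C_def using refl_root[OF r a] refl_root[OF r b] congr_reflect[OF c, of \<delta>] ne
      by (auto, metis refl_refl r, metis refl_refl r refl_simps(3))
    from mx[OF this] show ?thesis
      using height_refl[OF Q(1) that] height_refl[OF Q(2) that] by (simp add: v_def)
  qed
  have v0: "v \<noteq> 0" using ne(2) by (auto simp: v_def eq_neg_iff_add_eq_0 add.commute)
  have dpos: "d \<delta> \<ge> 1" if "\<delta> \<in> \<Delta>" for \<delta>
    using dominant_coef_pos[OF Q(3) v0 dom that] by (simp add: d_def)
  obtain z where z: "\<alpha> - \<beta> = zmult 2 z" using c unfolding congr_def by blast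
  \<comment> \<open>\<open>\<alpha> + \<beta> = (\<alpha> - \<beta>) + 2 \<beta>\<close>\<close>
  define x where "x = z + \<beta>"
  have vx: "v = zmult 2 x" unfolding x_def zmod.scale_right_distrib z[symmetric] v_def by (simp add: zmult_two)
  define m where "m \<delta> = cp x \<delta>" for \<delta>
  have cpm: "cp v \<delta> = 2 * m \<delta>" for \<delta> unfolding vx m_def by simp
  have m0: "m \<delta> \<ge> 0" if "\<delta> \<in> \<Delta>" for \<delta> using dom[OF that] cpm[of \<delta>] by simp
  define nb where "nb \<delta> = {\<epsilon>\<in>\<Delta>. \<epsilon> \<noteq> \<delta> \<and> cp \<delta> \<epsilon> \<noteq> 0}" for \<delta>
  have fnb: "finite (nb \<delta>)" for \<delta> by (simp add: nb_def)
  have harm: "2 * d \<delta> = 2 * m \<delta> + (\<Sum>\<epsilon>\<in>nb \<delta>. d \<epsilon>)" if dl: "\<delta> \<in> \<Delta>" for \<delta>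
  proof -
    have "2 * m \<delta> = (\<Sum>\<epsilon>\<in>\<Delta>. d \<epsilon> * cp \<epsilon> \<delta>)" unfolding cpm[symmetric] d_def by (rule pair_coef[OF Q(3)])
    also have "\<dots> = 2 * d \<delta> + (\<Sum>\<epsilon>\<in>\<Delta> - {\<delta>}. d \<epsilon> * cp \<epsilon> \<delta>)"
      unfolding sum.remove[OF finite_simple dl] using dl by simp
    also have "(\<Sum>\<epsilon>\<in>\<Delta> - {\<delta>}. d \<epsilon> * cp \<epsilon> \<delta>) = (\<Sum>\<epsilon>\<in>nb \<delta>. d \<epsilon> * cp \<epsilon> \<delta>)"
    proof (rule sum.mono_neutral_right)
      show "nb \<delta> \<subseteq> \<Delta> - {\<delta>}" by (auto simp: nb_def)
      show "\<forall>\<epsilon>\<in>\<Delta> - {\<delta>} - nb \<delta>. d \<epsilon> * cp \<epsilon> \<delta> = 0"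
        using simple_cp_zero_iff[OF dl] by (auto simp: nb_def)
    qed simp
    also have "\<dots> = (\<Sum>\<epsilon>\<in>nb \<delta>. - d \<epsilon>)"
    proof (rule sum.cong)
      fix \<epsilon> assume e: "\<epsilon> \<in> nb \<delta>"
      then have "cp \<epsilon> \<delta> \<noteq> 0" "\<epsilon> \<in> \<Delta>" "\<epsilon> \<noteq> \<delta>" using simple_cp_zero_iff[OF dl, of \<epsilon>] by (auto simp: nb_def)
      then have "cp \<epsilon> \<delta> = - 1" using sl dl unfolding simply_laced_def by blast
      then show "d \<epsilon> * cp \<epsilon> \<delta> = - d \<epsilon>" by simp
    qed simp
    finally show ?thesis by (simp add: sum_negf)
  qed
  have dm: "(\<Sum>\<delta>\<in>\<Delta>. d \<delta> * m \<delta>) = 2"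
  proof -
    define N where "N = frm \<alpha> \<alpha>"
    have N: "N > 0" "frm \<gamma> \<gamma> = N" if "\<gamma> \<in> \<Phi>" for \<gamma>
      using frm_pos[OF a] simply_laced_length[OF sl that a] by (auto simp: N_def)
    have "cp \<alpha> \<beta> = 0" by (rule congr_two_orthogonal[OF a b c ne])
    then have "frm \<alpha> \<beta> = 0" using frm_root[OF b, of \<alpha>] by simp
    then have "frm v v = 2 * N" unfolding v_def using N(2)[OF a] N(2)[OF b] frm_commute[of \<beta> \<alpha>] by simp
    moreover have "frm v v = (\<Sum>\<delta>\<in>\<Delta>. d \<delta> * frm v \<delta>)" unfolding d_def by (rule frm_coef[OF Q(3)])
    moreover have "(\<Sum>\<delta>\<in>\<Delta>. d \<delta> * frm v \<delta>) = (\<Sum>\<delta>\<in>\<Delta>. (d \<delta> * m \<delta>) * N)"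
    proof (rule sum.cong)
      fix \<delta> assume "\<delta> \<in> \<Delta>"
      then have "2 * frm v \<delta> = 2 * m \<delta> * N" using frm_root[of \<delta> v] N(2)[of \<delta>] cpm by simp
      then show "d \<delta> * frm v \<delta> = (d \<delta> * m \<delta>) * N" by simp
    qed simp
    ultimately have "2 * N = (\<Sum>\<delta>\<in>\<Delta>. d \<delta> * m \<delta>) * N" by (simp add: sum_distrib_right)
    then show ?thesis using N(1)[OF a] by simp
  qed
  have t0: "d \<delta> * m \<delta> \<ge> 0" if "\<delta> \<in> \<Delta>" for \<delta> using dpos[OF that] m0[OF that] by simp
  have "\<exists>k\<in>\<Delta>. d k * m k \<noteq> 0" using dm by (metis (no_types, lifting) sum.neutral zero_neq_numeral)
  then obtain k where k: "k \<in> \<Delta>" "d k * m k \<noteq> 0" by blast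
  have rest: "2 = d k * m k + (\<Sum>\<delta>\<in>\<Delta> - {k}. d \<delta> * m \<delta>)"
    using sum.remove[OF finite_simple k(1), of "\<lambda>\<delta>. d \<delta> * m \<delta>"] dm by simp
  have r0: "(\<Sum>\<delta>\<in>\<Delta> - {k}. d \<delta> * m \<delta>) \<ge> 0" by (rule sum_nonneg) (use t0 in auto)
  have mk: "m k \<ge> 1" using m0[OF k(1)] k(2) by (cases "m k = 0") auto
  \<comment> \<open>With \<open>d k = 1\<close> the node \<open>k\<close> would have no neighbours, and rank 1 contradicts the length of \<open>v\<close>.\<close>
  have dk: "d k \<noteq> 1"
  proof
    assume d1: "d k = 1"
    have "(\<Sum>\<epsilon>\<in>nb k. d \<epsilon>) \<le> 0" using harm[OF k(1)] d1 mk by simp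
    have "nb k = {}"
    proof (rule ccontr)
      assume "nb k \<noteq> {}"
      then obtain e where e: "e \<in> nb k" by blast
      have "d e \<le> (\<Sum>\<epsilon>\<in>nb k. d \<epsilon>)"
        by (rule member_le_sum[OF e _ fnb]) (use dpos in \<open>force simp: nb_def\<close>)
      moreover have "d e \<ge> 1" using e dpos by (auto simp: nb_def)
      ultimately show False using \<open>(\<Sum>\<epsilon>\<in>nb k. d \<epsilon>) \<le> 0\<close> by simp
    qed
    then have "{k} = \<Delta>" by (intro connected_closed) (use k in \<open>auto simp: nb_def\<close>)
    then have "m k = 2" using rest d1 by auto
    then show False using harm[OF k(1)] d1 \<open>nb k = {}\<close> by simp
  qed
  have dk2: "d k \<ge> 2" using dpos[OF k(1)] dk by simp
  have "d k * m k \<le> 2" using rest r0 by simp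
  moreover have "d k * m k \<ge> d k * 1" by (rule mult_left_mono) (use mk dk2 in auto)
  moreover have "d k * m k \<ge> 2 * m k" by (rule mult_right_mono) (use mk dk2 in auto)
  ultimately have kk: "d k = 2" "m k = 1" using mk dk2 by linarith+
  have m_other: "m \<delta> = 0" if "\<delta> \<in> \<Delta>" "\<delta> \<noteq> k" for \<delta>
  proof -
    have "(\<Sum>\<delta>\<in>\<Delta> - {k}. d \<delta> * m \<delta>) = 0" using rest kk by simp
    then have "\<forall>\<delta>\<in>\<Delta> - {k}. d \<delta> * m \<delta> = 0" by (subst (asm) sum_nonneg_eq_0_iff) (use t0 in auto)
    then have "d \<delta> * m \<delta> = 0" using that by blast
    then show ?thesis using dpos[OF that(1)] by auto
  qed
  define P where "P q t \<longleftrightarrow> linear_path q t \<and> q 1 = k \<and> (\<forall>s. 1 \<le> s \<and> s \<le> t \<longrightarrow> d (q s) = 2)" for q t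
  have "P (\<lambda>_. k) 1" using k kk by (auto simp: P_def linear_path_def)
  then obtain q t where P: "P q t" and mxp: "\<And>q'. \<not> P q' (Suc t)"
    using maximal_path[of P "\<lambda>_. k" 1] unfolding P_def by blast
  have path: "linear_path q t" and q1: "q 1 = k" and dq: "\<And>s. 1 \<le> s \<Longrightarrow> s \<le> t \<Longrightarrow> d (q s) = 2"
    using P by (auto simp: P_def)
  have t1: "1 \<le> t" using path_pos[OF path] .
  have qtD: "q t \<in> \<Delta>" using path_simple[OF path] t1 by auto
  have ex_sub: "exits q t \<subseteq> nb (q t)" by (auto simp: exits_def nb_def)
  \<comment> \<open>At \<open>k\<close> the term \<open>2 m\<close> plays the part of a predecessor with \<open>d = 2\<close>.\<close>
  have ex2: "(\<Sum>u\<in>exits q t. d u) = 2"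
  proof (cases "t = 1")
    case True
    then have "exits q t = nb (q t)" by (auto simp: exits_def nb_def)
    then show ?thesis using harm[OF qtD] True q1 kk by simp
  next
    case False
    have pr: "q (t - 1) \<in> nb (q t)" "q (t - 1) \<notin> exits q t"
    proof -
      have "Suc (t - 1) = t" using t1 False by simp
      then have e: "cp (q (t - 1)) (q t) \<noteq> 0" using path_edge[OF path, of "t - 1"] t1 False by simp
      have D': "q (t - 1) \<in> \<Delta>" using path_simple[OF path, of "t - 1"] t1 False by auto
      have "q (t - 1) \<noteq> q t" using path_inj[OF path, of "t - 1" t] t1 False by auto
      then show "q (t - 1) \<in> nb (q t)" using e D' simple_cp_zero_iff[OF D' qtD] by (auto simp: nb_def)
      show "q (t - 1) \<notin> exits q t" using t1 False by (auto simp: exits_def)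
    qed
    have "nb (q t) = insert (q (t - 1)) (exits q t)" using pr by (auto simp: exits_def nb_def)
    then have "(\<Sum>\<epsilon>\<in>nb (q t). d \<epsilon>) = d (q (t - 1)) + (\<Sum>u\<in>exits q t. d u)"
      using pr finite_exits[OF path] by simp
    moreover have "d (q (t - 1)) = 2" "d (q t) = 2" using dq t1 False by auto
    moreover have "q t \<noteq> k" using path_inj[OF path, of t 1] q1 t1 False by auto
    ultimately show ?thesis using harm[OF qtD] m_other[OF qtD] by simp
  qed
  from sum_two_cases[OF finite_exits[OF path] _ ex2] dpos exits_simple[OF path]
  have "(\<exists>u. exits q t = {u} \<and> d u = 2) \<or> (\<exists>u w. u \<noteq> w \<and> exits q t = {u, w} \<and> d u = 1 \<and> d w = 1)" by blast
  then show thesis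
  proof (elim disjE exE conjE)
    fix u assume u: "exits q t = {u}" "d u = 2"
    have "P (q(Suc t := u)) (Suc t)"
      unfolding P_def using path_extend[OF path u(1)] q1 dq u(2) t1 by (auto simp: le_Suc_eq)
    then show thesis using mxp by blast
  next
    fix u w assume uw: "u \<noteq> w" "exits q t = {u, w}" "d u = 1" "d w = 1"
    have terminal: "\<beta> = y \<or> \<beta> = q t" if y: "y \<in> exits q t" "d y = 1" and b: "\<beta> \<in> \<Delta>" "cp y \<beta> \<noteq> 0" for y \<beta>
    proof (rule ccontr)
      assume nb': "\<not> ?thesis"
      have yD: "y \<in> \<Delta>" using exits_simple[OF path] y by blast
      have yk: "y \<noteq> k" using exits_new[OF path y(1), of 1] q1 t1 by auto
      have "q t \<in> nb y" using exits_cp[OF path y(1)] exits_new[OF path y(1), of t] t1 qtD by (auto simp: nb_def)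
      moreover have "\<beta> \<in> nb y" using b nb' by (auto simp: nb_def)
      ultimately have "{q t, \<beta>} \<subseteq> nb y" by blast
      then have "(\<Sum>\<epsilon>\<in>{q t, \<beta>}. d \<epsilon>) \<le> (\<Sum>\<epsilon>\<in>nb y. d \<epsilon>)"
        by (rule sum_mono2[OF fnb]) (use dpos in \<open>force simp: nb_def\<close>)
      moreover have "(\<Sum>\<epsilon>\<in>{q t, \<beta>}. d \<epsilon>) = 2 + d \<beta>" using nb' dq[of t] t1 by auto
      ultimately show False using harm[OF yD] y(2) m_other[OF yD yk] dpos[OF b(1)] by simp
    qed
    let ?l = "\<lambda>s. if s \<le> t then q s else if s = t + 1 then u else w"
    have nt: "n = t + 2" and lab: "bourbaki_labelling R \<Delta> (DynD n) ?l"
      using fork_labelling[OF sl path uw(2,1)] terminal[of u] terminal[of w] uw by auto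
    show thesis
    proof (rule that)
      show "3 \<le> n" using nt t1 by simp
      show "bourbaki_labelling R \<Delta> (DynD n) ?l" by (rule lab)
      fix j assume j: "j \<in> {1..n}"
      have bij: "bij_betw ?l {1..n} \<Delta>" using lab unfolding bourbaki_labelling_def by simp
      have lj: "?l j \<in> \<Delta>" using bij_betwE[OF bij] j by (rule bspec)
      have l1: "?l 1 = k" using q1 t1 by simp
      show "cp x (?l j) = (if j = 1 then 1 else 0)"
      proof (cases "j = 1")
        case True
        then have "?l j = k" using l1 by (simp only:)
        then show ?thesis using True kk by (simp only: m_def if_True simp_thms)
      next
        case False
        have "inj_on ?l {1..n}" using bij by (rule bij_betw_imp_inj_on)
        then have "?l j \<noteq> ?l 1" using inj_on_eq_iff[of ?l "{1..n}" j 1] j False nt by auto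
        then show ?thesis using m_other[OF lj] l1 False by (simp add: m_def)
      qed
    qed
  qed
qed

end

section \<open>Coordinates for the classical types\<close>

text \<open>Types \<open>B\<close>, \<open>C\<close> and \<open>D\<close> are treated together. The element \<open>y k\<close> measures the \<open>k\<close>-th coordinate with respect
  to the standard basis \<open>\<epsilon>\<^sub>1, \<dots>, \<epsilon>\<^sub>n\<close>, multiplied by \<open>\<sigma>\<close>. In types \<open>B\<close> and \<open>D\<close>, where \<open>X\<close> can contain
  half-integral vectors, \<open>\<sigma> = 2\<close>; in type \<open>C\<close> it is 1. The simple roots are \<open>\<epsilon>\<^sub>i - \<epsilon>\<^sub>i\<^sub>+\<^sub>1\<close> for \<open>i < n\<close> and the last one,
  which is \<open>\<epsilon>\<^sub>n\<^sub>-\<^sub>1 + \<epsilon>\<^sub>n\<close> in type \<open>D\<close> (\<open>forked\<close>), \<open>\<epsilon>\<^sub>n\<close> in type \<open>B\<close> and \<open>2 \<epsilon>\<^sub>n\<close> in type \<open>C\<close>.\<close>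

locale coordinates = irreducible_datum R \<Delta> n
  for R :: "('x::ab_group_add, 'y::ab_group_add) root_data" and \<Delta> n +
  fixes l :: "nat \<Rightarrow> 'x" and y :: "nat \<Rightarrow> 'y" and \<sigma> :: int and forked :: bool
  assumes bij: "bij_betw l {1..n} \<Delta>" and n2: "2 \<le> n" and sigma: "\<sigma> = 1 \<or> \<sigma> = 2"
    and step: "1 \<le> k \<Longrightarrow> k < n \<Longrightarrow> y k = y (Suc k) + zmult \<sigma> (coroot R (l k))"
    and chain_coord: "1 \<le> i \<Longrightarrow> i < n \<Longrightarrow> 1 \<le> k \<Longrightarrow> k \<le> n \<Longrightarrow>
      pair R (l i) (y k) = (if k = i then \<sigma> else if k = Suc i then - \<sigma> else 0)"
    and last_forked: "forked \<Longrightarrow> \<sigma> = 2 \<and> 3 \<le> n \<and> y (n - 1) + y n = zmult 2 (coroot R (l n)) \<and>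
      (\<forall>k\<in>{1..n}. pair R (l n) (y k) = (if k = n \<or> k = n - 1 then 2 else 0))"
    and last_unforked: "\<not> forked \<Longrightarrow> y n = coroot R (l n) \<and>
      (\<forall>k\<in>{1..n}. pair R (l n) (y k) = (if k = n then 2 else 0))"
begin

definition \<theta> where "\<theta> k x = pair R x (y k)"

lemma theta_simps [simp]:
  "\<theta> k (a + b) = \<theta> k a + \<theta> k b" "\<theta> k (a - b) = \<theta> k a - \<theta> k b" "\<theta> k (- a) = - \<theta> k a"
  "\<theta> k (zmult c a) = c * \<theta> k a" "\<theta> k 0 = 0" "\<theta> k (sum f A) = (\<Sum>i\<in>A. \<theta> k (f i))"
  by (simp_all add: \<theta>_def)

lemma l_simple: "1 \<le> i \<Longrightarrow> i \<le> n \<Longrightarrow> l i \<in> \<Delta>"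
  using bij_betwE[OF bij] by simp

lemma l_surj: assumes "\<delta> \<in> \<Delta>" obtains i where "1 \<le> i" "i \<le> n" "\<delta> = l i"
proof -
  have "\<delta> \<in> l ` {1..n}" using bij assms by (simp add: bij_betw_def)
  then show thesis using that by auto
qed

lemma theta_chain: "1 \<le> i \<Longrightarrow> i < n \<Longrightarrow> 1 \<le> k \<Longrightarrow> k \<le> n \<Longrightarrow>
    \<theta> k (l i) = (if k = i then \<sigma> else if k = Suc i then - \<sigma> else 0)"
  unfolding \<theta>_def by (rule chain_coord)

lemma theta_last: "1 \<le> k \<Longrightarrow> k \<le> n \<Longrightarrow> \<theta> k (l n) = (if k = n \<or> forked \<and> k = n - 1 then 2 else 0)"
  unfolding \<theta>_def using last_forked last_unforked by (cases forked) auto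

lemma cp_chain: "1 \<le> k \<Longrightarrow> k < n \<Longrightarrow> \<sigma> * cp x (l k) = \<theta> k x - \<theta> (Suc k) x"
  unfolding \<theta>_def by (simp add: step)

lemma cp_last_unforked: "\<not> forked \<Longrightarrow> cp x (l n) = \<theta> n x"
  unfolding \<theta>_def using last_unforked by simp

lemma cp_last_forked: "forked \<Longrightarrow> 2 * cp x (l n) = \<theta> (n - 1) x + \<theta> n x"
proof -
  assume f: forked
  have "pair R x (y (n - 1) + y n) = pair R x (zmult 2 (coroot R (l n)))" using last_forked[OF f] by simp
  then show ?thesis by (simp add: \<theta>_def)
qed

lemma theta_inj: assumes "\<And>k. 1 \<le> k \<Longrightarrow> k \<le> n \<Longrightarrow> \<theta> k x = \<theta> k x'" shows "x = x'"
proof (rule eq_by_simple)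
  fix \<delta> assume "\<delta> \<in> \<Delta>"
  then obtain i where i: "1 \<le> i" "i \<le> n" "\<delta> = l i" by (rule l_surj)
  show "cp x \<delta> = cp x' \<delta>"
  proof (cases "i = n")
    case True
    have "1 \<le> n - 1" using n2 by simp
    then show ?thesis using cp_last_unforked[of x] cp_last_unforked[of x'] cp_last_forked[of x] cp_last_forked[of x']
        assms[of n] assms[of "n - 1"] i True by (cases forked) simp_all
  next
    case False
    then show ?thesis using cp_chain[of i x] cp_chain[of i x'] assms[of i] assms[of "Suc i"] i sigma by auto
  qed
qed

definition tr where "tr i k = (if k = i then Suc i else if k = Suc i then i else k)" for i k :: nat

lemma tr_tr [simp]: "tr i (tr i k) = k" by (simp add: tr_def)

lemma theta_refl: assumes "1 \<le> i" "i < n" "1 \<le> k" "k \<le> n" shows "\<theta> k (refl (l i) x) = \<theta> (tr i k) x"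
proof -
  have "\<theta> k (refl (l i) x) = \<theta> k x - cp x (l i) * \<theta> k (l i)" by (simp add: refl_def)
  also have "\<dots> = \<theta> k x - (if k = i then \<sigma> * cp x (l i) else if k = Suc i then - (\<sigma> * cp x (l i)) else 0)"
    using theta_chain[OF assms] by simp
  also have "\<dots> = \<theta> (tr i k) x" unfolding cp_chain[OF assms(1,2)] tr_def by simp
  finally show ?thesis .
qed

lemma theta_refl_unforked: assumes "\<not> forked" "1 \<le> k" "k \<le> n"
  shows "\<theta> k (refl (l n) x) = (if k = n then - \<theta> n x else \<theta> k x)"
proof -
  have "\<theta> k (refl (l n) x) = \<theta> k x - cp x (l n) * \<theta> k (l n)" by (simp add: refl_def)
  then show ?thesis using theta_last[OF assms(2,3)] assms(1) cp_last_unforked[OF assms(1), of x] by simp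
qed

lemma theta_refl_forked: assumes "forked" "1 \<le> k" "k \<le> n"
  shows "\<theta> k (refl (l n) x) = (if k = n \<or> k = n - 1 then - \<theta> (tr (n - 1) k) x else \<theta> k x)"
proof -
  have "\<theta> k (refl (l n) x) = \<theta> k x - cp x (l n) * \<theta> k (l n)" by (simp add: refl_def)
  also have "\<dots> = \<theta> k x - (if k = n \<or> k = n - 1 then 2 * cp x (l n) else 0)"
    using theta_last[OF assms(2,3)] assms(1) by simp
  finally show ?thesis unfolding cp_last_forked[OF assms(1)] using n2 by (auto simp: tr_def)
qed

definition supp where "supp x = {k \<in> {1..n}. \<theta> k x \<noteq> 0}"

text \<open>The absolute value of the nonzero entries of a root with support \<open>S\<close>: it is 2 for \<open>\<plusminus>\<epsilon>\<^sub>i\<close> in type \<open>B\<close> and for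
  \<open>\<plusminus>2 \<epsilon>\<^sub>i\<close> in type \<open>C\<close>, and \<open>\<sigma>\<close> for \<open>\<plusminus>\<epsilon>\<^sub>i \<plusminus> \<epsilon>\<^sub>j\<close>.\<close>

definition amp where "amp S = (if card S = 1 then 2 else \<sigma>)" for S :: "nat set"

text \<open>The simple roots have this shape, and simple reflections only permute the coordinates and change signs.\<close>

lemma root_shape:
  assumes "\<alpha> \<in> \<Phi>"
  shows "card (supp \<alpha>) \<in> (if forked then {2} else {1, 2}) \<and>
    (\<forall>k\<in>{1..n}. \<bar>\<theta> k \<alpha>\<bar> = (if k \<in> supp \<alpha> then amp (supp \<alpha>) else 0))"
proof -
  have amp0: "amp S > 0" for S using sigma by (auto simp: amp_def)
  define P where "P \<alpha> \<longleftrightarrow> (\<exists>S \<subseteq> {1..n}. card S \<in> (if forked then {2} else {1, 2}) \<and>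
    (\<forall>k\<in>{1..n}. \<bar>\<theta> k \<alpha>\<bar> = (if k \<in> S then amp S else 0)))" for \<alpha>
  have tr: "P \<beta>" if P: "P \<alpha>" and i: "1 \<le> i" "i < n"
    and h: "\<And>k. 1 \<le> k \<Longrightarrow> k \<le> n \<Longrightarrow> \<bar>\<theta> k \<beta>\<bar> = \<bar>\<theta> (tr i k) \<alpha>\<bar>" for \<alpha> \<beta> i
  proof -
    obtain S where S: "S \<subseteq> {1..n}" "card S \<in> (if forked then {2} else {1, 2})"
      "\<forall>k\<in>{1..n}. \<bar>\<theta> k \<alpha>\<bar> = (if k \<in> S then amp S else 0)" using P unfolding P_def by blast
    have inj: "inj_on (tr i) S" by (rule inj_on_inverseI[of _ "tr i"]) simp
    have c: "card (tr i ` S) = card S" by (rule card_image[OF inj])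
    have mem: "k \<in> tr i ` S \<longleftrightarrow> tr i k \<in> S" for k
    proof
      assume "tr i k \<in> S"
      then have "tr i (tr i k) \<in> tr i ` S" by (rule imageI)
      then show "k \<in> tr i ` S" by simp
    qed auto
    have rng: "tr i k \<in> {1..n}" if "k \<in> {1..n}" for k using that i by (auto simp: tr_def)
    have sub: "tr i ` S \<subseteq> {1..n}" using S(1) rng by blast
    have amp_eq: "amp (tr i ` S) = amp S" by (simp add: amp_def c)
    have "\<bar>\<theta> k \<beta>\<bar> = (if k \<in> tr i ` S then amp (tr i ` S) else 0)" if k: "k \<in> {1..n}" for k
    proof -
      have "\<bar>\<theta> k \<beta>\<bar> = \<bar>\<theta> (tr i k) \<alpha>\<bar>" using k by (intro h) simp_all
      also have "\<dots> = (if tr i k \<in> S then amp S else 0)" using S(3) rng[OF k] by (rule bspec)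
      finally show ?thesis unfolding mem amp_eq .
    qed
    then show ?thesis unfolding P_def using S(2) sub c by (intro exI[of _ "tr i ` S"]) simp
  qed
  have "P \<alpha>" using assms
  proof (induction rule: root_induct)
    case (simple \<delta>)
    then obtain i where i: "1 \<le> i" "i \<le> n" "\<delta> = l i" by (rule l_surj)
    show ?case
    proof (cases "i < n")
      case True
      then show ?thesis unfolding P_def i(3)
        using i sigma by (intro exI[of _ "{i, Suc i}"]) (auto simp: theta_chain amp_def)
    next
      case False
      then have "i = n" using i by simp
      show ?thesis
      proof (cases forked)
        case True
        have n3: "3 \<le> n" and s2: "\<sigma> = 2" using last_forked[OF True] by blast+
        have c2: "card {n - 1, n} = 2" using n3 by simp
        have "amp {n - 1, n} = \<sigma>" unfolding amp_def c2 by simp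
        from trans[OF this s2] have "amp {n - 1, n} = 2" .
        then show ?thesis unfolding P_def i(3) \<open>i = n\<close> using True n3 c2
          by (intro exI[of _ "{n - 1, n}"]) (auto simp: theta_last)
      next
        case False
        have "amp {n} = 2" by (simp add: amp_def)
        then show ?thesis unfolding P_def i(3) \<open>i = n\<close> using False n2
          by (intro exI[of _ "{n}"]) (auto simp: theta_last)
      qed
    qed
  next
    case (refl \<alpha> \<delta>)
    obtain i where i: "1 \<le> i" "i \<le> n" "\<delta> = l i" using refl(2) by (rule l_surj)
    consider "i < n" | "i = n" "forked" | "i = n" "\<not> forked" using i by linarith
    then show ?case
    proof cases
      case 1
      show ?thesis by (rule tr[OF refl(3) i(1) 1]) (simp add: i(3) theta_refl[OF i(1) 1])
    next
      case 2
      show ?thesis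
      proof (rule tr[OF refl(3), of "n - 1"])
        fix k assume k: "1 \<le> k" "k \<le> n"
        have "k = n \<or> k = n - 1 \<or> tr (n - 1) k = k" using n2 by (auto simp: tr_def)
        then show "\<bar>\<theta> k (refl \<delta> \<alpha>)\<bar> = \<bar>\<theta> (tr (n - 1) k) \<alpha>\<bar>"
          unfolding i(3) 2(1) theta_refl_forked[OF 2(2) k] by auto
      qed (use n2 in auto)
    next
      case 3
      obtain S where S: "S \<subseteq> {1..n}" "card S \<in> (if forked then {2} else {1, 2})"
        "\<forall>k\<in>{1..n}. \<bar>\<theta> k \<alpha>\<bar> = (if k \<in> S then amp S else 0)" using refl(3) unfolding P_def by blast
      have "\<bar>\<theta> k (refl \<delta> \<alpha>)\<bar> = (if k \<in> S then amp S else 0)" if "k \<in> {1..n}" for k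
      proof -
        have "\<bar>\<theta> k (refl \<delta> \<alpha>)\<bar> = \<bar>\<theta> k \<alpha>\<bar>" unfolding i(3) 3(1) using theta_refl_unforked[OF 3(2), of k] that by auto
        then show ?thesis using S(3) that by simp
      qed
      then show ?thesis unfolding P_def using S by blast
    qed
  qed
  then obtain S where S: "S \<subseteq> {1..n}" "card S \<in> (if forked then {2} else {1, 2})"
      "\<forall>k\<in>{1..n}. \<bar>\<theta> k \<alpha>\<bar> = (if k \<in> S then amp S else 0)" unfolding P_def by blast
  have "k \<in> supp \<alpha> \<longleftrightarrow> k \<in> S" for k
  proof (cases "k \<in> {1..n}")
    case True
    have "\<theta> k \<alpha> \<noteq> 0 \<longleftrightarrow> \<bar>\<theta> k \<alpha>\<bar> \<noteq> 0" by simp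
    also have "\<dots> \<longleftrightarrow> k \<in> S" using S(3) True amp0[of S] by auto
    finally show ?thesis using True by (simp add: supp_def)
  qed (use S(1) in \<open>auto simp: supp_def\<close>)
  then have "supp \<alpha> = S" by blast
  then show ?thesis using S(2,3) by simp
qed

text \<open>The entries of \<open>s \<epsilon>\<^sub>i + t \<epsilon>\<^sub>j\<close>.\<close>

definition unit2 where "unit2 s i t j k = (if k = i then s * \<sigma> else if k = j then t * \<sigma> else 0)"
  for s t :: int and i j k :: nat

definition realized where "realized v \<longleftrightarrow> (\<exists>\<alpha>\<in>\<Phi>. \<forall>k\<in>{1..n}. \<theta> k \<alpha> = v k)" for v :: "nat \<Rightarrow> int"

lemma realized_refl: assumes "realized v" "1 \<le> i" "i < n" "\<And>k. k \<in> {1..n} \<Longrightarrow> w k = v (tr i k)" shows "realized w"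
proof -
  obtain \<alpha> where a: "\<alpha> \<in> \<Phi>" "\<forall>k\<in>{1..n}. \<theta> k \<alpha> = v k" using assms(1) unfolding realized_def by blast
  have "refl (l i) \<alpha> \<in> \<Phi>" using refl_root a l_simple assms by simp
  moreover have "\<theta> k (refl (l i) \<alpha>) = w k" if "k \<in> {1..n}" for k
  proof -
    have "tr i k \<in> {1..n}" using that assms(2,3) by (auto simp: tr_def)
    then show ?thesis using theta_refl[OF assms(2,3), of k \<alpha>] that a(2) assms(4) by simp
  qed
  ultimately show ?thesis unfolding realized_def by blast
qed

lemma realized_neg: assumes "realized v" "\<And>k. k \<in> {1..n} \<Longrightarrow> w k = - v k" shows "realized w"
proof -
  obtain \<alpha> where a: "\<alpha> \<in> \<Phi>" "\<forall>k\<in>{1..n}. \<theta> k \<alpha> = v k" using assms(1) unfolding realized_def by blast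
  show ?thesis unfolding realized_def using neg_root[OF a(1)] a(2) assms(2) by (intro bexI[of _ "- \<alpha>"]) auto
qed

lemma realized_minus: assumes "1 \<le> i" "i < j" "j \<le> n" shows "realized (unit2 1 i (-1) j)"
proof -
  have "Suc i \<le> j" using assms by simp
  then show ?thesis using assms(3)
  proof (induction j rule: dec_induct)
    case base
    then have "\<theta> k (l i) = unit2 1 i (-1) (Suc i) k" if "k \<in> {1..n}" for k
      using that theta_chain[of i k] assms(1) by (auto simp: unit2_def)
    then show ?case unfolding realized_def using l_simple[of i] assms base by (intro bexI[of _ "l i"]) auto
  next
    case (step m)
    then have "realized (unit2 1 i (-1) m)" by simp
    then show ?case by (rule realized_refl[of _ m]) (use step assms in \<open>auto simp: unit2_def tr_def\<close>)
  qed
qed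

text \<open>For the pair \<open>n - 1, n\<close> the root is the last simple root in type \<open>D\<close>, and otherwise the reflection of the
  previous simple root in the last one. Transpositions of neighbouring coordinates move this pair to \<open>i, j\<close>.\<close>

lemma realized_plus: assumes "1 \<le> i" "i < j" "j \<le> n" shows "realized (unit2 1 i 1 j)"
proof -
  have base: "realized (unit2 1 (n - 1) 1 n)"
  proof (cases forked)
    case True
    then have "\<theta> k (l n) = unit2 1 (n - 1) 1 n k" if "k \<in> {1..n}" for k
      using that theta_last[of k] True last_forked[OF True] unfolding unit2_def by auto
    then show ?thesis unfolding realized_def using l_simple[of n] n2 by (intro bexI[of _ "l n"]) auto
  next
    case False
    have "\<theta> k (refl (l n) (l (n - 1))) = unit2 1 (n - 1) 1 n k" if "k \<in> {1..n}" for k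
      using that theta_refl_unforked[OF False, of k] theta_chain[of "n - 1" k] theta_chain[of "n - 1" n] n2
      by (auto simp: unit2_def)
    moreover have "refl (l n) (l (n - 1)) \<in> \<Phi>" using l_simple[of n] l_simple[of "n - 1"] n2 refl_root by simp
    ultimately show ?thesis unfolding realized_def by blast
  qed
  have P1: "realized (unit2 1 i 1 n)" if "1 \<le> i" "i < n" for i
  proof -
    have "i \<le> n - 1" using that by simp
    then show ?thesis using that(1)
    proof (induction i rule: inc_induct)
      case base show ?case by (rule \<open>realized (unit2 1 (n - 1) 1 n)\<close>)
    next
      case (step m)
      then have "realized (unit2 1 (Suc m) 1 n)" by simp
      then show ?case by (rule realized_refl[of _ m]) (use step in \<open>auto simp: unit2_def tr_def\<close>)
    qed
  qed
  show ?thesis using assms(3,2)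
  proof (induction j rule: inc_induct)
    case base then show ?case using P1 assms(1) by simp
  next
    case (step m)
    then have "realized (unit2 1 i 1 (Suc m))" by simp
    then show ?case by (rule realized_refl[of _ m]) (use step assms in \<open>auto simp: unit2_def tr_def\<close>)
  qed
qed

lemma realized_unit2:
  assumes ij: "i \<in> {1..n}" "j \<in> {1..n}" "i \<noteq> j" and st: "s = 1 \<or> s = -1" "t = 1 \<or> t = -1"
  shows "realized (unit2 s i t j)"
proof -
  have *: "realized (unit2 s i t j)" if "1 \<le> i" "i < j" "j \<le> n" "s = 1 \<or> s = -1" "t = 1 \<or> t = -1" for i j s t
    using that(4,5) realized_plus[OF that(1-3)] realized_minus[OF that(1-3)]
      realized_neg[OF realized_plus[OF that(1-3)], of "unit2 (-1) i (-1) j"]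
      realized_neg[OF realized_minus[OF that(1-3)], of "unit2 (-1) i 1 j"]
    by (auto simp: unit2_def)
  show ?thesis
  proof (cases "i < j")
    case True then show ?thesis using * ij st by simp
  next
    case False
    then have "unit2 s i t j = unit2 t j s i" "j < i" using ij by (auto simp: unit2_def)
    then show ?thesis using *[of j i t s] ij st by simp
  qed
qed

definition unit1 where "unit1 s i k = (if k = i then s else 0)" for s :: int and i k :: nat

lemma realized_unit1:
  assumes nf: "\<not> forked" and i: "1 \<le> i" "i \<le> n" and s: "s = 2 \<or> s = -2"
  shows "realized (unit1 s i)"
proof -
  have "realized (unit1 2 i)" using i(2,1)
  proof (induction i rule: inc_induct)
    case base
    have "\<theta> k (l n) = unit1 2 n k" if "k \<in> {1..n}" for k using that theta_last[of k] nf by (auto simp: unit1_def)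
    then show ?case unfolding realized_def using l_simple[of n] n2 by (intro bexI[of _ "l n"]) auto
  next
    case (step m)
    then have "realized (unit1 2 (Suc m))" by simp
    then show ?case by (rule realized_refl[of _ m]) (use step in \<open>auto simp: unit1_def tr_def\<close>)
  qed
  then show ?thesis using s realized_neg[of "unit1 2 i" "unit1 (-2) i"] by (auto simp: unit1_def)
qed

lemma supp_eqI: "(\<And>k. k \<in> {1..n} \<Longrightarrow> \<theta> k \<alpha> \<noteq> 0 \<longleftrightarrow> k \<in> S) \<Longrightarrow> S \<subseteq> {1..n} \<Longrightarrow> supp \<alpha> = S"
  unfolding supp_def by blast

text \<open>Coordinates separate the elements of \<open>X\<close>, so these roots correspond to the choices of two signs.\<close>

lemma card_supp2: assumes S: "S \<subseteq> {1..n}" "card S = 2" shows "card {\<alpha> \<in> \<Phi>. supp \<alpha> = S} = 4"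
proof -
  obtain i j where ij: "S = {i, j}" "i \<noteq> j" using S(2) by (auto simp: card_2_iff)
  have in_n: "i \<in> {1..n}" "j \<in> {1..n}" using S ij by auto
  let ?T = "{1, -1} \<times> {1, -1 :: int}"
  have "\<forall>p\<in>?T. \<exists>\<alpha>\<in>\<Phi>. \<forall>k\<in>{1..n}. \<theta> k \<alpha> = unit2 (fst p) i (snd p) j k"
    using realized_unit2[OF in_n ij(2)] unfolding realized_def by auto
  then obtain r where r: "\<And>p. p \<in> ?T \<Longrightarrow> r p \<in> \<Phi>"
    "\<And>p k. p \<in> ?T \<Longrightarrow> k \<in> {1..n} \<Longrightarrow> \<theta> k (r p) = unit2 (fst p) i (snd p) j k" by metis
  have s0: "\<sigma> \<noteq> 0" using sigma by auto
  have inj: "inj_on r ?T"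
  proof (rule inj_onI)
    fix p p' assume p: "p \<in> ?T" "p' \<in> ?T" "r p = r p'"
    have "\<theta> i (r p) = \<theta> i (r p')" "\<theta> j (r p) = \<theta> j (r p')" using p by simp_all
    then have "fst p = fst p'" "snd p = snd p'" using r(2)[OF p(1)] r(2)[OF p(2)] in_n ij(2) s0 by (auto simp: unit2_def)
    then show "p = p'" by (rule prod_eqI)
  qed
  have "{\<alpha> \<in> \<Phi>. supp \<alpha> = S} = r ` ?T"
  proof
    show "r ` ?T \<subseteq> {\<alpha> \<in> \<Phi>. supp \<alpha> = S}"
    proof
      fix \<alpha> assume "\<alpha> \<in> r ` ?T"
      then obtain p where p: "p \<in> ?T" "\<alpha> = r p" by blast
      have "supp \<alpha> = S" unfolding p(2)
        by (rule supp_eqI[OF _ S(1)]) (use r(2)[OF p(1)] p(1) s0 ij in \<open>auto simp: unit2_def\<close>)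
      then show "\<alpha> \<in> {\<alpha> \<in> \<Phi>. supp \<alpha> = S}" using r(1)[OF p(1)] p(2) by simp
    qed
    show "{\<alpha> \<in> \<Phi>. supp \<alpha> = S} \<subseteq> r ` ?T"
    proof
      fix \<alpha> assume "\<alpha> \<in> {\<alpha> \<in> \<Phi>. supp \<alpha> = S}"
      then have a: "\<alpha> \<in> \<Phi>" "supp \<alpha> = S" by auto
      have v: "\<bar>\<theta> k \<alpha>\<bar> = (if k \<in> S then \<sigma> else 0)" if "k \<in> {1..n}" for k
        using root_shape[OF a(1)] that a(2) S(2) by (simp add: amp_def)
      have "\<exists>s. (s = 1 \<or> s = -1) \<and> \<theta> k \<alpha> = s * \<sigma>" if "k \<in> S" for k
      proof -
        have "k \<in> {1..n}" using that S(1) by blast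
        then have "\<bar>\<theta> k \<alpha>\<bar> = \<sigma>" using v[of k] that by simp
        then have "\<theta> k \<alpha> = 1 * \<sigma> \<or> \<theta> k \<alpha> = - 1 * \<sigma>" by linarith
        then show ?thesis by blast
      qed
      then obtain s t where s: "s = 1 \<or> s = -1" "\<theta> i \<alpha> = s * \<sigma>" and t: "t = 1 \<or> t = -1" "\<theta> j \<alpha> = t * \<sigma>"
        using ij by (metis insertI1 insertI2)
      have st: "(s, t) \<in> ?T" using s t by auto
      have "\<alpha> = r (s, t)"
      proof (rule theta_inj)
        fix k assume "1 \<le> k" "k \<le> n"
        then show "\<theta> k \<alpha> = \<theta> k (r (s, t))" using r(2)[OF st, of k] s t v[of k] ij by (auto simp: unit2_def)
      qed
      then show "\<alpha> \<in> r ` ?T" using st by (rule image_eqI)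
    qed
  qed
  then show ?thesis using card_image[OF inj] by (simp add: card_cartesian_product)
qed

lemma card_supp1: assumes nf: "\<not> forked" and S: "S \<subseteq> {1..n}" "card S = 1" shows "card {\<alpha> \<in> \<Phi>. supp \<alpha> = S} = 2"
proof -
  obtain i where i: "S = {i}" using S(2) by (auto simp: card_1_singleton_iff)
  have in_n: "1 \<le> i" "i \<le> n" using S i by auto
  obtain \<alpha> where a: "\<alpha> \<in> \<Phi>" "\<forall>k\<in>{1..n}. \<theta> k \<alpha> = unit1 2 i k"
    using realized_unit1[OF nf in_n] unfolding realized_def by blast
  have "{\<beta> \<in> \<Phi>. supp \<beta> = S} = {\<alpha>, - \<alpha>}"
  proof
    have "supp \<alpha> = S" "supp (- \<alpha>) = S" by (rule supp_eqI; use a(2) i S(1) in \<open>auto simp: unit1_def\<close>)+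
    then show "{\<alpha>, - \<alpha>} \<subseteq> {\<beta> \<in> \<Phi>. supp \<beta> = S}" using a neg_root by auto
    show "{\<beta> \<in> \<Phi>. supp \<beta> = S} \<subseteq> {\<alpha>, - \<alpha>}"
    proof
      fix \<beta> assume "\<beta> \<in> {\<beta> \<in> \<Phi>. supp \<beta> = S}"
      then have b: "\<beta> \<in> \<Phi>" "supp \<beta> = S" by auto
      have v: "\<bar>\<theta> k \<beta>\<bar> = (if k = i then 2 else 0)" if "k \<in> {1..n}" for k
        using root_shape[OF b(1)] that b(2) S(2) i by (simp add: amp_def)
      show "\<beta> \<in> {\<alpha>, - \<alpha>}"
      proof (cases "\<theta> i \<beta> \<ge> 0")
        case True
        have "\<beta> = \<alpha>"
        proof (rule theta_inj)
          fix k assume "1 \<le> k" "k \<le> n"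
          then show "\<theta> k \<beta> = \<theta> k \<alpha>" using a(2) v[of k] True by (auto simp: unit1_def split: if_splits)
        qed
        then show ?thesis by simp
      next
        case False
        have "\<beta> = - \<alpha>"
        proof (rule theta_inj)
          fix k assume "1 \<le> k" "k \<le> n"
          then show "\<theta> k \<beta> = \<theta> k (- \<alpha>)" using a(2) v[of k] False by (auto simp: unit1_def split: if_splits)
        qed
        then show ?thesis by simp
      qed
    qed
  qed
  then show ?thesis using root_ne_neg[OF a(1)] by (simp add: card_insert_if)
qed

lemma supp_subset: "supp \<alpha> \<subseteq> {1..n}" by (auto simp: supp_def)

definition level where "level m = {\<alpha> \<in> \<Phi>. card (supp \<alpha>) = m}"

lemma level_image: assumes "\<And>S. S \<subseteq> {1..n} \<Longrightarrow> card S = m \<Longrightarrow> card {\<alpha> \<in> \<Phi>. supp \<alpha> = S} > 0"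
  shows "supp ` level m = {S. S \<subseteq> {1..n} \<and> card S = m}"
proof
  show "supp ` level m \<subseteq> {S. S \<subseteq> {1..n} \<and> card S = m}" using supp_subset by (auto simp: level_def)
  show "{S. S \<subseteq> {1..n} \<and> card S = m} \<subseteq> supp ` level m"
  proof
    fix S assume S: "S \<in> {S. S \<subseteq> {1..n} \<and> card S = m}"
    then have "card {\<alpha> \<in> \<Phi>. supp \<alpha> = S} > 0" using assms[of S] by simp
    then have "{\<alpha> \<in> \<Phi>. supp \<alpha> = S} \<noteq> {}" unfolding card_gt_0_iff by (rule conjunct1)
    then show "S \<in> supp ` level m" using S by (auto simp: level_def)
  qed
qed

lemma level_fibres: assumes c: "\<And>S. S \<subseteq> {1..n} \<Longrightarrow> card S = m \<Longrightarrow> card {\<alpha> \<in> \<Phi>. supp \<alpha> = S} = r" and r: "r > 0"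
  shows "fibres supp (level m) = replicate_mset (n choose m) r"
proof -
  have im: "supp ` level m = {S. S \<subseteq> {1..n} \<and> card S = m}" by (rule level_image) (simp add: c r)
  have "fibres supp (level m) = replicate_mset (card (supp ` level m)) r"
  proof (rule fibres_const)
    fix S assume "S \<in> supp ` level m"
    then have S: "S \<subseteq> {1..n}" "card S = m" unfolding im by auto
    then have "{\<alpha> \<in> level m. supp \<alpha> = S} = {\<alpha> \<in> \<Phi>. supp \<alpha> = S}" by (auto simp: level_def)
    then show "card {\<alpha> \<in> level m. supp \<alpha> = S} = r" using c[OF S] by simp
  qed (simp add: level_def)
  then show ?thesis unfolding im by (simp add: n_subsets)
qed

lemma level2_fibres: "fibres supp (level 2) = replicate_mset (n choose 2) 4"
  by (rule level_fibres) (simp_all add: card_supp2)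

lemma level1_fibres: "\<not> forked \<Longrightarrow> fibres supp (level 1) = replicate_mset n 2"
  using level_fibres[of 1 2] card_supp1 by simp

lemma roots_levels: "\<Phi> = (if forked then level 2 else level 1 \<union> level 2)"
proof (rule set_eqI)
  fix \<alpha> show "\<alpha> \<in> \<Phi> \<longleftrightarrow> \<alpha> \<in> (if forked then level 2 else level 1 \<union> level 2)"
    using root_shape[of \<alpha>] by (auto simp: level_def split: if_splits)
qed

lemma supp_fibres: "fibres supp \<Phi> = (if forked then {#} else replicate_mset n 2) + replicate_mset (n choose 2) 4"
proof (cases forked)
  case True then show ?thesis using roots_levels level2_fibres by simp
next
  case False
  have "fibres supp (level 1 \<union> level 2) = fibres supp (level 1) + fibres supp (level 2)"
    by (rule fibres_union) (auto simp: level_def)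
  then show ?thesis using roots_levels level2_fibres level1_fibres False by simp
qed

end

section \<open>Multiplicities of the classical types in characteristic 2\<close>

lemma fibres_sum: assumes "finite A" shows "sum_mset (fibres f A) = card A"
proof -
  have "sum_mset (fibres f A) = (\<Sum>k\<in>f ` A. card {a \<in> A. f a = k})"
    unfolding fibres_def by (simp add: sum_unfold_sum_mset)
  also have "\<dots> = card (\<Union>k\<in>f ` A. {a \<in> A. f a = k})"
    by (rule card_UN_disjoint[symmetric]) (use assms in auto)
  also have "(\<Union>k\<in>f ` A. {a \<in> A. f a = k}) = A" by auto
  finally show ?thesis .
qed

lemma fibres_single: assumes "finite A" "A \<noteq> {}" "\<And>a b. a \<in> A \<Longrightarrow> b \<in> A \<Longrightarrow> f a = f b"
  shows "fibres f A = {#card A#}"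
proof -
  obtain a where a: "a \<in> A" using assms(2) by blast
  have "f ` A = {f a}" using a assms(3) by blast
  moreover have "{b \<in> A. f b = f a} = A" using a assms(3) by blast
  ultimately show ?thesis by (simp add: fibres_def)
qed

lemma abs_zero_two_mod_four:
  fixes a b m :: int
  assumes "\<bar>a\<bar> = (if P then 2 else 0)" "\<bar>b\<bar> = (if Q then 2 else 0)"
  shows "a - b = 4 * m \<Longrightarrow> P \<longleftrightarrow> Q" "a - b = 4 * m + 2 \<Longrightarrow> P \<longleftrightarrow> \<not> Q"
proof -
  have a: "P \<Longrightarrow> a = 2 \<or> a = - 2" "\<not> P \<Longrightarrow> a = 0" and b: "Q \<Longrightarrow> b = 2 \<or> b = - 2" "\<not> Q \<Longrightarrow> b = 0"
    using assms by (auto split: if_splits)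
  show "P \<longleftrightarrow> Q" if "a - b = 4 * m"
  proof (cases P; cases Q)
    assume "P" "\<not> Q" then show ?thesis using a(1) b(2) that by presburger
  next
    assume "\<not> P" "Q" then show ?thesis using a(2) b(1) that by presburger
  qed auto
  show "P \<longleftrightarrow> \<not> Q" if "a - b = 4 * m + 2"
  proof (cases P; cases Q)
    assume "P" "Q" then show ?thesis using a(1) b(1) that by presburger
  next
    assume "\<not> P" "\<not> Q" then show ?thesis using a(2) b(2) that by presburger
  qed auto
qed

context irreducible_datum begin

definition has_mults where
  "has_mults p Z M \<longleftrightarrow> fibres (residue (int p)) (null_roots (int p)) = Z \<and>
     fibres (residue (int p)) (\<Phi> - null_roots (int p)) = M"

lemma has_mults_key:
  assumes z: "\<And>\<alpha>. \<alpha> \<in> \<Phi> \<Longrightarrow> \<not> congr (int p) \<alpha> 0"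
    and k: "\<And>\<alpha> \<beta>. \<alpha> \<in> \<Phi> \<Longrightarrow> \<beta> \<in> \<Phi> \<Longrightarrow> congr (int p) \<alpha> \<beta> \<longleftrightarrow> key \<alpha> = key \<beta>"
  shows "has_mults p {#} (fibres key \<Phi>)"
proof -
  have n: "null_roots (int p) = {}" using z by (auto simp: null_roots_def)
  have "fibres (residue (int p)) \<Phi> = fibres key \<Phi>"
    by (rule fibres_cong[OF finite_roots]) (simp add: residue_eq k)
  then show ?thesis by (simp add: has_mults_def n)
qed

end

context coordinates begin

text \<open>Neighbouring coordinates differ by twice the pairing with a simple coroot.\<close>

lemma theta_parity:
  assumes "\<sigma> = 2" shows "(\<forall>k\<in>{1..n}. even (\<theta> k x)) \<or> (\<forall>k\<in>{1..n}. odd (\<theta> k x))"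
proof -
  have "even (\<theta> k x) \<longleftrightarrow> even (\<theta> n x)" if "1 \<le> k" "k \<le> n" for k using that(2,1)
  proof (induction k rule: inc_induct)
    case (step m)
    have "2 * cp x (l m) = \<theta> m x - \<theta> (Suc m) x" using cp_chain[of m x] step assms by simp
    then have "even (\<theta> m x - \<theta> (Suc m) x)" by (rule dvdI[OF sym])
    then show ?case using step by simp
  qed simp
  note par = this
  show ?thesis
  proof (cases "even (\<theta> n x)")
    case True
    have "even (\<theta> k x)" if "k \<in> {1..n}" for k using par[of k] that True by simp
    then show ?thesis by blast
  next
    case False
    have "odd (\<theta> k x)" if "k \<in> {1..n}" for k using par[of k] that False by simp
    then show ?thesis by blast
  qed
qed

lemma card_supp: "\<alpha> \<in> \<Phi> \<Longrightarrow> card (supp \<alpha>) = 1 \<or> card (supp \<alpha>) = 2"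
  "\<alpha> \<in> \<Phi> \<Longrightarrow> forked \<Longrightarrow> card (supp \<alpha>) = 2"
  using root_shape[of \<alpha>] by (auto split: if_splits)

lemma theta_two: assumes "\<sigma> = 2" "\<alpha> \<in> \<Phi>" "k \<in> {1..n}" shows "\<bar>\<theta> k \<alpha>\<bar> = (if k \<in> supp \<alpha> then 2 else 0)"
  using root_shape[OF assms(2), unfolded amp_def] assms(1,3) by auto

lemma theta_even: assumes "\<sigma> = 2" "\<alpha> \<in> \<Phi>" "k \<in> {1..n}" shows "even (\<theta> k \<alpha>)"
proof -
  have "even \<bar>\<theta> k \<alpha>\<bar>" unfolding theta_two[OF assms] by simp
  then show ?thesis by simp
qed

text \<open>Let \<open>\<alpha> - \<beta> = 2x\<close>. If the doubled coordinates of \<open>x\<close> are even, those of \<open>\<alpha>\<close> and \<open>\<beta>\<close> agree modulo 4 and the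
  supports are equal. If they are odd, the supports are complementary, and \<open>n\<close> is the sum of their
  sizes: at most 4, and equal to 4 in type \<open>D\<close>. This is the origin of the exceptional entries of the
  list for the simply connected types \<open>B\<^sub>2\<close>, \<open>B\<^sub>3\<close>, \<open>B\<^sub>4\<close> and \<open>D\<^sub>4\<close>.\<close>

lemma supp_if_congr:
  assumes s: "\<sigma> = 2" and A: "(\<forall>x. \<forall>k\<in>{1..n}. even (\<theta> k x)) \<or> 5 \<le> n \<or> forked \<and> n = 3"
    and a: "\<alpha> \<in> \<Phi>" and b: "\<beta> \<in> \<Phi>" and c: "congr 2 \<alpha> \<beta>"
  shows "supp \<alpha> = supp \<beta>"
proof -
  obtain x where x: "\<alpha> - \<beta> = zmult 2 x" using c unfolding congr_def by blast
  have tx: "\<theta> k \<alpha> - \<theta> k \<beta> = 2 * \<theta> k x" for k using arg_cong[OF x, of "\<theta> k"] by simp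
  have ab: "\<bar>\<theta> k \<alpha>\<bar> = (if k \<in> supp \<alpha> then 2 else 0)" "\<bar>\<theta> k \<beta>\<bar> = (if k \<in> supp \<beta> then 2 else 0)"
    if "k \<in> {1..n}" for k using theta_two[OF s] a b that by auto
  show ?thesis
  proof (cases "\<forall>k\<in>{1..n}. even (\<theta> k x)")
    case True
    have "k \<in> supp \<alpha> \<longleftrightarrow> k \<in> supp \<beta>" if k: "k \<in> {1..n}" for k
    proof -
      have "even (\<theta> k x)" using True k by blast
      then obtain m where "\<theta> k x = 2 * m" by (rule evenE)
      then have "\<theta> k \<alpha> - \<theta> k \<beta> = 4 * m" using tx[of k] by simp
      then show ?thesis by (rule abs_zero_two_mod_four(1)[OF ab[OF k]])
    qed
    then show ?thesis using supp_subset by blast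
  next
    case False
    then have odd: "\<forall>k\<in>{1..n}. odd (\<theta> k x)" using theta_parity[OF s, of x] by blast
    have x: "k \<in> supp \<alpha> \<longleftrightarrow> k \<notin> supp \<beta>" if k: "k \<in> {1..n}" for k
    proof -
      have "odd (\<theta> k x)" using odd k by blast
      then obtain m where "\<theta> k x = 2 * m + 1" by (rule oddE)
      then have "\<theta> k \<alpha> - \<theta> k \<beta> = 4 * m + 2" using tx[of k] by simp
      then show ?thesis by (rule abs_zero_two_mod_four(2)[OF ab[OF k]])
    qed
    have u: "supp \<alpha> \<union> supp \<beta> = {1..n}" and d: "supp \<alpha> \<inter> supp \<beta> = {}"
      using x supp_subset[of \<alpha>] supp_subset[of \<beta>] by blast+
    have "finite (supp \<alpha>)" "finite (supp \<beta>)" using supp_subset finite_subset by blast+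
    then have "n = card (supp \<alpha>) + card (supp \<beta>)" using card_Un_disjoint[OF _ _ d] u by simp
    then have "n \<le> 4" "forked \<Longrightarrow> n = 4" using card_supp[OF a] card_supp[OF b] by auto
    then have False using A False by auto
    then show ?thesis ..
  qed
qed

text \<open>If \<open>\<alpha> = 2x\<close>, a nonzero coordinate of \<open>\<alpha>\<close> makes the doubled coordinates of \<open>x\<close> odd. Then all coordinates of
  \<open>\<alpha>\<close> are nonzero, and the rank is at most 2.\<close>

lemma not_null:
  assumes s: "\<sigma> = 2" and A: "(\<forall>x. \<forall>k\<in>{1..n}. even (\<theta> k x)) \<or> 5 \<le> n \<or> forked \<and> n = 3" and a: "\<alpha> \<in> \<Phi>"
  shows "\<not> congr 2 \<alpha> 0"
proof
  assume "congr 2 \<alpha> 0"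
  then obtain x where x: "\<alpha> = zmult 2 x" unfolding congr_def by auto
  have tx: "\<theta> k \<alpha> = 2 * \<theta> k x" for k using arg_cong[OF x, of "\<theta> k"] by simp
  have ab: "\<bar>\<theta> k \<alpha>\<bar> = (if k \<in> supp \<alpha> then 2 else 0)" if "k \<in> {1..n}" for k
    using theta_two[OF s a that] .
  have "supp \<alpha> \<noteq> {}" using card_supp(1)[OF a] by auto
  then obtain j where j: "j \<in> supp \<alpha>" "j \<in> {1..n}" using supp_subset by blast
  then have "\<theta> j x = 1 \<or> \<theta> j x = -1" using ab[OF j(2)] tx[of j] by auto
  then have "odd (\<theta> j x)" by auto
  then have odd: "\<forall>k\<in>{1..n}. odd (\<theta> k x)" using theta_parity[OF s, of x] j(2) by blast
  have "k \<in> supp \<alpha>" if k: "k \<in> {1..n}" for k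
  proof (rule ccontr)
    assume "k \<notin> supp \<alpha>"
    then have "\<theta> k x = 0" using ab[OF k] tx[of k] by simp
    then show False using odd k by force
  qed
  then have "supp \<alpha> = {1..n}" using supp_subset by blast
  then have "n \<le> 2" using card_supp(1)[OF a] by auto
  then show False using A odd j(2) by auto
qed

text \<open>In doubled coordinates, that is for \<open>\<sigma> = 2\<close>, these vectors are the standard basis \<open>\<epsilon>\<^sub>1, \<dots>, \<epsilon>\<^sub>n\<close>.\<close>

definition frame where "frame E \<longleftrightarrow> (\<forall>i\<in>{1..n}. \<forall>k\<in>{1..n}. \<theta> k (E i) = (if k = i then 2 else 0))"
  for E :: "nat \<Rightarrow> 'x"

lemma frame_comb: assumes E: "frame E" and k: "k \<in> {1..n}"
  shows "\<theta> k (\<Sum>i\<in>{1..n}. zmult (c i) (E i)) = 2 * c k"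
proof -
  have "\<theta> k (\<Sum>i\<in>{1..n}. zmult (c i) (E i)) = (\<Sum>i\<in>{1..n}. if i = k then 2 * c k else 0)"
    unfolding theta_simps by (rule sum.cong) (use E k in \<open>auto simp: frame_def\<close>)
  then show ?thesis using k by simp
qed

lemma four_dvd_double: "4 dvd 2 * a \<Longrightarrow> 2 dvd a" for a :: int by presburger

text \<open>For equal supports the doubled coordinates of \<open>\<alpha> - \<beta>\<close> are divisible by 4. If the \<open>\<epsilon>\<^sub>i\<close> lie in \<open>X\<close>, half of
  \<open>\<alpha> - \<beta>\<close> is an integral combination of them. If \<open>Y\<close> is generated by the simple coroots, it suffices that these
  take even values at \<open>\<alpha> - \<beta>\<close>, which are half sums or half differences of two doubled coordinates, or
  such a coordinate itself.\<close>

lemma congr_if_supp: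
  assumes s: "\<sigma> = 2" and H: "(\<exists>E. frame E) \<or> simply_connected_type R"
    and a: "\<alpha> \<in> \<Phi>" and b: "\<beta> \<in> \<Phi>" and c: "supp \<alpha> = supp \<beta>"
  shows "congr 2 \<alpha> \<beta>"
proof -
  have d4: "4 dvd \<theta> k \<alpha> - \<theta> k \<beta>" if "k \<in> {1..n}" for k
  proof -
    have "\<bar>\<theta> k \<alpha>\<bar> = (if k \<in> supp \<beta> then 2 else 0)" "\<bar>\<theta> k \<beta>\<bar> = (if k \<in> supp \<beta> then 2 else 0)"
      using theta_two[OF s _ that] a b c by auto
    then have "\<theta> k \<alpha> - \<theta> k \<beta> \<in> {0, 4, -4}" by (auto split: if_splits)
    then show ?thesis by auto
  qed
  show ?thesis using H
  proof
    assume "\<exists>E. frame E"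
    then obtain E where E: "frame E" by blast
    define v where "v = (\<Sum>i\<in>{1..n}. zmult ((\<theta> i \<alpha> - \<theta> i \<beta>) div 4) (E i))"
    have "\<alpha> - \<beta> = zmult 2 v"
    proof (rule theta_inj)
      fix k assume k: "1 \<le> k" "k \<le> n"
      then have "\<theta> k v = 2 * ((\<theta> k \<alpha> - \<theta> k \<beta>) div 4)" unfolding v_def by (intro frame_comb[OF E]) simp
      then show "\<theta> k (\<alpha> - \<beta>) = \<theta> k (zmult 2 v)" using d4[of k] k by simp
    qed
    then show ?thesis unfolding congr_def by blast
  next
    assume sc: "simply_connected_type R"
    show ?thesis
    proof (rule simply_connected_congr[OF sc])
      fix \<delta> assume "\<delta> \<in> \<Delta>"
      then obtain i where i: "1 \<le> i" "i \<le> n" "\<delta> = l i" by (rule l_surj)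
      have "4 dvd 2 * (cp \<alpha> \<delta> - cp \<beta> \<delta>)"
      proof (cases "i = n")
        case True
        show ?thesis
        proof (cases forked)
          case f: True
          have "2 * (cp \<alpha> \<delta> - cp \<beta> \<delta>) = (\<theta> (n - 1) \<alpha> - \<theta> (n - 1) \<beta>) + (\<theta> n \<alpha> - \<theta> n \<beta>)"
            using cp_last_forked[OF f, of \<alpha>] cp_last_forked[OF f, of \<beta>] i True by simp
          then show ?thesis using d4[of n] d4[of "n - 1"] n2 by (simp add: dvd_add)
        next
          case False
          have "cp \<alpha> \<delta> - cp \<beta> \<delta> = \<theta> n \<alpha> - \<theta> n \<beta>"
            using cp_last_unforked[OF False] i True by simp
          then have "4 dvd cp \<alpha> \<delta> - cp \<beta> \<delta>" using d4[of n] n2 by simp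
          then show ?thesis by (rule dvd_mult)
        qed
      next
        case False
        then have "2 * (cp \<alpha> \<delta> - cp \<beta> \<delta>) = (\<theta> i \<alpha> - \<theta> i \<beta>) - (\<theta> (Suc i) \<alpha> - \<theta> (Suc i) \<beta>)"
          using cp_chain[of i \<alpha>] cp_chain[of i \<beta>] i s by simp
        then show ?thesis using d4[of i] d4[of "Suc i"] i False by (simp add: dvd_diff)
      qed
      then show "2 dvd cp \<alpha> \<delta> - cp \<beta> \<delta>" by (rule four_dvd_double)
    qed
  qed
qed

lemma mults_two:
  assumes s: "\<sigma> = 2" and A: "(\<forall>x. \<forall>k\<in>{1..n}. even (\<theta> k x)) \<or> 5 \<le> n \<or> forked \<and> n = 3"
    and H: "(\<exists>E. frame E) \<or> simply_connected_type R"
  shows "has_mults 2 {#} ((if forked then {#} else replicate_mset n 2) + replicate_mset (n choose 2) 4)"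
  unfolding supp_fibres[symmetric]
proof (rule has_mults_key)
  fix \<alpha> assume a: "\<alpha> \<in> \<Phi>"
  show "\<not> congr (int 2) \<alpha> 0" using not_null[OF s A a] by simp
  fix \<beta> assume b: "\<beta> \<in> \<Phi>"
  show "congr (int 2) \<alpha> \<beta> \<longleftrightarrow> supp \<alpha> = supp \<beta>"
    using supp_if_congr[OF s A a b] congr_if_supp[OF s H a b] by auto
qed

lemma unforked_frame: assumes "\<not> forked" obtains E where "frame E" "\<And>i. i \<in> {1..n} \<Longrightarrow> E i \<in> \<Phi>"
proof -
  have "\<exists>\<alpha>. \<alpha> \<in> \<Phi> \<and> (\<forall>k\<in>{1..n}. \<theta> k \<alpha> = (if k = i then 2 else 0))" if "i \<in> {1..n}" for i
    using realized_unit1[OF assms, of i 2] that unfolding realized_def unit1_def by auto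
  then have "\<forall>i\<in>{1..n}. \<exists>\<alpha>. \<alpha> \<in> \<Phi> \<and> (\<forall>k\<in>{1..n}. \<theta> k \<alpha> = (if k = i then 2 else 0))" by blast
  from bchoice[OF this] obtain E where
    E: "\<forall>i\<in>{1..n}. E i \<in> \<Phi> \<and> (\<forall>k\<in>{1..n}. \<theta> k (E i) = (if k = i then 2 else 0))" by blast
  have "frame E" unfolding frame_def using E by blast
  moreover have "\<And>i. i \<in> {1..n} \<Longrightarrow> E i \<in> \<Phi>" using E by blast
  ultimately show thesis by (rule that)
qed

lemma frame_expand: assumes E: "frame E" and x: "\<And>k. k \<in> {1..n} \<Longrightarrow> even (\<theta> k x)"
  shows "x = (\<Sum>i\<in>{1..n}. zmult (\<theta> i x div 2) (E i))"
proof (rule theta_inj)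
  fix k assume k: "1 \<le> k" "k \<le> n"
  then have "\<theta> k (\<Sum>i\<in>{1..n}. zmult (\<theta> i x div 2) (E i)) = 2 * (\<theta> k x div 2)" by (intro frame_comb[OF E]) simp
  then show "\<theta> k x = \<theta> k (\<Sum>i\<in>{1..n}. zmult (\<theta> i x div 2) (E i))" using x[of k] k by simp
qed

lemma weights_sc:
  assumes "\<And>i. 1 \<le> i \<Longrightarrow> i \<le> n \<Longrightarrow> \<exists>\<omega>. \<forall>j. 1 \<le> j \<and> j \<le> n \<longrightarrow> cp \<omega> (l j) = (if j = i then 1 else 0)"
  shows "simply_connected_type R"
proof (rule weights_simply_connected)
  fix \<delta> assume "\<delta> \<in> \<Delta>"
  then obtain i where i: "1 \<le> i" "i \<le> n" "\<delta> = l i" by (rule l_surj)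
  obtain \<omega> where w: "\<And>j. 1 \<le> j \<Longrightarrow> j \<le> n \<Longrightarrow> cp \<omega> (l j) = (if j = i then 1 else 0)" using assms[OF i(1,2)] by blast
  have "cp \<omega> \<epsilon> = (if \<epsilon> = \<delta> then 1 else 0)" if e: "\<epsilon> \<in> \<Delta>" for \<epsilon>
  proof -
    obtain j where j: "1 \<le> j" "j \<le> n" "\<epsilon> = l j" using e by (rule l_surj)
    have "l j = l i \<longleftrightarrow> j = i" using inj_on_eq_iff[OF bij_betw_imp_inj_on[OF bij], of j i] i j by simp
    then show ?thesis using w[OF j(1,2)] i j by simp
  qed
  then show "\<exists>\<omega>. \<forall>\<epsilon>\<in>\<Delta>. cp \<omega> \<epsilon> = (if \<epsilon> = \<delta> then 1 else 0)" by blast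
qed

text \<open>A vector with odd doubled coordinates and the \<open>\<epsilon>\<^sub>i\<close> produce the spin weight \<open>w = (\<epsilon>\<^sub>1 + \<dots> + \<epsilon>\<^sub>n) / 2\<close>. The
  fundamental weights are the partial sums \<open>P i = \<epsilon>\<^sub>1 + \<dots> + \<epsilon>\<^sub>i\<close> apart from \<open>w\<close> and, in type \<open>D\<close>, \<open>w - \<epsilon>\<^sub>n\<close>.\<close>

lemma spin_sc:
  assumes s: "\<sigma> = 2" and E: "frame E" and x: "\<not> (\<forall>k\<in>{1..n}. even (\<theta> k x))"
  shows "simply_connected_type R"
proof -
  have odd: "\<forall>k\<in>{1..n}. odd (\<theta> k x)" using theta_parity[OF s, of x] x by blast
  define w where "w = x - (\<Sum>i\<in>{1..n}. zmult ((\<theta> i x - 1) div 2) (E i))"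
  have w: "\<theta> k w = 1" if kn: "k \<in> {1..n}" for k
  proof -
    obtain m where m: "\<theta> k x = 2 * m + 1" using bspec[OF odd kn] by (rule oddE)
    have "\<theta> k w = \<theta> k x - 2 * ((\<theta> k x - 1) div 2)" unfolding w_def theta_simps(2) frame_comb[OF E kn] ..
    then show ?thesis by (simp add: m)
  qed
  define P where "P i = (\<Sum>m\<in>{1..n}. zmult (if m \<le> i then 1 else 0) (E m))" for i
  have P: "\<theta> k (P i) = (if k \<le> i then 2 else 0)" if "k \<in> {1..n}" for k i
    unfolding P_def frame_comb[OF E that] by simp
  have En: "\<theta> k (E n) = (if k = n then 2 else 0)" if "k \<in> {1..n}" for k using E that n2 unfolding frame_def by simp
  have last: "cp z (l n) = (if forked then (\<theta> (n - 1) z + \<theta> n z) div 2 else \<theta> n z)" for z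
    using cp_last_forked[of z] cp_last_unforked[of z] by auto
  have chn: "cp z (l j) = (\<theta> j z - \<theta> (Suc j) z) div 2" if "1 \<le> j" "j < n" for z j
    using cp_chain[OF that, of z] s by simp
  show ?thesis
  proof (rule weights_sc)
    fix i assume i: "1 \<le> i" "i \<le> n"
    have "i = n \<or> i < n" using i by linarith
    then consider "i = n" | "i = n - 1" "forked" | "i < n" "\<not> (i = n - 1 \<and> forked)" by blast
    then show "\<exists>\<omega>. \<forall>j. 1 \<le> j \<and> j \<le> n \<longrightarrow> cp \<omega> (l j) = (if j = i then 1 else 0)"
    proof cases
      case 1
      have "cp w (l j) = (if j = i then 1 else 0)" if j: "1 \<le> j" "j \<le> n" for j
        using w[of j] w[of "Suc j"] w[of n] w[of "n - 1"] last[of w] chn[of j w] 1 n2 j by (cases "j = n") auto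
      then show ?thesis by blast
    next
      case 2
      have "cp (w - E n) (l j) = (if j = i then 1 else 0)" if j: "1 \<le> j" "j \<le> n" for j
        using w[of j] w[of "Suc j"] w[of n] w[of "n - 1"] En[of j] En[of "Suc j"] En[of n] En[of "n - 1"]
          last[of "w - E n"] chn[of j "w - E n"] 2 n2 j
        by (cases "j = n") auto
      then show ?thesis by blast
    next
      case 3
      have "cp (P i) (l j) = (if j = i then 1 else 0)" if j: "1 \<le> j" "j \<le> n" for j
        using P[of j i] P[of "Suc j" i] P[of n i] P[of "n - 1" i] last[of "P i"] chn[of j "P i"] 3 n2 j
        by (cases "j = n") (auto split: if_splits)
      then show ?thesis by blast
    qed
  qed
qed

text \<open>The \<open>\<epsilon>\<^sub>i\<close> are roots of type \<open>B\<close>. They span \<open>X\<close> unless \<open>X\<close> contains a half-integral vector.\<close>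

lemma B_isogeny: assumes s: "\<sigma> = 2" and f: "\<not> forked" shows "adjoint_type R \<or> simply_connected_type R"
proof -
  obtain E where E: "frame E" "\<And>i. i \<in> {1..n} \<Longrightarrow> E i \<in> \<Phi>" using unforked_frame[OF f] by blast
  show ?thesis
  proof (cases "\<forall>x. \<forall>k\<in>{1..n}. even (\<theta> k x)")
    case True
    have "x \<in> QL" for x
    proof -
      have "(\<Sum>i\<in>{1..n}. zmult (\<theta> i x div 2) (E i)) \<in> QL"
        using E(2) root_in_QL by (intro zmod.span_sum zmod.span_scale) blast
      then show ?thesis using frame_expand[OF E(1), of x] True by simp
    qed
    then show ?thesis using adjoint_iff by blast
  qed (use spin_sc[OF s E(1)] in blast)
qed

lemma adjoint_even: assumes s: "\<sigma> = 2" and ad: "adjoint_type R" shows "\<forall>x. \<forall>k\<in>{1..n}. even (\<theta> k x)"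
proof (intro allI ballI)
  fix x k assume k: "k \<in> {1..n}"
  have "x \<in> zmod.span \<Phi>" using ad unfolding adjoint_type_def by simp
  then show "even (\<theta> k x)"
  proof (induction rule: zmod.span_induct_alt)
    case (step c a b)
    have "even (\<theta> k a)" by (rule theta_even[OF s step(1) k])
    then show ?case using step by simp
  qed simp
qed

text \<open>The first fundamental weight is \<open>\<epsilon>\<^sub>1\<close>, and \<open>\<epsilon>\<^sub>i = \<epsilon>\<^sub>1 - (\<epsilon>\<^sub>1 - \<epsilon>\<^sub>i)\<close>.\<close>

lemma D_frame:
  assumes f: forked and w: "\<And>j. j \<in> {1..n} \<Longrightarrow> cp \<omega> (l j) = (if j = 1 then 1 else 0)"
  obtains E where "frame E" "\<And>i. i \<in> {1..n} \<Longrightarrow> E i \<in> zmod.span (insert \<omega> \<Phi>)" "E 1 = \<omega>"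
proof -
  have s: "\<sigma> = 2" and n3: "3 \<le> n" using last_forked[OF f] by auto
  have c: "\<theta> k \<omega> = \<theta> n \<omega>" if "2 \<le> k" "k \<le> n" for k using that(2,1)
  proof (induction k rule: inc_induct)
    case (step m)
    then have "\<theta> m \<omega> - \<theta> (Suc m) \<omega> = 0" using cp_chain[of m \<omega>] w[of m] by simp
    then show ?case using step by simp
  qed simp
  have "2 * cp \<omega> (l n) = \<theta> (n - 1) \<omega> + \<theta> n \<omega>" by (rule cp_last_forked[OF f])
  then have "\<theta> n \<omega> = 0" using c[of "n - 1"] w[of n] n3 by simp
  moreover have "\<theta> 1 \<omega> - \<theta> (Suc 1) \<omega> = 2" using cp_chain[of 1 \<omega>] w[of 1] s n3 by simp
  ultimately have tw: "\<theta> k \<omega> = (if k = 1 then 2 else 0)" if "k \<in> {1..n}" for k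
    using c[of k] c[of 2] that n3 by (cases "k = 1") (auto simp: numeral_2_eq_2)
  have "\<forall>i\<in>{1..n}. \<exists>e. e \<in> zmod.span (insert \<omega> \<Phi>) \<and> (\<forall>k\<in>{1..n}. \<theta> k e = (if k = i then 2 else 0)) \<and> (i = 1 \<longrightarrow> e = \<omega>)"
  proof
    fix i assume i: "i \<in> {1..n}"
    show "\<exists>e. e \<in> zmod.span (insert \<omega> \<Phi>) \<and> (\<forall>k\<in>{1..n}. \<theta> k e = (if k = i then 2 else 0)) \<and> (i = 1 \<longrightarrow> e = \<omega>)"
    proof (cases "i = 1")
      case True then show ?thesis using tw by (intro exI[of _ \<omega>]) (auto intro: zmod.span_base)
    next
      case False
      obtain \<alpha> where a: "\<alpha> \<in> \<Phi>" "\<forall>k\<in>{1..n}. \<theta> k \<alpha> = unit2 1 1 (-1) i k"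
        using realized_minus[of 1 i] i False unfolding realized_def by auto
      have "\<omega> - \<alpha> \<in> zmod.span (insert \<omega> \<Phi>)" using a by (intro zmod.span_diff zmod.span_base) auto
      moreover have "\<theta> k (\<omega> - \<alpha>) = (if k = i then 2 else 0)" if k: "k \<in> {1..n}" for k
        using tw[OF k] bspec[OF a(2) k] s False unfolding theta_simps unit2_def by (simp split: if_splits)
      ultimately show ?thesis using False by blast
    qed
  qed
  from bchoice[OF this] obtain E where E: "\<forall>i\<in>{1..n}. E i \<in> zmod.span (insert \<omega> \<Phi>) \<and>
    (\<forall>k\<in>{1..n}. \<theta> k (E i) = (if k = i then 2 else 0)) \<and> (i = 1 \<longrightarrow> E i = \<omega>)" by blast
  have "1 \<in> {1..n}" using n2 by simp
  from bspec[OF E this] have "E 1 = \<omega>" by blast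
  moreover have "frame E" unfolding frame_def using E by blast
  ultimately show thesis using E by (intro that[of E]) blast+
qed

lemma D_span_even:
  assumes f: forked and w: "\<And>j. j \<in> {1..n} \<Longrightarrow> cp \<omega> (l j) = (if j = 1 then 1 else 0)"
    and sp: "zmod.span (insert \<omega> \<Phi>) = UNIV"
  shows "\<forall>x. \<forall>k\<in>{1..n}. even (\<theta> k x)"
proof (intro allI ballI)
  have s: "\<sigma> = 2" using last_forked[OF f] by auto
  obtain E where E: "frame E" "E 1 = \<omega>" using D_frame[OF f w] by metis
  fix x k assume k: "k \<in> {1..n}"
  have "x \<in> zmod.span (insert \<omega> \<Phi>)" using sp by simp
  then show "even (\<theta> k x)"
  proof (induction rule: zmod.span_induct_alt)
    case (step c a b)
    have "even (\<theta> k a)"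
    proof (cases "a \<in> \<Phi>")
      case True show ?thesis by (rule theta_even[OF s True k])
    next
      case False
      then have "a = E 1" using step E by auto
      then show ?thesis using E(1) k n2 unfolding frame_def by auto
    qed
    then show ?case using step by simp
  qed simp
qed

text \<open>The \<open>\<epsilon>\<^sub>i\<close> are combinations of \<open>\<omega>\<close> and roots. They span \<open>X\<close> unless \<open>X\<close> contains a half-integral vector.\<close>

lemma D_isogeny_cases:
  assumes f: forked and w: "\<And>j. j \<in> {1..n} \<Longrightarrow> cp \<omega> (l j) = (if j = 1 then 1 else 0)"
  shows "zmod.span (insert \<omega> \<Phi>) = UNIV \<or> simply_connected_type R"
proof -
  have s: "\<sigma> = 2" using last_forked[OF f] by auto
  obtain E where E: "frame E" "\<And>i. i \<in> {1..n} \<Longrightarrow> E i \<in> zmod.span (insert \<omega> \<Phi>)" using D_frame[OF f w] by metis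
  show ?thesis
  proof (cases "\<forall>x. \<forall>k\<in>{1..n}. even (\<theta> k x)")
    case True
    have "x \<in> zmod.span (insert \<omega> \<Phi>)" for x
    proof -
      have "(\<Sum>i\<in>{1..n}. zmult (\<theta> i x div 2) (E i)) \<in> zmod.span (insert \<omega> \<Phi>)"
        using E(2) by (intro zmod.span_sum zmod.span_scale) blast
      then show ?thesis using frame_expand[OF E(1), of x] True by simp
    qed
    then show ?thesis by blast
  qed (use spin_sc[OF s E(1)] in blast)
qed

text \<open>The sum of the coordinates detects the root lattice: in type \<open>C\<close> it is even there, and in type \<open>D\<close>,
  where the coordinates are doubled, these are even and the sum is divisible by 4.\<close>

definition total where "total x = (\<Sum>k\<in>{1..n}. \<theta> k x)"

lemma total_simps: "total (a + b) = total a + total b" "total (a - b) = total a - total b"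
    "total (zmult c a) = c * total a" "total 0 = 0"
  by (simp_all add: total_def sum.distrib sum_subtractf sum_distrib_left)

lemma total_supp: "total x = (\<Sum>k\<in>supp x. \<theta> k x)"
  unfolding total_def by (rule sum.mono_neutral_right) (auto simp: supp_def)

lemma total_root: assumes "\<alpha> \<in> \<Phi>" shows "2 * \<sigma> dvd total \<alpha> \<or> \<not> forked \<and> 2 dvd total \<alpha>"
proof -
  have sh: "\<bar>\<theta> k \<alpha>\<bar> = amp (supp \<alpha>)" if "k \<in> supp \<alpha>" for k
  proof -
    have "k \<in> {1..n}" using that supp_subset by blast
    then show ?thesis using root_shape[OF assms] that by simp
  qed
  show ?thesis
  proof (cases "card (supp \<alpha>) = 1")
    case True
    then have nf: "\<not> forked" using card_supp(2)[OF assms] by auto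
    obtain i where i: "supp \<alpha> = {i}" using True by (auto simp: card_1_singleton_iff)
    have "\<bar>total \<alpha>\<bar> = 2" unfolding total_supp using sh[of i] True i by (simp add: amp_def)
    then have "even \<bar>total \<alpha>\<bar>" by simp
    then show ?thesis using nf by simp
  next
    case False
    then have "card (supp \<alpha>) = 2" using card_supp(1)[OF assms] by simp
    then obtain i j where ij: "supp \<alpha> = {i, j}" "i \<noteq> j" by (auto simp: card_2_iff)
    have "\<bar>\<theta> i \<alpha>\<bar> = \<sigma>" "\<bar>\<theta> j \<alpha>\<bar> = \<sigma>" using sh[of i] sh[of j] ij False by (auto simp: amp_def)
    then have "total \<alpha> \<in> {2 * \<sigma>, 0, - (2 * \<sigma>)}" unfolding total_supp using ij by auto
    then show ?thesis by auto
  qed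
qed

text \<open>Subtracting the roots \<open>\<epsilon>\<^sub>i - \<epsilon>\<^sub>n\<close> collects all coordinates in the last one.\<close>

lemma realized_total:
  assumes x: "\<And>k. k \<in> {1..n} \<Longrightarrow> \<sigma> dvd \<theta> k x"
  obtains q where "q \<in> QL" "\<And>k. k \<in> {1..n} \<Longrightarrow> \<theta> k (x - q) = (if k = n then total x else 0)"
proof -
  have "\<exists>\<alpha>. \<alpha> \<in> \<Phi> \<and> (\<forall>k\<in>{1..n}. \<theta> k \<alpha> = unit2 1 i (-1) n k)" if "i \<in> {1..<n}" for i
    using realized_minus[of i n] that unfolding realized_def by auto
  then have "\<forall>i\<in>{1..<n}. \<exists>\<alpha>. \<alpha> \<in> \<Phi> \<and> (\<forall>k\<in>{1..n}. \<theta> k \<alpha> = unit2 1 i (-1) n k)" by blast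
  from bchoice[OF this] obtain r where
    R: "\<forall>i\<in>{1..<n}. r i \<in> \<Phi> \<and> (\<forall>k\<in>{1..n}. \<theta> k (r i) = unit2 1 i (-1) n k)" by blast
  have r: "\<And>i. i \<in> {1..<n} \<Longrightarrow> r i \<in> \<Phi>"
    "\<And>i k. i \<in> {1..<n} \<Longrightarrow> k \<in> {1..n} \<Longrightarrow> \<theta> k (r i) = unit2 1 i (-1) n k" using R by blast+
  define q where "q = (\<Sum>i\<in>{1..<n}. zmult (\<theta> i x div \<sigma>) (r i))"
  have qQ: "q \<in> QL" unfolding q_def using r(1) root_in_QL by (intro zmod.span_sum zmod.span_scale) blast
  have n_split: "{1..n} = insert n {1..<n}" using n2 by auto
  have "\<theta> k q = (if k = n then - (\<Sum>i\<in>{1..<n}. \<theta> i x) else \<theta> k x)" if k: "k \<in> {1..n}" for k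
  proof (cases "k = n")
    case True
    have "\<theta> k q = (\<Sum>i\<in>{1..<n}. - \<theta> i x)" unfolding q_def theta_simps
      by (rule sum.cong) (use True r(2) k x in \<open>auto simp: unit2_def\<close>)
    then show ?thesis using True by (simp add: sum_negf)
  next
    case False
    have "\<theta> k q = (\<Sum>i\<in>{1..<n}. if i = k then \<theta> k x else 0)" unfolding q_def theta_simps
      by (rule sum.cong) (use False r(2) k x in \<open>auto simp: unit2_def\<close>)
    then show ?thesis using False k by simp
  qed
  then have "\<theta> k (x - q) = (if k = n then total x else 0)" if "k \<in> {1..n}" for k
    using that unfolding total_def n_split by simp
  then show thesis using that qQ by blast
qed

lemma level_theta:
  assumes s: "\<sigma> = 1" and k: "k \<in> {1..n}"
  shows "\<alpha> \<in> level 1 \<Longrightarrow> \<bar>\<theta> k \<alpha>\<bar> = (if k \<in> supp \<alpha> then 2 else 0)"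
    "\<alpha> \<in> level 2 \<Longrightarrow> \<bar>\<theta> k \<alpha>\<bar> = (if k \<in> supp \<alpha> then 1 else 0)"
  using root_shape[of \<alpha>, unfolded amp_def] s k by (auto simp: level_def)

lemma even_if_abs: "\<bar>a\<bar> = (if P then 2 else 0) \<Longrightarrow> even a" "\<bar>a\<bar> = (if P then 1 else 0) \<Longrightarrow> odd a \<longleftrightarrow> P" for a :: int
proof -
  show "even a" if "\<bar>a\<bar> = (if P then 2 else 0)"
  proof -
    have "even \<bar>a\<bar>" unfolding that by simp
    then show ?thesis by simp
  qed
  show "odd a \<longleftrightarrow> P" if "\<bar>a\<bar> = (if P then 1 else 0)"
  proof -
    have "odd \<bar>a\<bar> \<longleftrightarrow> P" unfolding that by simp
    then show ?thesis by simp
  qed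
qed

lemma level_parity:
  assumes s: "\<sigma> = 1" and k: "k \<in> {1..n}"
  shows "\<alpha> \<in> level 1 \<Longrightarrow> even (\<theta> k \<alpha>)" "\<alpha> \<in> level 2 \<Longrightarrow> odd (\<theta> k \<alpha>) \<longleftrightarrow> k \<in> supp \<alpha>"
  using even_if_abs(1)[OF level_theta(1)[OF s k]] even_if_abs(2)[OF level_theta(2)[OF s k]] by blast+

lemma levels: "\<not> forked \<Longrightarrow> \<Phi> = level 1 \<union> level 2" "level 1 \<inter> level 2 = {}" "finite (level m)"
proof -
  show "\<Phi> = level 1 \<union> level 2" if "\<not> forked" using trans[OF roots_levels if_not_P[OF that]] .
  show "level 1 \<inter> level 2 = {}" by (auto simp: level_def)
  show "finite (level m)" by (simp add: level_def)
qed

lemma card_levels: "\<not> forked \<Longrightarrow> card (level 1) = 2 * n" "card (level 2) = 4 * (n choose 2)"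
  using fibres_sum[OF levels(3), of supp 1] level1_fibres fibres_sum[OF levels(3), of supp 2] level2_fibres by auto

lemma congr_even: assumes "congr 2 x x'" shows "even (\<theta> k x - \<theta> k x')"
proof -
  obtain v where "x - x' = zmult 2 v" using assms unfolding congr_def by blast
  from arg_cong[OF this, of "\<theta> k"] show ?thesis by simp
qed

lemma congr_supp_C:
  assumes s: "\<sigma> = 1" and a: "\<alpha> \<in> level 2" and b: "\<beta> \<in> level 2" and c: "congr 2 \<alpha> \<beta>"
  shows "supp \<alpha> = supp \<beta>"
proof -
  have "k \<in> supp \<alpha> \<longleftrightarrow> k \<in> supp \<beta>" if k: "k \<in> {1..n}" for k
  proof -
    have "odd (\<theta> k \<alpha>) \<longleftrightarrow> odd (\<theta> k \<beta>)" using congr_even[OF c, of k] by simp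
    then show ?thesis using level_parity(2)[OF s k a] level_parity(2)[OF s k b] by simp
  qed
  then show ?thesis using supp_subset by blast
qed

lemma level2_odd: assumes s: "\<sigma> = 1" and b: "\<beta> \<in> level 2" obtains k where "k \<in> {1..n}" "odd (\<theta> k \<beta>)"
proof -
  have "supp \<beta> \<noteq> {}" using b by (auto simp: level_def)
  then obtain k where k: "k \<in> supp \<beta>" "k \<in> {1..n}" using supp_subset by blast
  then show thesis using that level_parity(2)[OF s k(2) b] by blast
qed

text \<open>As the simple coroots are integral combinations of the coordinates, elements of \<open>X\<close> whose coordinates
  agree modulo 2 are congruent modulo \<open>2X\<close>. The long roots \<open>\<plusminus>2 \<epsilon>\<^sub>i\<close> have even coordinates, and the parities of the
  coordinates of a short root are given by its support.\<close>

lemma C_simply_connected: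
  assumes s: "\<sigma> = 1" and nf: "\<not> forked" and sc: "simply_connected_type R"
  shows "has_mults 2 {#2 * n#} (replicate_mset (n choose 2) 4)"
proof -
  have congr: "congr 2 x x'" if e: "\<And>k. k \<in> {1..n} \<Longrightarrow> even (\<theta> k x - \<theta> k x')" for x x'
  proof (rule simply_connected_congr[OF sc])
    fix \<delta> assume "\<delta> \<in> \<Delta>"
    then obtain i where i: "1 \<le> i" "i \<le> n" "\<delta> = l i" by (rule l_surj)
    show "2 dvd cp x \<delta> - cp x' \<delta>"
    proof (cases "i = n")
      case True
      then show ?thesis using e[of n] i cp_last_unforked[OF nf] by simp
    next
      case False
      then have "cp x \<delta> - cp x' \<delta> = (\<theta> i x - \<theta> i x') - (\<theta> (Suc i) x - \<theta> (Suc i) x')"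
        using cp_chain[of i x] cp_chain[of i x'] i s by simp
      moreover have "even ((\<theta> i x - \<theta> i x') - (\<theta> (Suc i) x - \<theta> (Suc i) x'))"
        by (rule dvd_diff) (use e[of i] e[of "Suc i"] i False in auto)
      ultimately show ?thesis by simp
    qed
  qed
  have null1: "congr 2 \<alpha> 0" if "\<alpha> \<in> level 1" for \<alpha>
    by (rule congr) (use level_parity(1)[OF s _ that] in simp)
  have null2: "\<not> congr 2 \<alpha> 0" if a: "\<alpha> \<in> level 2" for \<alpha>
  proof
    assume c: "congr 2 \<alpha> 0"
    obtain k where "k \<in> {1..n}" "odd (\<theta> k \<alpha>)" using level2_odd[OF s a] .
    then show False using congr_even[OF c, of k] by simp
  qed
  have null: "null_roots 2 = level 1" "\<Phi> - null_roots 2 = level 2"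
    using null1 null2 levels(2) unfolding null_roots_def levels(1)[OF nf] by blast+
  have "fibres (residue 2) (level 1) = {#card (level 1)#}"
  proof (rule fibres_single[OF levels(3)])
    show "level 1 \<noteq> {}" using card_levels(1)[OF nf] n2 by auto
    fix a b assume "a \<in> level 1" "b \<in> level 1"
    then show "residue 2 a = residue 2 b" unfolding residue_eq using null1 congr_sym congr_trans by blast
  qed
  moreover have "fibres (residue 2) (level 2) = fibres supp (level 2)"
  proof (rule fibres_cong[OF levels(3)])
    fix a b assume ab: "a \<in> level 2" "b \<in> level 2"
    have "congr 2 a b" if "supp a = supp b"
    proof (rule congr)
      fix k assume k: "k \<in> {1..n}"
      show "even (\<theta> k a - \<theta> k b)" using level_parity(2)[OF s k ab(1)] level_parity(2)[OF s k ab(2)] that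
        by (cases "k \<in> supp b") simp_all
    qed
    then show "residue 2 a = residue 2 b \<longleftrightarrow> supp a = supp b"
      unfolding residue_eq using congr_supp_C[OF s ab] by blast
  qed
  ultimately show ?thesis unfolding has_mults_def using null card_levels(1)[OF nf] level2_fibres by simp
qed

text \<open>Here the total of every element is even, so the totals of congruent elements agree modulo 4. Long roots
  have total \<open>\<plusminus>2\<close> and do not lie in \<open>2X\<close>, but any two of them are congruent, since half the difference of
  \<open>2 \<epsilon>\<^sub>i\<close> and \<open>2 \<epsilon>\<^sub>j\<close> is a root. Congruent short roots have the same support, and their totals decide whether
  they are equal up to sign.\<close>

lemma C_adjoint:
  assumes s: "\<sigma> = 1" and nf: "\<not> forked" and ad: "adjoint_type R"
  shows "has_mults 2 {#} ({#2 * n#} + replicate_mset (n * (n - 1)) 2)"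
proof -
  have tot: "even (total x)" for x
  proof -
    have "x \<in> zmod.span \<Phi>" using ad unfolding adjoint_type_def by simp
    then show ?thesis
    proof (induction rule: zmod.span_induct_alt)
      case (step c a b)
      have "even (total a)" using total_root[OF step(1)] s by auto
      then show ?case using step by (simp add: total_simps)
    qed (simp add: total_simps)
  qed
  have mod4: "4 dvd total x - total x'" if "congr 2 x x'" for x x'
  proof -
    obtain v where v: "x - x' = zmult 2 v" using \<open>congr 2 x x'\<close> unfolding congr_def by blast
    have "total x - total x' = 2 * total v" using arg_cong[OF v, of total] by (simp add: total_simps)
    moreover obtain m where "total v = 2 * m" using tot[of v] by (rule evenE)
    ultimately show ?thesis by simp
  qed
  have l1: "\<exists>i. supp \<alpha> = {i} \<and> i \<in> {1..n} \<and> (\<theta> i \<alpha> = 2 \<or> \<theta> i \<alpha> = - 2) \<and> (\<forall>k\<in>{1..n}. k \<noteq> i \<longrightarrow> \<theta> k \<alpha> = 0)"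
    if a: "\<alpha> \<in> level 1" for \<alpha>
  proof -
    obtain i where i: "supp \<alpha> = {i}" using a by (auto simp: level_def card_1_singleton_iff)
    then have i_n: "i \<in> {1..n}" using supp_subset[of \<alpha>] by simp
    have "\<bar>\<theta> i \<alpha>\<bar> = 2" using level_theta(1)[OF s i_n a] i by simp
    moreover have "\<theta> k \<alpha> = 0" if "k \<in> {1..n}" "k \<noteq> i" for k using level_theta(1)[OF s that(1) a] i that(2) by simp
    ultimately show ?thesis using i i_n by (intro exI[of _ i]) auto
  qed
  have n1: "\<not> congr 2 \<alpha> 0" if a: "\<alpha> \<in> level 1" for \<alpha>
  proof
    assume c: "congr 2 \<alpha> 0"
    obtain i where "supp \<alpha> = {i}" "\<theta> i \<alpha> = 2 \<or> \<theta> i \<alpha> = - 2" using l1[OF a] by blast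
    then have "total \<alpha> = 2 \<or> total \<alpha> = - 2" by (simp add: total_supp)
    then show False using mod4[OF c] by (auto simp: total_simps)
  qed
  have n2': "\<not> congr 2 \<alpha> 0" if a: "\<alpha> \<in> level 2" for \<alpha>
  proof
    assume c: "congr 2 \<alpha> 0"
    obtain k where "k \<in> {1..n}" "odd (\<theta> k \<alpha>)" using level2_odd[OF s a] .
    then show False using congr_even[OF c, of k] by simp
  qed
  have null: "null_roots 2 = {}" using n1 n2' unfolding null_roots_def levels(1)[OF nf] by blast
  have c11: "congr 2 \<alpha> \<beta>" if a: "\<alpha> \<in> level 1" and b: "\<beta> \<in> level 1" for \<alpha> \<beta>
  proof -
    obtain i where i: "i \<in> {1..n}" "\<theta> i \<alpha> = 2 \<or> \<theta> i \<alpha> = - 2" "\<forall>k\<in>{1..n}. k \<noteq> i \<longrightarrow> \<theta> k \<alpha> = 0" using l1[OF a] by blast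
    obtain j where j: "j \<in> {1..n}" "\<theta> j \<beta> = 2 \<or> \<theta> j \<beta> = - 2" "\<forall>k\<in>{1..n}. k \<noteq> j \<longrightarrow> \<theta> k \<beta> = 0" using l1[OF b] by blast
    show ?thesis
    proof (cases "i = j")
      case True
      have z: "\<theta> k \<alpha> = 0" "\<theta> k \<beta> = 0" if "k \<in> {1..n}" "k \<noteq> i" for k
        using bspec[OF i(3) that(1)] bspec[OF j(3) that(1)] that(2) True by simp_all
      have "\<theta> i \<beta> = \<theta> i \<alpha> \<or> \<theta> i \<beta> = - \<theta> i \<alpha>" using i(2) j(2) unfolding True by auto
      then show ?thesis
      proof
        assume e: "\<theta> i \<beta> = \<theta> i \<alpha>"
        have "\<beta> = \<alpha>"
        proof (rule theta_inj)
          fix k assume "1 \<le> k" "k \<le> n"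
          then show "\<theta> k \<beta> = \<theta> k \<alpha>" using z[of k] e by (cases "k = i") simp_all
        qed
        then show ?thesis by (simp only: congr_refl)
      next
        assume e: "\<theta> i \<beta> = - \<theta> i \<alpha>"
        have "\<beta> = - \<alpha>"
        proof (rule theta_inj)
          fix k assume "1 \<le> k" "k \<le> n"
          then show "\<theta> k \<beta> = \<theta> k (- \<alpha>)" using z[of k] e by (cases "k = i") simp_all
        qed
        then show ?thesis by (simp only: congr_neg_two)
      qed
    next
      case False
      define u w where "u = \<theta> i \<alpha> div 2" and "w = - (\<theta> j \<beta> div 2)"
      have uw: "u = 1 \<or> u = -1" "w = 1 \<or> w = -1" "\<theta> i \<alpha> = 2 * u" "\<theta> j \<beta> = - 2 * w"
        using i(2) j(2) by (auto simp: u_def w_def)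
      obtain v where v: "\<forall>k\<in>{1..n}. \<theta> k v = unit2 u i w j k"
        using realized_unit2[OF i(1) j(1) False uw(1,2)] unfolding realized_def by blast
      have "\<alpha> - \<beta> = zmult 2 v"
      proof (rule theta_inj)
        fix k assume "1 \<le> k" "k \<le> n"
        then have k: "k \<in> {1..n}" by simp
        have "\<theta> k v = (if k = i then u * \<sigma> else if k = j then w * \<sigma> else 0)"
          using bspec[OF v k] unfolding unit2_def .
        then have vk: "\<theta> k v = (if k = i then u else if k = j then w else 0)" unfolding s by simp
        have za: "k \<noteq> i \<Longrightarrow> \<theta> k \<alpha> = 0" and zb: "k \<noteq> j \<Longrightarrow> \<theta> k \<beta> = 0"
          using bspec[OF i(3) k] bspec[OF j(3) k] by simp_all
        show "\<theta> k (\<alpha> - \<beta>) = \<theta> k (zmult 2 v)"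
        proof (cases "k = i")
          case True
          then have "\<theta> k \<beta> = 0" using zb False by simp
          then show ?thesis using vk True uw(3) by simp
        next
          case ki: False
          have "\<theta> k \<alpha> = 0" using za ki by simp
          then show ?thesis using vk ki zb uw(4) by (cases "k = j") simp_all
        qed
      qed
      then show ?thesis unfolding congr_def by blast
    qed
  qed
  have c12: "\<not> congr 2 \<alpha> \<beta>" if a: "\<alpha> \<in> level 1" and b: "\<beta> \<in> level 2" for \<alpha> \<beta>
  proof
    assume c: "congr 2 \<alpha> \<beta>"
    obtain k where k: "k \<in> {1..n}" "odd (\<theta> k \<beta>)" using level2_odd[OF s b] .
    then show False using congr_even[OF c, of k] level_parity(1)[OF s k(1) a] by simp
  qed
  have c22: "\<beta> = \<alpha> \<or> \<beta> = - \<alpha>" if a: "\<alpha> \<in> level 2" and b: "\<beta> \<in> level 2" and c: "congr 2 \<alpha> \<beta>" for \<alpha> \<beta>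
  proof -
    have S: "supp \<alpha> = supp \<beta>" by (rule congr_supp_C[OF s a b c])
    obtain i j where ij: "supp \<beta> = {i, j}" "i \<noteq> j" using b by (auto simp: level_def card_2_iff)
    have n: "i \<in> {1..n}" "j \<in> {1..n}" using ij(1) supp_subset[of \<beta>] by auto
    have v: "\<theta> i \<alpha> = 1 \<or> \<theta> i \<alpha> = - 1" "\<theta> j \<alpha> = 1 \<or> \<theta> j \<alpha> = - 1" "\<theta> i \<beta> = 1 \<or> \<theta> i \<beta> = - 1" "\<theta> j \<beta> = 1 \<or> \<theta> j \<beta> = - 1"
      using level_theta(2)[OF s n(1) a] level_theta(2)[OF s n(2) a] level_theta(2)[OF s n(1) b] level_theta(2)[OF s n(2) b]
      unfolding S ij(1) by auto
    have z: "\<theta> k \<alpha> = 0" "\<theta> k \<beta> = 0" if "k \<in> {1..n}" "k \<noteq> i" "k \<noteq> j" for k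
      using level_theta(2)[OF s that(1) a] level_theta(2)[OF s that(1) b] that(2,3) unfolding S ij(1) by auto
    have "total \<alpha> - total \<beta> = (\<theta> i \<alpha> + \<theta> j \<alpha>) - (\<theta> i \<beta> + \<theta> j \<beta>)" unfolding total_supp S ij(1) using ij(2) by simp
    then have "4 dvd (\<theta> i \<alpha> + \<theta> j \<alpha>) - (\<theta> i \<beta> + \<theta> j \<beta>)" using mod4[OF c] by simp
    then have "\<theta> i \<beta> = \<theta> i \<alpha> \<and> \<theta> j \<beta> = \<theta> j \<alpha> \<or> \<theta> i \<beta> = - \<theta> i \<alpha> \<and> \<theta> j \<beta> = - \<theta> j \<alpha>"
      using v by (elim disjE) simp_all
    then show ?thesis
    proof
      assume e: "\<theta> i \<beta> = \<theta> i \<alpha> \<and> \<theta> j \<beta> = \<theta> j \<alpha>"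
      have "\<beta> = \<alpha>"
      proof (rule theta_inj)
        fix k assume "1 \<le> k" "k \<le> n"
        then show "\<theta> k \<beta> = \<theta> k \<alpha>" using z[of k] e by (cases "k = i"; cases "k = j") simp_all
      qed
      then show ?thesis ..
    next
      assume e: "\<theta> i \<beta> = - \<theta> i \<alpha> \<and> \<theta> j \<beta> = - \<theta> j \<alpha>"
      have "\<beta> = - \<alpha>"
      proof (rule theta_inj)
        fix k assume "1 \<le> k" "k \<le> n"
        then show "\<theta> k \<beta> = \<theta> k (- \<alpha>)" using z[of k] e by (cases "k = i"; cases "k = j") simp_all
      qed
      then show ?thesis ..
    qed
  qed
  have "fibres (residue 2) \<Phi> = fibres (residue 2) (level 1) + fibres (residue 2) (level 2)"
    unfolding levels(1)[OF nf]
  proof (rule fibres_union[OF levels(3) levels(3)])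
    show "residue 2 ` level 1 \<inter> residue 2 ` level 2 = {}"
    proof (rule ccontr)
      assume "\<not> ?thesis"
      then obtain a b where "a \<in> level 1" "b \<in> level 2" "residue 2 a = residue 2 b" by blast
      then show False using c12 unfolding residue_eq by blast
    qed
  qed
  moreover have "fibres (residue 2) (level 1) = {#2 * n#}"
    unfolding card_levels(1)[OF nf, symmetric]
  proof (rule fibres_single[OF levels(3)])
    show "level 1 \<noteq> {}" using card_levels(1)[OF nf] n2 by auto
    fix a b assume "a \<in> level 1" "b \<in> level 1"
    then show "residue 2 a = residue 2 b" unfolding residue_eq by (rule c11)
  qed
  moreover have "fibres (residue 2) (level 2) = replicate_mset (n * (n - 1)) 2"
  proof -
    have f: "fibres (residue 2) (level 2) = replicate_mset (card (residue 2 ` level 2)) 2"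
    proof (rule fibres_const[OF levels(3)])
      fix r assume "r \<in> residue 2 ` level 2"
      then obtain \<alpha> where a: "\<alpha> \<in> level 2" "r = residue 2 \<alpha>" by blast
      have ar: "\<alpha> \<in> \<Phi>" using a by (simp add: level_def)
      have "supp (- \<alpha>) = supp \<alpha>" by (simp add: supp_def)
      then have "- \<alpha> \<in> level 2" using a(1) neg_root by (simp add: level_def)
      then have "{\<beta> \<in> level 2. residue 2 \<beta> = r} = {\<alpha>, - \<alpha>}"
        unfolding a(2) residue_eq using a(1) c22[OF a(1)] congr_sym congr_neg_two congr_refl by blast
      then show "card {\<beta> \<in> level 2. residue 2 \<beta> = r} = 2" using root_ne_neg[OF ar] by (simp add: card_insert_if)
    qed
    have "2 * card (residue 2 ` level 2) = 4 * (n choose 2)"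
      using fibres_sum[OF levels(3), of "residue 2" 2] unfolding f card_levels(2) by simp
    then have "card (residue 2 ` level 2) = 2 * (n * (n - 1) div 2)" by (simp add: choose_two)
    also have "\<dots> = n * (n - 1)" by (rule dvd_mult_div_cancel) (cases n, auto)
    finally show ?thesis using f by simp
  qed
  ultimately show ?thesis unfolding has_mults_def by (simp add: null)
qed

text \<open>\<open>\<epsilon>\<^sub>i\<close> is the sum of \<open>\<epsilon>\<^sub>n\<close> and the root \<open>\<epsilon>\<^sub>i - \<epsilon>\<^sub>n\<close>.\<close>

lemma frame_from_last:
  assumes w: "\<And>k. k \<in> {1..n} \<Longrightarrow> \<theta> k w = (if k = n then \<sigma> else 0)"
  shows "\<exists>E. \<forall>i\<in>{1..n}. \<forall>k\<in>{1..n}. \<theta> k (E i) = (if k = i then \<sigma> else 0)"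
proof -
  have "\<exists>x. \<forall>k\<in>{1..n}. \<theta> k x = (if k = i then \<sigma> else 0)" if i: "i \<in> {1..n}" for i
  proof (cases "i = n")
    case True then show ?thesis using w by blast
  next
    case False
    obtain r where r: "\<forall>k\<in>{1..n}. \<theta> k r = unit2 1 i (-1) n k"
      using realized_minus[of i n] i False unfolding realized_def by auto
    have "\<theta> k (w + r) = (if k = i then \<sigma> else 0)" if k: "k \<in> {1..n}" for k
      using w[OF k] bspec[OF r k] False by (simp add: unit2_def)
    then show ?thesis by blast
  qed
  then have "\<forall>i\<in>{1..n}. \<exists>x. \<forall>k\<in>{1..n}. \<theta> k x = (if k = i then \<sigma> else 0)" by blast
  from bchoice[OF this] show ?thesis by blast
qed

text \<open>The root lattice consists of the elements with even total. An element with odd total brings all \<open>\<epsilon>\<^sub>i\<close> into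
  \<open>X\<close>, and their partial sums are the fundamental weights.\<close>

lemma C_isogeny: assumes s: "\<sigma> = 1" and nf: "\<not> forked" shows "adjoint_type R \<or> simply_connected_type R"
proof -
  have ln: "\<theta> k (l n) = (if k = n then 2 else 0)" if "k \<in> {1..n}" for k using theta_last[of k] that nf by simp
  have lnQ: "l n \<in> QL" using l_simple[of n] n2 by (intro zmod.span_base) simp
  show ?thesis
  proof (cases "\<forall>x. even (total x)")
    case True
    have "x \<in> QL" for x
    proof -
      obtain q where q: "q \<in> QL" "\<And>k. k \<in> {1..n} \<Longrightarrow> \<theta> k (x - q) = (if k = n then total x else 0)"
        using realized_total[of x] s by auto
      have "x = q + zmult (total x div 2) (l n)"
      proof (rule theta_inj)
        fix k assume "1 \<le> k" "k \<le> n"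
        then have k: "k \<in> {1..n}" by simp
        have "total x div 2 * 2 = total x" using True by simp
        then show "\<theta> k x = \<theta> k (q + zmult (total x div 2) (l n))"
          using q(2)[OF k] ln[OF k] by (cases "k = n") simp_all
      qed
      also have "\<dots> \<in> QL" by (intro zmod.span_add zmod.span_scale q(1) lnQ)
      finally show ?thesis .
    qed
    then show ?thesis using adjoint_iff by blast
  next
    case False
    then obtain x where x: "odd (total x)" by blast
    obtain q where q: "q \<in> QL" "\<And>k. k \<in> {1..n} \<Longrightarrow> \<theta> k (x - q) = (if k = n then total x else 0)"
      using realized_total[of x] s by auto
    obtain m where m: "total x = 2 * m + 1" using x by (rule oddE)
    have "\<theta> k (x - q - zmult m (l n)) = (if k = n then \<sigma> else 0)" if k: "k \<in> {1..n}" for k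
      using q(2)[OF k] ln[OF k] m s by simp
    from frame_from_last[OF this] obtain E where
      E0: "\<forall>i\<in>{1..n}. \<forall>k\<in>{1..n}. \<theta> k (E i) = (if k = i then \<sigma> else 0)" by blast
    have E: "\<theta> k (E i) = (if k = i then 1 else 0)" if "i \<in> {1..n}" "k \<in> {1..n}" for i k
      using bspec[OF bspec[OF E0 that(1)] that(2)] s by simp
    define P where "P i = (\<Sum>m\<in>{1..n}. zmult (if m \<le> i then 1 else 0) (E m))" for i
    have P: "\<theta> k (P i) = (if k \<le> i then 1 else 0)" if k: "k \<in> {1..n}" for k i
    proof -
      have "\<theta> k (P i) = (\<Sum>m\<in>{1..n}. if m = k then (if k \<le> i then 1 else 0) else 0)"
        unfolding P_def theta_simps by (rule sum.cong) (use E k in auto)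
      then show ?thesis using k by simp
    qed
    have "simply_connected_type R"
    proof (rule weights_sc)
      fix i assume i: "1 \<le> i" "i \<le> n"
      have "cp (P i) (l j) = (if j = i then 1 else 0)" if j: "1 \<le> j" "j \<le> n" for j
        using P[of j i] P[of "Suc j" i] cp_last_unforked[OF nf, of "P i"] cp_chain[of j "P i"] s i j
        by (cases "j = n") (auto split: if_splits)
      then show "\<exists>\<omega>. \<forall>j. 1 \<le> j \<and> j \<le> n \<longrightarrow> cp \<omega> (l j) = (if j = i then 1 else 0)" by blast
    qed
    then show ?thesis ..
  qed
qed

section \<open>The index of the root lattice in type D\<close>

lemma root_index_classes: "root_index R = card (range (\<lambda>x. {x'. x - x' \<in> QL}))"
proof -
  have "UNIV // {(x, y). x - y \<in> QL} = range (\<lambda>x. {x'. x - x' \<in> QL})"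
    unfolding quotient_def by (auto simp: Image_def)
  then show ?thesis unfolding root_index_def span_roots by simp
qed

lemma class_eq: "{x'. x - x' \<in> QL} = {x'. z - x' \<in> QL} \<longleftrightarrow> x - z \<in> QL"
proof
  assume "{x'. x - x' \<in> QL} = {x'. z - x' \<in> QL}"
  moreover have "z \<in> {x'. z - x' \<in> QL}" by (simp add: zmod.span_zero)
  ultimately show "x - z \<in> QL" by blast
next
  assume d: "x - z \<in> QL"
  have "x - x' \<in> QL \<longleftrightarrow> z - x' \<in> QL" for x'
    using zmod.span_add_eq[OF d, of "z - x'"] by simp
  then show "{x'. x - x' \<in> QL} = {x'. z - x' \<in> QL}" by simp
qed

context
  assumes f: forked
begin

lemma s2: "\<sigma> = 2" using last_forked[OF f] by blast

lemma QL_total: "x \<in> QL \<Longrightarrow> k \<in> {1..n} \<Longrightarrow> even (\<theta> k x)" "x \<in> QL \<Longrightarrow> 4 dvd total x"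
proof -
  show "even (\<theta> k x)" if "x \<in> QL" "k \<in> {1..n}" using that(1)[folded span_roots]
  proof (induction rule: zmod.span_induct_alt)
    case (step c a b)
    have "even (\<theta> k a)" by (rule theta_even[OF s2 step(1) that(2)])
    then show ?case using step by simp
  qed simp
  show "4 dvd total x" if "x \<in> QL" using that[folded span_roots]
  proof (induction rule: zmod.span_induct_alt)
    case (step c a b)
    have "4 dvd total a" using total_root[OF step(1)] f s2 by simp
    then show ?case using step by (simp add: total_simps)
  qed (simp add: total_simps)
qed

lemma last_axis:
  obtains p where "p \<in> QL" "\<And>k. k \<in> {1..n} \<Longrightarrow> \<theta> k p = (if k = n then 4 else 0)"
proof -
  have n1: "1 < n" using n2 by simp
  obtain p p' where p: "p \<in> \<Phi>" "\<forall>k\<in>{1..n}. \<theta> k p = unit2 1 1 1 n k" "p' \<in> \<Phi>" "\<forall>k\<in>{1..n}. \<theta> k p' = unit2 1 1 (-1) n k"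
    using realized_plus[OF _ n1] realized_minus[OF _ n1] unfolding realized_def by auto
  have "p - p' \<in> QL" using root_in_QL p zmod.span_diff by blast
  moreover have "\<theta> k (p - p') = (if k = n then 4 else 0)" if k: "k \<in> {1..n}" for k
  proof -
    have "\<theta> k (p - p') = unit2 1 1 1 n k - unit2 1 1 (-1) n k" using bspec[OF p(2) k] bspec[OF p(4) k] by simp
    then show ?thesis unfolding unit2_def using n1 s2 by simp
  qed
  ultimately show thesis by (rule that)
qed

lemma reduce_to_last:
  assumes e: "\<And>k. k \<in> {1..n} \<Longrightarrow> even (\<theta> k x)"
  obtains q where "q \<in> QL" "\<And>k. k \<in> {1..n} \<Longrightarrow> \<theta> k (x - q) = (if k = n then total x mod 4 else 0)"
proof -
  obtain q where q: "q \<in> QL" "\<And>k. k \<in> {1..n} \<Longrightarrow> \<theta> k (x - q) = (if k = n then total x else 0)"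
    using realized_total[of x] e s2 by auto
  obtain p where p: "p \<in> QL" "\<And>k. k \<in> {1..n} \<Longrightarrow> \<theta> k p = (if k = n then 4 else 0)" using last_axis by blast
  have "q + zmult (total x div 4) p \<in> QL" by (intro zmod.span_add zmod.span_scale q(1) p(1))
  moreover have "\<theta> k (x - (q + zmult (total x div 4) p)) = (if k = n then total x mod 4 else 0)" if k: "k \<in> {1..n}" for k
    using q(2)[OF k] p(2)[OF k] by (simp add: algebra_simps minus_div_mult_eq_mod[symmetric])
  ultimately show thesis by (rule that)
qed

text \<open>The root lattice of type \<open>D\<^sub>n\<close> consists of the integral vectors with even sum of coordinates. In doubled
  coordinates the entries are even and the total is divisible by 4.\<close>

lemma in_QL: assumes e: "\<And>k. k \<in> {1..n} \<Longrightarrow> even (\<theta> k x)" and t: "4 dvd total x" shows "x \<in> QL"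
proof -
  obtain q where q: "q \<in> QL" "\<And>k. k \<in> {1..n} \<Longrightarrow> \<theta> k (x - q) = (if k = n then total x mod 4 else 0)"
    using reduce_to_last[OF e] by blast
  have "x = q"
  proof (rule theta_inj)
    fix k assume "1 \<le> k" "k \<le> n"
    then have "\<theta> k (x - q) = (if k = n then total x mod 4 else 0)" by (intro q(2)) simp
    also have "\<dots> = 0" using t by simp
    finally show "\<theta> k x = \<theta> k q" by simp
  qed
  then show ?thesis using q(1) by simp
qed

lemma even_total_mod: "(\<And>k. k \<in> {1..n} \<Longrightarrow> even (\<theta> k x)) \<Longrightarrow> even (total x)"
  unfolding total_def by (rule dvd_sum)

text \<open>If \<open>x\<close> represents the nontrivial class modulo the root lattice, then \<open>2x\<close> lies in the root lattice and the
  total of \<open>x\<close> is even. Three odd coordinates have an odd total; so \<open>x\<close> is integral for \<open>n = 3\<close>, and modulo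
  the root lattice it is \<open>\<epsilon>\<^sub>3\<close>.\<close>

lemma index_two_frame: assumes n3: "n = 3" and ix: "root_index R = 2" shows "\<exists>E. frame E"
proof -
  let ?c = "\<lambda>x. {x'. x - x' \<in> QL}"
  have c2: "card (range ?c) = 2" using ix root_index_classes by simp
  have "\<exists>x. ?c x \<noteq> ?c 0"
  proof (rule ccontr)
    assume "\<not> ?thesis"
    then have "range ?c = {?c 0}" by blast
    then show False using c2 by simp
  qed
  then obtain x where x: "?c x \<noteq> ?c 0" by blast
  then have xQ: "x \<notin> QL" using class_eq[of x 0] by simp
  have "x + x \<in> QL"
  proof (rule ccontr)
    assume "x + x \<notin> QL"
    then have "?c (x + x) \<noteq> ?c 0" using class_eq[of "x + x" 0] by simp
    moreover have "?c (x + x) \<noteq> ?c x" using class_eq[of "x + x" x] xQ by simp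
    ultimately have "card {?c 0, ?c x, ?c (x + x)} = 3" using x by auto
    moreover have "finite (range ?c)" using c2 by (intro card_ge_0_finite) simp
    then have "card {?c 0, ?c x, ?c (x + x)} \<le> card (range ?c)" by (rule card_mono) blast
    ultimately show False using c2 by simp
  qed
  from QL_total(2)[OF this] have "4 dvd 2 * total x" by (simp add: total_simps)
  then have et: "even (total x)" by (rule four_dvd_double)
  have tot3: "total x = \<theta> 1 x + \<theta> 2 x + \<theta> 3 x"
  proof -
    have i3: "{1..n} = {1, 2, 3}" using n3 by auto
    show ?thesis unfolding total_def i3 by simp
  qed
  have "\<not> (\<forall>k\<in>{1..n}. odd (\<theta> k x))"
  proof
    assume o: "\<forall>k\<in>{1..n}. odd (\<theta> k x)"
    have "odd (\<theta> 1 x)" "odd (\<theta> 2 x)" "odd (\<theta> 3 x)" by (rule bspec[OF o]; simp add: n3)+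
    then show False using et tot3 by simp
  qed
  then have e: "\<And>k. k \<in> {1..n} \<Longrightarrow> even (\<theta> k x)" using theta_parity[OF s2, of x] by blast
  have "\<not> 4 dvd total x" using in_QL[OF e] xQ by blast
  then have m: "total x mod 4 = 2" using et by presburger
  obtain q where q: "\<And>k. k \<in> {1..n} \<Longrightarrow> \<theta> k (x - q) = (if k = n then total x mod 4 else 0)"
    using reduce_to_last[OF e] by blast
  have "\<theta> k (x - q) = (if k = n then \<sigma> else 0)" if "k \<in> {1..n}" for k using q[OF that] m s2 by simp
  from frame_from_last[OF this] show ?thesis unfolding frame_def s2 .
qed

text \<open>If \<open>X\<close> consists of the integral vectors, its classes modulo the root lattice are those of 0 and \<open>\<epsilon>\<^sub>1\<close>, told
  apart by the total.\<close>

lemma index_two: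
  assumes E: "frame E" and e: "\<And>x k. k \<in> {1..n} \<Longrightarrow> even (\<theta> k x)"
  shows "root_index R = 2"
proof -
  let ?c = "\<lambda>x. {x'. x - x' \<in> QL}"
  define w where "w = E 1"
  have w: "\<theta> k w = (if k = 1 then 2 else 0)" if "k \<in> {1..n}" for k
    using E n2 that unfolding frame_def w_def by simp
  have tw: "total w = 2"
  proof -
    have "total w = (\<Sum>k\<in>{1..n}. if k = 1 then 2 else 0)" unfolding total_def
      by (rule sum.cong) (simp_all add: w)
    then show ?thesis using n2 by simp
  qed
  have "w \<notin> QL" using QL_total(2)[of w] tw by auto
  then have ne: "?c 0 \<noteq> ?c w" using class_eq[of w 0] by auto
  have "?c x = ?c 0 \<or> ?c x = ?c w" for x
  proof (cases "4 dvd total x")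
    case True
    have "x \<in> QL" by (rule in_QL[OF e True])
    then show ?thesis using class_eq[of x 0] by simp
  next
    case False
    have "even (total x)" by (rule even_total_mod) (rule e)
    then have "4 dvd total x - 2" using False by presburger
    then have "4 dvd total (x - w)" by (simp add: total_simps tw)
    then have "x - w \<in> QL" by (intro in_QL e)
    then show ?thesis using class_eq[of x w] by simp
  qed
  then have "range ?c = {?c 0, ?c w}" by blast
  then show ?thesis unfolding root_index_classes using ne by simp
qed

end

end

context irreducible_datum begin

section \<open>Coordinates from a Bourbaki labelling\<close>

text \<open>The elements \<open>y k\<close> are obtained recursively from \<open>y n\<close>. The matrix \<open>V\<close> contains the intended values of
  the simple roots on them, and the first condition on \<open>V\<close> says that these obey the same recursion.\<close>

lemma coordinates_from_labelling:
  assumes bij: "bij_betw l {1..n} \<Delta>" and n2: "2 \<le> n" and s: "\<sigma> = 1 \<or> \<sigma> = 2"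
    and C: "\<And>i j. 1 \<le> i \<Longrightarrow> i \<le> n \<Longrightarrow> 1 \<le> j \<Longrightarrow> j < n \<Longrightarrow> \<sigma> * cp (l i) (l j) = V i j - V i (Suc j)"
    and Vn: "\<And>i. 1 \<le> i \<Longrightarrow> i \<le> n \<Longrightarrow> pair R (l i) yn = V i n"
    and V1: "\<And>i k. 1 \<le> i \<Longrightarrow> i < n \<Longrightarrow> 1 \<le> k \<Longrightarrow> k \<le> n \<Longrightarrow> V i k = (if k = i then \<sigma> else if k = Suc i then - \<sigma> else 0)"
    and lf: "forked \<Longrightarrow> \<sigma> = 2 \<and> 3 \<le> n \<and> zmult 2 (coroot R (l (n - 1))) + yn + yn = zmult 2 (coroot R (l n)) \<and>
      (\<forall>k\<in>{1..n}. V n k = (if k = n \<or> k = n - 1 then 2 else 0))"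
    and lu: "\<not> forked \<Longrightarrow> yn = coroot R (l n) \<and> (\<forall>k\<in>{1..n}. V n k = (if k = n then 2 else 0))"
  shows "coordinates R \<Delta> n l (\<lambda>k. yn + (\<Sum>j\<in>{k..<n}. zmult \<sigma> (coroot R (l j)))) \<sigma> forked"
proof -
  let ?y = "\<lambda>k. yn + (\<Sum>j\<in>{k..<n}. zmult \<sigma> (coroot R (l j)))"
  have step: "?y k = ?y (Suc k) + zmult \<sigma> (coroot R (l k))" if "k < n" for k
    using sum.atLeast_Suc_lessThan[OF that, of "\<lambda>j. zmult \<sigma> (coroot R (l j))"] by (simp add: ac_simps)
  have yn: "?y n = yn" by simp
  have V: "pair R (l i) (?y k) = V i k" if i: "1 \<le> i" "i \<le> n" and k: "1 \<le> k" "k \<le> n" for i k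
    using k(2,1)
  proof (induction k rule: inc_induct)
    case base show ?case using Vn[OF i] by simp
  next
    case (step m)
    have "pair R (l i) (?y m) = pair R (l i) (?y (Suc m)) + \<sigma> * cp (l i) (l m)"
      unfolding \<open>\<And>k. k < n \<Longrightarrow> ?y k = ?y (Suc k) + zmult \<sigma> (coroot R (l k))\<close>[OF step(2)] by simp
    then show ?case using C[OF i, of m] step by simp
  qed
  show ?thesis
  proof
    show "?y k = ?y (Suc k) + zmult \<sigma> (coroot R (l k))" if "1 \<le> k" "k < n" for k using step that by blast
    show "pair R (l i) (?y k) = (if k = i then \<sigma> else if k = Suc i then - \<sigma> else 0)"
      if "1 \<le> i" "i < n" "1 \<le> k" "k \<le> n" for i k
      using V[of i k] V1[of i k] that by simp
    show "\<sigma> = 2 \<and> 3 \<le> n \<and> ?y (n - 1) + ?y n = zmult 2 (coroot R (l n)) \<and>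
      (\<forall>k\<in>{1..n}. pair R (l n) (?y k) = (if k = n \<or> k = n - 1 then 2 else 0))" if f: forked
    proof -
      have "Suc (n - 1) = n" using n2 by simp
      then have "?y (n - 1) = yn + zmult \<sigma> (coroot R (l (n - 1)))" using step[of "n - 1"] n2 by simp
      then show ?thesis using lf[OF f] V[of n] n2 by (auto simp: ac_simps)
    qed
    show "?y n = coroot R (l n) \<and> (\<forall>k\<in>{1..n}. pair R (l n) (?y k) = (if k = n then 2 else 0))" if f: "\<not> forked"
      using lu[OF f] V[of n] n2 by simp
  qed (rule bij n2 s)+
qed

lemma labelling_cp:
  assumes "bourbaki_labelling R \<Delta> T l" "dynkin_rank T = n" "1 \<le> i" "i \<le> n" "1 \<le> j" "j \<le> n"
  shows "cp (l i) (l j) = (if i = j then 2 else cartan_off T i j)"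
  using assms unfolding bourbaki_labelling_def by simp

lemma labelling_bij: "bourbaki_labelling R \<Delta> T l \<Longrightarrow> dynkin_rank T = n \<Longrightarrow> bij_betw l {1..n} \<Delta>"
  unfolding bourbaki_labelling_def by simp

lemma labelling_rank: "bourbaki_labelling R \<Delta> T l \<Longrightarrow> dynkin_rank T = n"
  unfolding bourbaki_labelling_def using card_simple bij_betw_same_card by fastforce

lemma coordinates_B:
  assumes lab: "bourbaki_labelling R \<Delta> (DynB n) l" and n2: "2 \<le> n"
  shows "\<exists>y. coordinates R \<Delta> n l y 2 False"
proof -
  note C = labelling_cp[OF lab dynkin_rank.simps(2)]
  define V :: "nat \<Rightarrow> nat \<Rightarrow> int" where
    "V i k = (if i = n then (if k = n then 2 else 0) else if k = i then 2 else if k = Suc i then - 2 else 0)" for i k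
  have "coordinates R \<Delta> n l (\<lambda>k. coroot R (l n) + (\<Sum>j\<in>{k..<n}. zmult 2 (coroot R (l j)))) 2 False"
    by (rule coordinates_from_labelling[where V = V])
      (use labelling_bij[OF lab] n2 in \<open>auto simp: C V_def chain_def\<close>)
  then show ?thesis by blast
qed

lemma coordinates_C:
  assumes lab: "bourbaki_labelling R \<Delta> (DynC n) l" and n2: "2 \<le> n"
  shows "\<exists>y. coordinates R \<Delta> n l y 1 False"
proof -
  note C = labelling_cp[OF lab dynkin_rank.simps(3)]
  define V :: "nat \<Rightarrow> nat \<Rightarrow> int" where
    "V i k = (if i = n then (if k = n then 2 else 0) else if k = i then 1 else if k = Suc i then - 1 else 0)" for i k
  have "coordinates R \<Delta> n l (\<lambda>k. coroot R (l n) + (\<Sum>j\<in>{k..<n}. zmult 1 (coroot R (l j)))) 1 False"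
    by (rule coordinates_from_labelling[where V = V])
      (use labelling_bij[OF lab] n2 in \<open>auto simp: C V_def chain_def\<close>)
  then show ?thesis by blast
qed

lemma coordinates_D:
  assumes lab: "bourbaki_labelling R \<Delta> (DynD n) l" and n3: "3 \<le> n"
  shows "\<exists>y. coordinates R \<Delta> n l y 2 True"
proof -
  note C = labelling_cp[OF lab dynkin_rank.simps(4)]
  define V :: "nat \<Rightarrow> nat \<Rightarrow> int" where
    "V i k = (if i = n then (if k = n \<or> k = n - 1 then 2 else 0) else if k = i then 2 else if k = Suc i then - 2 else 0)" for i k
  have "coordinates R \<Delta> n l (\<lambda>k. (coroot R (l n) - coroot R (l (n - 1))) + (\<Sum>j\<in>{k..<n}. zmult 2 (coroot R (l j)))) 2 True"
    by (rule coordinates_from_labelling[where V = V])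
      (use labelling_bij[OF lab] n3 in \<open>auto simp: C V_def chain_def zmult_two\<close>)
  then show ?thesis by blast
qed

end

section \<open>Types of small rank\<close>

text \<open>Vectors of coefficients with respect to the simple roots are lists. A list of positive roots is
  certified by two finite checks: it is closed under the simple reflections, as far as these
  preserve positivity, and every entry is a simple root or the reflection of an earlier entry.\<close>

definition entry where "entry T i j = (if i = j then 2 else cartan_off T (Suc i) (Suc j))"

definition lpair where "lpair T c j = (\<Sum>i\<leftarrow>[0..<length c]. c ! i * entry T i j)"

definition lrefl where "lrefl T j c = c[j := c ! j - lpair T c j]"

definition lunit where "lunit r j = map (\<lambda>i. if i = j then 1 else 0 :: int) [0..<r]"

definition root_list where
  "root_list T r P \<longleftrightarrow> distinct P \<and> list_all (\<lambda>c. length c = r \<and> list_all (\<lambda>x. 0 \<le> x) c \<and> list_ex (\<lambda>x. 0 < x) c) P \<and>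
    list_all (\<lambda>j. lunit r j \<in> set P) [0..<r] \<and>
    list_all (\<lambda>c. list_all (\<lambda>j. c = lunit r j \<or> lrefl T j c \<in> set P) [0..<r]) P \<and>
    list_all (\<lambda>i. list_ex (\<lambda>j. P ! i = lunit r j \<or> lrefl T j (P ! i) \<in> set (take i P)) [0..<r]) [0..<length P]"

definition with_negatives where "with_negatives P = P @ map (map uminus) P" for P :: "int list list"

definition ad_key where "ad_key p c = map (\<lambda>x. x mod p) c" for c :: "int list"

definition sc_key where "sc_key T p c = map (\<lambda>j. lpair T c j mod p) [0..<length c]"

definition fibre_sizes where "fibre_sizes ks = map (\<lambda>k. length (filter ((=) k) ks)) (remdups ks)"

lemma fibres_list: assumes "distinct F" shows "fibres K (set F) = mset (fibre_sizes (map K F))"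
proof -
  have "fibres K (set F) = image_mset (\<lambda>k. card {c \<in> set F. K c = k}) (mset (remdups (map K F)))"
    unfolding fibres_def mset_set_set[OF distinct_remdups, symmetric] by simp
  also have "\<dots> = image_mset (\<lambda>k. length (filter ((=) k) (map K F))) (mset (remdups (map K F)))"
  proof (rule image_mset_cong)
    fix k
    have "card {c \<in> set F. K c = k} = card (set (filter (\<lambda>c. K c = k) F))" by (rule arg_cong[of _ _ card]) auto
    also have "\<dots> = length (filter (\<lambda>c. K c = k) F)" using assms by (intro distinct_card distinct_filter)
    also have "\<dots> = length (filter ((=) k) (map K F))" by (simp add: filter_map comp_def eq_commute)
    finally show "card {c \<in> set F. K c = k} = length (filter ((=) k) (map K F))" .
  qed
  also have "\<dots> = mset (fibre_sizes (map K F))" by (simp add: fibre_sizes_def)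
  finally show ?thesis .
qed

locale small_rank = irreducible_datum R \<Delta> n
  for R :: "('x::ab_group_add, 'y::ab_group_add) root_data" and \<Delta> n +
  fixes l :: "nat \<Rightarrow> 'x" and T :: dynkin and P :: "int list list"
  assumes labelling: "bourbaki_labelling R \<Delta> T l" and P: "root_list T n P"
begin

definition \<rho> where "\<rho> c = (\<Sum>i<n. zmult (c ! i) (l (Suc i)))" for c :: "int list"

lemma bij: "bij_betw l {1..n} \<Delta>" by (rule labelling_bij[OF labelling labelling_rank[OF labelling]])

lemma l_simple: "i < n \<Longrightarrow> l (Suc i) \<in> \<Delta>" using bij_betwE[OF bij] by simp

lemma l_surj: assumes "\<delta> \<in> \<Delta>" obtains i where "i < n" "\<delta> = l (Suc i)"
proof -
  have "\<delta> \<in> l ` {1..n}" using bij assms by (simp add: bij_betw_def)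
  then obtain j where "1 \<le> j" "j \<le> n" "\<delta> = l j" by auto
  then show thesis using that[of "j - 1"] by simp
qed

lemma l_inj: "i < n \<Longrightarrow> j < n \<Longrightarrow> l (Suc i) = l (Suc j) \<longleftrightarrow> i = j"
  using inj_on_eq_iff[OF bij_betw_imp_inj_on[OF bij], of "Suc i" "Suc j"] by simp

lemma l_cp: "i < n \<Longrightarrow> j < n \<Longrightarrow> cp (l (Suc i)) (l (Suc j)) = entry T i j"
  using labelling_cp[OF labelling labelling_rank[OF labelling], of "Suc i" "Suc j"] by (simp add: entry_def)

lemma rho_QL: "\<rho> c \<in> QL" unfolding \<rho>_def
  by (intro zmod.span_sum zmod.span_scale zmod.span_base l_simple) simp

lemma cp_rho: "length c = n \<Longrightarrow> j < n \<Longrightarrow> cp (\<rho> c) (l (Suc j)) = lpair T c j"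
  unfolding \<rho>_def lpair_def pair_simps
  by (simp add: l_cp interv_sum_list_conv_sum_set_nat atLeast0LessThan)

lemma coef_rho: assumes j: "j < n" shows "coef (\<rho> c) (l (Suc j)) = c ! j"
proof -
  have gen: "coef (\<Sum>i\<in>A. zmult (c ! i) (l (Suc i))) (l (Suc j)) = (\<Sum>i\<in>A. if i = j then c ! j else 0)"
    if "finite A" "A \<subseteq> {..<n}" for A using that
  proof (induction A rule: finite_induct)
    case (insert a A)
    have a: "l (Suc a) \<in> QL" using l_simple[of a] insert by (intro zmod.span_base) simp
    have "(\<Sum>i\<in>A. zmult (c ! i) (l (Suc i))) \<in> QL" using insert
      by (intro zmod.span_sum zmod.span_scale zmod.span_base l_simple) auto
    then have "coef (\<Sum>i\<in>insert a A. zmult (c ! i) (l (Suc i))) (l (Suc j))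
        = c ! a * coef (l (Suc a)) (l (Suc j)) + coef (\<Sum>i\<in>A. zmult (c ! i) (l (Suc i))) (l (Suc j))"
      using insert(1,2) a by (simp add: coef_simps(1,4) zmod.span_scale)
    moreover have "coef (l (Suc a)) (l (Suc j)) = (if a = j then 1 else 0)"
      using coef_simps(6)[OF l_simple[of a], of "l (Suc j)"] insert(4) l_inj[of j a] j by auto
    ultimately show ?case using insert by auto
  qed (simp add: coef_simps)
  show ?thesis unfolding \<rho>_def using gen[of "{..<n}"] j by simp
qed

definition coefs where "coefs x = map (\<lambda>i. coef x (l (Suc i))) [0..<n]"

lemma coefs_rho: "length c = n \<Longrightarrow> coefs (\<rho> c) = c"
  unfolding coefs_def by (rule nth_equalityI) (simp_all add: coef_rho)

lemma rho_unit: assumes "j < n" shows "\<rho> (lunit n j) = l (Suc j)"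
proof -
  have "\<rho> (lunit n j) = (\<Sum>i<n. if i = j then l (Suc j) else 0)"
    unfolding \<rho>_def by (rule sum.cong) (simp_all add: lunit_def)
  then show ?thesis using assms by simp
qed

lemma rho_refl: assumes c: "length c = n" and j: "j < n" shows "\<rho> (lrefl T j c) = refl (l (Suc j)) (\<rho> c)"
proof -
  have len: "length (lrefl T j c) = n" using c by (simp add: lrefl_def)
  have rQ: "refl (l (Suc j)) (\<rho> c) \<in> QL" unfolding refl_def
    by (intro zmod.span_diff zmod.span_scale rho_QL zmod.span_base l_simple j)
  show ?thesis
  proof (rule coef_eqI[OF rho_QL rQ])
    fix \<delta> assume "\<delta> \<in> \<Delta>"
    then obtain i where i: "i < n" "\<delta> = l (Suc i)" by (rule l_surj)
    show "coef (\<rho> (lrefl T j c)) \<delta> = coef (refl (l (Suc j)) (\<rho> c)) \<delta>"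
      unfolding i(2) coef_rho[OF i(1)] coef_refl[OF rho_QL l_simple[OF j]] l_inj[OF i(1) j] cp_rho[OF c j]
      using c i j by (simp add: lrefl_def nth_list_update)
  qed
qed

lemma rho_neg: "length c = n \<Longrightarrow> \<rho> (map uminus c) = - \<rho> c"
  unfolding \<rho>_def by (simp add: zmult_minus sum_negf)

lemma P_length: "c \<in> set P \<Longrightarrow> length c = n" and P_distinct: "distinct P"
  and P_nonneg: "c \<in> set P \<Longrightarrow> list_all (\<lambda>x. 0 \<le> x) c \<and> list_ex (\<lambda>x. 0 < x) c"
  and P_unit: "j < n \<Longrightarrow> lunit n j \<in> set P"
  and P_closed: "c \<in> set P \<Longrightarrow> j < n \<Longrightarrow> c = lunit n j \<or> lrefl T j c \<in> set P"
  and P_reach: "i < length P \<Longrightarrow> \<exists>j<n. P ! i = lunit n j \<or> lrefl T j (P ! i) \<in> set (take i P)"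
  using P unfolding root_list_def by (simp_all add: list_all_iff list_ex_iff Bex_def)

abbreviation "F \<equiv> with_negatives P"

lemma F_set: "set F = set P \<union> map uminus ` set P" by (simp add: with_negatives_def)

lemma F_length: "c \<in> set F \<Longrightarrow> length c = n" unfolding F_set using P_length by auto

lemma F_distinct: "distinct F"
proof -
  have "c \<notin> map uminus ` set P" if c: "c \<in> set P" for c
  proof
    assume "c \<in> map uminus ` set P"
    then obtain d where d: "d \<in> set P" "c = map uminus d" by blast
    have "list_ex (\<lambda>x. 0 < x) d" "list_all (\<lambda>x. 0 \<le> x) c" using P_nonneg[OF d(1)] P_nonneg[OF c] by simp_all
    then show False unfolding d(2) by (auto simp: list_ex_iff list_all_iff)
  qed
  moreover have "inj_on (map (uminus :: int \<Rightarrow> int)) (set P)" by (rule inj_on_subset[OF inj_mapI[OF inj_uminus]]) simp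
  ultimately show ?thesis unfolding with_negatives_def using P_distinct by (auto simp: distinct_map)
qed

text \<open>Closure of the list under simple reflections gives one inclusion, by induction over the roots. Conversely
  each entry is led back to a simple root by simple reflections.\<close>

lemma roots_eq: "\<Phi> = \<rho> ` set F"
proof
  show "\<Phi> \<subseteq> \<rho> ` set F"
  proof
    fix \<alpha> assume "\<alpha> \<in> \<Phi>"
    then have "\<exists>c\<in>set P. \<alpha> = \<rho> c \<or> \<alpha> = - \<rho> c"
    proof (induction rule: root_induct)
      case (simple \<delta>)
      then obtain i where "i < n" "\<delta> = l (Suc i)" by (rule l_surj)
      then show ?case using P_unit[of i] rho_unit[of i] by (intro bexI[of _ "lunit n i"]) simp_all
    next
      case (refl \<alpha> \<delta>)
      obtain j where j: "j < n" "\<delta> = l (Suc j)" using refl(2) by (rule l_surj)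
      obtain c where c: "c \<in> set P" "\<alpha> = \<rho> c \<or> \<alpha> = - \<rho> c" using refl(3) by blast
      have rn: "refl \<delta> (- \<rho> c) = - refl \<delta> (\<rho> c)" by (rule refl_simps(3))
      show ?case
      proof (cases "c = lunit n j")
        case True
        then have rc: "\<rho> c = \<delta>" using rho_unit[OF j(1)] j(2) by simp
        have "refl \<delta> \<delta> = - \<delta>" using refl(2) by (intro refl_self) simp
        then show ?thesis using c rn unfolding rc by (intro bexI[OF _ c(1)]) (auto simp: rc)
      next
        case False
        then have m: "lrefl T j c \<in> set P" using P_closed[OF c(1) j(1)] by blast
        have "\<rho> (lrefl T j c) = refl \<delta> (\<rho> c)" unfolding j(2) by (rule rho_refl[OF P_length[OF c(1)] j(1)])
        then show ?thesis using c(2) rn by (intro bexI[OF _ m]) auto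
      qed
    qed
    then obtain c where c: "c \<in> set P" "\<alpha> = \<rho> c \<or> \<alpha> = - \<rho> c" by blast
    have "- \<rho> c = \<rho> (map uminus c)" using rho_neg[OF P_length[OF c(1)]] by simp
    then show "\<alpha> \<in> \<rho> ` set F" using c unfolding F_set by auto
  qed
  have pos: "\<rho> (P ! i) \<in> \<Phi>" if "i < length P" for i using that
  proof (induction i rule: less_induct)
    case (less i)
    obtain j where j: "j < n" "P ! i = lunit n j \<or> lrefl T j (P ! i) \<in> set (take i P)" using P_reach[OF less.prems] by blast
    have lj: "l (Suc j) \<in> \<Phi>" using l_simple[OF j(1)] by simp
    have len: "length (P ! i) = n" using P_length less.prems by simp
    show ?case using j(2)
    proof
      assume "P ! i = lunit n j" then show ?thesis using rho_unit[OF j(1)] lj by simp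
    next
      assume "lrefl T j (P ! i) \<in> set (take i P)"
      then obtain k where k: "k < i" "lrefl T j (P ! i) = P ! k" using less.prems by (auto simp: in_set_conv_nth)
      have "\<rho> (P ! k) \<in> \<Phi>" using less.IH[OF k(1)] k(1) less.prems by simp
      then have "refl (l (Suc j)) (\<rho> (P ! i)) \<in> \<Phi>" using rho_refl[OF len j(1)] k(2) by simp
      then have "refl (l (Suc j)) (refl (l (Suc j)) (\<rho> (P ! i))) \<in> \<Phi>" by (rule refl_root[OF lj])
      then show ?thesis unfolding refl_refl[OF lj] .
    qed
  qed
  show "\<rho> ` set F \<subseteq> \<Phi>"
  proof
    fix \<alpha> assume "\<alpha> \<in> \<rho> ` set F"
    then obtain c where c: "c \<in> set P" "\<alpha> = \<rho> c \<or> \<alpha> = \<rho> (map uminus c)" unfolding F_set by blast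
    obtain i where "i < length P" "c = P ! i" using c(1) by (auto simp: in_set_conv_nth)
    then have "\<rho> c \<in> \<Phi>" using pos by blast
    then show "\<alpha> \<in> \<Phi>" using c(2) rho_neg[OF P_length[OF c(1)]] neg_root by auto
  qed
qed

text \<open>On vectors of coefficients congruence is expressed by a computable function \<open>K\<close>, whose value at 0 is
  \<open>k0\<close>. The fibre sizes of \<open>K\<close> on the list of roots can then be evaluated.\<close>

lemma mults_by_key:
  assumes K: "\<And>c d. length c = n \<Longrightarrow> length d = n \<Longrightarrow> congr (int p) (\<rho> c) (\<rho> d) \<longleftrightarrow> K c = K d"
    and z: "K (replicate n 0) = k0"
  shows "has_mults p (mset (fibre_sizes (filter ((=) k0) (map K F)))) (mset (fibre_sizes (filter ((\<noteq>) k0) (map K F))))"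
proof -
  have r0: "\<rho> (replicate n 0) = 0" unfolding \<rho>_def by (rule sum.neutral) simp
  have cf: "coefs (\<rho> c) = c" if "c \<in> set F" for c using coefs_rho F_length that by blast
  have inj: "inj_on \<rho> (set F)" by (rule inj_on_inverseI[of _ coefs]) (rule cf)
  have null: "null_roots (int p) = \<rho> ` set (filter (\<lambda>c. k0 = K c) F)"
    unfolding null_roots_def roots_eq using K[OF F_length, of _ "replicate n 0"] r0 z by auto
  have rest: "\<Phi> - null_roots (int p) = \<rho> ` set (filter (\<lambda>c. k0 \<noteq> K c) F)"
  proof -
    have "\<Phi> - null_roots (int p) = \<rho> ` (set F - set (filter (\<lambda>c. k0 = K c) F))"
      unfolding null roots_eq by (rule inj_on_image_set_diff[OF inj, symmetric]) auto
    also have "set F - set (filter (\<lambda>c. k0 = K c) F) = set (filter (\<lambda>c. k0 \<noteq> K c) F)" by auto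
    finally show ?thesis .
  qed
  have fib: "fibres (residue (int p)) (\<rho> ` set (filter Q F)) = mset (fibre_sizes (map K (filter Q F)))" for Q
  proof -
    have sub: "c \<in> set F" if "c \<in> set (filter Q F)" for c using that by simp
    have "fibres (residue (int p)) (\<rho> ` set (filter Q F)) = fibres (K \<circ> coefs) (\<rho> ` set (filter Q F))"
    proof (rule fibres_cong)
      fix a b assume "a \<in> \<rho> ` set (filter Q F)" "b \<in> \<rho> ` set (filter Q F)"
      then obtain c d where cd: "c \<in> set F" "a = \<rho> c" "d \<in> set F" "b = \<rho> d" by auto
      show "residue (int p) a = residue (int p) b \<longleftrightarrow> (K \<circ> coefs) a = (K \<circ> coefs) b"
        unfolding residue_eq cd(2,4) comp_apply cf[OF cd(1)] cf[OF cd(3)]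
        by (rule K[OF F_length[OF cd(1)] F_length[OF cd(3)]])
    qed simp
    also have "\<dots> = fibres K (set (filter Q F))"
    proof -
      have im: "(K \<circ> coefs) ` \<rho> ` set (filter Q F) = K ` set (filter Q F)"
        unfolding image_image comp_apply by (rule image_cong) (use cf in auto)
      have "card {a \<in> \<rho> ` set (filter Q F). (K \<circ> coefs) a = k} = card {c \<in> set (filter Q F). K c = k}" for k
      proof -
        have "{a \<in> \<rho> ` set (filter Q F). (K \<circ> coefs) a = k} = \<rho> ` {c \<in> set (filter Q F). K c = k}"
          using cf by auto
        moreover have "inj_on \<rho> {c \<in> set (filter Q F). K c = k}" by (rule inj_on_subset[OF inj]) auto
        ultimately show ?thesis by (simp add: card_image)
      qed
      then show ?thesis unfolding fibres_def im by simp
    qed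
    also have "\<dots> = mset (fibre_sizes (map K (filter Q F)))" by (rule fibres_list) (simp add: F_distinct)
    finally show ?thesis .
  qed
  show ?thesis unfolding has_mults_def rest unfolding null fib by (simp add: filter_map comp_def)
qed

lemma mults_adjoint:
  assumes ad: "adjoint_type R"
  shows "has_mults p (mset (fibre_sizes (filter ((=) (replicate n 0)) (map (ad_key (int p)) F))))
      (mset (fibre_sizes (filter ((\<noteq>) (replicate n 0)) (map (ad_key (int p)) F))))"
proof (rule mults_by_key)
  fix c d :: "int list" assume c: "length c = n" and d: "length d = n"
  show "congr (int p) (\<rho> c) (\<rho> d) \<longleftrightarrow> ad_key (int p) c = ad_key (int p) d"
  proof
    assume h: "congr (int p) (\<rho> c) (\<rho> d)"
    show "ad_key (int p) c = ad_key (int p) d"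
    proof (rule nth_equalityI)
      fix i assume "i < length (ad_key (int p) c)"
      then have i: "i < n" using c by (simp add: ad_key_def)
      have "int p dvd c ! i - d ! i" using adjoint_congr[OF ad h, of "l (Suc i)"] by (simp add: coef_rho i)
      then show "ad_key (int p) c ! i = ad_key (int p) d ! i" using i c d by (simp add: ad_key_def mod_eq_dvd_iff)
    qed (simp add: ad_key_def c d)
  next
    assume h: "ad_key (int p) c = ad_key (int p) d"
    show "congr (int p) (\<rho> c) (\<rho> d)"
    proof (rule congr_of_coef[OF rho_QL rho_QL])
      fix \<delta> assume "\<delta> \<in> \<Delta>"
      then obtain i where i: "i < n" "\<delta> = l (Suc i)" by (rule l_surj)
      have "ad_key (int p) c ! i = ad_key (int p) d ! i" using h by simp
      then show "int p dvd coef (\<rho> c) \<delta> - coef (\<rho> d) \<delta>" using i c d by (simp add: coef_rho ad_key_def mod_eq_dvd_iff)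
    qed
  qed
qed (simp add: ad_key_def)

lemma mults_simply_connected:
  assumes sc: "simply_connected_type R"
  shows "has_mults p (mset (fibre_sizes (filter ((=) (replicate n 0)) (map (sc_key T (int p)) F))))
      (mset (fibre_sizes (filter ((\<noteq>) (replicate n 0)) (map (sc_key T (int p)) F))))"
proof (rule mults_by_key)
  fix c d :: "int list" assume c: "length c = n" and d: "length d = n"
  show "congr (int p) (\<rho> c) (\<rho> d) \<longleftrightarrow> sc_key T (int p) c = sc_key T (int p) d"
  proof
    assume h: "congr (int p) (\<rho> c) (\<rho> d)"
    show "sc_key T (int p) c = sc_key T (int p) d"
    proof (rule nth_equalityI)
      fix i assume "i < length (sc_key T (int p) c)"
      then have i: "i < n" using c by (simp add: sc_key_def)
      have "int p dvd lpair T c i - lpair T d i"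
        using congr_cp[OF h, of "l (Suc i)"] unfolding cp_rho[OF c i] cp_rho[OF d i] .
      then show "sc_key T (int p) c ! i = sc_key T (int p) d ! i" using i c d by (simp add: sc_key_def mod_eq_dvd_iff)
    qed (simp add: sc_key_def c d)
  next
    assume h: "sc_key T (int p) c = sc_key T (int p) d"
    show "congr (int p) (\<rho> c) (\<rho> d)"
    proof (rule simply_connected_congr[OF sc])
      fix \<delta> assume "\<delta> \<in> \<Delta>"
      then obtain i where i: "i < n" "\<delta> = l (Suc i)" by (rule l_surj)
      have "sc_key T (int p) c ! i = sc_key T (int p) d ! i" using h by simp
      then have "int p dvd lpair T c i - lpair T d i" using i c d by (simp add: sc_key_def mod_eq_dvd_iff)
      then show "int p dvd cp (\<rho> c) \<delta> - cp (\<rho> d) \<delta>" unfolding i(2) cp_rho[OF c i(1)] cp_rho[OF d i(1)] .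
    qed
  qed
next
  have "lpair T (replicate n 0) j = 0" for j
    unfolding lpair_def interv_sum_list_conv_sum_set_nat by (rule sum.neutral) simp
  then show "sc_key T (int p) (replicate n 0) = replicate n 0"
    unfolding sc_key_def by (simp add: map_replicate_const)
qed

text \<open>The rows of an integral inverse of the Cartan matrix express the fundamental weights by simple roots. They
  generate \<open>X\<close>, since by nondegeneracy every \<open>x\<close> is their combination with the coefficients \<open>\<langle>x, \<delta>\<^sup>\<vee>\<rangle>\<close>.\<close>

lemma unimodular_adjoint:
  assumes I: "length I = n" "\<And>j. j < n \<Longrightarrow> length (I ! j) = n"
    "\<And>j. j < n \<Longrightarrow> map (lpair T (I ! j)) [0..<n] = lunit n j"
  shows "adjoint_type R"
proof -
  have w: "cp (\<rho> (I ! j)) (l (Suc k)) = (if k = j then 1 else 0)" if jk: "j < n" "k < n" for j k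
  proof -
    have "map (lpair T (I ! j)) [0..<n] ! k = lunit n j ! k" using I(3)[OF jk(1)] by simp
    then show ?thesis using jk cp_rho[OF I(2)[OF jk(1)] jk(2)] by (simp add: lunit_def)
  qed
  have "x \<in> QL" for x
  proof -
    have "x = (\<Sum>j<n. zmult (cp x (l (Suc j))) (\<rho> (I ! j)))"
    proof (rule eq_by_simple)
      fix \<delta> assume "\<delta> \<in> \<Delta>"
      then obtain k where k: "k < n" "\<delta> = l (Suc k)" by (rule l_surj)
      have "cp (\<Sum>j<n. zmult (cp x (l (Suc j))) (\<rho> (I ! j))) \<delta> = (\<Sum>j<n. if j = k then cp x (l (Suc k)) else 0)"
        unfolding pair_simps k(2) by (rule sum.cong) (use w k(1) in auto)
      then show "cp x \<delta> = cp (\<Sum>j<n. zmult (cp x (l (Suc j))) (\<rho> (I ! j))) \<delta>" using k by simp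
    qed
    also have "\<dots> \<in> QL" by (intro zmod.span_sum zmod.span_scale rho_QL)
    finally show ?thesis .
  qed
  then show ?thesis using adjoint_iff by blast
qed

end

definition "roots_A2 = ([
  [1,0], [0,1], [1,1]] :: int list list)"

definition "roots_G2 = ([
  [1,0], [0,1], [1,1], [3,1], [2,1], [3,2]] :: int list list)"

definition "roots_B2 = ([
  [1,0], [0,1], [1,2], [1,1]] :: int list list)"

definition "roots_B3 = ([
  [1,0,0], [0,1,0], [0,0,1], [1,1,0], [0,1,2], [0,1,1], [1,1,2], [1,1,1], [1,2,2]] :: int list list)"

definition "roots_B4 = ([
  [1,0,0,0], [0,1,0,0], [0,0,1,0], [0,0,0,1], [1,1,0,0], [0,1,1,0], [0,0,1,2], [0,0,1,1],
   [1,1,1,0], [0,1,1,2], [0,1,1,1], [1,1,1,2], [0,1,2,2], [1,1,1,1], [1,1,2,2], [1,2,2,2]] :: int list list)"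

definition "roots_D4 = ([
  [1,0,0,0], [0,1,0,0], [0,0,1,0], [0,0,0,1], [1,1,0,0], [0,1,1,0], [0,1,0,1], [1,1,1,0],
   [1,1,0,1], [0,1,1,1], [1,1,1,1], [1,2,1,1]] :: int list list)"

definition "roots_F4 = ([
  [1,0,0,0], [0,1,0,0], [0,0,1,0], [0,0,0,1], [1,1,0,0], [0,1,2,0], [0,1,1,0], [0,0,1,1],
   [1,1,2,0], [0,1,2,2], [1,1,1,0], [0,1,1,1], [1,2,2,0], [1,1,2,2], [1,1,1,1], [0,1,2,1],
   [1,2,2,2], [1,1,2,1], [1,2,4,2], [1,2,2,1], [1,3,4,2], [1,2,3,1], [2,3,4,2], [1,2,3,2]] :: int list list)"

lemma root_list_A2: "root_list (DynA 2) 2 roots_A2" by code_simp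

lemma root_list_G2: "root_list (DynG2) 2 roots_G2" by code_simp

lemma root_list_B2: "root_list (DynB 2) 2 roots_B2" by code_simp

lemma root_list_B3: "root_list (DynB 3) 3 roots_B3" by code_simp

lemma root_list_B4: "root_list (DynB 4) 4 roots_B4" by code_simp

lemma root_list_D4: "root_list (DynD 4) 4 roots_D4" by code_simp

lemma root_list_F4: "root_list (DynF4) 4 roots_F4" by code_simp

text \<open>The sizes come in the order in which the residues first occur among the roots; sorting makes them
  independent of this order.\<close>

lemma sizes_A2_sc_3:
  "sort (fibre_sizes (filter ((=) (replicate 2 0)) (map (sc_key (DynA 2) 3) (with_negatives roots_A2)))) = []"
  "sort (fibre_sizes (filter ((\<noteq>) (replicate 2 0)) (map (sc_key (DynA 2) 3) (with_negatives roots_A2)))) = replicate 2 3"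
  by code_simp+

lemma sizes_G2_ad_3:
  "sort (fibre_sizes (filter ((=) (replicate 2 0)) (map (ad_key 3) (with_negatives roots_G2)))) = []"
  "sort (fibre_sizes (filter ((\<noteq>) (replicate 2 0)) (map (ad_key 3) (with_negatives roots_G2)))) = replicate 6 1 @ replicate 2 3"
  by code_simp+

lemma sizes_G2_ad_2:
  "sort (fibre_sizes (filter ((=) (replicate 2 0)) (map (ad_key 2) (with_negatives roots_G2)))) = []"
  "sort (fibre_sizes (filter ((\<noteq>) (replicate 2 0)) (map (ad_key 2) (with_negatives roots_G2)))) = replicate 3 4"
  by code_simp+

lemma sizes_B2_sc_2:
  "sort (fibre_sizes (filter ((=) (replicate 2 0)) (map (sc_key (DynB 2) 2) (with_negatives roots_B2)))) = replicate 1 4"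
  "sort (fibre_sizes (filter ((\<noteq>) (replicate 2 0)) (map (sc_key (DynB 2) 2) (with_negatives roots_B2)))) = replicate 1 4"
  by code_simp+

lemma sizes_B3_sc_2:
  "sort (fibre_sizes (filter ((=) (replicate 3 0)) (map (sc_key (DynB 3) 2) (with_negatives roots_B3)))) = []"
  "sort (fibre_sizes (filter ((\<noteq>) (replicate 3 0)) (map (sc_key (DynB 3) 2) (with_negatives roots_B3)))) = replicate 3 6"
  by code_simp+

lemma sizes_B4_sc_2:
  "sort (fibre_sizes (filter ((=) (replicate 4 0)) (map (sc_key (DynB 4) 2) (with_negatives roots_B4)))) = []"
  "sort (fibre_sizes (filter ((\<noteq>) (replicate 4 0)) (map (sc_key (DynB 4) 2) (with_negatives roots_B4)))) = replicate 4 2 @ replicate 3 8"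
  by code_simp+

lemma sizes_D4_sc_2:
  "sort (fibre_sizes (filter ((=) (replicate 4 0)) (map (sc_key (DynD 4) 2) (with_negatives roots_D4)))) = []"
  "sort (fibre_sizes (filter ((\<noteq>) (replicate 4 0)) (map (sc_key (DynD 4) 2) (with_negatives roots_D4)))) = replicate 3 8"
  by code_simp+

lemma sizes_F4_ad_2:
  "sort (fibre_sizes (filter ((=) (replicate 4 0)) (map (ad_key 2) (with_negatives roots_F4)))) = []"
  "sort (fibre_sizes (filter ((\<noteq>) (replicate 4 0)) (map (ad_key 2) (with_negatives roots_F4)))) = replicate 12 2 @ replicate 3 8"
  by code_simp+

definition "inverse_G2 = ([[2,1], [3,2]] :: int list list)"

lemma inverse_G2: "list_all (\<lambda>j. length (inverse_G2 ! j) = 2 \<and> map (lpair DynG2 (inverse_G2 ! j)) [0..<2] = lunit 2 j) [0..<2]"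
  by code_simp

definition "inverse_F4 = ([[2,3,4,2], [3,6,8,4], [2,4,6,3], [1,2,3,2]] :: int list list)"

lemma inverse_F4: "list_all (\<lambda>j. length (inverse_F4 ! j) = 4 \<and> map (lpair DynF4 (inverse_F4 ! j)) [0..<4] = lunit 4 j) [0..<4]"
  by code_simp

context irreducible_datum begin

lemma small_rank:
  assumes "bourbaki_labelling R \<Delta> T l" "root_list T (dynkin_rank T) P"
  shows "small_rank R \<Delta> n l T P"
proof (intro small_rank.intro small_rank_axioms.intro irreducible_datum_axioms assms(1))
  show "root_list T n P" using assms(2) unfolding labelling_rank[OF assms(1)] .
qed

lemma has_type_labelling: assumes "has_type R \<Delta> T" obtains l where "bourbaki_labelling R \<Delta> T l" "dynkin_rank T = n"
  using assms labelling_rank unfolding has_type_def by blast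

lemma mset_sort_eq: "sort xs = ys \<Longrightarrow> mset xs = mset ys"
  by (metis mset_sort)

lemma adjoint_G2: assumes "has_type R \<Delta> DynG2" shows "adjoint_type R"
proof -
  obtain l where l: "bourbaki_labelling R \<Delta> DynG2 l" and n: "n = 2" using has_type_labelling[OF assms] by force
  interpret small_rank R \<Delta> n l DynG2 roots_G2 by (rule small_rank[OF l]) (simp add: root_list_G2)
  have I: "length (inverse_G2 ! j) = 2 \<and> map (lpair DynG2 (inverse_G2 ! j)) [0..<2] = lunit 2 j" if "j < 2" for j
    using inverse_G2 that unfolding list_all_iff by simp
  show ?thesis by (rule unimodular_adjoint[of inverse_G2]) (use I n in \<open>simp_all add: inverse_G2_def\<close>)
qed

lemma adjoint_F4: assumes "has_type R \<Delta> DynF4" shows "adjoint_type R"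
proof -
  obtain l where l: "bourbaki_labelling R \<Delta> DynF4 l" and n: "n = 4" using has_type_labelling[OF assms] by force
  interpret small_rank R \<Delta> n l DynF4 roots_F4 by (rule small_rank[OF l]) (simp add: root_list_F4)
  have I: "length (inverse_F4 ! j) = 4 \<and> map (lpair DynF4 (inverse_F4 ! j)) [0..<4] = lunit 4 j" if "j < 4" for j
    using inverse_F4 that unfolding list_all_iff by simp
  show ?thesis by (rule unimodular_adjoint[of inverse_F4]) (use I n in \<open>simp_all add: inverse_F4_def\<close>)
qed

lemma mults_A2_sc_3:
  assumes "has_type R \<Delta> (DynA 2)" and iso: "simply_connected_type R"
  shows "has_mults 3 {#} (replicate_mset 2 3)"
proof -
  obtain l where l: "bourbaki_labelling R \<Delta> (DynA 2) l" and n: "n = 2" using has_type_labelling[OF assms(1)] by force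
  interpret small_rank R \<Delta> n l "DynA 2" roots_A2 by (rule small_rank[OF l]) (simp add: root_list_A2)
  show ?thesis using mults_simply_connected[OF iso, of 3] unfolding n of_nat_numeral
    mset_sort_eq[OF sizes_A2_sc_3(1)] mset_sort_eq[OF sizes_A2_sc_3(2)] by simp
qed

lemma mults_G2_ad_3:
  assumes "has_type R \<Delta> (DynG2)" and iso: "adjoint_type R"
  shows "has_mults 3 {#} (replicate_mset 6 1 + replicate_mset 2 3)"
proof -
  obtain l where l: "bourbaki_labelling R \<Delta> (DynG2) l" and n: "n = 2" using has_type_labelling[OF assms(1)] by force
  interpret small_rank R \<Delta> n l "DynG2" roots_G2 by (rule small_rank[OF l]) (simp add: root_list_G2)
  show ?thesis using mults_adjoint[OF iso, of 3] unfolding n of_nat_numeral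
    mset_sort_eq[OF sizes_G2_ad_3(1)] mset_sort_eq[OF sizes_G2_ad_3(2)] by simp
qed

lemma mults_G2_ad_2:
  assumes "has_type R \<Delta> (DynG2)" and iso: "adjoint_type R"
  shows "has_mults 2 {#} (replicate_mset 3 4)"
proof -
  obtain l where l: "bourbaki_labelling R \<Delta> (DynG2) l" and n: "n = 2" using has_type_labelling[OF assms(1)] by force
  interpret small_rank R \<Delta> n l "DynG2" roots_G2 by (rule small_rank[OF l]) (simp add: root_list_G2)
  show ?thesis using mults_adjoint[OF iso, of 2] unfolding n of_nat_numeral
    mset_sort_eq[OF sizes_G2_ad_2(1)] mset_sort_eq[OF sizes_G2_ad_2(2)] by simp
qed

lemma mults_B2_sc_2:
  assumes "has_type R \<Delta> (DynB 2)" and iso: "simply_connected_type R"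
  shows "has_mults 2 {#4#} (replicate_mset 1 4)"
proof -
  obtain l where l: "bourbaki_labelling R \<Delta> (DynB 2) l" and n: "n = 2" using has_type_labelling[OF assms(1)] by force
  interpret small_rank R \<Delta> n l "DynB 2" roots_B2 by (rule small_rank[OF l]) (simp add: root_list_B2)
  show ?thesis using mults_simply_connected[OF iso, of 2] unfolding n of_nat_numeral
    mset_sort_eq[OF sizes_B2_sc_2(1)] mset_sort_eq[OF sizes_B2_sc_2(2)] by simp
qed

lemma mults_B3_sc_2:
  assumes "has_type R \<Delta> (DynB 3)" and iso: "simply_connected_type R"
  shows "has_mults 2 {#} (replicate_mset 3 6)"
proof -
  obtain l where l: "bourbaki_labelling R \<Delta> (DynB 3) l" and n: "n = 3" using has_type_labelling[OF assms(1)] by force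
  interpret small_rank R \<Delta> n l "DynB 3" roots_B3 by (rule small_rank[OF l]) (simp add: root_list_B3)
  show ?thesis using mults_simply_connected[OF iso, of 2] unfolding n of_nat_numeral
    mset_sort_eq[OF sizes_B3_sc_2(1)] mset_sort_eq[OF sizes_B3_sc_2(2)] by simp
qed

lemma mults_B4_sc_2:
  assumes "has_type R \<Delta> (DynB 4)" and iso: "simply_connected_type R"
  shows "has_mults 2 {#} (replicate_mset 4 2 + replicate_mset 3 8)"
proof -
  obtain l where l: "bourbaki_labelling R \<Delta> (DynB 4) l" and n: "n = 4" using has_type_labelling[OF assms(1)] by force
  interpret small_rank R \<Delta> n l "DynB 4" roots_B4 by (rule small_rank[OF l]) (simp add: root_list_B4)
  show ?thesis using mults_simply_connected[OF iso, of 2] unfolding n of_nat_numeral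
    mset_sort_eq[OF sizes_B4_sc_2(1)] mset_sort_eq[OF sizes_B4_sc_2(2)] by simp
qed

lemma mults_D4_sc_2:
  assumes "has_type R \<Delta> (DynD 4)" and iso: "simply_connected_type R"
  shows "has_mults 2 {#} (replicate_mset 3 8)"
proof -
  obtain l where l: "bourbaki_labelling R \<Delta> (DynD 4) l" and n: "n = 4" using has_type_labelling[OF assms(1)] by force
  interpret small_rank R \<Delta> n l "DynD 4" roots_D4 by (rule small_rank[OF l]) (simp add: root_list_D4)
  show ?thesis using mults_simply_connected[OF iso, of 2] unfolding n of_nat_numeral
    mset_sort_eq[OF sizes_D4_sc_2(1)] mset_sort_eq[OF sizes_D4_sc_2(2)] by simp
qed

lemma mults_F4_ad_2:
  assumes "has_type R \<Delta> (DynF4)" and iso: "adjoint_type R"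
  shows "has_mults 2 {#} (replicate_mset 12 2 + replicate_mset 3 8)"
proof -
  obtain l where l: "bourbaki_labelling R \<Delta> (DynF4) l" and n: "n = 4" using has_type_labelling[OF assms(1)] by force
  interpret small_rank R \<Delta> n l "DynF4" roots_F4 by (rule small_rank[OF l]) (simp add: root_list_F4)
  show ?thesis using mults_adjoint[OF iso, of 2] unfolding n of_nat_numeral
    mset_sort_eq[OF sizes_F4_ad_2(1)] mset_sort_eq[OF sizes_F4_ad_2(2)] by simp
qed

section \<open>The types of the list\<close>

lemma relabel:
  assumes lab: "bourbaki_labelling R \<Delta> T l" and r: "dynkin_rank T = r" "dynkin_rank T' = r"
    and p: "bij_betw \<pi> {1..r} {1..r}"
    and C: "\<And>a b. a \<in> {1..r} \<Longrightarrow> b \<in> {1..r} \<Longrightarrow> a \<noteq> b \<Longrightarrow> cartan_off T' a b = cartan_off T (\<pi> a) (\<pi> b)"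
  shows "bourbaki_labelling R \<Delta> T' (l \<circ> \<pi>)"
proof -
  have lb: "bij_betw l {1..r} \<Delta>" and v: "\<And>a b. a \<in> {1..r} \<Longrightarrow> b \<in> {1..r} \<Longrightarrow>
      cp (l a) (l b) = (if a = b then 2 else cartan_off T a b)"
    using lab unfolding bourbaki_labelling_def r by blast+
  have "cp ((l \<circ> \<pi>) a) ((l \<circ> \<pi>) b) = (if a = b then 2 else cartan_off T' a b)"
    if ab: "a \<in> {1..r}" "b \<in> {1..r}" for a b
  proof -
    have m: "\<pi> a \<in> {1..r}" "\<pi> b \<in> {1..r}" using bij_betwE[OF p] ab by blast+
    have "\<pi> a = \<pi> b \<longleftrightarrow> a = b" by (rule inj_on_eq_iff[OF bij_betw_imp_inj_on[OF p] ab])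
    then show ?thesis using v[OF m] C[OF ab] by simp
  qed
  then show ?thesis unfolding bourbaki_labelling_def r using bij_betw_trans[OF p lb] by blast
qed

definition swap1 :: "nat \<Rightarrow> nat \<Rightarrow> nat" where "swap1 i j = (if j = 1 then i else if j = i then 1 else j)"

lemma swap1_bij: "1 \<le> i \<Longrightarrow> i \<le> r \<Longrightarrow> bij_betw (swap1 i) {1..r} {1..r}"
  by (rule bij_betwI[of _ _ _ "swap1 i"]) (auto simp: swap1_def)

lemma interval_3: "{1..3} = {1, 2, 3 :: nat}" and interval_4: "{1..4} = {1, 2, 3, 4 :: nat}" by auto

text \<open>The middle node of \<open>A\<^sub>3\<close> is the first node of \<open>D\<^sub>3\<close>.\<close>

lemma A3_to_D3: assumes "bourbaki_labelling R \<Delta> (DynA 3) l" shows "bourbaki_labelling R \<Delta> (DynD 3) (l \<circ> swap1 2)"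
proof (rule relabel[OF assms, of 3])
  fix a b :: nat assume "a \<in> {1..3}" "b \<in> {1..3}" "a \<noteq> b"
  then show "cartan_off (DynD 3) a b = cartan_off (DynA 3) (swap1 2 a) (swap1 2 b)"
    unfolding interval_3 by (elim insertE emptyE) (simp_all add: swap1_def chain_def)
next
  show "bij_betw (swap1 2) {1..3} {1..3}" by (rule swap1_bij) simp_all
qed simp_all

lemma D3_to_A3: assumes "bourbaki_labelling R \<Delta> (DynD 3) l" shows "bourbaki_labelling R \<Delta> (DynA 3) (l \<circ> swap1 2)"
proof (rule relabel[OF assms, of 3])
  fix a b :: nat assume "a \<in> {1..3}" "b \<in> {1..3}" "a \<noteq> b"
  then show "cartan_off (DynA 3) a b = cartan_off (DynD 3) (swap1 2 a) (swap1 2 b)"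
    unfolding interval_3 by (elim insertE emptyE) (simp_all add: swap1_def chain_def)
next
  show "bij_betw (swap1 2) {1..3} {1..3}" by (rule swap1_bij) simp_all
qed simp_all

text \<open>The three legs of the diagram \<open>D\<^sub>4\<close> are interchangeable.\<close>

lemma triality:
  assumes "bourbaki_labelling R \<Delta> (DynD 4) l" "i \<in> {1, 3, 4}"
  shows "bourbaki_labelling R \<Delta> (DynD 4) (l \<circ> swap1 i)"
proof (rule relabel[OF assms(1), of 4])
  show "bij_betw (swap1 i) {1..4} {1..4}" using assms(2) by (intro swap1_bij) auto
  fix a b :: nat assume "a \<in> {1..4}" "b \<in> {1..4}" "a \<noteq> b"
  then show "cartan_off (DynD 4) a b = cartan_off (DynD 4) (swap1 i a) (swap1 i b)"
    using assms(2) unfolding interval_4 by (elim insertE emptyE) (simp_all add: swap1_def chain_def)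
qed simp_all

lemma D_isogeny_triality: assumes "D_isogeny R \<Delta> 4 i" "i \<in> {1, 3, 4}" shows "D_isogeny R \<Delta> 4 1"
proof -
  obtain l \<omega> where l: "bourbaki_labelling R \<Delta> (DynD 4) l"
    and w: "\<forall>j\<in>{1..4}. cp \<omega> (l j) = (if j = i then 1 else 0)" and sp: "zmod.span (insert \<omega> \<Phi>) = UNIV"
    using assms(1) unfolding D_isogeny_def by blast
  have b: "bij_betw (swap1 i) {1..4} {1..4}" using assms(2) by (intro swap1_bij) auto
  have "cp \<omega> ((l \<circ> swap1 i) j) = (if j = 1 then 1 else 0)" if j: "j \<in> {1..4}" for j
  proof -
    have "swap1 i j \<in> {1..4}" using bij_betwE[OF b] j by blast
    then have "cp \<omega> (l (swap1 i j)) = (if swap1 i j = i then 1 else 0)" by (rule bspec[OF w])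
    moreover have "swap1 i j = i \<longleftrightarrow> j = 1" by (auto simp: swap1_def)
    ultimately show ?thesis by simp
  qed
  then show ?thesis unfolding D_isogeny_def using triality[OF l assms(2)] sp by blast
qed

lemma D_mults_isogeny: assumes "D_isogeny R \<Delta> m 1" "3 \<le> m" shows "has_mults 2 {#} (replicate_mset (m choose 2) 4)"
proof -
  obtain l \<omega> where l: "bourbaki_labelling R \<Delta> (DynD m) l"
    and w: "\<forall>j\<in>{1..m}. cp \<omega> (l j) = (if j = 1 then 1 else 0)" and sp: "zmod.span (insert \<omega> \<Phi>) = UNIV"
    using assms(1) unfolding D_isogeny_def by blast
  have m: "m = n" using labelling_rank[OF l] by simp
  obtain y where "coordinates R \<Delta> n l y 2 True" using coordinates_D[of l] l assms(2) m by blast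
  then interpret c: coordinates R \<Delta> n l y 2 True .
  have w': "\<And>j. j \<in> {1..n} \<Longrightarrow> cp \<omega> (l j) = (if j = 1 then 1 else 0)" using w m by blast
  obtain E where "c.frame E" using c.D_frame[OF TrueI w'] by blast
  then show ?thesis using c.mults_two c.D_span_even[OF TrueI w' sp] m by auto
qed

lemma D_mults_simply_connected:
  assumes "has_type R \<Delta> (DynD m)" "simply_connected_type R" "m = 3 \<or> 5 \<le> m"
  shows "has_mults 2 {#} (replicate_mset (m choose 2) 4)"
proof -
  obtain l where l: "bourbaki_labelling R \<Delta> (DynD m) l" and m: "m = n" using has_type_labelling[OF assms(1)] by force
  obtain y where "coordinates R \<Delta> n l y 2 True" using coordinates_D[of l] l assms(3) m by auto
  then interpret c: coordinates R \<Delta> n l y 2 True .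
  show ?thesis using c.mults_two assms m by auto
qed

lemma A3_mults:
  assumes "has_type R \<Delta> (DynA 3)" "simply_connected_type R \<or> root_index R = 2"
  shows "has_mults 2 {#} (replicate_mset 3 4)"
proof -
  obtain l0 where l0: "bourbaki_labelling R \<Delta> (DynA 3) l0" and n: "n = 3" using has_type_labelling[OF assms(1)] by force
  have l: "bourbaki_labelling R \<Delta> (DynD n) (l0 \<circ> swap1 2)" unfolding n by (rule A3_to_D3[OF l0])
  obtain y where "coordinates R \<Delta> n (l0 \<circ> swap1 2) y 2 True" using coordinates_D[OF l] n by auto
  then interpret c: coordinates R \<Delta> n "l0 \<circ> swap1 2" y 2 True .
  have c3: "(3::nat) choose 2 = 3" by (simp add: choose_two)
  have "(\<exists>E. c.frame E) \<or> simply_connected_type R" using assms(2) c.index_two_frame[OF TrueI n] by blast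
  then show ?thesis using c.mults_two n c3 by simp
qed

lemma B_mults:
  assumes "has_type R \<Delta> (DynB m)" "2 \<le> m" "adjoint_type R \<or> 5 \<le> m"
  shows "has_mults 2 {#} (replicate_mset m 2 + replicate_mset (m choose 2) 4)"
proof -
  obtain l where l: "bourbaki_labelling R \<Delta> (DynB m) l" and m: "m = n" using has_type_labelling[OF assms(1)] by force
  obtain y where "coordinates R \<Delta> n l y 2 False" using coordinates_B[of l] l assms(2) m by auto
  then interpret c: coordinates R \<Delta> n l y 2 False .
  obtain E where "c.frame E" using c.unforked_frame by blast
  moreover have "(\<forall>x. \<forall>k\<in>{1..n}. even (c.\<theta> k x)) \<or> 5 \<le> n" using assms(3) m c.adjoint_even by blast
  ultimately show ?thesis using c.mults_two m by auto
qed

lemma C_mults: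
  assumes "has_type R \<Delta> (DynC m)" "2 \<le> m"
  shows "adjoint_type R \<Longrightarrow> has_mults 2 {#} ({#2 * m#} + replicate_mset (m * (m - 1)) 2)"
    "simply_connected_type R \<Longrightarrow> has_mults 2 {#2 * m#} (replicate_mset (m choose 2) 4)"
    "adjoint_type R \<or> simply_connected_type R"
proof -
  obtain l where l: "bourbaki_labelling R \<Delta> (DynC m) l" and m: "m = n" using has_type_labelling[OF assms(1)] by force
  obtain y where "coordinates R \<Delta> n l y 1 False" using coordinates_C[of l] l assms(2) m by auto
  then interpret c: coordinates R \<Delta> n l y 1 False .
  show "adjoint_type R \<Longrightarrow> has_mults 2 {#} ({#2 * m#} + replicate_mset (m * (m - 1)) 2)"
    using c.C_adjoint m by simp
  show "simply_connected_type R \<Longrightarrow> has_mults 2 {#2 * m#} (replicate_mset (m choose 2) 4)"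
    using c.C_simply_connected m by simp
  show "adjoint_type R \<or> simply_connected_type R" using c.C_isogeny by simp
qed

lemma B_isogeny: assumes "has_type R \<Delta> (DynB m)" "2 \<le> m" shows "adjoint_type R \<or> simply_connected_type R"
proof -
  obtain l where l: "bourbaki_labelling R \<Delta> (DynB m) l" and m: "m = n" using has_type_labelling[OF assms(1)] by force
  obtain y where "coordinates R \<Delta> n l y 2 False" using coordinates_B[of l] l assms(2) m by auto
  then interpret c: coordinates R \<Delta> n l y 2 False .
  show ?thesis using c.B_isogeny by simp
qed

lemma listed_mults: assumes "listed R \<Delta> p Z M" shows "has_mults p Z M"
  using assms
proof cases
  case A2_sc_3 then show ?thesis using mults_A2_sc_3 by simp
next
  case G2_3 then show ?thesis using mults_G2_ad_3 adjoint_G2 by simp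
next
  case A3_sc then show ?thesis using A3_mults by simp
next
  case A3_2 then show ?thesis using A3_mults by simp
next
  case B2_ad
  have "(2::nat) choose 2 = 1" by simp
  then show ?thesis using B_mults[of 2] B2_ad by (simp add: numeral_eq_Suc)
next
  case (Bn_ad m) then show ?thesis using B_mults[of m] by simp
next
  case B2_sc then show ?thesis using mults_B2_sc_2 by simp
next
  case B3_sc then show ?thesis using mults_B3_sc_2 by simp
next
  case B4_sc then show ?thesis using mults_B4_sc_2 by simp
next
  case (Bn_sc m) then show ?thesis using B_mults[of m] by simp
next
  case (Cn_ad m) then show ?thesis using C_mults(1)[of m] by simp
next
  case (Cn_sc m) then show ?thesis using C_mults(2)[of m] by simp
next
  case (D4_intermediate i)
  have "(4::nat) choose 2 = 6" by (simp add: choose_two)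
  then show ?thesis using D_mults_isogeny[of 4] D_isogeny_triality[of i] D4_intermediate by simp
next
  case D4_sc then show ?thesis using mults_D4_sc_2 by simp
next
  case (Dn_1 m) then show ?thesis using D_mults_isogeny[of m] by simp
next
  case (Dn_sc m) then show ?thesis using D_mults_simply_connected[of m] by simp
next
  case F4 then show ?thesis using mults_F4_ad_2 adjoint_F4 by simp
next
  case G2_2 then show ?thesis using mults_G2_ad_2 adjoint_G2 by simp
qed

lemma multiply_laced_listed: assumes "\<not> simply_laced" shows "\<exists>Z M. listed R \<Delta> 2 Z M"
  using multiply_laced_types[OF assms]
proof (elim disjE conjE)
  assume "has_type R \<Delta> DynG2" then show ?thesis using listed.G2_2 by blast
next
  assume "has_type R \<Delta> DynF4" then show ?thesis using listed.F4 by blast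
next
  assume B: "2 \<le> n" "has_type R \<Delta> (DynB n)"
  show ?thesis using B_isogeny[OF B(2,1)]
  proof
    assume "adjoint_type R"
    moreover have "n = 2 \<or> 3 \<le> n" using B by linarith
    ultimately show ?thesis using B(2) listed.B2_ad listed.Bn_ad by metis
  next
    assume "simply_connected_type R"
    moreover have "n = 2 \<or> n = 3 \<or> n = 4 \<or> 5 \<le> n" using B by linarith
    ultimately show ?thesis using B(2) listed.B2_sc listed.B3_sc listed.B4_sc listed.Bn_sc by metis
  qed
next
  assume C: "3 \<le> n" "has_type R \<Delta> (DynC n)"
  have "2 \<le> n" using C by simp
  from C_mults(3)[OF C(2) this] show ?thesis using C listed.Cn_ad listed.Cn_sc by metis
qed

text \<open>In the simply laced case the weight \<open>\<epsilon>\<^sub>1\<close> found with the type \<open>D\<^sub>n\<close> either generates \<open>X\<close> together with the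
  roots, or \<open>X\<close> contains a half-integral vector and the datum is simply connected.\<close>

lemma coincidence_listed:
  assumes a: "\<alpha> \<in> \<Phi>" and b: "\<beta> \<in> \<Phi>" and c: "congr 2 \<alpha> \<beta>" and ne: "\<beta> \<noteq> \<alpha>" "\<beta> \<noteq> - \<alpha>"
  shows "\<exists>Z M. listed R \<Delta> 2 Z M"
proof (cases simply_laced)
  case True
  obtain l \<omega> where n3: "3 \<le> n" and l: "bourbaki_labelling R \<Delta> (DynD n) l"
    and w: "\<And>j. j \<in> {1..n} \<Longrightarrow> cp \<omega> (l j) = (if j = 1 then 1 else 0)"
    using coincidence_D[OF True a b c ne] by blast
  obtain y where "coordinates R \<Delta> n l y 2 True" using coordinates_D[OF l n3] by blast
  then interpret c: coordinates R \<Delta> n l y 2 True .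
  have ty: "has_type R \<Delta> (DynD n)" using l unfolding has_type_def by blast
  have A3: "has_type R \<Delta> (DynA 3)" if "n = 3" using D3_to_A3 l that unfolding has_type_def by blast
  consider "n = 3" | "n = 4" | "5 \<le> n" using n3 by linarith
  note n_cases = this
  show ?thesis using c.D_isogeny_cases[OF TrueI w]
  proof
    assume sp: "zmod.span (insert \<omega> \<Phi>) = UNIV"
    then have iso: "D_isogeny R \<Delta> n 1" unfolding D_isogeny_def using l w by blast
    show ?thesis
    proof (rule n_cases)
      assume n: "n = 3"
      obtain E where "c.frame E" using c.D_frame[OF TrueI w] by blast
      then have "root_index R = 2" using c.index_two[OF TrueI] c.D_span_even[OF TrueI w sp] by blast
      then show ?thesis using listed.A3_2[OF A3[OF n]] by blast
    next
      assume "n = 4" then show ?thesis using listed.D4_intermediate[of 1] iso by blast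
    next
      assume "5 \<le> n" then show ?thesis using listed.Dn_1 iso by blast
    qed
  next
    assume sc: "simply_connected_type R"
    show ?thesis
    proof (rule n_cases)
      assume "n = 3" then show ?thesis using listed.A3_sc[OF A3 sc] by blast
    next
      assume "n = 4" then show ?thesis using listed.D4_sc[OF _ sc] ty by metis
    next
      assume "5 \<le> n" then show ?thesis using listed.Dn_sc[OF _ ty sc] by blast
    qed
  qed
next
  case False then show ?thesis by (rule multiply_laced_listed)
qed

lemma unlisted_two:
  assumes "\<nexists>Z M. listed R \<Delta> 2 Z M"
  shows "fibres (residue 2) \<Phi> = replicate_mset (card pos) 2"
    "null_roots 2 = {} \<or> has_type R \<Delta> (DynA 1) \<and> simply_connected_type R"
proof -
  show "fibres (residue 2) \<Phi> = replicate_mset (card pos) 2"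
    by (rule fibres_plus_minus) (use coincidence_listed assms in blast)
  have sl: simply_laced using multiply_laced_listed assms by blast
  show "null_roots 2 = {} \<or> has_type R \<Delta> (DynA 1) \<and> simply_connected_type R"
    using simply_laced_null[OF sl] unfolding null_roots_def by blast
qed

lemma unlisted_odd:
  fixes p :: nat
  assumes p: "prime p \<or> p = 0" "p \<noteq> 2" and un: "\<nexists>Z M. listed R \<Delta> p Z M"
    and a: "\<alpha> \<in> \<Phi>" and b: "\<beta> \<in> \<Phi>" and c: "congr (int p) \<alpha> \<beta>"
  shows "\<alpha> = \<beta>"
proof (cases "p = 0")
  case True then show ?thesis using congr_zero c by simp
next
  case False
  then have pr: "prime p" using p by blast
  show ?thesis
  proof (rule ccontr)
    assume ne: "\<alpha> \<noteq> \<beta>"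
    have p3: "p = 3" by (rule congr_odd(1)[OF pr p(2) a b c ne])
    have nt: "cp i j \<noteq> - 3" if "i \<in> \<Delta>" "j \<in> \<Delta>" "i \<noteq> j" for i j
      using triple_bond[OF that] listed.G2_3 un p3 by blast
    have "congr 3 \<alpha> \<beta>" using c p3 by simp
    then have "has_type R \<Delta> (DynA 2)" "simply_connected_type R" using congr_three_types[OF nt a b ne] by blast+
    then show False using listed.A2_sc_3 un p3 by blast
  qed
qed

end

theorem proposition3:
  fixes R :: "('x::ab_group_add, 'y::ab_group_add) root_data"
    and \<Delta> :: "'x set"
    and n p :: nat
    and brZ :: "'z::ab_group_add \<Rightarrow> 'z \<Rightarrow> 'z"
    and h :: "'y \<Rightarrow> 'z" and e :: "'x \<Rightarrow> 'z"
    and scale :: "'f::field \<Rightarrow> 'l::ab_group_add \<Rightarrow> 'l"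
    and br :: "'l \<Rightarrow> 'l \<Rightarrow> 'l"
    and \<iota> :: "'z \<Rightarrow> 'l"
    and \<eta> :: "'y \<Rightarrow> 'l"
    and \<Phi>bar zero_part :: "('l \<Rightarrow> 'f) set"
  assumes R: "irreducible_root_datum n R \<Delta>"
    and p: "CHAR('f) = p"
    and LZ: "chevalley_lie_ring R brZ h e"
    and L: "lie_algebra scale br" "scalar_extension brZ scale br \<iota>"
    and \<eta>: "\<eta> = \<iota> \<circ> h"
    and \<Phi>bar: "\<Phi>bar = roots_on R scale \<eta>"
    and zero_part: "zero_part = \<Phi>bar \<inter> {zero_on scale \<eta>}"
  shows "(\<forall>Z M. listed R \<Delta> p Z M \<longrightarrow>
            mults R scale \<eta> zero_part = Z \<and> mults R scale \<eta> (\<Phi>bar - zero_part) = M) \<and>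
         (p = 2 \<and> (\<nexists>Z M. listed R \<Delta> p Z M) \<longrightarrow>
            mults R scale \<eta> \<Phi>bar = replicate_mset (card (positive_roots R \<Delta>)) 2 \<and>
            (zero_part = {} \<or> has_type R \<Delta> (DynA 1) \<and> simply_connected_type R)) \<and>
         (p \<noteq> 2 \<and> (\<nexists>Z M. listed R \<Delta> p Z M) \<longrightarrow>
            (\<forall>\<phi>\<in>\<Phi>bar. root_mult R scale \<eta> \<phi> = 1))"
proof -
  interpret root_functions R \<Delta> n brZ h e scale br \<iota> \<eta>
    by (intro root_functions.intro root_functions_axioms.intro irreducible_datum.intro R LZ L \<eta>)
  have char: "prime p \<or> p = 0" using prime_CHAR_semidom[where 'a = 'f] p by auto
  note parts = mults_parts[unfolded p]
  have Zp: "zero_part = roots_on R scale \<eta> \<inter> {zero_on scale \<eta>}" unfolding zero_part \<Phi>bar ..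
  show ?thesis
  proof (intro conjI allI impI)
    fix Z M assume "listed R \<Delta> p Z M"
    then have "has_mults p Z M" by (rule listed_mults)
    then show "mults R scale \<eta> zero_part = Z" "mults R scale \<eta> (\<Phi>bar - zero_part) = M"
      unfolding Zp \<Phi>bar parts has_mults_def by blast+
  next
    assume h: "p = 2 \<and> (\<nexists>Z M. listed R \<Delta> p Z M)"
    then have un: "\<nexists>Z M. listed R \<Delta> 2 Z M" by blast
    have i2: "int p = 2" using h by simp
    show "mults R scale \<eta> \<Phi>bar = replicate_mset (card (positive_roots R \<Delta>)) 2"
      unfolding \<Phi>bar parts positive_roots_eq i2 by (rule unlisted_two(1)[OF un])
    show "zero_part = {} \<or> has_type R \<Delta> (DynA 1) \<and> simply_connected_type R"
      using unlisted_two(2)[OF un] unfolding Zp zero_part_eq(1) p i2 by blast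
  next
    assume h: "p \<noteq> 2 \<and> (\<nexists>Z M. listed R \<Delta> p Z M)"
    show "\<forall>\<phi>\<in>\<Phi>bar. root_mult R scale \<eta> \<phi> = 1"
      unfolding \<Phi>bar using root_mult_one unlisted_odd[OF char] h p by blast
  qed
qed

end
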